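(* Let $d=2$, $T>0$ and $u_0\in\mathscr D(H)$. For $\varepsilon\in(0,1)$ put $u_0^\varepsilon:=(-H_\varepsilon)^{-1}(-H)u_0\in\mathscr H^2$, and let $u_\varepsilon\in C([0,T];\mathscr H^2)\cap C^1([0,T];L^2)$ be the unique global strong solution of $$i\partial_tu_\varepsilon=H_\varepsilon u_\varepsilon-u_\varepsilon|u_\varepsilon|^2,\qquad u_\varepsilon(0)=u_0^\varepsilon .$$ Let $u\in C([0,T];\mathscr D(H))\cap C^1([0,T];L^2)$ be the unique global strong solution of $$i\partial_tu=Hu-u|u|^2,\qquad u(0)=u_0 .$$ Then, as $\varepsilon\to0$, for all $t\in[0,T]$, $$u_\varepsilon(t)\to u(t),\qquad H_\varepsilon u_\varepsilon(t)\to Hu(t),\qquad \partial_tu_\varepsilon(t)\to\partial_tu(t)\qquad\text{in }L^2 .$$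
   Context: Function spaces. $\mathbb T^2=\mathbb R^2/\mathbb Z^2$; $L^2=L^2(\mathbb T^2)$ (complex valued); $\mathscr H^s$ is the $L^2$-based Sobolev space. $\Delta$ without index is the Laplacian. $\Delta_j$, $j\ge -1$, are Littlewood–Paley blocks: Fourier multipliers with symbols $\chi$ ($j=-1$) and $\rho(2^{-j}\cdot)$ ($j\ge0$), where $\chi,\rho\ge 0$ are smooth radial, $\chi$ supported in a ball, $\rho$ in an annulus, $\chi+\sum_{j\ge0}\rho(2^{-j}\cdot)=1$, $\chi\rho(2^{-j}\cdot)=0$ for $j\ge1$, $\rho(2^{-i}\cdot)\rho(2^{-j}\cdot)=0$ for $|i-j|>1$. $\mathscr C^a=B^a_{\infty,\infty}$ with norm $\sup_j2^{ja}\|\Delta_jf\|_{L^\infty}$. Paraproducts: $f\prec g=\sum_{j}\sum_{i\le j-2}\Delta_if\,\Delta_jg$, $f\succ g=g\prec f$; resonant product: $f\circ g=\sum_{|i-j|\le1}\Delta_if\,\Delta_jg$ (products of gradients are contracted). For $a\in(0,1)$, $b+c<0$, $a+b+c>0$, $C:\mathscr H^a\times\mathscr C^b\times\mathscr C^c\to\mathscr H^{a+b+c}$ is the bounded trilinear operator which on smooth functions is $C(f,g,h)=(f\prec g)\circ h-f(g\circ h)$. Noise. $\xi=\sum_{k\in\mathbb Z^2}\hat\xi(k)e^{2\pi ik\cdot x}$ is (real) Gaussian white noise on $\mathbb T^2$, i.e. $\hat\xi(k)$ are centred complex Gaussians, independent up to $\hat\xi(-k)=\overline{\hat\xi(k)}$,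 with $\mathbb E[\hat\xi(k)\overline{\hat\xi(l)}]=\delta_{kl}$. $\xi_\varepsilon=\sum_{k\in\mathbb Z^2}m(\varepsilon k)\hat\xi(k)e^{2\pi ik\cdot x}$, with $m$ radial, smooth away from $0$, compactly supported, $\lim_{x\to0}m(x)=1$, and $c_\varepsilon=\sum_{k\in\mathbb Z^2}|m(\varepsilon k)|^2/(1+4\pi^2|k|^2)$. Almost surely $\Xi^\varepsilon=(\xi_\varepsilon,\ \xi_\varepsilon\circ(1-\Delta)^{-1}\xi_\varepsilon-c_\varepsilon)$ converges as $\varepsilon\to0$ in $\mathscr C^{\alpha}\times\mathscr C^{2\alpha+2}$, for every $\alpha<-1$, to a limit $\Xi=(\xi,\Xi_2)$ (the enhanced noise). Everything is pathwise: a realization for which this holds is fixed. The operator. Fix $-4/3<\alpha<-1$, $2/3<\gamma\le\alpha+2$. Put $X=(1-\Delta)^{-1}\xi$, $B_\Xi(u)=(1-\Delta)^{-1}(\Delta u\prec X+2\nabla u\prec\nabla X+\xi\prec u+u\prec\Xi_2)$, and $\mathscr D(A)=\{u\in\mathscr H^\gamma:\ R(u):=u-u\prec X-B_\Xi(u)\in\mathscr H^2\}$ (independent of $\gamma$). For $u\in\mathscr D(A)$, $Au:=\Delta u+u\prec\xi+\xi\prec u+u\circ\xi\in L^2$, with $u\circ\xi:=C(u,X,\xi)+u\,\Xi_2+B_\Xi(u)\circ\xi+R(u)\circ\xi$. Further $A_\varepsilon=\Delta+\xi_\varepsilon-c_\varepsilon$ on $\mathscr D(A_\varepsilon)=\mathscr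 H^2$. Finally $H=A-K_\Xi$, $\mathscr D(H)=\mathscr D(A)$ with norm $\|u\|_{\mathscr D(H)}=\|Hu\|_{L^2}$, and $H_\varepsilon=A_\varepsilon-K_\Xi$, $\mathscr D(H_\varepsilon)=\mathscr H^2$, where $K_\Xi>0$ is a sufficiently large constant depending only on $\Xi$ and not on $\varepsilon$; in particular $\langle -Hu,u\rangle\ge\|u\|_{L^2}^2$ and $\langle-H_\varepsilon v,v\rangle\ge\|v\|_{L^2}^2$ on the respective domains (claims are meant for all $K_\Xi$ above some threshold depending only on $\Xi$). $H$ and $H_\varepsilon$ are self-adjoint. Existence and uniqueness of the global strong solutions named in the claim is known. *)

theory Defs
  imports "HOL-Probability.Probability" "HOL-Library.Function_Algebras"
begin

section \<open>Distributions and functions on the torus\<close>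

text \<open>
  A distribution on the torus \<open>\<real>\<^sup>2 / \<int>\<^sup>2\<close> is represented by its family of Fourier coefficients:
  \<open>u\<close> stands for the series of \<open>u k * exp (2 \<pi> i k \<bullet> x)\<close> over all \<open>k\<close>.  All spaces below are
  sets of such families; sums, differences and negatives are those of Function_Algebras.
\<close>

type_synonym tdist = "int \<times> int \<Rightarrow> complex"

definition freq :: "int \<times> int \<Rightarrow> real \<times> real" where
  "freq k = (of_int (fst k), of_int (snd k))"

definition tscale :: "complex \<Rightarrow> tdist \<Rightarrow> tdist" where
  "tscale c f = (\<lambda>k. c * f k)"

definition tconst :: "complex \<Rightarrow> tdist" where
  "tconst c = (\<lambda>k. if k = 0 then c else 0)"

text \<open>Functions on the torus are functions on the fundamental domain \<open>[0,1) \<times> [0,1)\<close>.\<close>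

definition torus :: "(real \<times> real) measure" where
  "torus = restrict_space lborel ({0..<1} \<times> {0..<1})"

definition fourier :: "(real \<times> real \<Rightarrow> complex) \<Rightarrow> tdist" where
  "fourier f = (\<lambda>k. \<integral>x. f x * cis (- 2 * pi * (freq k \<bullet> x)) \<partial>torus)"

definition L2fun :: "(real \<times> real \<Rightarrow> complex) set" where
  "L2fun = {f \<in> borel_measurable torus. integrable torus (\<lambda>x. (norm (f x))\<^sup>2)}"

definition L2 :: "tdist set" where
  "L2 = fourier ` L2fun"

text \<open>The function represented by \<open>u \<in> L2\<close>; it is unique up to null sets.\<close>

definition tfun :: "tdist \<Rightarrow> real \<times> real \<Rightarrow> complex" where
  "tfun u = (SOME f. f \<in> L2fun \<and> fourier f = u)"

definition L2norm :: "tdist \<Rightarrow> real" where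
  "L2norm u = sqrt (\<integral>x. (norm (tfun u x))\<^sup>2 \<partial>torus)"

text \<open>The nonlinearity \<open>u |u|\<^sup>2\<close>, formed pointwise.\<close>

definition cubic :: "tdist \<Rightarrow> tdist" where
  "cubic u = fourier (\<lambda>x. tfun u x * of_real ((norm (tfun u x))\<^sup>2))"

text \<open>Smoothness on an open set: \<open>D p q\<close> is the iterated partial derivative of order \<open>(p, q)\<close>.\<close>

definition smooth_on :: "(real \<times> real) set \<Rightarrow> (real \<times> real \<Rightarrow> 'a::real_normed_vector) \<Rightarrow> bool" where
  "smooth_on S f \<longleftrightarrow> (\<exists>D :: nat \<Rightarrow> nat \<Rightarrow> real \<times> real \<Rightarrow> 'a.
     D 0 0 = f \<and>
     (\<forall>p q. \<forall>x\<in>S. (D p q has_derivative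
        (\<lambda>h. fst h *\<^sub>R D (Suc p) q x + snd h *\<^sub>R D p (Suc q) x)) (at x)))"

definition smooth_torus :: "tdist set" where
  "smooth_torus = fourier ` {f. smooth_on UNIV f \<and>
     (\<forall>x y. f (x + 1, y) = f (x, y) \<and> f (x, y + 1) = f (x, y))}"

definition bessel :: "int \<times> int \<Rightarrow> real" where
  "bessel k = 1 + 4 * pi\<^sup>2 * (norm (freq k))\<^sup>2"

definition sobolev :: "real \<Rightarrow> tdist set" where
  "sobolev s = {f. (\<lambda>k. bessel k powr s * (norm (f k))\<^sup>2) summable_on UNIV}"

definition sobolev_norm :: "real \<Rightarrow> tdist \<Rightarrow> real" where
  "sobolev_norm s f = sqrt (\<Sum>\<^sub>\<infinity>k. bessel k powr s * (norm (f k))\<^sup>2)"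

definition laplace :: "tdist \<Rightarrow> tdist" where
  "laplace f = (\<lambda>k. - of_real (4 * pi\<^sup>2 * (norm (freq k))\<^sup>2) * f k)"

text \<open>\<open>(1 - \<Delta>)\<^sup>-\<^sup>1\<close>\<close>

definition resolv :: "tdist \<Rightarrow> tdist" where
  "resolv f = (\<lambda>k. f k / of_real (bessel k))"

definition dx1 :: "tdist \<Rightarrow> tdist" where
  "dx1 f = (\<lambda>k. 2 * of_real pi * \<i> * of_int (fst k) * f k)"

definition dx2 :: "tdist \<Rightarrow> tdist" where
  "dx2 f = (\<lambda>k. 2 * of_real pi * \<i> * of_int (snd k) * f k)"

text \<open>
  The product of two distributions, given on Fourier coefficients by convolution.  It is only
  used where this series converges absolutely: for products of smooth functions, of a
  trigonometric polynomial with a distribution, and of elements of \<open>sobolev a\<close> and of the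
  Hoelder-Besov space of order \<open>b\<close> with \<open>a + b > 0\<close>.
\<close>

definition tmul :: "tdist \<Rightarrow> tdist \<Rightarrow> tdist" where
  "tmul f g = (\<lambda>k. \<Sum>\<^sub>\<infinity>l. f l * g (k - l))"


section \<open>Littlewood--Paley blocks and paraproducts\<close>

definition radial :: "(real \<times> real \<Rightarrow> real) \<Rightarrow> bool" where
  "radial f \<longleftrightarrow> (\<forall>x y. norm x = norm y \<longrightarrow> f x = f y)"

text \<open>The pair of the low-frequency symbol (supported in a ball) and the annular symbol.\<close>

type_synonym dyadic = "(real \<times> real \<Rightarrow> real) \<times> (real \<times> real \<Rightarrow> real)"

definition dyadic_partition :: "dyadic \<Rightarrow> bool" where
  "dyadic_partition P \<longleftrightarrow> (case P of (\<psi>, \<rho>) \<Rightarrow>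
     (\<forall>x. \<psi> x \<ge> 0) \<and> (\<forall>x. \<rho> x \<ge> 0) \<and>
     smooth_on UNIV \<psi> \<and> smooth_on UNIV \<rho> \<and> radial \<psi> \<and> radial \<rho> \<and>
     (\<exists>r. \<forall>x. \<psi> x \<noteq> 0 \<longrightarrow> norm x \<le> r) \<and>
     (\<exists>r R. 0 < r \<and> (\<forall>x. \<rho> x \<noteq> 0 \<longrightarrow> r \<le> norm x \<and> norm x \<le> R)) \<and>
     (\<forall>x. (\<lambda>j::nat. \<rho> (x /\<^sub>R 2 ^ j)) sums (1 - \<psi> x)) \<and>
     (\<forall>x. \<forall>j::nat. j \<ge> 1 \<longrightarrow> \<psi> x * \<rho> (x /\<^sub>R 2 ^ j) = 0) \<and>
     (\<forall>x. \<forall>i j::nat. \<bar>int i - int j\<bar> > 1 \<longrightarrow> \<rho> (x /\<^sub>R 2 ^ i) * \<rho> (x /\<^sub>R 2 ^ j) = 0))"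

definition block :: "dyadic \<Rightarrow> int \<Rightarrow> tdist \<Rightarrow> tdist" where
  "block P j f = (\<lambda>k. of_real (if j = -1 then fst P (freq k)
                               else snd P (freq k /\<^sub>R 2 ^ nat j)) * f k)"

text \<open>The value at \<open>x\<close> of a trigonometric polynomial, such as a Littlewood--Paley block.\<close>

definition trig :: "tdist \<Rightarrow> real \<times> real \<Rightarrow> complex" where
  "trig f x = (\<Sum>\<^sub>\<infinity>k. f k * cis (2 * pi * (freq k \<bullet> x)))"

definition block_size :: "dyadic \<Rightarrow> real \<Rightarrow> tdist \<Rightarrow> int \<Rightarrow> real" where
  "block_size P a f j = 2 powr (of_int j * a) * (SUP x. norm (trig (block P j f) x))"

definition holder :: "dyadic \<Rightarrow> real \<Rightarrow> tdist set" where
  "holder P a = {f. bdd_above (block_size P a f ` {-1..})}"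

definition holder_norm :: "dyadic \<Rightarrow> real \<Rightarrow> tdist \<Rightarrow> real" where
  "holder_norm P a f = (SUP j\<in>{-1..}. block_size P a f j)"

text \<open>\<open>f \<prec> g\<close> is \<open>para P f g\<close> and \<open>f \<circ> g\<close> is \<open>reso P f g\<close>; the series in \<open>j\<close> are
  taken coefficientwise.\<close>

definition para :: "dyadic \<Rightarrow> tdist \<Rightarrow> tdist \<Rightarrow> tdist" where
  "para P f g = (\<lambda>k. \<Sum>\<^sub>\<infinity>j\<in>{-1..}. \<Sum>i\<in>{-1..j - 2}. tmul (block P i f) (block P j g) k)"

definition reso :: "dyadic \<Rightarrow> tdist \<Rightarrow> tdist \<Rightarrow> tdist" where
  "reso P f g = (\<lambda>k. \<Sum>\<^sub>\<infinity>j\<in>{-1..}. \<Sum>i\<in>{i. i \<ge> -1 \<and> \<bar>i - j\<bar> \<le> 1}.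
     tmul (block P i f) (block P j g) k)"

text \<open>
  \<open>C\<close> is a bounded trilinear operator from \<open>H\<^sup>a \<times> C\<^sup>b \<times> C\<^sup>c\<close> to \<open>H\<^sup>a\<^sup>+\<^sup>b\<^sup>+\<^sup>c\<close> extending the commutator
  of smooth functions.  Smooth functions are not dense in \<open>C\<^sup>b\<close> and \<open>C\<^sup>c\<close>, but these conditions
  determine \<open>C f g h\<close> for \<open>g\<close>, \<open>h\<close> in the closure of the smooth functions.
\<close>

definition is_commutator ::
  "dyadic \<Rightarrow> real \<Rightarrow> real \<Rightarrow> real \<Rightarrow> (tdist \<Rightarrow> tdist \<Rightarrow> tdist \<Rightarrow> tdist) \<Rightarrow> bool" where
  "is_commutator P a b c C \<longleftrightarrow>
     (\<forall>f\<in>sobolev a. \<forall>g\<in>holder P b. \<forall>h\<in>holder P c. C f g h \<in> sobolev (a + b + c)) \<and>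
     (\<exists>B. \<forall>f\<in>sobolev a. \<forall>g\<in>holder P b. \<forall>h\<in>holder P c.
        sobolev_norm (a + b + c) (C f g h)
          \<le> B * sobolev_norm a f * holder_norm P b g * holder_norm P c h) \<and>
     (\<forall>z. \<forall>f\<in>sobolev a. \<forall>f'\<in>sobolev a. \<forall>g\<in>holder P b. \<forall>h\<in>holder P c.
        C (tscale z f + f') g h = tscale z (C f g h) + C f' g h) \<and>
     (\<forall>z. \<forall>f\<in>sobolev a. \<forall>g\<in>holder P b. \<forall>g'\<in>holder P b. \<forall>h\<in>holder P c.
        C f (tscale z g + g') h = tscale z (C f g h) + C f g' h) \<and>
     (\<forall>z. \<forall>f\<in>sobolev a. \<forall>g\<in>holder P b. \<forall>h\<in>holder P c. \<forall>h'\<in>holder P c.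
        C f g (tscale z h + h') = tscale z (C f g h) + C f g h') \<and>
     (\<forall>f\<in>smooth_torus. \<forall>g\<in>smooth_torus. \<forall>h\<in>smooth_torus.
        C f g h = reso P (para P f g) h - tmul f (reso P g h))"


section \<open>White noise and its enhancement\<close>

text \<open>Real linear combinations of real and imaginary part are centred normal, where the
  degenerate normal law (the point mass at 0) is allowed.\<close>

definition centred_complex_gaussian :: "'w measure \<Rightarrow> ('w \<Rightarrow> complex) \<Rightarrow> bool" where
  "centred_complex_gaussian M Z \<longleftrightarrow> (\<forall>a b :: real.
     (\<exists>\<sigma>>0. distributed M lborel (\<lambda>\<omega>. a * Re (Z \<omega>) + b * Im (Z \<omega>)) (normal_density 0 \<sigma>)) \<or>
     (AE \<omega> in M. a * Re (Z \<omega>) + b * Im (Z \<omega>) = 0))"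

definition white_noise :: "'w measure \<Rightarrow> (int \<times> int \<Rightarrow> 'w \<Rightarrow> complex) \<Rightarrow> bool" where
  "white_noise M \<xi> \<longleftrightarrow> prob_space M \<and>
     (\<forall>k. \<xi> k \<in> borel_measurable M) \<and>
     (\<forall>k. centred_complex_gaussian M (\<xi> k)) \<and>
     (\<forall>k. \<forall>\<omega>\<in>space M. \<xi> (- k) \<omega> = cnj (\<xi> k \<omega>)) \<and>
     (\<forall>S. (\<forall>k\<in>S. k \<noteq> 0 \<longrightarrow> - k \<notin> S) \<longrightarrow> prob_space.indep_vars M (\<lambda>_. borel) \<xi> S) \<and>
     (\<forall>k l. (\<integral>\<omega>. \<xi> k \<omega> * cnj (\<xi> l \<omega>) \<partial>M) = (if k = l then 1 else 0))"

definition mollifier :: "(real \<times> real \<Rightarrow> real) \<Rightarrow> bool" where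
  "mollifier m \<longleftrightarrow> radial m \<and> smooth_on (- {0}) m \<and>
     (\<exists>r. \<forall>x. m x \<noteq> 0 \<longrightarrow> norm x \<le> r) \<and> (m \<longlongrightarrow> 1) (at 0)"

definition regularised :: "(real \<times> real \<Rightarrow> real) \<Rightarrow> tdist \<Rightarrow> real \<Rightarrow> tdist" where
  "regularised m \<xi> \<epsilon> = (\<lambda>k. of_real (m (\<epsilon> *\<^sub>R freq k)) * \<xi> k)"

definition renorm_const :: "(real \<times> real \<Rightarrow> real) \<Rightarrow> real \<Rightarrow> real" where
  "renorm_const m \<epsilon> = (\<Sum>\<^sub>\<infinity>k. \<bar>m (\<epsilon> *\<^sub>R freq k)\<bar>\<^sup>2 / bessel k)"

definition enhanced_noise ::
  "dyadic \<Rightarrow> (real \<times> real \<Rightarrow> real) \<Rightarrow> tdist \<Rightarrow> tdist \<Rightarrow> bool" where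
  "enhanced_noise P m \<xi> \<Xi>2 \<longleftrightarrow> (\<forall>a < -1.
     \<xi> \<in> holder P a \<and> \<Xi>2 \<in> holder P (2 * a + 2) \<and>
     ((\<lambda>\<epsilon>. holder_norm P a (regularised m \<xi> \<epsilon> - \<xi>)) \<longlongrightarrow> 0) (at_right 0) \<and>
     ((\<lambda>\<epsilon>. holder_norm P (2 * a + 2)
         (reso P (regularised m \<xi> \<epsilon>) (resolv (regularised m \<xi> \<epsilon>))
            - tconst (of_real (renorm_const m \<epsilon>)) - \<Xi>2)) \<longlongrightarrow> 0) (at_right 0))"


section \<open>The operators\<close>

definition B_op :: "dyadic \<Rightarrow> tdist \<Rightarrow> tdist \<Rightarrow> tdist \<Rightarrow> tdist" where
  "B_op P \<xi> \<Xi>2 u = (let X = resolv \<xi> in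
     resolv (para P (laplace u) X
           + tscale 2 (para P (dx1 u) (dx1 X) + para P (dx2 u) (dx2 X))
           + para P \<xi> u + para P u \<Xi>2))"

definition R_op :: "dyadic \<Rightarrow> tdist \<Rightarrow> tdist \<Rightarrow> tdist \<Rightarrow> tdist" where
  "R_op P \<xi> \<Xi>2 u = u - para P u (resolv \<xi>) - B_op P \<xi> \<Xi>2 u"

definition A_dom :: "dyadic \<Rightarrow> real \<Rightarrow> tdist \<Rightarrow> tdist \<Rightarrow> tdist set" where
  "A_dom P \<gamma> \<xi> \<Xi>2 = {u \<in> sobolev \<gamma>. R_op P \<xi> \<Xi>2 u \<in> sobolev 2}"

definition A_op ::
  "dyadic \<Rightarrow> (tdist \<Rightarrow> tdist \<Rightarrow> tdist \<Rightarrow> tdist) \<Rightarrow> tdist \<Rightarrow> tdist \<Rightarrow> tdist \<Rightarrow> tdist" where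
  "A_op P C \<xi> \<Xi>2 u = laplace u + para P u \<xi> + para P \<xi> u
     + (C u (resolv \<xi>) \<xi> + tmul u \<Xi>2 + reso P (B_op P \<xi> \<Xi>2 u) \<xi> + reso P (R_op P \<xi> \<Xi>2 u) \<xi>)"

definition H_op ::
  "dyadic \<Rightarrow> (tdist \<Rightarrow> tdist \<Rightarrow> tdist \<Rightarrow> tdist) \<Rightarrow> tdist \<Rightarrow> tdist \<Rightarrow> real \<Rightarrow> tdist \<Rightarrow> tdist" where
  "H_op P C \<xi> \<Xi>2 K u = A_op P C \<xi> \<Xi>2 u - tscale (of_real K) u"

definition A_eps :: "(real \<times> real \<Rightarrow> real) \<Rightarrow> tdist \<Rightarrow> real \<Rightarrow> tdist \<Rightarrow> tdist" where
  "A_eps m \<xi> \<epsilon> v = laplace v + tmul (regularised m \<xi> \<epsilon>) v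
     - tscale (of_real (renorm_const m \<epsilon>)) v"

definition H_eps :: "(real \<times> real \<Rightarrow> real) \<Rightarrow> tdist \<Rightarrow> real \<Rightarrow> real \<Rightarrow> tdist \<Rightarrow> tdist" where
  "H_eps m \<xi> K \<epsilon> v = A_eps m \<xi> \<epsilon> v - tscale (of_real K) v"


section \<open>Strong solutions\<close>

definition cont_on_time :: "(tdist \<Rightarrow> real) \<Rightarrow> tdist set \<Rightarrow> real \<Rightarrow> (real \<Rightarrow> tdist) \<Rightarrow> bool" where
  "cont_on_time nrm V T u \<longleftrightarrow> (\<forall>t\<in>{0..T}. u t \<in> V \<and>
     ((\<lambda>s. nrm (u s - u t)) \<longlongrightarrow> 0) (at t within {0..T}))"

text \<open>\<open>u \<in> C\<^sup>1([0,T]; L2)\<close> with time derivative \<open>du\<close> (one-sided at the end points).\<close>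

definition C1_L2 :: "real \<Rightarrow> (real \<Rightarrow> tdist) \<Rightarrow> (real \<Rightarrow> tdist) \<Rightarrow> bool" where
  "C1_L2 T u du \<longleftrightarrow> cont_on_time L2norm L2 T u \<and> cont_on_time L2norm L2 T du \<and>
     (\<forall>t\<in>{0..T}. ((\<lambda>s. L2norm (tscale (of_real (1 / (s - t))) (u s - u t) - du t)) \<longlongrightarrow> 0)
        (at t within {0..T}))"

text \<open>\<open>i \<partial>\<^sub>t u = Lu - u |u|\<^sup>2\<close>, \<open>u(0) = u0\<close>, where \<open>L\<close> has domain \<open>V\<close> with norm \<open>nrm\<close> and
  \<open>du = \<partial>\<^sub>t u\<close>.\<close>

definition strong_solution ::
  "(tdist \<Rightarrow> tdist) \<Rightarrow> tdist set \<Rightarrow> (tdist \<Rightarrow> real) \<Rightarrow> real \<Rightarrow> tdist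
     \<Rightarrow> (real \<Rightarrow> tdist) \<Rightarrow> (real \<Rightarrow> tdist) \<Rightarrow> bool" where
  "strong_solution L V nrm T u0 u du \<longleftrightarrow>
     cont_on_time nrm V T u \<and> C1_L2 T u du \<and> u 0 = u0 \<and>
     (\<forall>t\<in>{0..T}. tscale \<i> (du t) = L (u t) - cubic (u t))"

end

theory Submission
  imports Defs
begin

text \<open>Sobolev norms are read off the Fourier coefficients, Besov norms off the Littlewood--Paley blocks.  On a
 block, resolvent and derivatives are bounded in the sup norm by the maximum principle for trigonometric polynomials.
 For \<open>v = (v \<prec> X) + B(v) + R\<close> one has \<open>A v = \<Delta>R\<close> plus terms of lower order, so that for large \<open>\<lambda>\<close> the quantity
 \<open>\<parallel>v\<parallel>\<^sub>\<gamma> + \<parallel>R\<parallel>\<^sub>1\<^sub>.\<^sub>1\<close> is at most \<open>C \<lambda>\<close> to the power \<open>-0.18\<close> times \<open>\<parallel>(\<lambda> - A)v\<parallel>\<close>, uniformly in the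
 noise.  The difference of two such equations gives convergence of the resolvents, and letting \<open>\<lambda>\<close> vary gives, for every \<open>\<delta>\<close>,
 the uniform bound \<open>sup |v| \<le> \<delta> \<parallel>H\<^sub>\<epsilon> v\<parallel> + C\<^sub>\<delta> \<parallel>v\<parallel>\<close>.

 For the evolution, the energy identity for \<open>u\<^sub>\<epsilon> - u\<close> yields convergence in \<open>L\<^sup>2\<close> as long as \<open>u\<^sub>\<epsilon>\<close> is bounded, and the last
 bound makes this a bootstrap up to time \<open>T\<close>.  Difference quotients in time bound \<open>\<partial>\<^sub>t u\<^sub>\<epsilon>\<close>; second differences show that \<open>\<partial>\<^sub>t u\<^sub>\<epsilon>\<close> is
 equicontinuous once this is known at \<open>t = 0\<close>, where it follows from weak convergence and convergence of the norms.
 Equicontinuity upgrades \<open>u\<^sub>\<epsilon> \<rightarrow> u\<close> to \<open>\<partial>\<^sub>t u\<^sub>\<epsilon> \<rightarrow> \<partial>\<^sub>t u\<close>, and the equation gives \<open>H\<^sub>\<epsilon> u\<^sub>\<epsilon> \<rightarrow> H u\<close>.\<close>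

section \<open>Sobolev norms\<close>

text \<open>Elements of \<open>A_dom\<close> are rough and those of \<open>sobolev 2\<close> are
  not, so neither operator can be applied to the difference of the two solutions. The unknowns of
  the evolution argument are therefore f_e = H_e u_e and f = H u. With G_e the inverse of H_e one
  has u_e - u = G_e(f_e - f) + (G_e f - u): the first term drops out of the energy identity, the
  second is a resolvent error along a compact curve. The initial data are made for this, since
  f_e(0) = f(0). The other obstacle is the cubic term: \<gamma> < 1 gives no Sobolev embedding into
  bounded functions in two dimensions. The sup bound comes from the structure: v \<prec> X is
  bounded since \<gamma> - 1 plus the order of X is positive, and the rest of \<open>v\<close> has
  order 11/10 > 1. This number is -9/10 + 2; paraproducts of negative order are put into order -9/10
  by an elementary splitting that yields half of the usual gain, which \<gamma> > 2/3 can afford.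
  The commutator is prescribed on smooth functions only, so for regularised noise it is identified
  by testing on characters. That G_e exists is shown by the method of continuity.\<close>

definition sob_le :: "real \<Rightarrow> tdist \<Rightarrow> real \<Rightarrow> bool" where
 "sob_le s f c \<longleftrightarrow> (\<forall>F. finite F --> L2_set (\<lambda>k. bessel k powr (s/2)*norm (f k)) F \<le> c)"

lemma bessel_ge_1 [simp]: "bessel k \<ge> 1" and bessel_pos [simp]: "bessel k > 0" by (auto simp: bessel_def intro!: add_pos_nonneg)

lemma bessel_nz [simp]: "bessel k \<noteq> 0" using bessel_pos[of k] by linarith

lemma sob_leD_nonneg: "sob_le s f c ==> 0 \<le> c" unfolding sob_le_def by (metis L2_set_empty finite.emptyI)

lemma L2_set_bessel_sq:
 "(L2_set (\<lambda>k. bessel k powr (s/2)*norm (f k)) F)^2 = (\<Sum>k\<in>F. bessel k powr s*(norm (f k))^2)"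
proof -
 have "(bessel k powr (s/2))^2 = bessel k powr s" for k by (simp add: power2_eq_square powr_add[symmetric])
 thus ?thesis by (simp add: L2_set_def sum_nonneg power_mult_distrib)
qed

text \<open>Bounding all finite partial sums at once says that the weighted series converges and
  that the root of its sum is at most \<open>c\<close>. Working with \<open>sob_le\<close> turns
  norm estimates into estimates of finite sums, without summability side conditions.\<close>

lemma sob_le_iff: "sob_le s f c \<longleftrightarrow> f \<in> sobolev s \<and> sobolev_norm s f \<le> c"
proof
 assume *: "sob_le s f c"
 have c: "0 \<le> c" by (rule sob_leD_nonneg[OF *])
 have bd: "(\<Sum>k\<in>F. bessel k powr s*(norm (f k))^2) \<le> c^2" if "finite F" for F unfolding L2_set_bessel_sq[symmetric]
  using * that by (auto simp: sob_le_def intro!: power_mono)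
 have sm: "(\<lambda>k. bessel k powr s*(norm (f k))^2) summable_on UNIV" by (rule nonneg_bdd_above_summable_on) (auto intro!: bdd_aboveI2 bd)
 moreover have "(\<Sum>\<^sub>\<infinity>k. bessel k powr s*(norm (f k))^2) \<le> c^2" by (rule infsum_le_finite_sums[OF sm]) (use bd in auto)
 ultimately show "f \<in> sobolev s \<and> sobolev_norm s f \<le> c" using c by (auto simp: sobolev_def sobolev_norm_def intro: real_le_lsqrt)
next
 assume *: "f \<in> sobolev s \<and> sobolev_norm s f \<le> c"
 hence sm: "(\<lambda>k. bessel k powr s*(norm (f k))^2) summable_on UNIV" by (auto simp: sobolev_def)
 have "L2_set (\<lambda>k. bessel k powr (s/2)*norm (f k)) F \<le> c" if "finite F" for F
 proof -
  have "(\<Sum>k\<in>F. bessel k powr s*(norm (f k))^2) \<le> (\<Sum>\<^sub>\<infinity>k. bessel k powr s*(norm (f k))^2)"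
   by (rule finite_sum_le_infsum[OF sm that]) auto
  hence "L2_set (\<lambda>k. bessel k powr (s/2)*norm (f k)) F \<le> sobolev_norm s f"
   unfolding L2_set_bessel_sq[symmetric] sobolev_norm_def by (rule real_le_rsqrt)
  thus ?thesis using * by linarith
 qed
 thus "sob_le s f c" by (auto simp: sob_le_def)
qed

lemma sob_le_sobolev: "sob_le s f c ==> f \<in> sobolev s"
 and sob_le_norm: "sob_le s f c ==> sobolev_norm s f \<le> c" by (auto simp: sob_le_iff)

lemma sobolev_sob_le: "f \<in> sobolev s ==> sob_le s f (sobolev_norm s f)" by (auto simp: sob_le_iff)

lemma sobolev_norm_nonneg [simp]: "0 \<le> sobolev_norm s f" by (auto simp: sobolev_norm_def intro!: infsum_nonneg)

lemma sob_le_mono: "sob_le s f c ==> c \<le> d ==> sob_le s f d" by (auto simp: sob_le_iff)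

lemma sob_le_add: "sob_le s f a ==> sob_le s g b ==> sob_le s (f + g) (a + b)" unfolding sob_le_def
proof (intro allI impI)
 fix F :: "(int \<times> int) set"
 assume f: "\<forall>F. finite F --> L2_set (\<lambda>k. bessel k powr (s/2)*norm (f k)) F \<le> a"
  and g: "\<forall>F. finite F --> L2_set (\<lambda>k. bessel k powr (s/2)*norm (g k)) F \<le> b" and F: "finite F"
 have "L2_set (\<lambda>k. bessel k powr (s/2)*norm ((f + g) k)) F \<le>
   L2_set (\<lambda>k. bessel k powr (s/2)*norm (f k) + bessel k powr (s/2)*norm (g k)) F"
  by (rule L2_set_mono) (auto simp: distrib_left[symmetric] intro!: mult_left_mono norm_triangle_ineq)
 also have "... \<le> L2_set (\<lambda>k. bessel k powr (s/2)*norm (f k)) F + L2_set (\<lambda>k. bessel k powr (s/2)*norm (g k)) F"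
  by (rule L2_set_triangle_ineq)
 also have "... \<le> a + b" using f g F by (meson add_mono)
 finally show "L2_set (\<lambda>k. bessel k powr (s/2)*norm ((f + g) k)) F \<le> a + b" .
qed

text \<open>A Fourier multiplier whose symbol grows at most like \<open>bessel k powr (r/2)\<close>
  has order \<open>r\<close>. The mapping properties of \<open>resolv\<close>,
  \<open>laplace\<close>, the derivatives and \<open>mres\<close> on Sobolev spaces are
  instances.\<close>

lemma sob_le_mult:
 assumes f: "sob_le (s + r) f a" and c: "0 \<le> c"
  and le: "\<And>k. norm (g k) \<le> c*bessel k powr (r/2)*norm (f k)"
 shows "sob_le s g (c*a)" unfolding sob_le_def
proof (intro allI impI)
 fix F :: "(int \<times> int) set" assume F: "finite F"
 have "bessel k powr (s/2)*norm (g k) \<le> c*(bessel k powr ((s + r)/2)*norm (f k))" for k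
 proof -
  have "bessel k powr (s/2)*norm (g k) \<le> bessel k powr (s/2)*(c*bessel k powr (r/2)*norm (f k))" by (rule mult_left_mono[OF le]) auto
  also have "... = c*(bessel k powr ((s + r)/2)*norm (f k))" by (simp add: add_divide_distrib powr_add)
  finally show ?thesis .
 qed
 hence "L2_set (\<lambda>k. bessel k powr (s/2)*norm (g k)) F
   \<le> L2_set (\<lambda>k. c*(bessel k powr ((s + r)/2)*norm (f k))) F" by (intro L2_set_mono) auto
 also have "... = c*L2_set (\<lambda>k. bessel k powr ((s + r)/2)*norm (f k)) F" using c by (simp add: L2_set_right_distrib)
 also have "... \<le> c*a" using f F c by (auto simp: sob_le_def intro!: mult_left_mono)
 finally show "L2_set (\<lambda>k. bessel k powr (s/2)*norm (g k)) F \<le> c*a" .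
qed

lemma sob_le_mult0:
 assumes f: "sob_le s f a" and c: "0 \<le> c" and le: "\<And>k. norm (g k) \<le> c*norm (f k)"
 shows "sob_le s g (c*a)" using sob_le_mult[of s 0 f a c g] assms by simp

lemma sob_le_tscale: "sob_le s f a ==> sob_le s (tscale c f) (norm c*a)" by (rule sob_le_mult0) (auto simp: tscale_def norm_mult)

lemma sob_le_uminus: "sob_le s f a ==> sob_le s (- f) a" using sob_le_mult0[of s f a 1 "- f"] by simp

lemma sob_le_diff: "sob_le s f a ==> sob_le s g b ==> sob_le s (f - g) (a + b)"
 using sob_le_add[OF _ sob_le_uminus, of s f a g b] by (simp only: diff_conv_add_uminus)

lemma sob_le_index:
 assumes "sob_le s f a" "r \<le> s" shows "sob_le r f a"
proof -
 have "norm (f k) \<le> 1*bessel k powr ((s - r)/2)*norm (f k)" for k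
  using mult_right_mono[OF ge_one_powr_ge_zero[of "bessel k" "(s - r)/2"], of "norm (f k)"] assms by simp
 thus ?thesis using sob_le_mult[of r "s - r" f a 1 f] assms by simp
qed

lemma sob_le_coeff:
 assumes "sob_le s f a" shows "bessel k powr (s/2)*norm (f k) \<le> a"
proof -
 have "L2_set (\<lambda>k. bessel k powr (s/2)*norm (f k)) {k} \<le> a" using assms unfolding sob_le_def by blast
 thus ?thesis by (simp add: L2_set_def)
qed

lemma sob_le_coeff_diff:
 assumes "sob_le s f a" shows "norm (f k) \<le> bessel k powr (- s/2)*a"
proof -
 have "norm (f k) = bessel k powr (- s/2)*(bessel k powr (s/2)*norm (f k))" by (simp add: powr_add[symmetric] mult.assoc[symmetric])
 also have "... \<le> bessel k powr (- s/2)*a" by (rule mult_left_mono[OF sob_le_coeff[OF assms]]) auto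
 finally show ?thesis .
qed

lemma sob_le_zero: "0 \<le> a ==> sob_le s 0 a" by (auto simp: sob_le_def L2_set_def)

lemma sob_le_sum:
 assumes "finite J" "\<And>j. j \<in> J ==> sob_le s (F j) (a j)"
 shows "sob_le s (\<lambda>k. \<Sum>j\<in>J. F j k) (\<Sum>j\<in>J. a j)" using assms
proof (induction rule: finite_induct)
 case empty
 thus ?case using sob_le_zero[of 0 s] by (simp add: zero_fun_def)
next
 case (insert x J)
 hence "sob_le s (F x + (\<lambda>k. \<Sum>j\<in>J. F j k)) (a x + sum a J)" by (intro sob_le_add) auto
 thus ?case using insert by (simp add: plus_fun_def)
qed

text \<open>A square sum over finitely many frequencies is continuous in the coefficients, so the
  bound for finite subfamilies survives the coefficientwise limit. Convergence of the series in norm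
  never has to be shown.\<close>

lemma sob_le_infsum:
 fixes a :: "'i \<Rightarrow> real"
 assumes le: "\<And>j. j \<in> J ==> sob_le s (F j) (a j)" and a: "a summable_on J"
 shows "(\<lambda>j. norm (F j k)) summable_on J" and "sob_le s (\<lambda>k. \<Sum>\<^sub>\<infinity>j\<in>J. F j k) (\<Sum>\<^sub>\<infinity>j\<in>J. a j)"
proof -
 have pos: "0 \<le> a j" if "j \<in> J" for j using sob_leD_nonneg[OF le[OF that]] .
 have sm: "(\<lambda>j. norm (F j k)) summable_on J" for k
 proof (rule summable_on_comparison_test)
  show "(\<lambda>j. bessel k powr (- s/2)*a j) summable_on J" by (rule summable_on_cmult_right[OF a])
  show "norm (F j k) \<le> bessel k powr (- s/2)*a j" if "j \<in> J" for j by (rule sob_le_coeff_diff[OF le[OF that]])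
 qed auto
 show "(\<lambda>j. norm (F j k)) summable_on J" by (rule sm)
 show "sob_le s (\<lambda>k. \<Sum>\<^sub>\<infinity>j\<in>J. F j k) (\<Sum>\<^sub>\<infinity>j\<in>J. a j)" unfolding sob_le_def
 proof (intro allI impI)
  fix K :: "(int \<times> int) set" assume K: "finite K"
  have "((\<lambda>j. F j k) has_sum (\<Sum>\<^sub>\<infinity>j\<in>J. F j k)) J" for k by (rule has_sum_infsum[OF abs_summable_summable[OF sm]])
  hence "((\<lambda>A. \<Sum>j\<in>A. F j k) \<longlongrightarrow> (\<Sum>\<^sub>\<infinity>j\<in>J. F j k)) (finite_subsets_at_top J)" for k
   by (simp add: has_sum_def)
  hence "((\<lambda>A. L2_set (\<lambda>k. bessel k powr (s/2)*norm (\<Sum>j\<in>A. F j k)) K) \<longlongrightarrow>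
   L2_set (\<lambda>k. bessel k powr (s/2)*norm (\<Sum>\<^sub>\<infinity>j\<in>J. F j k)) K) (finite_subsets_at_top J)"
   unfolding L2_set_def by (intro tendsto_intros)
  moreover have "eventually (\<lambda>A. L2_set (\<lambda>k. bessel k powr (s/2)*norm (\<Sum>j\<in>A. F j k)) K
    \<le> (\<Sum>\<^sub>\<infinity>j\<in>J. a j)) (finite_subsets_at_top J)"
  proof (rule eventually_finite_subsets_at_top_weakI)
   fix A assume A: "finite A" "A \<subseteq> J"
   have "sob_le s (\<lambda>k. \<Sum>j\<in>A. F j k) (\<Sum>j\<in>A. a j)" by (rule sob_le_sum) (use A le in auto)
   moreover have "(\<Sum>j\<in>A. a j) \<le> (\<Sum>\<^sub>\<infinity>j\<in>J. a j)" by (rule finite_sum_le_infsum[OF a]) (use A pos in auto)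
   ultimately show "L2_set (\<lambda>k. bessel k powr (s/2)*norm (\<Sum>j\<in>A. F j k)) K \<le> (\<Sum>\<^sub>\<infinity>j\<in>J. a j)"
    using K unfolding sob_le_def by (meson order_trans)
  qed
  ultimately show "L2_set (\<lambda>k. bessel k powr (s/2)*norm (\<Sum>\<^sub>\<infinity>j\<in>J. F j k)) K \<le> (\<Sum>\<^sub>\<infinity>j\<in>J. a j)"
   by (rule tendsto_upperbound) auto
 qed
qed

section \<open>Fourier series on the torus\<close>

definition character :: "int \<times> int \<Rightarrow> real \<times> real \<Rightarrow> complex" where
 "character k x = cis (2*pi*(freq k \<bullet> x))"

definition fsupp :: "tdist \<Rightarrow> bool" where
 "fsupp f \<longleftrightarrow> finite {k. f k \<noteq> 0}"

lemma freq_add: "freq (k + l) = freq k + freq l"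
 and freq_diff: "freq (k - l) = freq k - freq l"
 and freq_uminus: "freq (- k) = - freq k"
 and freq_zero [simp]: "freq 0 = 0" by (auto simp: freq_def zero_prod_def)

lemma norm_character [simp]: "norm (character k x) = 1" by (simp add: character_def)

lemma character_add: "character (k + l) x = character k x*character l x" by (simp add: character_def freq_add inner_add_left cis_mult ring_distribs)

lemma cnj_character: "cnj (character k x) = character (- k) x" by (simp add: character_def freq_uminus cis_cnj)

lemma fourier_character: "fourier f k = (\<integral>x. f x*character (- k) x \<partial>torus)" by (simp add: fourier_def character_def freq_uminus)

lemma trig_character: "trig f x = (\<Sum>\<^sub>\<infinity>k. f k*character k x)" by (simp add: trig_def character_def)

lemma trig_finite:
 assumes "finite A" "\<And>k. k \<notin> A ==> f k = 0"
 shows "trig f x = (\<Sum>k\<in>A. f k*character k x)"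
proof -
 have "trig f x = (\<Sum>\<^sub>\<infinity>k\<in>A. f k*character k x)" unfolding trig_character by (rule infsum_cong_neutral) (use assms in auto)
 thus ?thesis using assms by simp
qed

lemma space_torus [simp]: "space torus = {0..<1} \<times> {0..<1}" by (simp add: torus_def space_restrict_space)

lemma unit_square_sets [measurable]: "({0..<1} \<times> {0..<1} :: (real \<times> real) set) \<in> sets borel"
 by (simp add: borel_prod[symmetric] pair_measureI)

lemma sets_torus: "sets torus = sets (restrict_space borel ({0..<1} \<times> {0..<1}))" unfolding torus_def by (rule sets_restrict_space_cong) simp

lemma measurable_torus [measurable (raw)]: "f \<in> borel_measurable borel ==> f \<in> borel_measurable torus"
 unfolding torus_def by (rule measurable_restrict_space1) simp

lemma continuous_character: "continuous_on UNIV (character k)" unfolding character_def cis_conv_exp by (intro continuous_intros)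

lemma measurable_character [measurable]: "character k \<in> borel_measurable torus"
 by (rule measurable_torus) (rule borel_measurable_continuous_onI[OF continuous_character])

lemma integral_cis_unit:
 "integrable lborel (\<lambda>x. indicator {0..<1} x *\<^sub>R cis (2*pi*(of_int n*x)))"
 "(\<integral>x. indicator {0..<1} x *\<^sub>R cis (2*pi*(of_int n*x)) \<partial>lborel) = (if n = 0 then 1 else 0)"
proof -
 \<comment> \<open>The fundamental theorem of calculus is applied on the closed interval while the
   torus is half-open; the missing end point is a null set.\<close>
 have ae: "AE x in lborel. indicator {0..<1} x *\<^sub>R cis (2*pi*(of_int n*x)) = indicator {0..1::real} x *\<^sub>R cis (2*pi*(of_int n*x))"
  using AE_lborel_singleton[of "1::real"] by eventually_elim (auto simp: indicator_def)
 define F where "F = (\<lambda>x::real. if n = 0 then of_real x else cis (2*pi*(of_int n*x))/(2*pi*n*\<i>))"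
 have "has_bochner_integral lborel (\<lambda>x. indicator {0..1} x *\<^sub>R cis (2*pi*(of_int n*x))) (F 1 - F 0)"
 proof (rule has_bochner_integral_FTC_Icc)
  fix x :: real
  have "(F has_vector_derivative cis (2*pi*(of_int n*x))) (at x)"
  proof (cases "n = 0")
   case True
   thus ?thesis unfolding F_def has_vector_derivative_complex_iff by (auto intro!: derivative_eq_intros simp: has_vector_derivative_def)
  next
   case False
   have "((\<lambda>x. cis (2*pi*(of_int n*x))/(2*pi*n*\<i>)) has_vector_derivative cis (2*pi*(of_int n*x))) (at x)" unfolding cis_conv_exp
    by (rule has_vector_derivative_real_field derivative_eq_intros refl exI | use False in \<open>simp add: field_simps scaleR_conv_of_real\<close>)+
   thus ?thesis using False by (simp add: F_def)
  qed
  thus "(F has_vector_derivative cis (2*pi*(of_int n*x))) (at x within {0..1})" by (rule has_vector_derivative_at_within)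
 qed (auto simp: cis_conv_exp intro!: continuous_intros)
 moreover have "F 1 - F 0 = (if n = 0 then 1 else 0)"
 proof -
  have "cis (2*(pi*real_of_int n)) = 1" using cis_multiple_2pi[of "of_int n"] by (simp add: mult.assoc mult.commute mult.left_commute)
  thus ?thesis by (auto simp: F_def)
 qed
 ultimately have *: "has_bochner_integral lborel (\<lambda>x. indicator {0..1} x *\<^sub>R cis (2*pi*(of_int n*x))) (if n = 0 then 1 else 0)" by simp
 have "has_bochner_integral lborel (\<lambda>x. indicator {0..<1} x *\<^sub>R cis (2*pi*(of_int n*x))) (if n = 0 then 1 else 0)"
 proof (subst has_bochner_integral_cong_AE[OF _ _ ae])
  have [measurable]: "(\<lambda>x. cis (2*pi*(of_int n*x))) \<in> borel_measurable borel"
   unfolding cis_conv_exp by (intro borel_measurable_continuous_onI continuous_intros)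
  show "(\<lambda>x. indicator {0..<1} x *\<^sub>R cis (2*pi*(of_int n*x))) \<in> borel_measurable lborel"
   "(\<lambda>x. indicator {0..1} x *\<^sub>R cis (2*pi*(of_int n*x))) \<in> borel_measurable lborel" by measurable
 qed (rule *)
 thus "integrable lborel (\<lambda>x. indicator {0..<1} x *\<^sub>R cis (2*pi*(of_int n*x)))"
  "(\<integral>x. indicator {0..<1} x *\<^sub>R cis (2*pi*(of_int n*x)) \<partial>lborel) = (if n = 0 then 1 else 0)" by (auto simp: has_bochner_integral_iff)
qed

abbreviation nsq :: "(real \<times> real \<Rightarrow> complex) \<Rightarrow> real" where "nsq g \<equiv> \<integral>x. (norm (g x))^2 \<partial>torus"

lemma prob_torus: "prob_space torus"
proof
 have "emeasure torus (space torus) = emeasure lborel ({0..<1::real} \<times> {0..<1::real})"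
  unfolding space_torus unfolding torus_def by (subst emeasure_restrict_space) auto
 also have "... = emeasure (lborel \<Otimes>\<^sub>M lborel) ({0..<1::real} \<times> {0..<1::real})" by (simp add: lborel_prod)
 also have "... = 1" by (subst lborel.emeasure_pair_measure_Times) auto
 finally show "emeasure torus (space torus) = 1" .
qed

interpretation torus: prob_space torus by (rule prob_torus)

lemma integrable_torus_bounded:
 fixes f :: "real \<times> real \<Rightarrow> 'a :: {banach, second_countable_topology}"
 shows "f \<in> borel_measurable torus ==> (\<And>x. x \<in> space torus ==> norm (f x) \<le> B) ==> integrable torus f"
 by (rule torus.integrable_const_bound[where B = B]) auto

lemma integral_character: "(\<integral>x. character k x \<partial>torus) = (if k = 0 then 1 else 0)"
proof -
 obtain a b where k: "k = (a, b)" by (cases k)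
 let ?g = "\<lambda>n x. indicator {0..<1::real} x *\<^sub>R cis (2*pi*(of_int n*x))"
 have eq: "indicator ({0..<1} \<times> {0..<1}) (x, y) *\<^sub>R character k (x, y) = ?g a x*?g b y" for x y :: real
  by (auto simp: character_def k freq_def indicator_def cis_mult ring_distribs)
 have int: "integrable (lborel \<Otimes>\<^sub>M lborel) (\<lambda>z. indicator ({0..<1} \<times> {0..<1}) z *\<^sub>R character k z)"
 proof -
  have "integrable torus (character k)" by (rule integrable_torus_bounded[where B = 1]) auto
  thus ?thesis unfolding torus_def by (subst (asm) integrable_restrict_space) (auto simp: lborel_prod)
 qed
 have "(\<integral>x. character k x \<partial>torus) = (\<integral>z. indicator ({0..<1} \<times> {0..<1}) z *\<^sub>R character k z \<partial>lborel)"
  unfolding torus_def by (rule integral_restrict_space) simp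
 also have "... = (\<integral>x. (\<integral>y. indicator ({0..<1} \<times> {0..<1}) (x, y) *\<^sub>R character k (x, y) \<partial>lborel) \<partial>lborel)"
  using lborel_pair.integral_fst'[OF int] by (simp add: lborel_prod)
 also have "... = (\<integral>x. ?g a x*(if b = 0 then 1 else 0) \<partial>lborel)" unfolding eq by (simp only: integral_mult_right_zero integral_cis_unit)
 also have "... = (if k = 0 then 1 else 0)" unfolding integral_mult_left_zero integral_cis_unit by (auto simp: k zero_prod_def)
 finally show ?thesis .
qed

lemma integrable_character_mult: "g \<in> L2fun ==> integrable torus (\<lambda>x. g x*character k x)"
proof -
 assume g: "g \<in> L2fun"
 hence [measurable]: "g \<in> borel_measurable torus" and i: "integrable torus (\<lambda>x. (norm (g x))^2)" by (auto simp: L2fun_def)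
 have "integrable torus (\<lambda>x. 1 + (norm (g x))^2)" using i by auto
 thus ?thesis
 proof (rule Bochner_Integration.integrable_bound)
  have "norm (g x) \<le> 1 + (norm (g x))^2" for x using sum_squares_bound[of "norm (g x)" 1] by (simp add: power2_eq_square) (smt (verit) norm_ge_zero)
  thus "AE x in torus. norm (g x*character k x) \<le> norm (1 + (norm (g x))^2)" by (auto simp: norm_mult)
 qed auto
qed

lemma L2fun_bounded: "f \<in> borel_measurable torus ==> (\<And>x. x \<in> space torus ==> norm (f x) \<le> B) ==> f \<in> L2fun"
proof -
 assume [measurable]: "f \<in> borel_measurable torus" and B: "\<And>x. x \<in> space torus ==> norm (f x) \<le> B"
 have "integrable torus (\<lambda>x. (norm (f x))^2)" by (rule integrable_torus_bounded[where B = "B^2"]) (use B in \<open>auto intro!: power_mono\<close>)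
 thus ?thesis by (simp add: L2fun_def)
qed

lemma integrable_L2fun_mult:
 assumes "f \<in> L2fun" "g \<in> L2fun"
 shows "integrable torus (\<lambda>x. f x*g x)"
proof -
 have [measurable]: "f \<in> borel_measurable torus" "g \<in> borel_measurable torus"
  and i: "integrable torus (\<lambda>x. (norm (f x))^2)" "integrable torus (\<lambda>x. (norm (g x))^2)" using assms by (auto simp: L2fun_def)
 have "integrable torus (\<lambda>x. (norm (f x))^2 + (norm (g x))^2)" using i by auto
 thus ?thesis
 proof (rule Bochner_Integration.integrable_bound)
  have "norm (f x*g x) \<le> (norm (f x))^2 + (norm (g x))^2" for x
   using sum_squares_bound[of "norm (f x)" "norm (g x)"] mult_nonneg_nonneg[OF norm_ge_zero norm_ge_zero, of "f x" "g x"] unfolding norm_mult by linarith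
  thus "AE x in torus. norm (f x*g x) \<le> norm ((norm (f x))^2 + (norm (g x))^2)" by auto
 qed auto
qed

lemma L2fun_cnj: "g \<in> L2fun ==> (\<lambda>x. cnj (g x)) \<in> L2fun"
 by (auto simp: L2fun_def intro: measurable_compose[OF _ borel_measurable_continuous_onI[OF continuous_on_cnj[OF continuous_on_id]]])

lemma L2fun_scale: "g \<in> L2fun ==> (\<lambda>x. c*g x) \<in> L2fun" by (auto simp: L2fun_def norm_mult power_mult_distrib)

lemma L2fun_add:
 assumes "f \<in> L2fun" "g \<in> L2fun"
 shows "(\<lambda>x. f x + g x) \<in> L2fun"
proof -
 have [measurable]: "f \<in> borel_measurable torus" "g \<in> borel_measurable torus"
  and i: "integrable torus (\<lambda>x. (norm (f x))^2)" "integrable torus (\<lambda>x. (norm (g x))^2)" using assms by (auto simp: L2fun_def)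
 have "integrable torus (\<lambda>x. 2*((norm (f x))^2 + (norm (g x))^2))" using i by auto
 hence "integrable torus (\<lambda>x. (norm (f x + g x))^2)"
 proof (rule Bochner_Integration.integrable_bound)
  have "(norm (f x + g x))^2 \<le> 2*((norm (f x))^2 + (norm (g x))^2)" for x
  proof -
   have "(norm (f x + g x))^2 \<le> (norm (f x) + norm (g x))^2" by (intro power_mono norm_triangle_ineq) auto
   also have "... \<le> 2*((norm (f x))^2 + (norm (g x))^2)" using sum_squares_bound[of "norm (f x)" "norm (g x)"] by (simp add: power2_sum)
   finally show ?thesis .
  qed
  thus "AE x in torus. norm ((norm (f x + g x))^2) \<le> norm (2*((norm (f x))^2 + (norm (g x))^2))" by auto
 qed auto
 thus ?thesis by (simp add: L2fun_def)
qed

lemma L2fun_diff: "f \<in> L2fun ==> g \<in> L2fun ==> (\<lambda>x. f x - g x) \<in> L2fun"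
 using L2fun_add[of f "\<lambda>x. (-1)*g x"] L2fun_scale[of g "-1"] by simp

lemma trig_finite_fun:
 assumes "finite A" "\<And>k. k \<notin> A ==> f k = 0"
 shows "trig f = (\<lambda>x. \<Sum>k\<in>A. f k*character k x)" using trig_finite[OF assms] by auto

lemma measurable_trig_fsupp [measurable]: "fsupp f ==> trig f \<in> borel_measurable torus"
 by (subst trig_finite_fun[of "{k. f k \<noteq> 0}"]) (auto simp: fsupp_def)

lemma L2fun_trig: "fsupp f ==> trig f \<in> L2fun"
proof (rule L2fun_bounded)
 assume f: "fsupp f"
 show "norm (trig f x) \<le> (\<Sum>k\<in>{k. f k \<noteq> 0}. norm (f k))" for x
  using f by (subst trig_finite[of "{k. f k \<noteq> 0}"]) (auto simp: fsupp_def norm_mult intro!: sum_norm_le)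
qed auto

lemma fourier_add: "f \<in> L2fun ==> g \<in> L2fun ==> fourier (\<lambda>x. f x + g x) = fourier f + fourier g"
 by (rule ext) (simp add: fourier_character ring_distribs integrable_character_mult)

lemma fourier_scale: "fourier (\<lambda>x. c*f x) = tscale c (fourier f)" by (rule ext) (simp add: fourier_character tscale_def mult.assoc)

lemma fourier_diff: "f \<in> L2fun ==> g \<in> L2fun ==> fourier (\<lambda>x. f x - g x) = fourier f - fourier g"
 by (rule ext) (simp add: fourier_character ring_distribs integrable_character_mult)

lemma cmod_diff_sq: "(norm (z - w))^2 = (norm z)^2 - 2*Re (z*cnj w) + (norm w)^2" by (simp add: cmod_power2) (simp add: power2_eq_square algebra_simps)

text \<open>Completing the square in the coefficients of \<open>f\<close>. With \<open>f\<close> the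
  truncated Fourier series the last sum vanishes and Bessel's inequality results; with
  \<open>trig f\<close> close to \<open>g\<close> the same identity shows that the partial sums
  nearly exhaust the norm.\<close>

lemma L2_distance_trig:
 assumes g: "g \<in> L2fun" and A: "finite A" "\<And>k. k \<notin> A ==> f k = 0"
 shows "nsq (\<lambda>x. g x - trig f x) =
  nsq g - (\<Sum>k\<in>A. (norm (fourier g k))^2) + (\<Sum>k\<in>A. (norm (f k - fourier g k))^2)"
proof -
 have fs: "fsupp f" using A unfolding fsupp_def by (metis (mono_tags, lifting) finite_subset mem_Collect_eq subsetI)
 note t = L2fun_trig[OF fs]
 have [measurable]: "g \<in> borel_measurable torus" using g by (simp add: L2fun_def)
 have i1: "integrable torus (\<lambda>x. (norm (g x))^2)" "integrable torus (\<lambda>x. (norm (trig f x))^2)" using g t by (auto simp: L2fun_def)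
 have i2: "integrable torus (\<lambda>x. g x*cnj (trig f x))" by (rule integrable_L2fun_mult[OF g L2fun_cnj[OF t]])
 have pt: "(norm (g x - trig f x))^2 = (norm (g x))^2 - 2*Re (g x*cnj (trig f x)) + (norm (trig f x))^2" for x by (rule cmod_diff_sq)
 have c1: "(\<integral>x. g x*cnj (trig f x) \<partial>torus) = (\<Sum>k\<in>A. cnj (f k)*fourier g k)"
 proof -
  have "g x*cnj (trig f x) = (\<Sum>k\<in>A. cnj (f k)*(g x*character (- k) x))" for x
   by (subst trig_finite[OF A]) (simp_all add: sum_distrib_left cnj_character mult_ac)
  thus ?thesis by (simp add: integrable_character_mult[OF g] fourier_character)
 qed
 have c2: "nsq (trig f) = (\<Sum>k\<in>A. (norm (f k))^2)"
 proof -
  have "of_real ((norm (trig f x))^2) = (\<Sum>k\<in>A. \<Sum>l\<in>A. f k*cnj (f l)*character (k - l) x)" for x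
  proof -
   have "of_real ((norm (trig f x))^2) = trig f x*cnj (trig f x)" by (rule complex_norm_square)
   also have "... = (\<Sum>k\<in>A. f k*character k x)*(\<Sum>l\<in>A. cnj (f l)*character (- l) x)"
    by (subst (1 2) trig_finite[OF A]) (simp_all add: cnj_character)
   also have "... = (\<Sum>k\<in>A. \<Sum>l\<in>A. f k*cnj (f l)*character (k - l) x)"
    unfolding sum_product by (intro sum.cong refl) (simp add: character_add[of _ "- _", simplified])
   finally show ?thesis .
  qed
  hence "(\<integral>x. complex_of_real ((norm (trig f x))^2) \<partial>torus) = (\<integral>x. (\<Sum>k\<in>A. \<Sum>l\<in>A. f k*cnj (f l)*character (k - l) x) \<partial>torus)"
   by simp
  also have "... = (\<Sum>k\<in>A. \<Sum>l\<in>A. f k*cnj (f l)*(if k = l then 1 else 0))"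
  proof -
   have [simp]: "integrable torus (character k)" for k by (rule integrable_torus_bounded[where B = 1]) auto
   show ?thesis by (simp add: integral_character)
  qed
  also have "... = (\<Sum>k\<in>A. f k*cnj (f k))" using A(1) by (intro sum.cong refl) (simp add: if_distrib cong: if_cong)
  also have "... = of_real (\<Sum>k\<in>A. (norm (f k))^2)" by (simp only: of_real_sum complex_norm_square)
  finally show ?thesis by (simp only: integral_complex_of_real of_real_eq_iff)
 qed
 have "nsq (\<lambda>x. g x - trig f x) =
  nsq g - 2*Re (\<Sum>k\<in>A. cnj (f k)*fourier g k) + (\<Sum>k\<in>A. (norm (f k))^2)"
 proof -
  have i3: "integrable torus (\<lambda>x. 2*Re (g x*cnj (trig f x)))" by (intro integrable_mult_right integrable_Re i2)
  have "nsq (\<lambda>x. g x - trig f x) =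
    nsq g - (\<integral>x. 2*Re (g x*cnj (trig f x)) \<partial>torus) + nsq (trig f)"
   unfolding pt using i1 i3 by (simp only: Bochner_Integration.integral_add Bochner_Integration.integral_diff Bochner_Integration.integrable_diff)
  thus ?thesis by (simp only: integral_mult_right_zero integral_Re[OF i2] c1 c2)
 qed
 also have "... = nsq g + (\<Sum>k\<in>A. (norm (f k))^2 - 2*Re (cnj (f k)*fourier g k))" unfolding sum_subtractf sum_distrib_left[symmetric] Re_sum by linarith
 also have "(\<Sum>k\<in>A. (norm (f k))^2 - 2*Re (cnj (f k)*fourier g k)) =
  (\<Sum>k\<in>A. (norm (f k - fourier g k))^2 - (norm (fourier g k))^2)"
 proof (intro sum.cong refl)
  fix k
  have "Re (f k*cnj (fourier g k)) = Re (cnj (f k)*fourier g k)" by simp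
  thus "(norm (f k))^2 - 2*Re (cnj (f k)*fourier g k) = (norm (f k - fourier g k))^2 - (norm (fourier g k))^2"
   using cmod_diff_sq[of "f k" "fourier g k"] by linarith
 qed
 also have "... = (\<Sum>k\<in>A. (norm (f k - fourier g k))^2) - (\<Sum>k\<in>A. (norm (fourier g k))^2)" by (rule sum_subtractf)
 finally show ?thesis by linarith
qed

section \<open>Density of trigonometric polynomials in L2 and Parseval's identity\<close>

definition trig_approx :: "(real \<times> real \<Rightarrow> complex) \<Rightarrow> bool" where
 "trig_approx g \<longleftrightarrow> g \<in> L2fun \<and> (\<forall>e>0. \<exists>f. fsupp f \<and> nsq (\<lambda>x. g x - trig f x) < e)"

lemma fsupp_add: "fsupp f ==> fsupp g ==> fsupp (f + g)"
 unfolding fsupp_def by (rule finite_subset[of _ "{k. f k \<noteq> 0} \<union> {k. g k \<noteq> 0}"]) auto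

lemma fsupp_tscale: "fsupp f ==> fsupp (tscale c f)" unfolding fsupp_def tscale_def by (erule rev_finite_subset) auto

lemma fsupp_finite: "finite A ==> (\<And>k. k \<notin> A ==> f k = 0) ==> fsupp f" unfolding fsupp_def by (rule finite_subset[of _ A]) auto

lemma trig_add: "fsupp f ==> fsupp g ==> trig (f + g) x = trig f x + trig g x"
 by (subst (1 2 3) trig_finite[of "{k. f k \<noteq> 0} \<union> {k. g k \<noteq> 0}"])
  (auto simp: fsupp_def ring_distribs sum.distrib)

lemma trig_tscale: "trig (tscale c f) x = c*trig f x" by (simp add: trig_def tscale_def mult.assoc infsum_cmult_right')

lemma integrable_L2fun_sq: "g \<in> L2fun ==> integrable torus (\<lambda>x. (norm (g x))^2)" by (simp add: L2fun_def)

lemma L2_integral_add_le: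
 assumes "f \<in> L2fun" "g \<in> L2fun"
 shows "nsq (\<lambda>x. f x + g x) \<le> 2*nsq f + 2*nsq g"
proof -
 note i = integrable_L2fun_sq[OF assms(1)] integrable_L2fun_sq[OF assms(2)] integrable_L2fun_sq[OF L2fun_add[OF assms]]
 have "nsq (\<lambda>x. f x + g x) \<le> (\<integral>x. 2*(norm (f x))^2 + 2*(norm (g x))^2 \<partial>torus)"
 proof (rule integral_mono[OF i(3)])
  show "integrable torus (\<lambda>x. 2*(norm (f x))^2 + 2*(norm (g x))^2)" using i by auto
  fix x
  have "(norm (f x + g x))^2 \<le> (norm (f x) + norm (g x))^2" by (intro power_mono norm_triangle_ineq) auto
  also have "... \<le> 2*(norm (f x))^2 + 2*(norm (g x))^2" using sum_squares_bound[of "norm (f x)" "norm (g x)"] by (simp add: power2_sum)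
  finally show "(norm (f x + g x))^2 \<le> 2*(norm (f x))^2 + 2*(norm (g x))^2" .
 qed
 also have "... = 2*nsq f + 2*nsq g" using i by simp
 finally show ?thesis .
qed

lemma trig_approx_add:
 assumes "trig_approx g" "trig_approx h"
 shows "trig_approx (\<lambda>x. g x + h x)" unfolding trig_approx_def
proof (intro conjI allI impI)
 have L: "g \<in> L2fun" "h \<in> L2fun" using assms by (auto simp: trig_approx_def)
 show "(\<lambda>x. g x + h x) \<in> L2fun" using L by (rule L2fun_add)
 fix e :: real assume "e > 0"
 hence "e/4 > 0" by simp
 then obtain p q where p: "fsupp p" "nsq (\<lambda>x. g x - trig p x) < e/4"
  and q: "fsupp q" "nsq (\<lambda>x. h x - trig q x) < e/4" using assms unfolding trig_approx_def by blast
 have "nsq (\<lambda>x. (g x - trig p x) + (h x - trig q x)) < e"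
  using L2_integral_add_le[OF L2fun_diff[OF L(1) L2fun_trig[OF p(1)]] L2fun_diff[OF L(2) L2fun_trig[OF q(1)]]] p q by linarith
 moreover have "(g x - trig p x) + (h x - trig q x) = g x + h x - trig (p + q) x" for x by (simp add: trig_add[OF p(1) q(1)])
 ultimately show "\<exists>f. fsupp f \<and> nsq (\<lambda>x. g x + h x - trig f x) < e" using fsupp_add[OF p(1) q(1)] by auto
qed

lemma trig_approx_scale:
 assumes "trig_approx g"
 shows "trig_approx (\<lambda>x. c*g x)" unfolding trig_approx_def
proof (intro conjI allI impI)
 show "(\<lambda>x. c*g x) \<in> L2fun" using assms L2fun_scale by (auto simp: trig_approx_def)
 fix e :: real assume e: "e > 0"
 define d where "d = e/((norm c)^2 + 1)"
 have "d > 0" using e by (auto simp: d_def intro!: divide_pos_pos add_nonneg_pos)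
 then obtain p where p: "fsupp p" "nsq (\<lambda>x. g x - trig p x) < d" using assms unfolding trig_approx_def by blast
 have "(norm (c*g x - trig (tscale c p) x))^2 = (norm c)^2*(norm (g x - trig p x))^2" for x
  by (simp add: trig_tscale right_diff_distrib[symmetric] norm_mult power_mult_distrib)
 hence "nsq (\<lambda>x. c*g x - trig (tscale c p) x) = (norm c)^2*nsq (\<lambda>x. g x - trig p x)" by simp
 also have "... \<le> (norm c)^2*d" using p(2) by (intro mult_left_mono) auto
 also have "... < ((norm c)^2 + 1)*d" using \<open>d > 0\<close> by simp
 also have "... = e"
 proof -
  have "(norm c)^2 + 1 \<noteq> 0" by (smt (verit) zero_le_power2)
  thus ?thesis by (simp add: d_def)
 qed
 finally show "\<exists>f. fsupp f \<and> nsq (\<lambda>x. c*g x - trig f x) < e" using fsupp_tscale[OF p(1)] by blast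
qed

lemma trig_approx_trig: "fsupp f ==> trig_approx (trig f)" unfolding trig_approx_def using L2fun_trig by (auto intro!: exI[of _ f])

lemma trig_approx_close:
 assumes g: "g \<in> L2fun" and c: "\<And>e. e > 0 ==> \<exists>h. trig_approx h \<and> nsq (\<lambda>x. g x - h x) < e"
 shows "trig_approx g" unfolding trig_approx_def
proof (intro conjI allI impI)
 show "g \<in> L2fun" by (rule g)
 fix e :: real assume "e > 0"
 hence e4: "e/4 > 0" by simp
 obtain h where h: "trig_approx h" "nsq (\<lambda>x. g x - h x) < e/4" using c[OF e4] by blast
 obtain q where q: "fsupp q" "nsq (\<lambda>x. h x - trig q x) < e/4" using h(1) e4 unfolding trig_approx_def by blast
 have hL: "h \<in> L2fun" using h by (simp add: trig_approx_def)
 have "nsq (\<lambda>x. (g x - h x) + (h x - trig q x)) < e" using L2_integral_add_le[OF L2fun_diff[OF g hL] L2fun_diff[OF hL L2fun_trig[OF q(1)]]] h q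
  by linarith
 thus "\<exists>f. fsupp f \<and> nsq (\<lambda>x. g x - trig f x) < e" using q(1) by auto
qed

lemma trig_approx_limit:
 assumes g: "g \<in> borel_measurable torus" and h: "\<And>n. trig_approx (h n)"
  and w: "integrable torus w" and bd: "\<And>n x. x \<in> space torus ==> (norm (g x - h n x))^2 \<le> w x"
  and gw: "\<And>x. x \<in> space torus ==> (norm (g x))^2 \<le> w x"
  and lim: "\<And>x. x \<in> space torus ==> (\<lambda>n. h n x) \<longlonglongrightarrow> g x"
 shows "trig_approx g"
proof (rule trig_approx_close)
 note [measurable] = g
 have [measurable]: "h n \<in> borel_measurable torus" for n using h[of n] by (auto simp: trig_approx_def L2fun_def)
 have "integrable torus (\<lambda>x. (norm (g x))^2)"
  by (rule Bochner_Integration.integrable_bound[OF w]) (use gw in \<open>auto intro!: AE_I2 order_trans[OF _ abs_ge_self] simp del: split_paired_All\<close>)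
 thus "g \<in> L2fun" by (simp add: L2fun_def)
 have "(\<lambda>n. \<integral>x. (norm (g x - h n x))^2 \<partial>torus) \<longlonglongrightarrow> (\<integral>x. 0 \<partial>torus)"
 proof (rule integral_dominated_convergence[where w = w])
  have "(\<lambda>n. (norm (g x - h n x))^2) \<longlonglongrightarrow> 0" if "x \<in> space torus" for x
  proof -
   have "(\<lambda>n. (norm (g x - h n x))^2) \<longlonglongrightarrow> (norm (g x - g x))^2" by (intro tendsto_intros lim that)
   thus ?thesis by simp
  qed
  thus "AE x in torus. (\<lambda>n. (norm (g x - h n x))^2) \<longlonglongrightarrow> 0" by auto
 qed (use w bd in auto)
 hence "(\<lambda>n. \<integral>x. (norm (g x - h n x))^2 \<partial>torus) \<longlonglongrightarrow> 0" by simp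
 moreover fix e :: real assume "e > 0"
 ultimately have "eventually (\<lambda>n. nsq (\<lambda>x. g x - h n x) < e) sequentially" by (rule order_tendstoD)
 thus "\<exists>h. trig_approx h \<and> nsq (\<lambda>x. g x - h x) < e" using h eventually_happens'[OF sequentially_bot] by blast
qed

text \<open>Two unit circles carry the periodic structure: continuous functions of
  \<open>circ_embed x\<close> are periodic, and polynomials in the real coordinates of the target
  become trigonometric polynomials, so Stone-Weierstrass on a compact set applies.\<close>

definition circ_embed :: "real \<times> real \<Rightarrow> complex \<times> complex" where
 "circ_embed x = (cis (2*pi*fst x), cis (2*pi * snd x))"

lemma circ_embed_character: "fst (circ_embed x) = character (1, 0) x" "snd (circ_embed x) = character (0, 1) x"
 by (auto simp: circ_embed_def character_def freq_def inner_prod_def)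

lemma continuous_circ_embed: "continuous_on UNIV circ_embed" unfolding circ_embed_def cis_conv_exp by (intro continuous_intros)

lemma cis_inj_unit: "cis (2*pi*x) = cis (2*pi*y) ==> x \<in> {0..<1} ==> y \<in> {0..<1} ==> x = y"
proof -
 assume *: "cis (2*pi*x) = cis (2*pi*y)" and x: "x \<in> {0..<1}" and y: "y \<in> {0..<1}"
 hence "exp (of_real (2*pi*x)*\<i>) = exp (of_real (2*pi*y)*\<i>)" by (simp add: cis_conv_exp mult.commute)
 then obtain n :: int where "of_real (2*pi*x)*\<i> = of_real (2*pi*y)*\<i> + (of_int (2*n)*pi)*\<i>" by (auto simp: exp_eq)
 hence "Im (of_real (2*pi*x)*\<i>) = Im (of_real (2*pi*y)*\<i> + (of_int (2*n)*pi)*\<i>)" by simp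
 hence "2*pi*x = 2*pi*y + 2*n*pi" by simp
 hence "pi*(2*(x - y - n)) = 0" by (simp add: algebra_simps)
 hence "x - y = n" by simp
 moreover have "\<bar>x - y\<bar> < 1" using x y by auto
 ultimately have "n = 0" by linarith
 with \<open>x - y = n\<close> show "x = y" by simp
qed

lemma inj_circ_embed: "inj_on circ_embed ({0..<1} \<times> {0..<1})"
proof (rule inj_onI)
 fix x y :: "real \<times> real"
 assume "x \<in> {0..<1} \<times> {0..<1}" "y \<in> {0..<1} \<times> {0..<1}" "circ_embed x = circ_embed y"
 hence "fst x = fst y" "snd x = snd y" using cis_inj_unit[of "fst x" "fst y"] cis_inj_unit[of "snd x" "snd y"] by (simp_all add: circ_embed_def mem_Times_iff)
 thus "x = y" by (rule prod_eqI)
qed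

definition trig_poly :: "(real \<times> real \<Rightarrow> complex) \<Rightarrow> bool" where
 "trig_poly g \<longleftrightarrow> (\<exists>f. fsupp f \<and> (\<forall>x. g x = trig f x))"

lemma trig_polyI: "fsupp f ==> (\<And>x. g x = trig f x) ==> trig_poly g" by (auto simp: trig_poly_def)

lemma trig_poly_add:
 assumes "trig_poly g" "trig_poly h" shows "trig_poly (\<lambda>x. g x + h x)"
proof -
 obtain p q where "fsupp p" "\<And>x. g x = trig p x" "fsupp q" "\<And>x. h x = trig q x" using assms by (auto simp: trig_poly_def)
 thus ?thesis by (intro trig_polyI[OF fsupp_add, of p q]) (simp_all add: trig_add)
qed

lemma trig_poly_scale:
 assumes "trig_poly g" shows "trig_poly (\<lambda>x. c*g x)"
proof -
 obtain p where "fsupp p" "\<And>x. g x = trig p x" using assms by (auto simp: trig_poly_def)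
 thus ?thesis by (intro trig_polyI[OF fsupp_tscale, of p _ c]) (simp_all add: trig_tscale)
qed

lemma trig_poly_character: "trig_poly (character k)"
proof -
 have "fsupp (\<lambda>l. if l = k then 1 else 0)" by (rule fsupp_finite[of "{k}"]) auto
 moreover have "trig (\<lambda>l. if l = k then 1 else 0) x = character k x" for x by (subst trig_finite[of "{k}"]) auto
 ultimately show ?thesis by (intro trig_polyI) auto
qed

lemma trig_poly_sum: "finite A ==> (\<And>a. a \<in> A ==> trig_poly (g a)) ==> trig_poly (\<lambda>x. \<Sum>a\<in>A. g a x)"
proof (induction rule: finite_induct)
 case empty
 show ?case using trig_poly_scale[OF trig_poly_character, of 0] by simp
qed (simp add: trig_poly_add)

lemma trig_poly_mult:
 assumes "trig_poly g" "trig_poly h" shows "trig_poly (\<lambda>x. g x*h x)"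
proof -
 obtain p q where p: "fsupp p" "\<And>x. g x = trig p x" and q: "fsupp q" "\<And>x. h x = trig q x" using assms by (auto simp: trig_poly_def)
 have "g x*h x = (\<Sum>k\<in>{k. p k \<noteq> 0}. \<Sum>l\<in>{k. q k \<noteq> 0}. (p k*q l)*character (k + l) x)" for x
 proof -
  have "g x*h x = (\<Sum>k\<in>{k. p k \<noteq> 0}. p k*character k x)*(\<Sum>l\<in>{k. q k \<noteq> 0}. q l*character l x)" unfolding p q
   by (rule arg_cong2[where f = "(*)"]; rule trig_finite) (use p q in \<open>auto simp: fsupp_def\<close>)
  also have "... = (\<Sum>k\<in>{k. p k \<noteq> 0}. \<Sum>l\<in>{k. q k \<noteq> 0}. (p k*q l)*character (k + l) x)"
   unfolding sum_product by (intro sum.cong refl) (simp add: character_add)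
  finally show ?thesis .
 qed
 hence "(\<lambda>x. g x*h x) = (\<lambda>x. \<Sum>k\<in>{k. p k \<noteq> 0}. \<Sum>l\<in>{k. q k \<noteq> 0}. (p k*q l)*character (k + l) x)" by auto
 moreover have "trig_poly ..." using p(1) q(1) by (intro trig_poly_sum trig_poly_scale trig_poly_character) (auto simp: fsupp_def)
 ultimately show ?thesis by simp
qed

lemma trig_poly_real_polynomial:
 "real_polynomial_function q ==> trig_poly (\<lambda>x. of_real (q (circ_embed x)))"
proof (induction rule: real_polynomial_function.induct)
 case (linear f)
 interpret bounded_linear f by fact
 have Re: "trig_poly (\<lambda>x. of_real (Re (character k x)))" for k
 proof -
  have "of_real (Re (character k x)) = (1/2)*character k x + (1/2)*character (- k) x" for x by (simp add: complex_eq_iff cnj_character[symmetric])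
  hence "(\<lambda>x. of_real (Re (character k x))) = (\<lambda>x. (1/2)*character k x + (1/2)*character (- k) x)" by (rule ext)
  thus ?thesis by (metis trig_poly_add trig_poly_scale trig_poly_character)
 qed
 have Im: "trig_poly (\<lambda>x. of_real (Im (character k x)))" for k
 proof -
  have "of_real (Im (character k x)) = (- \<i>/2)*character k x + (\<i>/2)*character (- k) x" for x by (simp add: complex_eq_iff cnj_character[symmetric])
  hence "(\<lambda>x. of_real (Im (character k x))) = (\<lambda>x. (- \<i>/2)*character k x + (\<i>/2)*character (- k) x)" by (rule ext)
  thus ?thesis by (metis trig_poly_add trig_poly_scale trig_poly_character)
 qed
 have *: "f (z, w) = Re z*f (1, 0) + Im z*f (\<i>, 0) + Re w*f (0, 1) + Im w*f (0, \<i>)" for z w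
 proof -
  have "(z, w) = Re z *\<^sub>R (1, 0) + Im z *\<^sub>R (\<i>, 0) + Re w *\<^sub>R (0, 1) + Im w *\<^sub>R (0, \<i>)" by (simp add: complex_eq_iff)
  hence "f (z, w) = f (Re z *\<^sub>R (1, 0) + Im z *\<^sub>R (\<i>, 0) + Re w *\<^sub>R (0, 1) + Im w *\<^sub>R (0, \<i>))" by (rule arg_cong)
  thus ?thesis by (simp only: add scaleR real_scaleR_def)
 qed
 hence "complex_of_real (f (circ_embed x)) = of_real (f (1, 0)) * of_real (Re (character (1, 0) x))
  + of_real (f (\<i>, 0)) * of_real (Im (character (1, 0) x))
  + of_real (f (0, 1)) * of_real (Re (character (0, 1) x))
  + of_real (f (0, \<i>)) * of_real (Im (character (0, 1) x))" for x
 proof -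
  have "f (circ_embed x) = f (1, 0)*Re (character (1, 0) x) + f (\<i>, 0)*Im (character (1, 0) x)
    + f (0, 1)*Re (character (0, 1) x) + f (0, \<i>)*Im (character (0, 1) x)" using * [of "fst (circ_embed x)" "snd (circ_embed x)"]
   unfolding circ_embed_character[symmetric] prod.collapse by (simp only: mult.commute)
  thus ?thesis by (simp only: of_real_add of_real_mult)
 qed
 moreover have "trig_poly (\<lambda>x. of_real (f (1, 0)) * of_real (Re (character (1, 0) x))
  + of_real (f (\<i>, 0)) * of_real (Im (character (1, 0) x))
  + of_real (f (0, 1)) * of_real (Re (character (0, 1) x))
  + of_real (f (0, \<i>)) * of_real (Im (character (0, 1) x)))" by (intro trig_poly_add trig_poly_scale Re Im)
 ultimately show ?case by (simp only:)
next
 case (const c)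
 thus ?case using trig_poly_scale[OF trig_poly_character[of 0], of "of_real c"] by (simp add: character_def)
next
 case (add f g)
 thus ?case using trig_poly_add[OF add.IH] by simp
next
 case (mult f g)
 thus ?case using trig_poly_mult[OF mult.IH] by simp
qed

lemma trig_poly_approx: "trig_poly g ==> trig_approx g"
proof -
 assume "trig_poly g"
 then obtain f where f: "fsupp f" "\<And>x. g x = trig f x" by (auto simp: trig_poly_def)
 hence "g = trig f" by auto
 thus ?thesis using trig_approx_trig[OF f(1)] by simp
qed

lemma trig_approx_cong:
 assumes "\<And>x. x \<in> space torus ==> g x = h x"
 shows "trig_approx g \<longleftrightarrow> trig_approx h"
proof -
 have m: "g \<in> borel_measurable torus \<longleftrightarrow> h \<in> borel_measurable torus" by (rule measurable_cong[OF assms])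
 have i: "integrable torus (\<lambda>x. (norm (g x))^2) \<longleftrightarrow> integrable torus (\<lambda>x. (norm (h x))^2)"
  by (intro Bochner_Integration.integrable_cong) (auto simp: assms simp del: space_torus)
 have n: "nsq (\<lambda>x. g x - trig f x) = nsq (\<lambda>x. h x - trig f x)" for f
  by (intro Bochner_Integration.integral_cong) (auto simp: assms simp del: space_torus)
 show ?thesis unfolding trig_approx_def L2fun_def by (simp add: m i n)
qed

lemma L2_integral_le_sq:
 fixes g :: "real \<times> real \<Rightarrow> complex"
 assumes "g \<in> borel_measurable torus" "\<And>x. x \<in> space torus ==> norm (g x) \<le> B"
 shows "nsq g \<le> B^2"
proof -
 have "nsq g \<le> (\<integral>x. B^2 \<partial>torus)"
  by (rule integral_mono) (use assms integrable_L2fun_sq[OF L2fun_bounded[OF assms]] in \<open>auto intro!: power_mono\<close>)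
 thus ?thesis by (simp add: torus.prob_space[unfolded space_torus])
qed

lemma trig_approx_continuous:
 fixes h :: "complex \<times> complex \<Rightarrow> real"
 assumes h: "continuous_on UNIV h"
 shows "trig_approx (\<lambda>x. of_real (h (circ_embed x)))"
proof (rule trig_approx_close)
 define K where "K = sphere (0::complex) 1 \<times> sphere (0::complex) 1"
 have K: "compact K" unfolding K_def by (intro compact_Times compact_sphere)
 have EK: "circ_embed x \<in> K" for x by (simp add: K_def circ_embed_def)
 have mh: "(\<lambda>x. of_real (h (circ_embed x)) :: complex) \<in> borel_measurable torus"
  by (rule measurable_torus, rule borel_measurable_continuous_onI, rule continuous_on_of_real,
    rule continuous_on_compose2[OF h continuous_circ_embed]) simp
 have "compact (h ` K)" by (intro compact_continuous_image K continuous_on_subset[OF h]) auto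
 hence "bounded (h ` K)" by (rule compact_imp_bounded)
 then obtain B where B: "\<And>z. z \<in> h ` K ==> norm z \<le> B" unfolding bounded_iff by blast
 show hL: "(\<lambda>x. complex_of_real (h (circ_embed x))) \<in> L2fun"
 proof (rule L2fun_bounded[OF mh])
  fix x
  have "norm (h (circ_embed x)) \<le> B" using EK[of x] B by blast
  thus "norm (complex_of_real (h (circ_embed x))) \<le> B" by (simp only: norm_of_real real_norm_def)
 qed
 fix e :: real assume "e > 0"
 define d where "d = sqrt (e/2)"
 have d: "d > 0" "d^2 < e" using \<open>e > 0\<close> by (auto simp: d_def)
 obtain q where q: "real_polynomial_function q" "\<And>z. z \<in> K ==> \<bar>h z - q z\<bar> < d"
  using Stone_Weierstrass_real_polynomial_function[OF K continuous_on_subset[OF h] d(1)] by auto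
 have tq: "trig_approx (\<lambda>x. of_real (q (circ_embed x)))" (is "trig_approx ?q") by (intro trig_poly_approx trig_poly_real_polynomial q)
 have "(\<lambda>x. of_real (h (circ_embed x)) - ?q x) \<in> L2fun" by (rule L2fun_diff[OF hL]) (use tq in \<open>simp add: trig_approx_def\<close>)
 hence m: "(\<lambda>x. of_real (h (circ_embed x)) - ?q x) \<in> borel_measurable torus" by (simp add: L2fun_def)
 have "norm (of_real (h (circ_embed x)) - ?q x) \<le> d" for x using q(2)[OF EK, of x] by (simp only: of_real_diff[symmetric] norm_of_real less_imp_le)
 hence "nsq (\<lambda>x. of_real (h (circ_embed x)) - ?q x) \<le> d^2" by (rule L2_integral_le_sq[OF m])
 thus "\<exists>g. trig_approx g \<and> nsq (\<lambda>x. of_real (h (circ_embed x)) - g x) < e"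
  using tq d(2) by (intro exI[of _ ?q] conjI) (assumption, linarith)
qed

lemma trig_approx_zero: "trig_approx (\<lambda>x. 0)" using trig_approx_scale[OF trig_approx_trig[of "0"], of 0] by (simp add: fsupp_def)

lemma trig_approx_indicator_compact:
 assumes K: "compact K" "K \<subseteq> {0..<1} \<times> {0..<1}"
 shows "trig_approx (indicator K)"
proof (cases "K = {}")
 case True
 hence "(indicator K :: _ \<Rightarrow> complex) = (\<lambda>x. 0)" by auto
 thus ?thesis using trig_approx_zero by simp
next
 case False
 \<comment> \<open>The distance is measured in the image under \<open>circ_embed\<close>, where it
   is periodic. The embedding is injective on the half-open square, so points outside
   \<open>K\<close> have positive distance and \<open>h n\<close> eventually vanishes there.\<close>
 define h where "h n z = max 0 (1 - real n*infdist z (circ_embed ` K))" for n z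
 have cK: "compact (circ_embed ` K)" by (rule compact_continuous_image[OF continuous_on_subset[OF continuous_circ_embed] K(1)]) auto
 have t: "trig_approx (\<lambda>x. of_real (h n (circ_embed x)))" for n
 proof (rule trig_approx_continuous)
  show "continuous_on UNIV (h n)" unfolding h_def by (intro continuous_intros)
 qed
 show ?thesis
 proof (rule trig_approx_limit[OF _ t, where w = "\<lambda>x. 1"])
  have "K \<in> sets torus"
  proof -
   have "K \<in> sets borel" using K(1) by (simp add: borel_compact)
   thus ?thesis unfolding sets_torus sets_restrict_space by (rule image_eqI[rotated]) (use K(2) in blast)
  qed
  thus "(indicator K :: _ \<Rightarrow> complex) \<in> borel_measurable torus" by simp
  fix n :: nat and x :: "real \<times> real" assume x: "x \<in> space torus"
  have h01: "0 \<le> h n z" "h n z \<le> 1" for z by (auto simp: h_def infdist_nonneg)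
  have h1: "x \<in> K ==> h n (circ_embed x) = 1" for n by (simp add: h_def)
  have "norm (indicator K x - complex_of_real (h n (circ_embed x))) \<le> 1"
  proof (cases "x \<in> K")
   case True
   thus ?thesis using h1 by simp
  next
   case False
   thus ?thesis using h01 by simp
  qed
  thus "(norm (indicator K x - complex_of_real (h n (circ_embed x))))^2 \<le> 1" by (simp add: abs_square_le_1)
  show "(norm (indicator K x :: complex))^2 \<le> 1" by (auto simp: indicator_def)
 next
  fix x :: "real \<times> real" assume x: "x \<in> space torus"
  show "(\<lambda>n. complex_of_real (h n (circ_embed x))) \<longlonglongrightarrow> indicator K x"
  proof (cases "x \<in> K")
   case True
   hence "h n (circ_embed x) = 1" for n by (simp add: h_def)
   thus ?thesis using True by simp
  next
   case False
   have "circ_embed x \<notin> circ_embed ` K" using inj_on_image_mem_iff[OF inj_circ_embed _ K(2), of x] False x by simp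
   hence d: "infdist (circ_embed x) (circ_embed ` K) > 0" using infdist_pos_not_in_closed[OF compact_imp_closed[OF cK]] \<open>K \<noteq> {}\<close> by simp
   obtain N where N: "1 < real N*infdist (circ_embed x) (circ_embed ` K)" using reals_Archimedean3[OF d] by blast
   have "h n (circ_embed x) = 0" if "n \<ge> N" for n
   proof -
    have "real N*infdist (circ_embed x) (circ_embed ` K) \<le> real n*infdist (circ_embed x) (circ_embed ` K)" using that d by (intro mult_right_mono) auto
    thus ?thesis using N by (simp add: h_def)
   qed
   hence "eventually (\<lambda>n. complex_of_real (h n (circ_embed x)) = indicator K x) sequentially" using False by (auto simp: eventually_sequentially)
   thus ?thesis by (rule tendsto_eventually)
  qed
 qed auto
qed

lemma trig_approx_indicator:
 assumes A: "A \<in> sets torus"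
 shows "trig_approx (indicator A)"
proof (rule trig_approx_close)
 note [measurable] = A
 \<comment> \<open>Inner regularity concerns measures on the Borel sets of the whole plane, so the
   measure is pushed forward from the restricted space.\<close>
 let ?M = "distr torus borel (\<lambda>x. x)"
 have id: "(\<lambda>x. x) \<in> torus \<rightarrow>\<^sub>M borel" by (rule measurable_torus) simp
 have "A \<in> (\<inter>) ({0..<1} \<times> {0..<1}) ` sets borel" using A unfolding sets_torus sets_restrict_space .
 hence AS: "A \<subseteq> {0..<1} \<times> {0..<1}" and Ab: "A \<in> sets borel" using unit_square_sets by auto
 show "(indicator A :: _ \<Rightarrow> complex) \<in> L2fun" by (rule L2fun_bounded[where B = 1]) (auto simp: indicator_def)
 fix e :: real assume e: "e > 0"
 interpret M: prob_space ?M by (rule torus.prob_space_distr[OF id])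
 have "M.prob A - e < M.prob A" using e by simp
 have *: "emeasure ?M A = (SUP K \<in> {K. K \<subseteq> A \<and> compact K}. emeasure ?M K)"
  using Ab by (intro inner_regular) (simp_all add: M.emeasure_finite)
 have "\<exists>K. K \<subseteq> A \<and> compact K \<and> M.prob A - e < M.prob K"
 \<comment> \<open>\<open>ennreal\<close> sends negative numbers to 0, so the case of negative
   \<open>M.prob A - e\<close> is separated; there the empty set serves.\<close>
 proof (cases "M.prob A < e")
  case False
  hence "ennreal (M.prob A - e) < emeasure ?M A" using e by (simp add: M.emeasure_eq_measure ennreal_less_iff)
  then obtain K where "K \<subseteq> A" "compact K" "ennreal (M.prob A - e) < emeasure ?M K" unfolding * less_SUP_iff by blast
  thus ?thesis using False by (auto simp: M.emeasure_eq_measure ennreal_less_iff)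
 qed (auto intro!: exI[of _ "{}"])
 then obtain K where K: "K \<subseteq> A" "compact K" "M.prob A - e < M.prob K" by blast
 have Kb: "K \<in> sets borel" using K(2) by (simp add: borel_compact)
 have "nsq (\<lambda>x. indicator A x - indicator K x :: complex) = (\<integral>x. (norm (indicator A x - indicator K x :: complex))^2 \<partial>?M)"
  using Ab Kb by (intro integral_distr[OF id, symmetric]) simp
 also have "... = (\<integral>x. indicator (A - K) x \<partial>?M)" using K(1) by (intro Bochner_Integration.integral_cong) (auto simp: indicator_def)
 also have "... = M.prob A - M.prob K" using Ab Kb K(1) by (simp add: M.finite_measure_Diff)
 finally show "\<exists>h. trig_approx h \<and> nsq (\<lambda>x. indicator A x - h x :: complex) < e"
  using K AS by (intro exI[of _ "indicator K"] conjI trig_approx_indicator_compact) auto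
qed

lemma trig_approx_sum: "finite A ==> (\<And>a. a \<in> A ==> trig_approx (g a)) ==> trig_approx (\<lambda>x. \<Sum>a\<in>A. g a x)"
 by (induction rule: finite_induct) (auto simp: trig_approx_zero intro: trig_approx_add)

lemma trig_approx_simple:
 assumes "simple_function torus g"
 shows "trig_approx g"
proof -
 have "trig_approx (\<lambda>x. \<Sum>y\<in>g ` space torus. y*indicator (g -` {y} \<inter> space torus) x)"
  by (intro trig_approx_sum trig_approx_scale trig_approx_indicator)
   (use assms in \<open>auto simp: simple_function_def simp del: space_torus\<close>)
 moreover have "(\<Sum>y\<in>g ` space torus. y*indicator (g -` {y} \<inter> space torus) x) = g x" if "x \<in> space torus" for x
 proof -
  have "y*indicator S x = indicator S x *\<^sub>R y" for y :: complex and S by (simp add: indicator_def)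
  thus ?thesis using simple_function_indicator_representation_banach[OF assms that] by (simp only:)
 qed
 ultimately show ?thesis by (rule iffD1[OF trig_approx_cong, rotated])
qed

theorem trig_approx_L2fun:
 assumes "g \<in> L2fun"
 shows "trig_approx g"
proof -
 have m: "g \<in> borel_measurable torus" and i: "integrable torus (\<lambda>x. (norm (g x))^2)" using assms by (auto simp: L2fun_def)
 obtain F where F: "\<And>i. simple_function torus (F i)" "\<And>x. x \<in> space torus ==> (\<lambda>i. F i x) \<longlonglongrightarrow> g x"
  "\<And>i x. x \<in> space torus ==> dist (F i x) 0 \<le> 2*dist (g x) 0" using borel_measurable_implies_sequence_metric[OF m, of 0] by blast
 show ?thesis
 \<comment> \<open>The simple functions satisfy \<open>norm (F n x) \<le> 2*norm (g x)\<close>, so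
   the difference is at most \<open>3*norm (g x)\<close>; hence the 9.\<close>
 proof (rule trig_approx_limit[OF m, where h = F and w = "\<lambda>x. 9*(norm (g x))^2"])
  show "trig_approx (F n)" for n by (rule trig_approx_simple[OF F(1)])
  fix n x assume x: "x \<in> space torus"
  have "norm (g x - F n x) \<le> norm (g x) + norm (F n x)" by (rule norm_triangle_ineq4)
  also have "... \<le> 3*norm (g x)" using F(3)[OF x, of n] by simp
  finally have "(norm (g x - F n x))^2 \<le> (3*norm (g x))^2" by (intro power_mono) auto
  thus "(norm (g x - F n x))^2 \<le> 9*(norm (g x))^2" by (simp add: power_mult_distrib)
 qed (use i F in \<open>auto simp del: space_torus\<close>)
qed

theorem parseval:
 assumes g: "g \<in> L2fun"
 shows "((\<lambda>k. (norm (fourier g k))^2) has_sum nsq g) UNIV"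
proof -
 let ?I = "\<integral>x. (norm (g x))^2 \<partial>torus"
 have bessel: "(\<Sum>k\<in>A. (norm (fourier g k))^2) \<le> ?I" if A: "finite A" for A
 proof -
  define f where "f k = (if k \<in> A then fourier g k else 0)" for k
  have "nsq (\<lambda>x. g x - trig f x) = ?I - (\<Sum>k\<in>A. (norm (fourier g k))^2) + (\<Sum>k\<in>A. (norm (f k - fourier g k))^2)"
   by (rule L2_distance_trig[OF g A]) (simp add: f_def)
  also have "(\<Sum>k\<in>A. (norm (f k - fourier g k))^2) = 0" by (simp add: f_def)
  finally have "nsq (\<lambda>x. g x - trig f x) = ?I - (\<Sum>k\<in>A. (norm (fourier g k))^2)" by simp
  moreover have "0 \<le> nsq (\<lambda>x. g x - trig f x)" by (rule Bochner_Integration.integral_nonneg) auto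
  ultimately show ?thesis by linarith
 qed
 have near: "\<exists>A. finite A \<and> ?I - e < (\<Sum>k\<in>A. (norm (fourier g k))^2)" if "e > 0" for e
 proof -
  obtain f where f: "fsupp f" "nsq (\<lambda>x. g x - trig f x) < e" using trig_approx_L2fun[OF g] \<open>e > 0\<close> by (auto simp: trig_approx_def)
  let ?A = "{k. f k \<noteq> 0}"
  have A: "finite ?A" using f by (simp add: fsupp_def)
  have "nsq (\<lambda>x. g x - trig f x) = ?I - (\<Sum>k\<in>?A. (norm (fourier g k))^2) + (\<Sum>k\<in>?A. (norm (f k - fourier g k))^2)"
   by (rule L2_distance_trig[OF g A]) simp
  moreover have "(\<Sum>k\<in>?A. (norm (f k - fourier g k))^2) \<ge> 0" by (rule sum_nonneg) simp
  ultimately show ?thesis using f(2) A by (intro exI[of _ ?A]) auto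
 qed
 have "(\<lambda>k. (norm (fourier g k))^2) summable_on UNIV" by (rule nonneg_bdd_above_summable_on) (auto intro!: bdd_aboveI2 bessel)
 hence hs: "((\<lambda>k. (norm (fourier g k))^2) has_sum (\<Sum>\<^sub>\<infinity>k. (norm (fourier g k))^2)) UNIV" by simp
 have "(\<Sum>\<^sub>\<infinity>k. (norm (fourier g k))^2) \<le> ?I"
  by (rule infsum_le_finite_sums) (use hs bessel in \<open>auto simp: has_sum_imp_summable\<close>)
 moreover have "?I \<le> (\<Sum>\<^sub>\<infinity>k. (norm (fourier g k))^2) + e" if e: "e > 0" for e
 proof -
  obtain A where A: "finite A" "?I - e < (\<Sum>k\<in>A. (norm (fourier g k))^2)" using near[OF e] by blast
  have "(\<Sum>k\<in>A. (norm (fourier g k))^2) \<le> (\<Sum>\<^sub>\<infinity>k. (norm (fourier g k))^2)"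
   by (rule finite_sum_le_infsum) (use hs A in \<open>auto simp: has_sum_imp_summable\<close>)
  thus ?thesis using A by linarith
 qed
 ultimately have "(\<Sum>\<^sub>\<infinity>k. (norm (fourier g k))^2) = ?I"
  using field_le_epsilon[of ?I "\<Sum>\<^sub>\<infinity>k. (norm (fourier g k))^2"] by (intro antisym) auto
 thus ?thesis using hs by simp
qed

lemma sobolev_norm_0: "sobolev_norm 0 u = sqrt (\<Sum>\<^sub>\<infinity>k. (norm (u k))^2)" by (simp add: sobolev_norm_def)

lemma fourier_L2fun:
 assumes "g \<in> L2fun"
 shows "fourier g \<in> sobolev 0" "(sobolev_norm 0 (fourier g))^2 = nsq g" using has_sum_imp_summable[OF parseval[OF assms]] infsumI[OF parseval[OF assms]]
 by (auto simp: sobolev_def sobolev_norm_0)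

lemma sob_le_fourierD:
 assumes "g \<in> L2fun" "sob_le 0 (fourier g) c"
 shows "nsq g \<le> c^2" unfolding fourier_L2fun(2)[OF assms(1), symmetric] using assms(2) by (intro power_mono) (auto simp: sob_le_iff)

lemma sob_le_fourier:
 assumes g: "g \<in> L2fun" and le: "nsq g \<le> c^2" and c: "0 \<le> c"
 shows "sob_le 0 (fourier g) c"
proof -
 have "(sobolev_norm 0 (fourier g))^2 \<le> c^2" unfolding fourier_L2fun(2)[OF g] by (rule le)
 hence "sobolev_norm 0 (fourier g) \<le> c" by (rule power2_le_imp_le[OF _ c])
 thus ?thesis using fourier_L2fun(1)[OF g] unfolding sob_le_iff by blast
qed

lemma tfun_L2:
 assumes "u \<in> L2" shows "tfun u \<in> L2fun" "fourier (tfun u) = u"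
proof -
 have "\<exists>f. f \<in> L2fun \<and> fourier f = u" using assms unfolding L2_def by blast
 hence "tfun u \<in> L2fun \<and> fourier (tfun u) = u" unfolding tfun_def by (rule someI_ex)
 thus "tfun u \<in> L2fun" "fourier (tfun u) = u" by auto
qed

lemma L2_sobolev: "u \<in> L2 ==> u \<in> sobolev 0" using fourier_L2fun(1)[OF tfun_L2(1)] by (simp add: tfun_L2(2))

lemma L2norm_sobolev_norm:
 assumes "u \<in> L2" shows "L2norm u = sobolev_norm 0 u"
proof -
 have "(sobolev_norm 0 u)^2 = nsq (tfun u)" using fourier_L2fun(2)[OF tfun_L2(1)[OF assms]] unfolding tfun_L2(2)[OF assms] .
 thus ?thesis unfolding L2norm_def by (rule real_sqrt_unique) simp
qed

lemma L2I: "f \<in> L2fun ==> fourier f \<in> L2" by (simp add: L2_def)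

lemma L2_add: "u \<in> L2 ==> v \<in> L2 ==> u + v \<in> L2"
 using L2I[OF L2fun_add[of "tfun u" "tfun v"]] fourier_add[of "tfun u" "tfun v"] by (simp add: tfun_L2)

lemma L2_diff: "u \<in> L2 ==> v \<in> L2 ==> u - v \<in> L2"
 using L2I[OF L2fun_diff[of "tfun u" "tfun v"]] fourier_diff[of "tfun u" "tfun v"] by (simp add: tfun_L2)

lemma L2_tscale: "u \<in> L2 ==> tscale c u \<in> L2" using L2I[OF L2fun_scale[of "tfun u" c]] fourier_scale[of c "tfun u"] by (simp add: tfun_L2)

lemma fourier_unique:
 assumes "f \<in> L2fun" "g \<in> L2fun" "fourier f = fourier g"
 shows "AE x in torus. f x = g x"
proof -
 have d: "(\<lambda>x. f x - g x) \<in> L2fun" using assms L2fun_diff by blast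
 have "fourier (\<lambda>x. f x - g x) = 0" using assms by (simp add: fourier_diff)
 hence "nsq (\<lambda>x. f x - g x) = 0" using fourier_L2fun(2)[OF d] by (simp add: sobolev_norm_0)
 hence "AE x in torus. (norm (f x - g x))^2 = 0" by (subst (asm) integral_nonneg_eq_0_iff_AE) (use d in \<open>auto simp: L2fun_def\<close>)
 thus ?thesis by eventually_elim simp
qed

section \<open>Essential sup bounds and the cubic nonlinearity\<close>

definition sup_le :: "real \<Rightarrow> tdist \<Rightarrow> bool" where
 "sup_le M u \<longleftrightarrow> (\<exists>f\<in>borel_measurable torus. (\<forall>x\<in>space torus. norm (f x) \<le> M) \<and> fourier f = u)"

text \<open>\<open>tfun\<close> picks an arbitrary representative. Functions with equal Fourier
  coefficients agree almost everywhere by Parseval, so the pointwise bound of the witness becomes an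
  almost-everywhere bound of \<open>tfun u\<close>.\<close>

lemma sup_leD:
 assumes "sup_le M u"
 shows "u \<in> L2" "AE x in torus. norm (tfun u x) \<le> M" "0 \<le> M"
proof -
 obtain f where f: "f \<in> borel_measurable torus" "\<And>x. x \<in> space torus ==> norm (f x) \<le> M" "fourier f = u"
  using assms by (auto simp: sup_le_def simp del: space_torus)
 have fL: "f \<in> L2fun" by (rule L2fun_bounded[OF f(1,2)])
 thus u: "u \<in> L2" using f(3) by (auto simp: L2_def)
 have "AE x in torus. tfun u x = f x" by (rule fourier_unique) (use fL tfun_L2[OF u] f(3) in auto)
 thus "AE x in torus. norm (tfun u x) \<le> M" using AE_space by eventually_elim (use f(2) in auto)
 have "0 \<le> norm (f (0, 0))" by simp
 also have "... \<le> M" by (rule f(2)) simp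
 finally show "0 \<le> M" .
qed

lemma sup_leI_AE:
 assumes f: "f \<in> borel_measurable torus" and le: "AE x in torus. norm (f x) \<le> M" and M: "0 \<le> M"
 shows "sup_le M (fourier f)" unfolding sup_le_def
proof (intro bexI conjI ballI)
 note [measurable] = f
 let ?g = "\<lambda>x. if norm (f x) \<le> M then f x else 0"
 show m: "?g \<in> borel_measurable torus" by measurable
 show "norm (?g x) \<le> M" for x using M by simp
 show "fourier ?g = fourier f" unfolding fourier_character by (intro ext integral_cong_AE) (use le m in \<open>auto elim!: eventually_mono\<close>)
qed

lemma sup_le_L2: "u \<in> L2 ==> AE x in torus. norm (tfun u x) \<le> M ==> 0 \<le> M ==> sup_le M u"
 using sup_leI_AE[of "tfun u" M] tfun_L2[of u] by (simp add: L2fun_def)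

lemma sup_le_mono: "sup_le M u ==> M \<le> N ==> sup_le N u" unfolding sup_le_def by (blast intro: order_trans)

lemma tfun_diff_AE:
 assumes "u \<in> L2" "v \<in> L2"
 shows "AE x in torus. tfun (u - v) x = tfun u x - tfun v x"
proof (rule fourier_unique)
 show "tfun (u - v) \<in> L2fun" "(\<lambda>x. tfun u x - tfun v x) \<in> L2fun" by (simp_all add: tfun_L2 L2_diff assms L2fun_diff)
 show "fourier (tfun (u - v)) = fourier (\<lambda>x. tfun u x - tfun v x)" using assms by (simp add: fourier_diff tfun_L2 L2_diff)
qed

lemma sup_le_add:
 assumes "sup_le M u" "sup_le N v" shows "sup_le (M + N) (u + v)"
proof -
 obtain f where f: "f \<in> borel_measurable torus" "\<And>x. x \<in> space torus ==> norm (f x) \<le> M" "fourier f = u"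
  using assms(1) by (auto simp: sup_le_def simp del: space_torus)
 obtain g where g: "g \<in> borel_measurable torus" "\<And>x. x \<in> space torus ==> norm (g x) \<le> N" "fourier g = v"
  using assms(2) by (auto simp: sup_le_def simp del: space_torus)
 have "fourier (\<lambda>x. f x + g x) = u + v" using fourier_add[OF L2fun_bounded[OF f(1,2)] L2fun_bounded[OF g(1,2)]] f(3) g(3) by simp
 moreover have "norm (f x + g x) \<le> M + N" if "x \<in> space torus" for x using f(2)[OF that] g(2)[OF that] norm_triangle_ineq[of "f x" "g x"] by linarith
 moreover have "(\<lambda>x. f x + g x) \<in> borel_measurable torus" using f(1) g(1) by measurable
 ultimately show ?thesis unfolding sup_le_def by (intro bexI[of _ "\<lambda>x. f x + g x"] conjI ballI)
qed

text \<open>The excess \<open>max 0 (norm (tfun u x) - M)\<close> lies pointwise below the distance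
  to any function bounded by \<open>M\<close>, so its square integral is arbitrarily small. This is
  how sup bounds for the regularised resolvents reach the limit solution.\<close>

lemma sup_le_closed:
 assumes u: "u \<in> L2" and M: "0 \<le> M"
  and ap: "\<And>e. e > 0 ==> \<exists>v. sup_le M v \<and> sob_le 0 (u - v) e"
 shows "sup_le M u"
proof (rule sup_le_L2[OF u _ M])
 note uL = tfun_L2(1)[OF u]
 have [measurable]: "tfun u \<in> borel_measurable torus" using uL by (simp add: L2fun_def)
 let ?p = "\<lambda>x. max 0 (norm (tfun u x) - M)"
 have pi: "integrable torus (\<lambda>x. (?p x)^2)"
 proof (rule Bochner_Integration.integrable_bound[OF integrable_L2fun_sq[OF uL]])
  show "AE x in torus. norm ((?p x)^2) \<le> norm ((norm (tfun u x))^2)" using M by (auto intro!: power_mono)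
 qed measurable
 have "(\<integral>x. (?p x)^2 \<partial>torus) \<le> e" if e: "e > 0" for e
 proof -
  have "sqrt e > 0" using e by simp
  then obtain v where v: "sup_le M v" "sob_le 0 (u - v) (sqrt e)" using ap by blast
  note vL = tfun_L2(1)[OF sup_leD(1)[OF v(1)]]
  note dL = L2fun_diff[OF uL vL]
  have "(\<integral>x. (?p x)^2 \<partial>torus) \<le> nsq (\<lambda>x. tfun u x - tfun v x)"
  proof (rule integral_mono_AE[OF pi integrable_L2fun_sq[OF dL]])
   show "AE x in torus. (?p x)^2 \<le> (norm (tfun u x - tfun v x))^2" using sup_leD(2)[OF v(1)]
   proof eventually_elim
    case (elim x)
    have "norm (tfun u x) \<le> norm (tfun v x) + norm (tfun u x - tfun v x)" by (rule norm_triangle_sub)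
    hence "?p x \<le> norm (tfun u x - tfun v x)" using elim by simp
    thus ?case by (intro power_mono) auto
   qed
  qed
  also have "... = (sobolev_norm 0 (u - v))^2" using fourier_L2fun(2)[OF dL] fourier_diff[OF uL vL] tfun_L2(2)[OF u] tfun_L2(2)[OF sup_leD(1)[OF v(1)]] by simp
  also have "... \<le> (sqrt e)^2" using v(2) by (intro power_mono) (auto simp: sob_le_iff)
  also have "... = e" using e by simp
  finally show ?thesis .
 qed
 hence "(\<integral>x. (?p x)^2 \<partial>torus) \<le> 0" by (rule field_le_epsilon[where y = 0, simplified])
 moreover have "0 \<le> (\<integral>x. (?p x)^2 \<partial>torus)" by simp
 ultimately have "(\<integral>x. (?p x)^2 \<partial>torus) = 0" by linarith
 hence "AE x in torus. (?p x)^2 = 0" by (subst (asm) integral_nonneg_eq_0_iff_AE[OF pi]) auto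
 thus "AE x in torus. norm (tfun u x) \<le> M" by eventually_elim (simp add: max_def split: if_splits)
qed

definition cube :: "complex \<Rightarrow> complex" where "cube z = z * of_real ((norm z)^2)"

lemma cube_tri: "cube z = z*z*cnj z" unfolding cube_def complex_norm_square by (simp add: mult_ac)

lemma norm_mult3_le: "norm (x :: complex) \<le> a ==> norm y \<le> b ==> norm z \<le> c ==> norm (x*y*cnj z) \<le> a*b*c"
 unfolding norm_mult complex_mod_cnj by (intro mult_mono) (auto intro: order_trans[OF norm_ge_zero] mult_nonneg_nonneg)

lemma cube_diff:
 assumes "norm a \<le> M" "norm b \<le> M" shows "norm (cube a - cube b) \<le> 3*M^2*norm (a - b)"
proof -
 have "cube a - cube b = (a - b)*a*cnj a + b*(a - b)*cnj a + b*b*cnj (a - b)" by (simp add: cube_tri algebra_simps)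
 also have "norm ... \<le> norm (a - b)*M*M + M*norm (a - b)*M + M*M*norm (a - b)" by (rule norm_triangle_mono norm_mult3_le assms order_refl)+
 finally show ?thesis by (simp add: power2_eq_square algebra_simps)
qed

text \<open>The three factors of z*z*cnj z are differenced in two directions. Every resulting term
  contains either the full second difference or the increment \<open>c - d\<close> together with one
  of \<open>a - c\<close> and \<open>b - d\<close>; the latter have the small size \<open>w\<close>
  when the lemma is applied to increments in time.\<close>

lemma cube_second_diff:
 assumes "norm a \<le> M" "norm b \<le> M" "norm c \<le> M" "norm d \<le> M" "norm (a - c) \<le> w" "norm (b - d) \<le> w"
 shows "norm (cube a - cube b - cube c + cube d) \<le> 3*M^2*norm (a - b - c + d) + 6*M*w*norm (c - d)"
proof -
 let ?q = "a - b - c + d"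
 let ?X = "(?q*a*cnj a + (c - d)*(a - c)*cnj a + (c - d)*c*cnj (a - c))
  + (b*?q*cnj a + (b - d)*(c - d)*cnj a + d*(c - d)*cnj (a - c))
  + (b*b*cnj ?q + (b - d)*b*cnj (c - d) + d*(b - d)*cnj (c - d))"
 have eq: "cube a - cube b - cube c + cube d = ?X" by (simp add: cube_tri algebra_simps)
 have "norm ?X \<le> (norm ?q*M*M + norm (c - d)*w*M + norm (c - d)*M*w)
  + (M*norm ?q*M + w*norm (c - d)*M + M*norm (c - d)*w)
  + (M*M*norm ?q + w*M*norm (c - d) + M*w*norm (c - d))" by (rule norm_triangle_mono norm_mult3_le assms order_refl)+
 also have "... = 3*M^2*norm ?q + 6*M*w*norm (c - d)"
 proof -
  have "(n*M*M + e*w*M + e*M*w) + (M*n*M + w*e*M + M*e*w) + (M*M*n + w*M*e + M*w*e)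
    = 3*M^2*n + 6*M*w*e" for n e :: real by (simp add: power2_eq_square algebra_simps)
  thus ?thesis .
 qed
 finally show ?thesis unfolding eq .
qed

lemma cubic_cube: "cubic u = fourier (\<lambda>x. cube (tfun u x))" by (simp add: cubic_def cube_def)

lemma measurable_cube [measurable]: "cube \<in> borel_measurable borel" unfolding cube_def[abs_def] by (intro borel_measurable_continuous_onI continuous_intros)

lemma sup_le_cubic:
 assumes "sup_le M u"
 shows "sup_le (M^3) (cubic u)" "(\<lambda>x. cube (tfun u x)) \<in> L2fun"
proof -
 have [measurable]: "tfun u \<in> borel_measurable torus" using tfun_L2(1)[OF sup_leD(1)[OF assms]] by (simp add: L2fun_def)
 have "AE x in torus. norm (cube (tfun u x)) \<le> M^3" using sup_leD(2)[OF assms]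
 proof eventually_elim
  case (elim x)
  have "norm (cube (tfun u x)) = norm (tfun u x)^3" by (simp add: cube_def norm_mult power3_eq_cube power2_eq_square)
  also have "... \<le> M^3" using elim by (intro power_mono) auto
  finally show ?case .
 qed
 note ae = this
 thus "sup_le (M^3) (cubic u)" unfolding cubic_cube using sup_leD(3)[OF assms] by (intro sup_leI_AE) auto
 have "integrable torus (\<lambda>x. (norm (cube (tfun u x)))^2)"
 proof (rule torus.integrable_const_bound[where B = "(M^3)^2"])
  show "AE x in torus. norm ((norm (cube (tfun u x)))^2) \<le> (M^3)^2" using ae
  proof eventually_elim
   case (elim x)
   hence "(norm (cube (tfun u x)))^2 \<le> (M^3)^2" by (rule power_mono) simp
   thus ?case by (simp only: real_norm_def abs_power2)
  qed
 qed measurable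
 thus "(\<lambda>x. cube (tfun u x)) \<in> L2fun" by (simp add: L2fun_def)
qed

text \<open>The right-hand side of the pointwise bound is the modulus of A|g| + B|h|, to which the
  triangle inequality in L2 applies; passing to moduli does not change the L2 norm.\<close>

lemma L2_integral_triangle:
 assumes f: "f \<in> L2fun" and g: "sob_le 0 (fourier g) a" "g \<in> L2fun" and h: "sob_le 0 (fourier h) b" "h \<in> L2fun"
  and A: "0 \<le> A" "0 \<le> B"
  and le: "AE x in torus. norm (f x) \<le> A*norm (g x) + B*norm (h x)"
 shows "sob_le 0 (fourier f) (A*a + B*b)"
proof (rule sob_le_fourier[OF f])
 have [measurable]: "f \<in> borel_measurable torus" "g \<in> borel_measurable torus" "h \<in> borel_measurable torus" using f g h by (auto simp: L2fun_def)
 have ab: "0 \<le> a" "0 \<le> b" using sob_leD_nonneg[OF g(1)] sob_leD_nonneg[OF h(1)] by auto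
 show n: "0 \<le> A*a + B*b" using ab A by simp
 let ?n = "\<lambda>x. complex_of_real (norm (g x))" and ?m = "\<lambda>x. complex_of_real (norm (h x))"
 have nm: "?n \<in> L2fun" "?m \<in> L2fun" using g(2) h(2) by (auto simp: L2fun_def)
 have gn: "sob_le 0 (fourier ?n) a" using sob_le_fourier[OF nm(1) _ ab(1)] sob_le_fourierD[OF g(2,1)] by simp
 have hn: "sob_le 0 (fourier ?m) b" using sob_le_fourier[OF nm(2) _ ab(2)] sob_le_fourierD[OF h(2,1)] by simp
 let ?s = "\<lambda>x. of_real A*?n x + of_real B*?m x"
 have sL: "?s \<in> L2fun" by (intro L2fun_add L2fun_scale nm)
 have "fourier ?s = tscale (of_real A) (fourier ?n) + tscale (of_real B) (fourier ?m)" by (simp add: fourier_add L2fun_scale nm fourier_scale)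
 hence "sob_le 0 (fourier ?s) (A*a + B*b)" using sob_le_add[OF sob_le_tscale[OF gn, of "of_real A"] sob_le_tscale[OF hn, of "of_real B"]] A by simp
 hence s: "nsq ?s \<le> (A*a + B*b)^2" by (rule sob_le_fourierD[OF sL])
 have "nsq f \<le> nsq ?s"
 proof (rule integral_mono_AE[OF integrable_L2fun_sq[OF f] integrable_L2fun_sq[OF sL]])
  show "AE x in torus. (norm (f x))^2 \<le> (norm (?s x))^2" using le
  proof eventually_elim
   case (elim x)
   have "norm (?s x) = A*norm (g x) + B*norm (h x)"
   proof -
    have "?s x = of_real (A*norm (g x) + B*norm (h x))" by simp
    thus ?thesis using A by (simp only: norm_of_real) simp
   qed
   thus ?case using elim by (intro power_mono) auto
  qed
 qed
 thus "nsq f \<le> (A*a + B*b)^2" using s by linarith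
qed

lemma cubic_diff_le:
 assumes u: "sup_le M u" and v: "sup_le M v" and uv: "sob_le 0 (u - v) a"
 shows "sob_le 0 (cubic u - cubic v) (3*M^2*a)"
proof -
 note L = sup_leD(1)[OF u] sup_leD(1)[OF v]
 have M: "0 \<le> M" by (rule sup_leD(3)[OF u])
 let ?f = "\<lambda>x. cube (tfun u x) - cube (tfun v x)"
 have "AE x in torus. norm (?f x) \<le> 3*M^2*norm (tfun (u - v) x) + 0*norm (tfun (u - v) x)"
  using sup_leD(2)[OF u] sup_leD(2)[OF v] tfun_diff_AE[OF L] by eventually_elim (use cube_diff in auto)
 hence "sob_le 0 (fourier ?f) (3*M^2*a + 0*a)" by (intro L2_integral_triangle[where g = "tfun (u - v)" and h = "tfun (u - v)"])
   (use uv tfun_L2[OF L2_diff[OF L]] sup_le_cubic(2)[OF u] sup_le_cubic(2)[OF v] L2fun_diff in auto)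
 thus ?thesis by (simp add: cubic_cube fourier_diff sup_le_cubic(2)[OF u] sup_le_cubic(2)[OF v])
qed

lemma cubic_second_diff_le:
 assumes a: "sup_le M a" and b: "sup_le M b" and c: "sup_le M c" and d: "sup_le M d"
  and ac: "sup_le w (a - c)" and bd: "sup_le w (b - d)"
  and q: "sob_le 0 (a - b - (c - d)) A" and cd: "sob_le 0 (c - d) B"
 shows "sob_le 0 (cubic a - cubic b - (cubic c - cubic d)) (3*M^2*A + 6*M*w*B)"
proof -
 note L = sup_leD(1)[OF a] sup_leD(1)[OF b] sup_leD(1)[OF c] sup_leD(1)[OF d]
 note C = sup_le_cubic(2)[OF a] sup_le_cubic(2)[OF b] sup_le_cubic(2)[OF c] sup_le_cubic(2)[OF d]
 have M: "0 \<le> M" "0 \<le> w" using sup_leD(3) a ac by auto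
 let ?f = "\<lambda>x. cube (tfun a x) - cube (tfun b x) - (cube (tfun c x) - cube (tfun d x))"
 have fL: "?f \<in> L2fun" by (intro L2fun_diff C)
 have "AE x in torus. norm (?f x) \<le> 3*M^2*norm (tfun (a - b - (c - d)) x) + 6*M*w*norm (tfun (c - d) x)"
  using sup_leD(2)[OF a] sup_leD(2)[OF b] sup_leD(2)[OF c] sup_leD(2)[OF d] sup_leD(2)[OF ac] sup_leD(2)[OF bd]
   tfun_diff_AE[OF L(1,2)] tfun_diff_AE[OF L(3,4)] tfun_diff_AE[OF L(1,3)] tfun_diff_AE[OF L(2,4)]
   tfun_diff_AE[OF L2_diff[OF L(1,2)] L2_diff[OF L(3,4)]]
 proof eventually_elim
  case (elim x)
  have "norm (cube (tfun a x) - cube (tfun b x) - cube (tfun c x) + cube (tfun d x)) \<le>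
   3*M^2*norm (tfun a x - tfun b x - tfun c x + tfun d x) + 6*M*w*norm (tfun c x - tfun d x)" by (rule cube_second_diff) (use elim in auto)
  moreover have "?f x = cube (tfun a x) - cube (tfun b x) - cube (tfun c x) + cube (tfun d x)" by simp
  moreover have "tfun (a - b - (c - d)) x = tfun a x - tfun b x - tfun c x + tfun d x" unfolding elim(11) elim(7) elim(8) by simp
  ultimately show ?case unfolding elim(8) by (simp only:)
 qed
 hence "sob_le 0 (fourier ?f) (3*M^2*A + 6*M*w*B)" by (intro L2_integral_triangle[OF fL, where g = "tfun (a - b - (c - d))" and h = "tfun (c - d)"])
   (use M q cd tfun_L2[OF L2_diff[OF L2_diff[OF L(1,2)] L2_diff[OF L(3,4)]]] tfun_L2[OF L2_diff[OF L(3,4)]] in auto)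
 thus ?thesis by (simp add: cubic_cube fourier_diff C L2fun_diff)
qed

section \<open>Trigonometric polynomials and the maximum principle\<close>

definition tsup :: "tdist \<Rightarrow> real \<Rightarrow> bool" where
 "tsup f B \<longleftrightarrow> (\<forall>x. norm (trig f x) \<le> B)"

lemma tsupD: "tsup f B ==> norm (trig f x) \<le> B" unfolding tsup_def by blast

lemma tsup_nonneg: "tsup f B ==> 0 \<le> B" unfolding tsup_def using order_trans[OF norm_ge_zero[of "trig f (0, 0)"]] by blast

lemma fsupp_finite_set: "fsupp f ==> finite {k. f k \<noteq> 0}" by (simp add: fsupp_def)

lemma trig_fsupp: "fsupp f ==> trig f x = (\<Sum>k\<in>{k. f k \<noteq> 0}. f k*character k x)" by (rule trig_finite) (simp_all add: fsupp_def)

lemma tsup_add: "fsupp f ==> fsupp g ==> tsup f A ==> tsup g B ==> tsup (f + g) (A + B)" unfolding tsup_def by (simp add: trig_add norm_triangle_mono)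

lemma tsup_tscale: "tsup f A ==> tsup (tscale c f) (norm c*A)" unfolding tsup_def by (simp add: trig_tscale norm_mult mult_left_mono)

lemma tsup_mono: "tsup f A ==> A \<le> B ==> tsup f B" unfolding tsup_def by (blast intro: order_trans)

lemma tsup_l1:
 assumes "finite A" "\<And>k. k \<notin> A ==> f k = 0"
 shows "tsup f (\<Sum>k\<in>A. norm (f k))" unfolding tsup_def
proof
 fix x
 have "norm (trig f x) \<le> (\<Sum>k\<in>A. norm (f k*character k x))" by (subst trig_finite[OF assms]) (simp_all add: norm_sum)
 thus "norm (trig f x) \<le> (\<Sum>k\<in>A. norm (f k))" by (simp add: norm_mult)
qed

lemma fourier_trig_fsupp:
 assumes "fsupp f" shows "fourier (trig f) = f"
proof
 fix k
 let ?A = "{k. f k \<noteq> 0}"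
 have [simp]: "integrable torus (character k)" for k by (rule integrable_torus_bounded[where B = 1]) simp_all
 have "trig f x*character (- k) x = (\<Sum>l\<in>?A. f l*character (l - k) x)" for x unfolding trig_fsupp[OF assms] sum_distrib_right
  by (intro sum.cong refl) (simp add: character_add[of _ "- k", simplified] mult.assoc)
 hence "fourier (trig f) k = (\<integral>x. (\<Sum>l\<in>?A. f l*character (l - k) x) \<partial>torus)" unfolding fourier_character by simp
 also have "... = (\<Sum>l\<in>?A. f l*(if l = k then 1 else 0))" by (simp add: integral_character)
 also have "... = f k" using fsupp_finite_set[OF assms] by (simp add: if_distrib cong: if_cong)
 finally show "fourier (trig f) k = f k" .
qed

lemma sob_le_tsup:
 assumes "fsupp f" "tsup f B" shows "sob_le 0 f B"
proof -
 have "sob_le 0 (fourier (trig f)) B"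
 proof (rule sob_le_fourier[OF L2fun_trig[OF assms(1)] _ tsup_nonneg[OF assms(2)]])
  show "nsq (trig f) \<le> B^2"
  proof (rule L2_integral_le_sq[OF measurable_trig_fsupp[OF assms(1)]])
   show "norm (trig f x) \<le> B" for x using assms(2) unfolding tsup_def by blast
  qed
 qed
 thus ?thesis by (simp add: fourier_trig_fsupp[OF assms(1)])
qed

lemma tmul_finite:
 assumes "finite A" "\<And>k. k \<notin> A ==> f k = 0"
 shows "tmul f g k = (\<Sum>l\<in>A. f l*g (k - l))"
proof -
 have "tmul f g k = (\<Sum>\<^sub>\<infinity>l\<in>A. f l*g (k - l))" unfolding tmul_def by (rule infsum_cong_neutral) (use assms in auto)
 thus ?thesis using assms by simp
qed

lemma tmul_commute: "tmul f g = tmul g f"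
proof
 fix k
 have b: "bij_betw (\<lambda>l. k - l) UNIV (UNIV :: (int \<times> int) set)" by (rule bij_betwI[where g = "\<lambda>l. k - l"]) simp_all
 have "tmul f g k = (\<Sum>\<^sub>\<infinity>l. f (k - l)*g (k - (k - l)))" unfolding tmul_def by (rule infsum_reindex_bij_betw[OF b, symmetric])
 also have "... = tmul g f k" unfolding tmul_def by (simp add: mult.commute)
 finally show "tmul f g k = tmul g f k" .
qed

lemma
 assumes "fsupp f" "fsupp g"
 shows fsupp_tmul: "fsupp (tmul f g)" and trig_tmul: "trig (tmul f g) x = trig f x*trig g x"
proof -
 let ?A = "{k. f k \<noteq> 0}"
 have A: "finite ?A" by (rule fsupp_finite_set[OF assms(1)])
 have "trig_poly (\<lambda>x. trig f x*trig g x)" by (intro trig_poly_mult trig_polyI[OF assms(1)] trig_polyI[OF assms(2)] refl)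
 then obtain h where h: "fsupp h" "\<And>x. trig f x*trig g x = trig h x" by (auto simp: trig_poly_def)
 have "h k = tmul f g k" for k
 proof -
  have "trig f x*trig g x*character (- k) x = (\<Sum>l\<in>?A. f l*(trig g x*character (- (k - l)) x))" for x
   unfolding trig_fsupp[OF assms(1)] sum_distrib_right by (intro sum.cong refl) (use character_add[of _ "- k" x] in \<open>simp add: mult_ac\<close>)
  hence "fourier (trig h) k = (\<integral>x. (\<Sum>l\<in>?A. f l*(trig g x*character (- (k - l)) x)) \<partial>torus)"
   unfolding fourier_character h(2)[symmetric] by simp
  also have "... = (\<Sum>l\<in>?A. f l*fourier (trig g) (k - l))"
   unfolding fourier_character by (simp add: integrable_character_mult[OF L2fun_trig[OF assms(2)]])
  also have "... = tmul f g k" by (subst tmul_finite[OF A]) (simp_all add: fourier_trig_fsupp assms)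
  finally show ?thesis by (simp add: fourier_trig_fsupp h(1))
 qed
 hence "h = tmul f g" by (rule ext)
 thus "fsupp (tmul f g)" "trig (tmul f g) x = trig f x*trig g x" using h by simp_all
qed

lemma sob_le_tmul:
 assumes f: "fsupp f" "sob_le 0 f A" and g: "fsupp g" "tsup g B"
 shows "sob_le 0 (tmul f g) (B*A)"
proof -
 have "sob_le 0 (fourier (trig (tmul f g))) (B*A + 0*A)"
 proof (rule L2_integral_triangle[where g = "trig f" and h = "trig f"])
  show "trig (tmul f g) \<in> L2fun" by (rule L2fun_trig[OF fsupp_tmul[OF f(1) g(1)]])
  show "sob_le 0 (fourier (trig f)) A" "sob_le 0 (fourier (trig f)) A" using f by (simp_all add: fourier_trig_fsupp)
  show "trig f \<in> L2fun" "trig f \<in> L2fun" by (rule L2fun_trig[OF f(1)])+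
  show "0 \<le> B" by (rule tsup_nonneg[OF g(2)])
  have "norm (trig (tmul f g) x) \<le> B*norm (trig f x)" for x using mult_left_mono[OF tsupD[OF g(2), of x] norm_ge_zero[of "trig f x"]]
   by (simp add: trig_tmul[OF f(1) g(1)] norm_mult mult.commute)
  thus "AE x in torus. norm (trig (tmul f g) x) \<le> B*norm (trig f x) + 0*norm (trig f x)" by simp
 qed simp
 thus ?thesis by (simp add: fourier_trig_fsupp[OF fsupp_tmul[OF f(1) g(1)]])
qed

lemma trig_summable:
 assumes f: "(\<lambda>k. norm (f k)) summable_on UNIV"
 shows "continuous_on UNIV (trig f)" "fourier (trig f) = f" "norm (trig f x) \<le> (\<Sum>\<^sub>\<infinity>k. norm (f k))"
proof -
 let ?F = "\<lambda>A y. \<Sum>k\<in>A. f k*character k y"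
 have tr: "trig f = (\<lambda>y. \<Sum>\<^sub>\<infinity>k. f k*character k y)" by (rule ext) (rule trig_character)
 have U: "uniform_limit UNIV ?F (trig f) (finite_subsets_at_top UNIV)" unfolding tr by (rule Weierstrass_m_test_general[OF _ f]) (simp add: norm_mult)
 show c: "continuous_on UNIV (trig f)" by (rule uniform_limit_theorem[OF _ U])
   (simp_all add: always_eventually continuous_on_sum continuous_on_mult continuous_character)
 have m: "trig f \<in> borel_measurable torus" by (rule measurable_torus[OF borel_measurable_continuous_onI[OF c]])
 have s: "(\<lambda>k. norm (f k*character k x)) summable_on UNIV" for x using f by (simp add: norm_mult)
 show b: "norm (trig f x) \<le> (\<Sum>\<^sub>\<infinity>k. norm (f k))" for x
  unfolding trig_character using norm_infsum_bound[OF s[of x]] by (simp add: norm_mult)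
 show "fourier (trig f) = f"
 proof
  fix k
  have "norm (fourier (trig f) k - f k) \<le> e" if "e > 0" for e
  proof -
   have "eventually (\<lambda>A. \<forall>y\<in>UNIV. dist (?F A y) (trig f y) < e) (finite_subsets_at_top UNIV)"
    using U \<open>e > 0\<close> by (rule uniform_limitD)
   moreover have "eventually (\<lambda>A. finite A \<and> k \<in> A) (finite_subsets_at_top UNIV)"
    unfolding eventually_finite_subsets_at_top by (intro exI[of _ "{k}"]) simp
   ultimately have "eventually (\<lambda>A. finite A \<and> k \<in> A \<and> (\<forall>y. dist (?F A y) (trig f y) < e)) (finite_subsets_at_top UNIV)"
    by eventually_elim simp
   from eventually_happens'[OF finite_subsets_at_top_neq_bot this]
   obtain A where A: "finite A" "k \<in> A" "\<And>y. dist (?F A y) (trig f y) < e" by blast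
   \<comment> \<open>The truncation contains \<open>k\<close>, so its coefficient at
     \<open>k\<close> is exact, while the function differs from the full series by less than
     \<open>e\<close> uniformly.\<close>
   define h where "h l = (if l \<in> A then f l else 0)" for l
   have h: "fsupp h" by (rule fsupp_finite[OF A(1)]) (simp add: h_def)
   have th: "trig h y = ?F A y" for y by (subst trig_finite[OF A(1)]) (simp_all add: h_def)
   have "fourier (trig f) k - f k = fourier (trig f) k - fourier (trig h) k" using A(2) by (simp add: fourier_trig_fsupp[OF h] h_def)
   also have "... = fourier (\<lambda>x. trig f x - trig h x) k" using fourier_diff[OF L2fun_bounded[OF m b] L2fun_trig[OF h]] by simp
   also have "norm ... \<le> (\<integral>x. norm ((trig f x - trig h x)*character (- k) x) \<partial>torus)"
    unfolding fourier_character by (rule integral_norm_bound)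
   also have "... \<le> (\<integral>x. e \<partial>torus)"
   proof (rule integral_mono)
    have "(\<lambda>x. trig f x - trig h x) \<in> L2fun" by (rule L2fun_diff[OF L2fun_bounded[OF m b] L2fun_trig[OF h]])
    thus "integrable torus (\<lambda>x. norm ((trig f x - trig h x)*character (- k) x))" by (rule integrable_norm[OF integrable_character_mult])
    show "norm ((trig f x - trig h x)*character (- k) x) \<le> e" for x using A(3)[of x] by (simp add: norm_mult th dist_norm norm_minus_commute)
   qed simp
   also have "... = e" using torus.prob_space by simp
   finally show ?thesis .
  qed
  hence "norm (fourier (trig f) k - f k) \<le> 0" by (rule field_le_epsilon[where y = 0, simplified])
  thus "fourier (trig f) k = f k" by simp
 qed
qed

lemma sup_le_trig:
 assumes f: "(\<lambda>k. norm (f k)) summable_on UNIV" and M: "\<And>x. norm (trig f x) \<le> M"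
 shows "sup_le M f" unfolding sup_le_def
proof (intro bexI[of _ "trig f"] conjI ballI)
 show "norm (trig f x) \<le> M" for x by (rule M)
 show "fourier (trig f) = f" by (rule trig_summable(2)[OF f])
 show "trig f \<in> borel_measurable torus" by (rule measurable_torus[OF borel_measurable_continuous_onI[OF trig_summable(1)[OF f]]])
qed

definition ddir :: "real \<times> real \<Rightarrow> tdist \<Rightarrow> tdist" where
 "ddir e f = (\<lambda>k. \<i> * of_real (2*pi*(freq k \<bullet> e))*f k)"

lemma dx_ddir: "dx1 f = ddir (1, 0) f" "dx2 f = ddir (0, 1) f" by (simp_all add: dx1_def dx2_def ddir_def freq_def inner_prod_def fun_eq_iff mult_ac)

lemma laplace_ddir: "laplace f = ddir (1, 0) (ddir (1, 0) f) + ddir (0, 1) (ddir (0, 1) f)"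
proof
 fix k
 have n: "(norm (freq k))^2 = (of_int (fst k))^2 + (of_int (snd k))^2" by (simp add: freq_def norm_Pair)
 have dd: "ddir e (ddir e f) k = - of_real ((2*pi*(freq k \<bullet> e))^2)*f k" for e
 proof -
  have "ddir e (ddir e f) k = (\<i>*\<i>) * of_real ((2*pi*(freq k \<bullet> e))*(2*pi*(freq k \<bullet> e)))*f k"
   unfolding ddir_def of_real_mult by (simp only: mult_ac)
  thus ?thesis by (simp add: power2_eq_square)
 qed
 show "laplace f k = (ddir (1, 0) (ddir (1, 0) f) + ddir (0, 1) (ddir (0, 1) f)) k"
  unfolding laplace_def n plus_fun_apply dd by (simp add: freq_def inner_prod_def power2_eq_square algebra_simps)
qed

lemma fsupp_mult: "fsupp f ==> fsupp (\<lambda>k. y k*f k)" unfolding fsupp_def by (erule rev_finite_subset) auto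

lemma fsupp_ddir: "fsupp f ==> fsupp (ddir e f)" unfolding ddir_def by (rule fsupp_mult)

lemma trig_shift_deriv:
 assumes f: "fsupp f"
 shows "((\<lambda>s. trig f (x + s *\<^sub>R e)) has_vector_derivative trig (ddir e f) (x + s *\<^sub>R e)) (at s)"
proof -
 let ?A = "{k. f k \<noteq> 0}"
 have A: "finite ?A" by (rule fsupp_finite_set[OF f])
 have "((\<lambda>s. character k (x + s *\<^sub>R e)) has_vector_derivative
   (\<i> * of_real (2*pi*(freq k \<bullet> e)))*character k (x + s *\<^sub>R e)) (at s)" for k unfolding character_def cis_conv_exp
  by (rule has_vector_derivative_real_field derivative_eq_intros refl
    | simp add: inner_add_right algebra_simps)+
 hence "((\<lambda>s. \<Sum>k\<in>?A. f k*character k (x + s *\<^sub>R e)) has_vector_derivative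
   (\<Sum>k\<in>?A. f k*((\<i> * of_real (2*pi*(freq k \<bullet> e)))*character k (x + s *\<^sub>R e)))) (at s)"
  by (intro has_vector_derivative_sum has_vector_derivative_mult_right)
 moreover have "(\<Sum>k\<in>?A. f k*((\<i> * of_real (2*pi*(freq k \<bullet> e)))*character k (x + s *\<^sub>R e)))
  = trig (ddir e f) (x + s *\<^sub>R e)" by (subst trig_finite[OF A]) (simp_all add: ddir_def mult_ac)
 moreover have "(\<lambda>s. \<Sum>k\<in>?A. f k*character k (x + s *\<^sub>R e)) = (\<lambda>s. trig f (x + s *\<^sub>R e))"
  by (rule ext) (rule trig_fsupp[OF f, symmetric])
 ultimately show ?thesis by simp
qed

lemma character_periodic: "character k (x + (of_int a, of_int b)) = character k x"
proof -
 have "freq k \<bullet> (of_int a, of_int b) = of_int (fst k*a + snd k*b)" by (simp add: freq_def inner_prod_def)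
 hence "character k (x + (of_int a, of_int b)) = cis (2*pi*(freq k \<bullet> x))*cis (2*pi * of_int (fst k*a + snd k*b))"
  unfolding character_def inner_add_right by (simp only: distrib_left cis_mult)
 also have "cis (2*pi * of_int (fst k*a + snd k*b)) = 1" by (rule cis_multiple_2pi) simp
 finally show ?thesis by (simp add: character_def)
qed

lemma trig_attains_max:
 assumes f: "fsupp f"
 shows "\<exists>x0. \<forall>x. norm (trig f x) \<le> norm (trig f x0)"
proof -
 let ?K = "cbox (0, 0) (1, 1) :: (real \<times> real) set"
 have "continuous_on ?K (\<lambda>x. norm (trig f x))"
 proof -
  have "continuous_on ?K (\<lambda>x. \<Sum>k\<in>{k. f k \<noteq> 0}. f k*character k x)"
   by (intro continuous_intros continuous_on_subset[OF continuous_character]) simp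
  moreover have "trig f = (\<lambda>x. \<Sum>k\<in>{k. f k \<noteq> 0}. f k*character k x)" by (rule ext) (rule trig_fsupp[OF f])
  ultimately show ?thesis by (simp only: continuous_on_norm)
 qed
 moreover have "compact ?K" "?K \<noteq> {}" by (rule compact_cbox, simp add: cbox_Pair_eq)
 ultimately obtain x0 where x0: "\<And>x. x \<in> ?K ==> norm (trig f x) \<le> norm (trig f x0)"
  using continuous_attains_sup[of ?K "\<lambda>x. norm (trig f x)"] by blast
 have "norm (trig f x) \<le> norm (trig f x0)" for x
 proof -
  let ?y = "x + (real_of_int (- \<lfloor>fst x\<rfloor>), real_of_int (- \<lfloor>snd x\<rfloor>))"
  have "?y = (frac (fst x), frac (snd x))" by (rule prod_eqI) (simp_all add: frac_def)
  hence "?y \<in> ?K" by (simp add: cbox_Pair_eq less_imp_le[OF frac_lt_1])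
  moreover have "trig f ?y = trig f x" unfolding trig_fsupp[OF f] character_periodic ..
  ultimately show ?thesis using x0[of ?y] by simp
 qed
 thus ?thesis by blast
qed

text \<open>At a maximum point of the modulus, the real part of the suitably rotated polynomial has a
 maximum along every line.\<close>

lemma trig_max_conditions:
 assumes f: "fsupp f" and x0: "\<And>x. norm (trig f x) \<le> norm (trig f x0)"
  and c: "norm c = 1" "c*trig f x0 = of_real (norm (trig f x0))"
 shows "Re (c*trig (ddir e f) x0) = 0" "Re (c*trig (ddir e (ddir e f)) x0) \<le> 0"
proof -
 define h where "h s = Re (c*trig f (x0 + s *\<^sub>R e))" for s
 define h1 where "h1 s = Re (c*trig (ddir e f) (x0 + s *\<^sub>R e))" for s
 have d: "(h has_real_derivative h1 s) (at s)" for s unfolding h_def h1_def has_real_derivative_iff_has_vector_derivative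
  by (intro bounded_linear.has_vector_derivative[OF bounded_linear_Re] has_vector_derivative_mult_right
    trig_shift_deriv f)
 have d1: "(h1 has_real_derivative Re (c*trig (ddir e (ddir e f)) (x0 + s *\<^sub>R e))) (at s)" for s
  unfolding h1_def has_real_derivative_iff_has_vector_derivative
  by (intro bounded_linear.has_vector_derivative[OF bounded_linear_Re] has_vector_derivative_mult_right
    trig_shift_deriv fsupp_ddir f)
 have mx: "h s \<le> h 0" for s
 proof -
  have "h s \<le> norm (c*trig f (x0 + s *\<^sub>R e))" unfolding h_def by (rule complex_Re_le_cmod)
  also have "... \<le> norm (trig f x0)" using x0 by (simp add: norm_mult c)
  also have "... = h 0" by (simp add: h_def c)
  finally show ?thesis .
 qed
 have z: "h1 0 = 0" by (rule DERIV_local_max[OF d, of 1]) (simp_all add: mx)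
 thus "Re (c*trig (ddir e f) x0) = 0" by (simp add: h1_def)
 show "Re (c*trig (ddir e (ddir e f)) x0) \<le> 0"
 proof (rule ccontr)
  assume "\<not> Re (c*trig (ddir e (ddir e f)) x0) \<le> 0"
  hence "0 < Re (c*trig (ddir e (ddir e f)) (x0 + 0 *\<^sub>R e))" by simp
  then obtain r where r: "0 < r" "\<And>s. 0 < s ==> s < r ==> h1 0 < h1 (0 + s)" using DERIV_pos_inc_right[OF d1[of 0]] by blast
  obtain s where s: "0 < s" "s < r/2" "h (r/2) - h 0 = (r/2 - 0)*h1 s" using MVT2[of 0 "r/2" h h1] d r(1) by auto
  have "0 < h1 s" using r(2)[of s] s z r(1) by simp
  hence "0 < (r/2 - 0)*h1 s" using r(1) by simp
  thus False using s(3) mx[of "r/2"] by linarith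
 qed
qed

lemma complex_rotation_exists: "\<exists>c. norm c = 1 \<and> c*z = of_real (norm (z :: complex))"
proof (cases "z = 0")
 case False
 have "norm (cnj z/of_real (norm z)) = 1" using False by (simp add: norm_divide)
 moreover have "cnj z/of_real (norm z)*z = of_real (norm z)"
 proof -
  have "cnj z/of_real (norm z)*z = (z*cnj z)/of_real (norm z)" by simp
  also have "... = of_real ((norm z)^2/norm z)" by (simp only: complex_norm_square[symmetric] of_real_divide)
  also have "(norm z)^2/norm z = norm z" by (simp add: power2_eq_square)
  finally show ?thesis .
 qed
 ultimately show ?thesis by blast
qed (rule exI[of _ 1], simp)

text \<open>At a maximum of the modulus the rotated first derivative is purely imaginary, so the
  real part of the equation sees only the zero-order term there. In effect the resolvent of a
  directional derivative is bounded by 1/l in the sup norm.\<close>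

lemma tsup_first_order:
 assumes f: "fsupp f" and l: "0 < l" and B: "tsup (tscale (of_real l) f + ddir e f) B"
 shows "tsup f (B/l)"
proof -
 obtain x0 where x0: "\<And>x. norm (trig f x) \<le> norm (trig f x0)" using trig_attains_max[OF f] by blast
 obtain c where c: "norm c = 1" "c*trig f x0 = of_real (norm (trig f x0))" using complex_rotation_exists by blast
 have "l*norm (trig f x0) = Re (of_real l*(c*trig f x0)) + Re (c*trig (ddir e f) x0)" using trig_max_conditions(1)[OF f x0 c, of e] by (simp add: c)
 also have "... = Re (c*trig (tscale (of_real l) f + ddir e f) x0)" by (simp add: trig_add fsupp_tscale fsupp_ddir f trig_tscale algebra_simps)
 also have "... \<le> norm (c*trig (tscale (of_real l) f + ddir e f) x0)" by (rule complex_Re_le_cmod)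
 also have "... \<le> B" using tsupD[OF B] by (simp add: norm_mult c)
 finally have "norm (trig f x0) \<le> B/l" using l by (simp add: field_simps)
 thus ?thesis unfolding tsup_def using x0 order_trans by blast
qed

text \<open>At a maximum of the modulus both rotated second derivatives have nonpositive real part,
  so the term \<open>- laplace f\<close> only helps.\<close>

lemma tsup_laplace:
 assumes f: "fsupp f" and l: "0 < l" and B: "tsup (tscale (of_real l) f - laplace f) B"
 shows "tsup f (B/l)"
proof -
 obtain x0 where x0: "\<And>x. norm (trig f x) \<le> norm (trig f x0)" using trig_attains_max[OF f] by blast
 obtain c where c: "norm c = 1" "c*trig f x0 = of_real (norm (trig f x0))" using complex_rotation_exists by blast
 let ?a = "ddir (1, 0) (ddir (1, 0) f)" and ?b = "ddir (0, 1) (ddir (0, 1) f)"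
 have eq: "tscale (of_real l) f - laplace f = tscale (of_real l) f + tscale (-1) (?a + ?b)" unfolding laplace_ddir by (simp add: tscale_def fun_eq_iff)
 have "l*norm (trig f x0) \<le> Re (of_real l*(c*trig f x0)) - Re (c*trig ?a x0) - Re (c*trig ?b x0)"
 proof -
  have "l*norm (trig f x0) = Re (of_real l*(c*trig f x0))" by (simp add: c)
  thus ?thesis using trig_max_conditions(2)[OF f x0 c, of "(1, 0)"] trig_max_conditions(2)[OF f x0 c, of "(0, 1)"] by linarith
 qed
 also have "... = Re (c*trig (tscale (of_real l) f - laplace f) x0)"
  unfolding eq by (simp add: trig_add fsupp_add fsupp_tscale fsupp_ddir f trig_tscale algebra_simps)
 also have "... \<le> norm (c*trig (tscale (of_real l) f - laplace f) x0)" by (rule complex_Re_le_cmod)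
 also have "... \<le> B" using tsupD[OF B] by (simp add: norm_mult c)
 finally have "norm (trig f x0) \<le> B/l" using l by (simp add: field_simps)
 thus ?thesis unfolding tsup_def using x0 order_trans by blast
qed

section \<open>Sup-norm bounds for multipliers on finitely many frequencies\<close>

lemma sum_norm_le_L2:
 assumes "finite A" "sob_le 0 f B"
 shows "(\<Sum>k\<in>A. norm (f k)) \<le> sqrt (card A)*B"
proof -
 have "(\<Sum>k\<in>A. \<bar>1\<bar>*\<bar>norm (f k)\<bar>) \<le> L2_set (\<lambda>k. 1) A*L2_set (\<lambda>k. norm (f k)) A" by (rule L2_set_mult_ineq)
 also have "L2_set (\<lambda>k. 1) A = sqrt (card A)" by (simp add: L2_set_def)
 also have "sqrt (card A)*L2_set (\<lambda>k. norm (f k)) A \<le> sqrt (card A)*B"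
  using assms(2)[unfolded sob_le_def, rule_format, OF assms(1)] by (intro mult_left_mono) simp_all
 finally show ?thesis by simp
qed

lemma laplace_bessel: "laplace f k = of_real (1 - bessel k)*f k" by (simp add: laplace_def bessel_def)

text \<open>Since \<open>bessel\<close> is the symbol of 1 - \<Delta>, the multiplier is l(l + 1 -
  \<Delta>)^(-1), and the maximum principle bounds it by l/(l + 1).\<close>

lemma tsup_resolv_step:
 assumes l: "0 < l" and h: "fsupp h" "tsup h B"
 shows "tsup (\<lambda>k. of_real (l/(l + bessel k))*h k) B"
proof -
 let ?g = "\<lambda>k. of_real (l/(l + bessel k))*h k"
 have g: "fsupp ?g" by (rule fsupp_mult[OF h(1)])
 have "(tscale (of_real (l + 1)) ?g - laplace ?g) k = tscale (of_real l) h k" for k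
 proof -
  have nz: "l + bessel k \<noteq> 0" using l bessel_pos[of k] by linarith
  have "(tscale (of_real (l + 1)) ?g - laplace ?g) k = (of_real (l + 1) - of_real (1 - bessel k))*?g k"
   unfolding fun_diff_def tscale_def laplace_bessel by (simp only: left_diff_distrib)
  also have "... = of_real ((l + bessel k)*(l/(l + bessel k)))*h k" unfolding of_real_diff[symmetric] mult.assoc[symmetric] of_real_mult[symmetric] by simp
  finally have "(tscale (of_real (l + 1)) ?g - laplace ?g) k = of_real ((l + bessel k)*(l/(l + bessel k)))*h k" .
  thus ?thesis using nz by (simp add: tscale_def)
 qed
 hence "tscale (of_real (l + 1)) ?g - laplace ?g = tscale (of_real l) h" by (rule ext)
 hence "tsup ?g (norm (of_real l :: complex)*B/(l + 1))" using l tsup_tscale[OF h(2), of "of_real l"] by (intro tsup_laplace[OF g]) simp_all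
 thus ?thesis by (rule tsup_mono) (use l tsup_nonneg[OF h(2)] in \<open>simp add: pos_divide_le_eq algebra_simps\<close>)
qed

text \<open>With z = d/(l + d) one has d = l*z + z*d; iterating this \<open>n\<close> times leaves a
  geometric sum in z and the remainder z^n*d.\<close>

lemma symbol_expansion:
 fixes l d :: "'a :: field"
 assumes "l + d \<noteq> 0"
 shows "l*(\<Sum>i\<in>{1..n}. (d/(l + d))^i) + (d/(l + d))^n*d = d"
proof -
 define z where "z = d/(l + d)"
 have z: "z*(l + d) = d" using assms by (simp add: z_def)
 have "l*(\<Sum>i\<in>{1..n}. z^i) + z^n*d = d"
 proof (induction n)
  case (Suc n)
  have "l*(\<Sum>i\<in>{1..Suc n}. z^i) + z^Suc n*d = l*(\<Sum>i\<in>{1..n}. z^i) + z^n*(z*(l + d))" by (simp add: algebra_simps)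
  thus ?case using Suc.IH by (simp only: z)
 qed simp
 thus ?thesis by (simp only: z_def)
qed

lemma tsup_sum:
 assumes "finite I" "\<And>i. i \<in> I ==> fsupp (F i)" "\<And>i. i \<in> I ==> tsup (F i) (a i)"
 shows "fsupp (\<lambda>k. \<Sum>i\<in>I. F i k) \<and> tsup (\<lambda>k. \<Sum>i\<in>I. F i k) (\<Sum>i\<in>I. a i)" using assms
proof (induction rule: finite_induct)
 case empty
 show ?case by (auto simp: fsupp_def tsup_def trig_def)
next
 case (insert i I)
 hence "fsupp (F i + (\<lambda>k. \<Sum>i\<in>I. F i k))" "tsup (F i + (\<lambda>k. \<Sum>i\<in>I. F i k)) (a i + sum a I)"
  by (simp_all add: fsupp_add tsup_add)
 thus ?case using insert(1,2) by (simp add: plus_fun_def)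
qed

text \<open>A symbol is expanded into powers of a symbol \<open>y\<close> under which the sup norm is stable, plus a remainder
 which is small on \<open>A\<close> and is estimated in the square norm.\<close>

lemma tsup_expand:
 assumes A: "finite A" "\<And>k. k \<notin> A ==> f k = 0" and B: "tsup f B"
  and y: "\<And>h B. fsupp h ==> tsup h B ==> tsup (\<lambda>k. y k*h k) (c*B)"
  and s: "\<And>k. s k = a*(\<Sum>i\<in>{1..n::nat}. y k^i) + r k" and r: "\<And>k. k \<in> A ==> norm (r k) \<le> \<rho>" and \<rho>: "0 \<le> \<rho>"
 shows "tsup (\<lambda>k. s k*f k) ((norm a*(\<Sum>i\<in>{1..n}. c^i) + sqrt (card A)*\<rho>)*B)"
proof -
 have f: "fsupp f" by (rule fsupp_finite[OF A])
 have p: "tsup (\<lambda>k. y k^i*f k) (c^i*B)" for i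
 proof (induction i)
  case (Suc i)
  from y[OF fsupp_mult[OF f] this] show ?case by (simp add: mult.assoc)
 qed (simp add: B)
 have S: "fsupp (\<lambda>k. \<Sum>i\<in>{1..n}. y k^i*f k) \<and> tsup (\<lambda>k. \<Sum>i\<in>{1..n}. y k^i*f k) (\<Sum>i\<in>{1..n}. c^i*B)"
  by (intro tsup_sum fsupp_mult[OF f] p) simp
 have R: "tsup (\<lambda>k. r k*f k) (\<rho>*(sqrt (card A)*B))"
 proof (rule tsup_mono[OF tsup_l1[OF A(1)]])
  have "(\<Sum>k\<in>A. norm (r k*f k)) \<le> \<rho>*(\<Sum>k\<in>A. norm (f k))"
   unfolding sum_distrib_left norm_mult by (intro sum_mono mult_right_mono r) simp_all
  also have "... \<le> \<rho>*(sqrt (card A)*B)" using sum_norm_le_L2[OF A(1) sob_le_tsup[OF f B]] \<rho> by (rule mult_left_mono)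
  finally show "(\<Sum>k\<in>A. norm (r k*f k)) \<le> \<rho>*(sqrt (card A)*B)" .
 qed (simp add: A(2))
 have *: "norm a*(\<Sum>i\<in>{1..n}. c^i*B) + \<rho>*(sqrt (card A)*B) = (norm a*(\<Sum>i\<in>{1..n}. c^i) + sqrt (card A)*\<rho>)*B"
  unfolding sum_distrib_right[symmetric] by (simp add: algebra_simps)
 from tsup_add[OF fsupp_tscale[OF conjunct1[OF S]] fsupp_mult[OF f] tsup_tscale[OF conjunct2[OF S]] R, of a]
 have "tsup (tscale a (\<lambda>k. \<Sum>i\<in>{1..n}. y k^i*f k) + (\<lambda>k. r k*f k)) ((norm a*(\<Sum>i\<in>{1..n}. c^i) + sqrt (card A)*\<rho>)*B)"
  unfolding * .
 moreover have "tscale a (\<lambda>k. \<Sum>i\<in>{1..n}. y k^i*f k) + (\<lambda>k. r k*f k) = (\<lambda>k. s k*f k)"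
  by (simp add: fun_eq_iff s tscale_def sum_distrib_right[symmetric] distrib_right)
 ultimately show ?thesis by simp
qed

text \<open>This replaces kernel estimates: 1/\<open>bessel\<close> is expanded in powers of
  L/(bessel + L), each of which is a contraction in the sup norm. On the frequencies in question
  this symbol is at most 1/(1 + c), so the remainder decays geometrically in \<open>n\<close>. It
  can therefore be estimated crudely through the square norm, at the cost of the root of the number
  of frequencies.\<close>

lemma tsup_resolv_annulus:
 assumes A: "finite A" "\<And>k. k \<notin> A ==> f k = 0" and B: "tsup f B" and L: "0 < L" and c: "0 < c"
  and low: "\<And>k. k \<in> A ==> c*L \<le> bessel k"
 shows "tsup (resolv f) ((real n/L + sqrt (card A)*(1/(1 + c))^n/(c*L))*B)"
proof -
 let ?y = "\<lambda>k. L/(bessel k + L)"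
 have s: "1/complex_of_real (bessel k) = of_real (1/L)*(\<Sum>i\<in>{1..n}. of_real (?y k)^i) + of_real (?y k^n/bessel k)" for k
 proof -
  have nz: "bessel k \<noteq> 0" "bessel k + L \<noteq> 0" using L bessel_pos[of k] by linarith+
  have "bessel k*(\<Sum>i\<in>{1..n}. ?y k^i) + ?y k^n*L = L" by (rule symbol_expansion[OF nz(2)])
  hence "1/bessel k = 1/L*(\<Sum>i\<in>{1..n}. ?y k^i) + ?y k^n/bessel k" using nz(1) L by (simp add: field_simps)
  hence "complex_of_real (1/bessel k) = of_real (1/L*(\<Sum>i\<in>{1..n}. ?y k^i) + ?y k^n/bessel k)" by (rule arg_cong)
  thus ?thesis by (simp only: of_real_add of_real_mult of_real_sum of_real_power of_real_divide of_real_1)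
 qed
 have "tsup (\<lambda>k. 1/of_real (bessel k)*f k) ((norm (complex_of_real (1/L))*(\<Sum>i\<in>{1..n}. 1^i) + sqrt (card A)*((1/(1 + c))^n/(c*L)))*B)"
 proof (rule tsup_expand[OF A B _ s])
  show "tsup (\<lambda>k. of_real (?y k)*h k) (1*B)" if "fsupp h" "tsup h B" for h B using tsup_resolv_step[OF L that] by (simp add: add.commute)
  fix k assume "k \<in> A"
  hence b: "c*L \<le> bessel k" by (rule low)
  have cL: "0 < c*L" using c L by simp
  have y0: "0 \<le> ?y k" using L bessel_pos[of k] by (intro divide_nonneg_nonneg) linarith+
  have "?y k \<le> L/(c*L + L)" using b L cL by (intro divide_left_mono) (simp_all add: add_pos_pos)
  also have "... = L*1/(L*(1 + c))" by (simp add: distrib_left mult.commute add.commute)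
  also have "... = 1/(1 + c)" using L by (subst mult_divide_mult_cancel_left) simp_all
  finally have y: "?y k \<le> 1/(1 + c)" .
  have "?y k^n/bessel k \<le> (1/(1 + c))^n/(c*L)" using c by (intro frac_le power_mono y y0 b cL) simp_all
  thus "norm (of_real (?y k^n/bessel k) :: complex) \<le> (1/(1 + c))^n/(c*L)"
   unfolding norm_of_real abs_of_nonneg[OF divide_nonneg_nonneg[OF zero_le_power[OF y0] less_imp_le[OF bessel_pos]]] .
 qed (use c L in simp_all)
 thus ?thesis using L by (simp add: resolv_def norm_divide)
qed

text \<open>The symbol d of a derivative is imaginary, so l + d never vanishes, and d/(l + d) = 1 -
  l/(l + d) has sup-norm bound 2 by the first-order maximum principle; hence the powers of 2. On the
  given frequencies the same symbol is at most N/l, so for \<open>l\<close> larger than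
  \<open>N\<close> the remainder is small already for fixed \<open>n\<close>.\<close>

lemma tsup_ddir_ball:
 assumes A: "finite A" "\<And>k. k \<notin> A ==> f k = 0" and B: "tsup f B" and l: "0 < l"
  and N: "\<And>k. k \<in> A ==> \<bar>2*pi*(freq k \<bullet> e)\<bar> \<le> N" "0 \<le> N"
 shows "tsup (ddir e f) ((l*2^(n + 1) + sqrt (card A)*(N/l)^n*N)*B)"
proof -
 let ?d = "\<lambda>k. \<i> * of_real (2*pi*(freq k \<bullet> e)) :: complex"
 let ?z = "\<lambda>k. ?d k/(of_real l + ?d k)"
 have nz: "of_real l + ?d k \<noteq> 0" for k using l by (simp add: complex_eq_iff)
 have "tsup (\<lambda>k. ?d k*f k) ((norm (of_real l :: complex)*(\<Sum>i\<in>{1..n}. 2^i) + sqrt (card A)*((N/l)^n*N))*B)"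
 proof (rule tsup_expand[OF A B _ symbol_expansion[OF nz, symmetric]])
  fix h B assume h: "fsupp h" "tsup h B"
  let ?g = "\<lambda>k. of_real l/(of_real l + ?d k)*h k"
  have g: "fsupp ?g" by (rule fsupp_mult[OF h(1)])
  have "(tscale (of_real l) ?g + ddir e ?g) k = tscale (of_real l) h k" for k
   unfolding plus_fun_apply tscale_def ddir_def distrib_right[symmetric] using nz[of k] by simp
  hence "tscale (of_real l) ?g + ddir e ?g = tscale (of_real l) h" by (rule ext)
  hence "tsup ?g (norm (of_real l :: complex)*B/l)" using tsup_tscale[OF h(2), of "of_real l"] by (intro tsup_first_order[OF g l, of e]) simp
  from tsup_add[OF h(1) fsupp_tscale[OF g] h(2) tsup_tscale[OF this], of "- 1"]
  have "tsup (h + tscale (- 1) ?g) (2*B)" using l by simp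
  moreover have "h + tscale (- 1) ?g = (\<lambda>k. ?z k*h k)"
  proof
   fix k
   have "x + - 1*(a/(a + d)*x) = d/(a + d)*x" if "a + d \<noteq> 0" for a d x :: complex using that by (simp add: field_simps)
   from this[OF nz] show "(h + tscale (- 1) ?g) k = ?z k*h k" by (simp only: plus_fun_apply tscale_def)
  qed
  ultimately show "tsup (\<lambda>k. ?z k*h k) (2*B)" by simp
 next
  fix k assume "k \<in> A"
  hence d: "norm (?d k) \<le> N" using N(1)[of k] by (simp add: norm_mult abs_mult)
  have "l \<le> norm (of_real l + ?d k)" using complex_Re_le_cmod[of "of_real l + ?d k"] by simp
  hence "norm (?z k) \<le> N/l" unfolding norm_divide using d l N(2) by (intro frac_le) simp_all
  thus "norm (?z k^n*?d k) \<le> (N/l)^n*N" unfolding norm_mult[of "_^n"] norm_power using d l N(2) by (intro mult_mono power_mono) simp_all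
 qed (assumption, intro mult_nonneg_nonneg zero_le_power divide_nonneg_nonneg N(2) less_imp_le[OF l])
 hence *: "tsup (ddir e f) ((l*(\<Sum>i\<in>{1..n}. 2^i) + sqrt (card A)*((N/l)^n*N))*B)" using l by (simp add: ddir_def[abs_def])
 have "(\<Sum>i\<in>{1..n}. 2^i :: real) \<le> 2^(n + 1)" by (induction n) simp_all
 from mult_left_mono[OF this, of l] l
 have "l*(\<Sum>i\<in>{1..n}. 2^i) + sqrt (card A)*((N/l)^n*N) \<le> l*2^(n + 1) + sqrt (card A)*(N/l)^n*N" by (simp only: mult.assoc) linarith
 from tsup_mono[OF * mult_right_mono[OF this tsup_nonneg[OF B]]] show ?thesis .
qed

section \<open>Littlewood--Paley blocks\<close>

lemma bessel_freq: "2*pi*norm (freq k) \<le> sqrt (bessel k)" by (rule real_le_rsqrt) (simp add: bessel_def power_mult_distrib)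

lemma norm_freq_le: "norm (freq k) \<le> sqrt (bessel k)"
proof -
 have "1 \<le> 2*pi" using pi_gt3 by simp
 hence "1*norm (freq k) \<le> 2*pi*norm (freq k)" by (intro mult_right_mono) simp_all
 thus ?thesis using bessel_freq[of k] by simp
qed

lemma bessel_ball:
 fixes \<rho> :: real
 assumes "1 \<le> \<rho>"
 shows "finite {k. bessel k \<le> \<rho>}" "card {k. bessel k \<le> \<rho>} \<le> 9*\<rho>"
proof -
 define n where "n = \<lfloor>sqrt \<rho>\<rfloor>"
 have n: "0 \<le> n" "of_int n \<le> sqrt \<rho>" unfolding n_def using assms by simp_all
 have sub: "{k. bessel k \<le> \<rho>} \<subseteq> {-n..n} \<times> {-n..n}"
 proof
  fix k assume "k \<in> {k. bessel k \<le> \<rho>}"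
  hence "sqrt (bessel k) \<le> sqrt \<rho>" by simp
  hence b: "norm (freq k) \<le> sqrt \<rho>" using norm_freq_le[of k] by linarith
  have "\<bar>real_of_int (fst k)\<bar> \<le> norm (freq k)" "\<bar>real_of_int (snd k)\<bar> \<le> norm (freq k)"
   using norm_fst_le[of "fst (freq k)" "snd (freq k)"] norm_snd_le[of "snd (freq k)" "fst (freq k)"] by (simp_all add: freq_def)
  hence "\<bar>fst k\<bar> \<le> n" "\<bar>snd k\<bar> \<le> n" unfolding n_def le_floor_iff using b by simp_all
  hence "fst k \<in> {-n..n}" "snd k \<in> {-n..n}" by (simp_all add: abs_le_iff)
  thus "k \<in> {-n..n} \<times> {-n..n}" by (simp add: mem_Times_iff)
 qed
 have fin: "finite ({-n..n} \<times> {-n..n})" by simp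
 show "finite {k. bessel k \<le> \<rho>}" by (rule finite_subset[OF sub fin])
 have "card {k. bessel k \<le> \<rho>} \<le> card ({-n..n} \<times> {-n..n})" by (rule card_mono[OF fin sub])
 also have "... = nat (2*n + 1)*nat (2*n + 1)" by (simp add: card_cartesian_product)
 finally have "real (card {k. bessel k \<le> \<rho>}) \<le> real (nat (2*n + 1)*nat (2*n + 1))" by (simp only: of_nat_le_iff)
 also have "... = (2 * of_int n + 1)^2" using n(1) by (simp add: power2_eq_square)
 also have "... \<le> (3 * sqrt \<rho>)^2"
 proof (rule power_mono)
  have "1 \<le> sqrt \<rho>" using assms by simp
  thus "2*real_of_int n + 1 \<le> 3 * sqrt \<rho>" using n(2) by linarith
 qed (use n(1) in simp)
 also have "... = 9*\<rho>" using assms by (simp add: power_mult_distrib)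
 finally show "card {k. bessel k \<le> \<rho>} \<le> 9*\<rho>" .
qed

lemma smooth_compact_lipschitz:
 fixes f :: "real \<times> real \<Rightarrow> real"
 assumes sm: "smooth_on UNIV f" and supp: "\<And>x. f x \<noteq> 0 ==> norm x \<le> r"
 shows "\<exists>L\<ge>0. \<forall>x y. \<bar>f x - f y\<bar> \<le> L*norm (x - y)"
proof -
 obtain D where D0: "D 0 0 = f" and D: "\<And>p q x. (D p q has_derivative (\<lambda>h. fst h *\<^sub>R D (Suc p) q x + snd h *\<^sub>R D p (Suc q) x)) (at x)"
  using sm unfolding smooth_on_def by auto
 let ?K = "cball 0 r :: (real \<times> real) set" and ?D = "\<lambda>x. norm (D (Suc 0) 0 x) + norm (D 0 (Suc 0) x)"
 have "continuous_on UNIV (D p q)" for p q by (rule has_derivative_continuous_on) (rule D)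
 hence "continuous_on ?K ?D" by (intro continuous_intros) (blast intro: continuous_on_subset)+
 hence "bounded (?D ` ?K)" by (intro compact_imp_bounded compact_continuous_image compact_cball)
 then obtain B where B: "\<And>x. x \<in> ?K ==> ?D x \<le> B" unfolding bounded_iff by force
 define L where "L = max 0 B"
 have out: "?D x = 0" if x: "x \<notin> ?K" for x
 proof -
  have "(f has_derivative (\<lambda>h. 0)) (at x)"
  proof (rule has_derivative_transform_within_open[of "\<lambda>_. 0" _ _ _ "- ?K"])
   fix y assume "y \<in> - ?K" thus "0 = f y" using supp[of y] by (cases "f y = 0") auto
  qed (use x in auto)
  from has_derivative_unique[OF D[of 0 0 x, unfolded D0] this]
  have *: "fst h *\<^sub>R D (Suc 0) 0 x + snd h *\<^sub>R D 0 (Suc 0) x = 0" for h by (rule fun_cong)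
  show ?thesis using *[of "(1, 0)"] *[of "(0, 1)"] by simp
 qed
 have bd: "?D x \<le> L" for x using B[of x] out[of x] by (cases "x \<in> ?K") (auto simp: L_def)
 have "norm (f x - f y) \<le> L*norm (x - y)" for x y
 proof (rule differentiable_bound[OF convex_UNIV])
  fix z
  show "(f has_derivative (\<lambda>h. fst h *\<^sub>R D (Suc 0) 0 z + snd h *\<^sub>R D 0 (Suc 0) z)) (at z)" using D[of 0 0 z] unfolding D0 .
  show "onorm (\<lambda>h. fst h *\<^sub>R D (Suc 0) 0 z + snd h *\<^sub>R D 0 (Suc 0) z) \<le> L"
  proof (rule onorm_le)
   fix h :: "real \<times> real"
   have "norm (fst h *\<^sub>R D (Suc 0) 0 z + snd h *\<^sub>R D 0 (Suc 0) z) \<le> norm (fst h)*norm (D (Suc 0) 0 z) + norm (snd h)*norm (D 0 (Suc 0) z)"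
    by (rule order_trans[OF norm_triangle_ineq]) (simp add: abs_mult)
   also have "... \<le> norm h*norm (D (Suc 0) 0 z) + norm h*norm (D 0 (Suc 0) z)"
    using norm_fst_le[of "fst h" "snd h"] norm_snd_le[of "snd h" "fst h"] by (intro add_mono mult_right_mono) simp_all
   also have "... \<le> L*norm h" using mult_right_mono[OF bd, of "norm h" z] by (simp add: algebra_simps)
   finally show "norm (fst h *\<^sub>R D (Suc 0) 0 z + snd h *\<^sub>R D 0 (Suc 0) z) \<le> L*norm h" .
  qed
 qed simp_all
 thus ?thesis by (intro exI[of _ L]) (simp add: L_def)
qed

locale lp_blocks =
 fixes P :: dyadic
 assumes partition: "dyadic_partition P"
begin

definition sym :: "int \<Rightarrow> real \<times> real \<Rightarrow> real" where
 "sym j x = (if j = -1 then fst P x else snd P (x /\<^sub>R 2^nat j))"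

lemma block_sym: "block P j f = (\<lambda>k. of_real (sym j (freq k))*f k)" by (rule ext) (simp add: block_def sym_def)

lemma partition_facts:
 shows low_nonneg: "0 \<le> fst P x" and ann_nonneg: "0 \<le> snd P x"
  and low_smooth: "smooth_on UNIV (fst P)" and ann_smooth: "smooth_on UNIV (snd P)"
  and low_radial: "radial (fst P)" and ann_radial: "radial (snd P)"
  and low_supp: "\<exists>r. \<forall>x. fst P x \<noteq> 0 --> norm x \<le> r"
  and ann_supp: "\<exists>r R. 0 < r \<and> (\<forall>x. snd P x \<noteq> 0 --> r \<le> norm x \<and> norm x \<le> R)"
  and sums_one: "(\<lambda>j::nat. snd P (x /\<^sub>R 2^j)) sums (1 - fst P x)"
  and low_ann: "1 \<le> i ==> fst P x * snd P (x /\<^sub>R 2^i) = 0"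
  and ann_ann: "\<bar>int i - int j\<bar> > 1 ==> snd P (x /\<^sub>R 2^i) * snd P (x /\<^sub>R 2^j) = 0"
proof -
 obtain p q where P: "P = (p, q)" by (cases P)
 note d = partition[unfolded dyadic_partition_def P prod.case]
 show "0 \<le> fst P x" "0 \<le> snd P x" "smooth_on UNIV (fst P)" "smooth_on UNIV (snd P)"
  "radial (fst P)" "radial (snd P)" "\<exists>r. \<forall>x. fst P x \<noteq> 0 --> norm x \<le> r"
  "\<exists>r R. 0 < r \<and> (\<forall>x. snd P x \<noteq> 0 --> r \<le> norm x \<and> norm x \<le> R)"
  "(\<lambda>j::nat. snd P (x /\<^sub>R 2^j)) sums (1 - fst P x)" using d by (simp_all only: P fst_conv snd_conv)
 show "1 \<le> i ==> fst P x * snd P (x /\<^sub>R 2^i) = 0"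
  "\<bar>int i - int j\<bar> > 1 ==> snd P (x /\<^sub>R 2^i) * snd P (x /\<^sub>R 2^j) = 0" using d by (simp_all only: P fst_conv snd_conv)
qed

lemma sym_nonneg: "0 \<le> sym j x" by (simp add: sym_def low_nonneg ann_nonneg)

lemma sym_has_sum: "((\<lambda>j. sym j x) has_sum 1) {-1..}"
proof -
 have "((\<lambda>j::nat. snd P (x /\<^sub>R 2^j)) has_sum (1 - fst P x)) UNIV" by (rule sums_nonneg_imp_has_sum[OF sums_one]) (simp add: ann_nonneg)
 moreover have "(\<lambda>j::nat. snd P (x /\<^sub>R 2^j)) = (\<lambda>j. sym j x) \<circ> int" by (rule ext) (simp add: sym_def)
 ultimately have "((\<lambda>j. sym j x) has_sum (1 - fst P x)) (range int)" by (simp add: has_sum_reindex)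
 moreover have "-1 \<notin> range int" by auto
 ultimately have "((\<lambda>j. sym j x) has_sum (sym (-1) x + (1 - fst P x))) (insert (-1) (range int))" by (intro has_sum_insert)
 moreover have "insert (-1) (range int) = {-1..}"
 proof
  show "{-1..} \<subseteq> insert (-1) (range int)"
  proof
   fix j :: int assume "j \<in> {-1..}"
   hence "j = -1 \<or> j = int (nat j)" by simp
   thus "j \<in> insert (-1) (range int)" by blast
  qed
  show "insert (-1) (range int) \<subseteq> {-1..}" by fastforce
 qed
 ultimately show ?thesis by (simp add: sym_def)
qed

lemma sym_le_1: assumes "-1 \<le> j" shows "sym j x \<le> 1"
proof -
 have "(\<Sum>i\<in>{j}. sym i x) \<le> 1" by (rule finite_sum_le_has_sum[OF sym_has_sum[of x]]) (use assms in \<open>simp_all add: sym_nonneg\<close>)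
 thus ?thesis by simp
qed

lemma sym_uminus: "sym j (- x) = sym j x"
proof -
 have "fst P (- x) = fst P x" by (rule low_radial[unfolded radial_def, rule_format]) simp
 moreover have "snd P ((- x) /\<^sub>R 2^nat j) = snd P (x /\<^sub>R 2^nat j)" by (rule ann_radial[unfolded radial_def, rule_format]) simp
 ultimately show ?thesis unfolding sym_def by (simp only:)
qed

lemma sym_disjoint:
 assumes "-1 \<le> i" "-1 \<le> j" "2 \<le> \<bar>i - j\<bar>" shows "sym i x * sym j x = 0"
proof -
 have *: "sym i x * sym j x = 0" if ij: "-1 \<le> i" "i + 2 \<le> j" for i j
 proof (cases "i = -1")
  case True
  thus ?thesis using low_ann[of "nat j" x] ij by (simp add: sym_def)
 next
  case False
  thus ?thesis using ann_ann[of "nat i" "nat j" x] ij by (simp add: sym_def)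
 qed
 show ?thesis
 proof (cases "i < j")
  case True
  thus ?thesis using *[of i j] assms by simp
 next
  case False
  thus ?thesis using *[of j i] assms by (simp add: mult.commute)
 qed
qed

lemma power_nat_powr: "0 \<le> j ==> 2^nat j = 2 powr real_of_int j" by (simp add: powr_realpow[symmetric])

definition "support_radii r R \<longleftrightarrow> 0 < r \<and> r \<le> R \<and> (\<forall>j\<ge>-1. \<forall>x. sym j x \<noteq> 0 --> norm x \<le> R*2 powr j) \<and>
 (\<forall>j\<ge>0. \<forall>x. sym j x \<noteq> 0 --> r*2 powr j \<le> norm x)"

lemma sym_support_ex: "\<exists>r R. support_radii r R"
proof -
 obtain r0 where r0: "\<And>x. fst P x \<noteq> 0 ==> norm x \<le> r0" using low_supp by blast
 obtain r R where r: "0 < r" "\<And>x. snd P x \<noteq> 0 ==> r \<le> norm x \<and> norm x \<le> R" using ann_supp by blast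
 \<comment> \<open>The block of index -1 sits at scale 1/2, hence the doubling of
   \<open>r0\<close>.\<close>
 define R' where "R' = max r (max R (2*r0))"
 have ann: "r*2 powr j \<le> norm x \<and> norm x \<le> R*2 powr j" if j: "0 \<le> j" and s: "sym j x \<noteq> 0" for j :: int and x
 proof -
  have p: "2^nat j = 2 powr j" by (rule power_nat_powr[OF j])
  have "snd P (x /\<^sub>R 2 powr j) \<noteq> 0" using s j unfolding sym_def p by (simp split: if_splits)
  hence "r \<le> norm (x /\<^sub>R 2 powr j) \<and> norm (x /\<^sub>R 2 powr j) \<le> R" by (rule r(2))
  thus ?thesis by (simp add: field_simps)
 qed
 have "norm x \<le> R'*2 powr j" if "-1 \<le> j" "sym j x \<noteq> 0" for j :: int and x
 proof (cases "j = -1")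
  case True
  hence "norm x \<le> r0" using that r0 by (simp add: sym_def)
  also have "... \<le> R'*(1/2)" by (simp add: R'_def)
  finally show ?thesis using True by (simp add: powr_minus)
 next
  case False
  hence "norm x \<le> R*2 powr j" using ann that by simp
  also have "... \<le> R'*2 powr j" by (rule mult_right_mono) (simp_all add: R'_def)
  finally show ?thesis .
 qed
 moreover have "r \<le> R'" by (simp add: R'_def)
 ultimately show ?thesis using r(1) ann unfolding support_radii_def by blast
qed

definition "sym_Lip L \<longleftrightarrow> 0 \<le> L \<and> (\<forall>j\<ge>-1. \<forall>x y. \<bar>sym j x - sym j y\<bar> \<le> L*2 powr (- real_of_int j)*norm (x - y))"

lemma sym_lipschitz_ex: "\<exists>L. sym_Lip L"
proof -
 obtain r0 where r0: "\<And>x. fst P x \<noteq> 0 ==> norm x \<le> r0" using low_supp by blast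
 obtain R where R: "\<And>x. snd P x \<noteq> 0 ==> norm x \<le> R" using ann_supp by blast
 obtain L1 where L1: "0 \<le> L1" "\<And>x y. \<bar>fst P x - fst P y\<bar> \<le> L1*norm (x - y)" using smooth_compact_lipschitz[OF low_smooth r0] by blast
 obtain L2 where L2: "0 \<le> L2" "\<And>x y. \<bar>snd P x - snd P y\<bar> \<le> L2*norm (x - y)" using smooth_compact_lipschitz[OF ann_smooth R] by blast
 have "\<bar>sym j x - sym j y\<bar> \<le> (L1 + L2)*2 powr (- real_of_int j)*norm (x - y)" if j: "-1 \<le> j" for j :: int and x y
 proof (cases "j = -1")
  case True
  have "\<bar>sym j x - sym j y\<bar> \<le> L1*norm (x - y)" using True L1(2) by (simp add: sym_def)
  also have "... \<le> ((L1 + L2)*2 powr (- real_of_int j))*norm (x - y)" using True L1(1) L2(1) by (intro mult_right_mono) simp_all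
  finally show ?thesis .
 next
  case False
  hence p: "2^nat j = 2 powr j" using j by (intro power_nat_powr) simp
  have "\<bar>sym j x - sym j y\<bar> = \<bar>snd P (x /\<^sub>R 2 powr j) - snd P (y /\<^sub>R 2 powr j)\<bar>" unfolding sym_def p using False by simp
  also have "... \<le> L2*norm (x /\<^sub>R 2 powr j - y /\<^sub>R 2 powr j)" by (rule L2(2))
  also have "... = L2*2 powr (- real_of_int j)*norm (x - y)" by (simp add: scaleR_diff_right[symmetric] powr_minus)
  also have "... \<le> ((L1 + L2)*2 powr (- real_of_int j))*norm (x - y)" using L1(1) by (intro mult_right_mono) simp_all
  finally show ?thesis .
 qed
 thus ?thesis using L1(1) L2(1) unfolding sym_Lip_def by (intro exI[of _ "L1 + L2"]) simp
qed

definition "rad = (SOME r. \<exists>R. support_radii r R)"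
definition "Rad = (SOME R. support_radii rad R)"
definition "Lip = (SOME L. sym_Lip L)"

lemma rad_pos: "0 < rad" and rad_le: "rad \<le> Rad" and Rad_pos: "0 < Rad"
 and sym_upper: "-1 \<le> j ==> sym j x \<noteq> 0 ==> norm x \<le> Rad*2 powr j"
 and sym_lower: "0 \<le> j ==> sym j x \<noteq> 0 ==> rad*2 powr j \<le> norm x"
 and Lip_nonneg: "0 \<le> Lip"
 and sym_lipschitz: "-1 \<le> j ==> \<bar>sym j x - sym j y\<bar> \<le> Lip*2 powr (- real_of_int j)*norm (x - y)"
proof -
 have r: "support_radii rad Rad" unfolding Rad_def by (rule someI_ex) (unfold rad_def, rule someI_ex[OF sym_support_ex])
 have L: "sym_Lip Lip" unfolding Lip_def by (rule someI_ex[OF sym_lipschitz_ex])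
 show "0 < rad" "rad \<le> Rad" "-1 \<le> j ==> sym j x \<noteq> 0 ==> norm x \<le> Rad*2 powr j"
  "0 \<le> j ==> sym j x \<noteq> 0 ==> rad*2 powr j \<le> norm x" using r unfolding support_radii_def by blast+
 thus "0 < Rad" by linarith
 show "0 \<le> Lip" "-1 \<le> j ==> \<bar>sym j x - sym j y\<bar> \<le> Lip*2 powr (- real_of_int j)*norm (x - y)" using L unfolding sym_Lip_def by blast+
qed

definition supp :: "int \<Rightarrow> (int \<times> int) set" where "supp j = {k. sym j (freq k) \<noteq> 0}"

text \<open>\<open>bmin\<close> and \<open>bmax\<close> enclose \<open>bessel k/4 powr j\<close> on
  the block \<open>j\<close>. The minimum with 1 covers the block -1, where only
  \<open>bessel k \<ge> 1\<close> is available; the summand 4 in \<open>bmax\<close> absorbs the 1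
  inside \<open>bessel\<close>, since 4*4^j \<ge> 1 for j \<ge> -1.\<close>

definition bmin :: real where "bmin = min 1 (4*pi^2*rad^2)"
definition bmax :: real where "bmax = 4 + 4*pi^2*Rad^2"

lemma bmin_pos: "0 < bmin" and bmin_le_1: "bmin \<le> 1" and bmax_ge_1: "1 \<le> bmax" and bmax_ge_4: "4 \<le> bmax"
 using rad_pos by (simp_all add: bmin_def bmax_def)

lemma powr_2_sq: "(2 powr (real_of_int j))^2 = 4 powr j"
proof -
 have "(2 powr (real_of_int j))^2 = 2 powr (of_int j)*2 powr (of_int j)" by (rule power2_eq_square)
 also have "... = (2*2) powr (of_int j)" by (rule powr_mult[symmetric])
 finally show ?thesis by simp
qed

lemma bessel_le_dyadic:
 assumes j: "-1 \<le> j" and k: "norm (freq k) \<le> R*2 powr real_of_int j" shows "bessel k \<le> (4 + 4*pi^2*R^2)*4 powr j"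
proof -
 have "(norm (freq k))^2 \<le> (R*2 powr j)^2" using k by (rule power_mono) simp
 hence "(norm (freq k))^2 \<le> R^2*4 powr j" by (simp add: power_mult_distrib powr_2_sq)
 hence "4*pi^2*(norm (freq k))^2 \<le> 4*pi^2*(R^2*4 powr j)" by (rule mult_left_mono) simp
 moreover have "4 powr (-1) \<le> 4 powr (real_of_int j)" using j by (intro powr_mono) simp_all
 hence "1 \<le> 4*4 powr j" by (simp add: powr_minus)
 ultimately show ?thesis unfolding bessel_def distrib_right mult.assoc by linarith
qed

lemma supp_bessel_le: assumes j: "-1 \<le> j" and k: "k \<in> supp j" shows "bessel k \<le> bmax*4 powr j"
 unfolding bmax_def by (rule bessel_le_dyadic[OF j sym_upper[OF j]]) (use k in \<open>simp add: supp_def\<close>)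

lemma supp_bessel_ge: assumes j: "-1 \<le> j" and k: "k \<in> supp j" shows "bmin*4 powr j \<le> bessel k"
proof (cases "j = -1")
 case True
 have "bmin*4 powr j \<le> 1*1" using True bmin_le_1 bmin_pos by (intro mult_mono) (simp_all add: powr_minus)
 thus ?thesis using bessel_ge_1[of k] by linarith
next
 case False
 hence "rad*2 powr j \<le> norm (freq k)" using sym_lower[of j] j k by (simp add: supp_def)
 hence "(rad*2 powr j)^2 \<le> (norm (freq k))^2" by (rule power_mono) (simp add: less_imp_le[OF rad_pos])
 hence "rad^2*4 powr j \<le> (norm (freq k))^2" by (simp add: power_mult_distrib powr_2_sq)
 hence "4*pi^2*(rad^2*4 powr j) \<le> 4*pi^2*(norm (freq k))^2" by (rule mult_left_mono) simp
 moreover have "bmin*4 powr j \<le> 4*pi^2*rad^2*4 powr j" by (rule mult_right_mono) (simp_all add: bmin_def)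
 moreover have "4*pi^2*rad^2*4 powr j = 4*pi^2*(rad^2*4 powr j)" by (rule mult.assoc)
 ultimately show ?thesis unfolding bessel_def by linarith
qed

lemma finite_supp: assumes "-1 \<le> j" shows "finite (supp j)"
proof -
 have "1 \<le> max 1 (bmax*4 powr j)" by simp
 from bessel_ball(1)[OF this] show ?thesis by (rule rev_finite_subset) (use supp_bessel_le[OF assms] in force)
qed

lemma card_supp: assumes j: "-1 \<le> j" shows "card (supp j) \<le> 9*(bmax*4 powr j)"
proof -
 have "4 powr (-1) \<le> 4 powr (real_of_int j)" using j by (intro powr_mono) simp_all
 hence "4*(1/4) \<le> bmax*4 powr j" using bmax_ge_4 by (intro mult_mono) (simp_all add: powr_minus)
 hence 1: "1 \<le> bmax*4 powr j" by simp
 have "supp j \<subseteq> {k. bessel k \<le> bmax*4 powr j}" using supp_bessel_le[OF j] by blast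
 hence "card (supp j) \<le> card {k. bessel k \<le> bmax*4 powr j}" by (rule card_mono[OF bessel_ball(1)[OF 1]])
 thus ?thesis using bessel_ball(2)[OF 1] by linarith
qed

lemma block_outside: "k \<notin> supp j ==> block P j f k = 0" by (simp add: block_sym supp_def)

lemma fsupp_block: "-1 \<le> j ==> fsupp (block P j f)" by (rule fsupp_finite[OF finite_supp[of j]]) (simp_all add: block_outside)

end

section \<open>Besov bounds for blocks and for products of two blocks\<close>

abbreviation dy :: "int \<Rightarrow> real \<Rightarrow> real" where "dy j s \<equiv> 2 powr (real_of_int j * s)"

lemma dy_add: "dy j s*dy j t = dy j (s + t)" by (simp add: powr_add[symmetric] distrib_left)

lemma dy_uminus: "dy j (- s)*dy j s = 1" by (simp only: dy_add) simp

lemma four_powr_dy: "4 powr real_of_int j = dy j 2"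
proof -
 have "4 powr real_of_int j = (2 powr 2) powr real_of_int j" by simp
 also have "... = dy j 2" unfolding powr_powr by (simp add: mult.commute)
 finally show ?thesis .
qed

lemma dy_powr: "dy j s powr t = dy j (s*t)" unfolding powr_powr by (simp add: mult.assoc)

lemma trig_fsupp_bdd: "fsupp f ==> bdd_above (range (\<lambda>x. norm (trig f x)))"
 using tsupD[OF tsup_l1[OF fsupp_finite_set[of f], of f]] by (intro bdd_aboveI2) simp

context lp_blocks begin

text \<open>The Besov scale over L2 with third index infinity, except that the coefficients are cut
  off sharply to the support of the block instead of being weighted by \<open>sym\<close>. The
  weight then remains available in \<open>pair_pointwise\<close>, where its smallness is the
  point.\<close>

definition lo :: "real \<Rightarrow> real \<Rightarrow> tdist \<Rightarrow> bool" where
 "lo s A f \<longleftrightarrow> (\<forall>j\<ge>-1. sob_le 0 (\<lambda>k. if k \<in> supp j then f k else 0) (A*dy j (- s)))"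

definition hi :: "real \<Rightarrow> real \<Rightarrow> tdist \<Rightarrow> bool" where
 "hi b B g \<longleftrightarrow> (\<forall>j\<ge>-1. tsup (block P j g) (B*dy j (- b)))"

lemma loD: "lo s A f ==> -1 \<le> j ==> sob_le 0 (\<lambda>k. if k \<in> supp j then f k else 0) (A*dy j (- s))" unfolding lo_def by blast

lemma hiD: "hi b B g ==> -1 \<le> j ==> tsup (block P j g) (B*dy j (- b))" unfolding hi_def by blast

lemma lo_nonneg: "lo s A f ==> 0 \<le> A" using sob_leD_nonneg[OF loD[of s A f 0]] by simp

lemma hi_nonneg: "hi s A f ==> 0 \<le> A" using tsup_nonneg[OF hiD[of s A f 0]] by simp

lemma hi_iff_holder: "hi a B f \<longleftrightarrow> f \<in> holder P a \<and> holder_norm P a f \<le> B"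
proof -
 have SUP: "(SUP x. norm (trig (block P j f) x)) \<le> c \<longleftrightarrow> tsup (block P j f) c" if j: "-1 \<le> j" for j c
  unfolding tsup_def by (subst cSUP_le_iff) (use trig_fsupp_bdd[OF fsupp_block[OF j]] in simp_all)
 have bs: "block_size P a f j \<le> B \<longleftrightarrow> tsup (block P j f) (B*dy j (- a))" if j: "-1 \<le> j" for j B
 proof -
  have "block_size P a f j \<le> B \<longleftrightarrow> (SUP x. norm (trig (block P j f) x)) \<le> B*dy j (- a)"
   unfolding block_size_def by (simp add: powr_minus field_simps)
  thus ?thesis using SUP[OF j] by simp
 qed
 show ?thesis
 proof
  assume h: "hi a B f"
  hence le: "block_size P a f j \<le> B" if "j \<in> {-1..}" for j using bs[of j B] hiD[OF h, of j] that by simp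
  hence "f \<in> holder P a" unfolding holder_def by (simp only: mem_Collect_eq) (rule bdd_aboveI2)
  moreover have "holder_norm P a f \<le> B" unfolding holder_norm_def by (rule cSUP_least) (use le in simp_all)
  ultimately show "f \<in> holder P a \<and> holder_norm P a f \<le> B" ..
 next
  assume h: "f \<in> holder P a \<and> holder_norm P a f \<le> B"
  hence bdd: "bdd_above (block_size P a f ` {-1..})" unfolding holder_def by simp
  show "hi a B f" unfolding hi_def
  proof (intro allI impI)
   fix j :: int assume j: "-1 \<le> j"
   have "block_size P a f j \<le> holder_norm P a f" unfolding holder_norm_def by (rule cSUP_upper[OF _ bdd]) (use j in simp)
   hence "block_size P a f j \<le> B" using h by linarith
   thus "tsup (block P j f) (B*dy j (- a))" by (simp only: bs[OF j])
  qed
 qed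
qed

lemma hi_holder: "f \<in> holder P a ==> hi a (holder_norm P a f) f" by (simp add: hi_iff_holder)

lemma block_add: "block P j (f + g) = block P j f + block P j g"
 and block_diff: "block P j (f - g) = block P j f - block P j g"
 and block_tscale: "block P j (tscale c f) = tscale c (block P j f)" by (simp_all add: block_sym fun_eq_iff tscale_def algebra_simps)

lemma block_zero: "block P j 0 = 0" by (simp add: block_sym fun_eq_iff)

lemma hi_mono: "hi b A f ==> A \<le> B ==> hi b B f"
 unfolding hi_def by (intro allI impI, rule tsup_mono, drule spec, erule mp, assumption, rule mult_right_mono) simp_all

lemma hi_add:
 assumes "hi b A f" "hi b B g" shows "hi b (A + B) (f + g)" unfolding hi_def block_add distrib_right by (intro allI impI tsup_add fsupp_block hiD assms)

lemma hi_tscale: assumes "hi b A f" shows "hi b (norm c*A) (tscale c f)" unfolding hi_def block_tscale mult.assoc by (intro allI impI tsup_tscale hiD assms)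

lemma uminus_tscale: "- f = tscale (-1) f" for f :: tdist by (simp add: tscale_def fun_eq_iff)

lemma hi_diff: "hi b A f ==> hi b B g ==> hi b (A + B) (f - g)" using hi_add[of b A f B "- g"] hi_tscale[of b B g "-1"] by (simp add: uminus_tscale[symmetric])

lemma dy_index_le: "s \<le> t ==> -1 \<le> j ==> dy j (- t) \<le> 2 powr (t - s)*dy j (- s)"
proof -
 assume "s \<le> t" "-1 \<le> j"
 hence "(-1)*(t - s) \<le> real_of_int j*(t - s)" by (intro mult_right_mono) simp_all
 hence "real_of_int j*(- t) \<le> (t - s) + real_of_int j*(- s)" by (simp add: algebra_simps)
 thus ?thesis by (simp only: powr_add[symmetric] powr_le_cancel_iff)
qed

lemma hi_index:
 assumes "hi t B g" "s \<le> t" shows "hi s (2 powr (t - s)*B) g" unfolding hi_def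
proof (intro allI impI)
 fix j :: int assume j: "-1 \<le> j"
 have "B*dy j (- t) \<le> B*(2 powr (t - s)*dy j (- s))" by (intro mult_left_mono dy_index_le assms j hi_nonneg[OF assms(1)])
 thus "tsup (block P j g) (2 powr (t - s)*B*dy j (- s))" by (intro tsup_mono[OF hiD[OF assms(1) j]]) (simp add: mult_ac)
qed

text \<open>On a block \<open>bessel k\<close> is 4^j times a number between \<open>bmin\<close> and
  \<open>bmax\<close>; which end is the worse one depends on the sign of \<open>s\<close>.\<close>

definition cs :: "real \<Rightarrow> real" where "cs s = max (bmin powr (- s/2)) (bmax powr (- s/2))"

lemma cs_pos: "0 < cs s" using bmin_pos by (simp add: cs_def less_max_iff_disj)

lemma sob_le_lo:
 assumes "sob_le s f A" shows "lo s (cs s*A) f" unfolding lo_def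
proof (intro allI impI)
 fix j :: int assume j: "-1 \<le> j"
 have "sob_le 0 (\<lambda>k. if k \<in> supp j then f k else 0) ((cs s*dy j (- s))*A)"
 proof (rule sob_le_mult[where r = s])
  show "sob_le (0 + s) f A" using assms by simp
  show "0 \<le> cs s*dy j (- s)" by (intro mult_nonneg_nonneg less_imp_le[OF cs_pos]) simp
  fix k
  show "norm (if k \<in> supp j then f k else 0) \<le> cs s*dy j (- s)*bessel k powr (s/2)*norm (f k)"
  proof (cases "k \<in> supp j")
   case True
   define u where "u = bessel k/4 powr j"
   have u: "bmin \<le> u" "u \<le> bmax" using supp_bessel_ge[OF j True] supp_bessel_le[OF j True] by (simp_all add: u_def field_simps)
   have up: "0 < u" using u(1) bmin_pos by linarith
   have bk: "bessel k = u*dy j 2" by (simp add: u_def four_powr_dy)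
   have csb: "0 \<le> cs s" "bmin powr (- s/2) \<le> cs s" "bmax powr (- s/2) \<le> cs s"
    using cs_pos[of s] by (simp_all only: cs_def less_imp_le max.cobounded1 max.cobounded2)
   have "1 \<le> cs s*u powr (s/2)"
   proof (cases "0 \<le> s")
    case True
    have "1 = bmin powr (- s/2)*bmin powr (s/2)" using bmin_pos by (simp add: powr_add[symmetric])
    also have "... \<le> cs s*u powr (s/2)" using u True bmin_pos csb by (intro mult_mono powr_mono2) simp_all
    finally show ?thesis .
   next
    case False
    have "1 = bmax powr (- s/2)*bmax powr (s/2)" using bmax_ge_1 by (simp add: powr_add[symmetric])
    also have "... \<le> cs s*u powr (s/2)" using u False up csb by (intro mult_mono powr_mono2') simp_all
    finally show ?thesis .
   qed
   also have "u powr (s/2) = dy j (- s)*bessel k powr (s/2)"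
   proof -
    have "bessel k powr (s/2) = u powr (s/2)*dy j s" unfolding bk using up by (simp add: powr_mult dy_powr)
    thus ?thesis using dy_uminus[of j s] by simp
   qed
   finally have "1*norm (f k) \<le> (cs s*(dy j (- s)*bessel k powr (s/2)))*norm (f k)" by (rule mult_right_mono) simp
   thus ?thesis using True by (simp add: mult.assoc)
  next
   case False
   thus ?thesis using cs_pos[of s] by simp
  qed
 qed
 thus "sob_le 0 (\<lambda>k. if k \<in> supp j then f k else 0) (cs s*A*dy j (- s))" by (simp add: mult_ac)
qed

lemma lo_mult:
 assumes f: "lo s A f" and c: "0 \<le> c" and le: "\<And>k j. -1 \<le> j ==> k \<in> supp j ==> norm (g k) \<le> c*dy j r*norm (f k)"
 shows "lo (s - r) (c*A) g" unfolding lo_def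
proof (intro allI impI)
 fix j :: int assume j: "-1 \<le> j"
 have "sob_le 0 (\<lambda>k. if k \<in> supp j then g k else 0) ((c*dy j r)*(A*dy j (- s)))" by (rule sob_le_mult0[OF loD[OF f j]]) (use c le[OF j] in simp_all)
 moreover have "(c*dy j r)*(A*dy j (- s)) = c*A*dy j (- (s - r))"
 proof -
  have "(c*dy j r)*(A*dy j (- s)) = c*A*(dy j r*dy j (- s))" by (simp only: mult_ac)
  also have "dy j r*dy j (- s) = dy j (r + - s)" by (rule dy_add)
  finally show ?thesis by simp
 qed
 ultimately show "sob_le 0 (\<lambda>k. if k \<in> supp j then g k else 0) (c*A*dy j (- (s - r)))" by (simp only:)
qed

lemma ddir_le_bessel:
 assumes "norm e \<le> 1" shows "\<bar>2*pi*(freq k \<bullet> e)\<bar> \<le> sqrt (bessel k)"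
proof -
 have "\<bar>freq k \<bullet> e\<bar> \<le> norm (freq k)*norm e" by (rule Cauchy_Schwarz_ineq2)
 also have "... \<le> norm (freq k)*1" using assms by (intro mult_left_mono) simp_all
 finally have "2*pi*\<bar>freq k \<bullet> e\<bar> \<le> 2*pi*norm (freq k)" by simp
 moreover have "\<bar>2*pi*(freq k \<bullet> e)\<bar> = 2*pi*\<bar>freq k \<bullet> e\<bar>" by (simp add: abs_mult)
 ultimately show ?thesis using bessel_freq[of k] by linarith
qed

lemma supp_sqrt_bessel: assumes "-1 \<le> j" "k \<in> supp j" shows "sqrt (bessel k) \<le> sqrt bmax*dy j 1"
proof -
 have "sqrt (bessel k) \<le> sqrt (bmax*4 powr j)" using supp_bessel_le[OF assms] by simp
 also have "... = sqrt bmax*dy j 1" by (simp add: real_sqrt_mult powr_2_sq[symmetric])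
 finally show ?thesis .
qed

lemma lo_block: assumes "lo s A f" "-1 \<le> j" shows "sob_le 0 (block P j f) (A*dy j (- s))"
proof -
 have "sob_le 0 (block P j f) (1*(A*dy j (- s)))"
 proof (rule sob_le_mult0[OF loD[OF assms]])
  fix k
  have "\<bar>sym j (freq k)\<bar>*norm (f k) \<le> 1*norm (f k)"
   using sym_le_1[OF assms(2), of "freq k"] sym_nonneg[of j "freq k"] by (intro mult_right_mono) simp_all
  thus "norm (block P j f k) \<le> 1*norm (if k \<in> supp j then f k else 0)" by (simp add: block_sym norm_mult supp_def)
 qed simp
 thus ?thesis by simp
qed

lemma hi_block: "hi b B g ==> -1 \<le> j ==> sob_le 0 (block P j g) (B*dy j (- b))" by (rule sob_le_tsup[OF fsupp_block hiD])

abbreviation pair :: "tdist \<Rightarrow> tdist \<Rightarrow> int \<Rightarrow> int \<Rightarrow> tdist" where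
 "pair f g i j \<equiv> tmul (block P i f) (block P j g)"

lemma pair_commute: "pair f g i j = pair g f j i" by (rule tmul_commute)

lemma pair_L2:
 assumes "lo s A f" "hi b B g" "-1 \<le> i" "-1 \<le> j"
 shows "sob_le 0 (pair f g i j) (A*B*(dy i (- s)*dy j (- b)))"
 using sob_le_tmul[OF fsupp_block[OF assms(3)] lo_block[OF assms(1,3)] fsupp_block[OF assms(4)] hiD[OF assms(2,4)]] by (simp add: mult_ac)

text \<open>Frequencies add under multiplication, so twice the larger radius is an upper bound.
  There is no lower bound to match it; for separated blocks \<open>pair_pointwise\<close> takes its
  place.\<close>

lemma pair_support:
 assumes "-1 \<le> i" "-1 \<le> j" "pair f g i j k \<noteq> 0"
 shows "bessel k \<le> 4*bmax*4 powr real_of_int (max i j)"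
proof -
 have eq: "pair f g i j k = (\<Sum>l\<in>supp i. block P i f l*block P j g (k - l))" by (rule tmul_finite[OF finite_supp[OF assms(1)] block_outside])
 have "(\<Sum>l\<in>supp i. block P i f l*block P j g (k - l)) \<noteq> 0" using assms(3) unfolding eq .
 from sum.not_neutral_contains_not_neutral[OF this]
 obtain l where l: "l \<in> supp i" "block P i f l*block P j g (k - l) \<noteq> 0" .
 have kl: "k - l \<in> supp j" using l(2) block_outside[of "k - l" j g] by fastforce
 let ?m = "max i j :: int"
 have mono: "2 powr real_of_int a \<le> 2 powr ?m" if "a \<le> ?m" for a :: int using that by simp
 have "norm (freq l) \<le> Rad*2 powr i" "norm (freq (k - l)) \<le> Rad*2 powr j" using sym_upper assms(1,2) l(1) kl by (simp_all add: supp_def)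
 moreover have "Rad*2 powr i \<le> Rad*2 powr ?m" "Rad*2 powr j \<le> Rad*2 powr ?m" using Rad_pos mono[of i] mono[of j] by simp_all
 moreover have "norm (freq k) \<le> norm (freq l) + norm (freq (k - l))" using norm_triangle_ineq[of "freq l" "freq (k - l)"] by (simp add: freq_diff)
 ultimately have "norm (freq k) \<le> 2*Rad*2 powr ?m" by linarith
 with assms(1) have "bessel k \<le> (4 + 4*pi^2*(2*Rad)^2)*4 powr ?m" by (intro bessel_le_dyadic) simp_all
 also have "... \<le> 4*bmax*4 powr ?m" by (rule mult_right_mono) (simp_all add: bmax_def power_mult_distrib)
 finally show ?thesis .
qed

definition cpt :: real where "cpt = max (2/rad) (Lip*(2*Rad/rad))"

lemma cpt_nonneg: "0 \<le> cpt" using rad_pos by (simp add: cpt_def le_max_iff_disj)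

text \<open>Blocks at distance at least two have disjoint symbols, but their supports may touch, so that
 their product can have small frequencies.  The Lipschitz bound shows that these carry a small factor.\<close>

lemma sym_far_le:
 assumes i: "-1 \<le> i" and j: "-1 \<le> j" and ij: "2 \<le> \<bar>i - j\<bar>"
  and nz: "sym i (freq l) \<noteq> 0" "sym j (freq (k - l)) \<noteq> 0"
 shows "sym i (freq l) \<le> cpt*2 powr (- real_of_int (max i j))*norm (freq k)"
proof -
 have z: "sym i (- freq (k - l)) = 0" using sym_disjoint[OF i j ij, of "freq (k - l)"] nz(2) by (simp add: sym_uminus)
 have "sym i (freq l) \<le> \<bar>sym i (freq l) - sym i (- freq (k - l))\<bar>" unfolding z by simp
 also have "... \<le> Lip*2 powr (- real_of_int i)*norm (freq l - (- freq (k - l)))" by (rule sym_lipschitz[OF i])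
 also have "freq l - (- freq (k - l)) = freq k" by (simp add: freq_diff)
 finally have lip: "sym i (freq l) \<le> Lip*2 powr (- real_of_int i)*norm (freq k)" .
 show ?thesis
 proof (cases "j < i")
  case True
  have "1 \<le> 2*Rad/rad" using rad_le rad_pos by (simp add: field_simps)
  hence "Lip*1 \<le> Lip*(2*Rad/rad)" using Lip_nonneg by (rule mult_left_mono)
  hence "Lip \<le> cpt" by (simp add: cpt_def)
  hence le: "Lip*(2 powr (- real_of_int i)*norm (freq k)) \<le> cpt*(2 powr (- real_of_int i)*norm (freq k))" by (rule mult_right_mono) simp
  have m: "max i j = i" using True by simp
  show ?thesis unfolding m mult.assoc by (rule order_trans[OF lip[unfolded mult.assoc] le])
 next
  case False
  hence j0: "0 \<le> j" and m: "max i j = j" using ij i by simp_all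
  show ?thesis
  \<comment> \<open>Either \<open>l\<close> is so small that \<open>k\<close> itself must have size
    of order 2^j, and the trivial bound \<open>sym_le_1\<close> is enough; or 2^i and 2^j are
    comparable, and the Lipschitz bound at scale i may be restated at scale j.\<close>
  proof (cases "Rad*2 powr i \<le> rad*2 powr j/2")
   case True
   have "norm (freq l) \<le> Rad*2 powr i" by (rule sym_upper[OF i nz(1)])
   moreover have "rad*2 powr j \<le> norm (freq (k - l))" by (rule sym_lower[OF j0 nz(2)])
   moreover have "norm (freq (k - l)) \<le> norm (freq k) + norm (freq l)" unfolding freq_diff by (rule norm_triangle_ineq4)
   ultimately have "rad*2 powr j/2 \<le> norm (freq k)" using True by linarith
   hence "1 \<le> 2/rad*2 powr (- real_of_int j)*norm (freq k)" using rad_pos by (simp add: field_simps powr_minus)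
   also have "... \<le> cpt*(2 powr (- real_of_int j)*norm (freq k))" unfolding mult.assoc by (rule mult_right_mono) (simp_all add: cpt_def)
   finally have "1 \<le> cpt*(2 powr (- real_of_int j)*norm (freq k))" .
   thus ?thesis using sym_le_1[OF i, of "freq l"] unfolding m mult.assoc by linarith
  next
   case False
   hence "2 powr (- real_of_int i) \<le> (2*Rad/rad)*2 powr (- real_of_int j)" using rad_pos by (simp add: field_simps powr_minus)
   hence "Lip*2 powr (- real_of_int i) \<le> Lip*((2*Rad/rad)*2 powr (- real_of_int j))" by (rule mult_left_mono[OF _ Lip_nonneg])
   also have "... \<le> cpt*2 powr (- real_of_int j)" unfolding mult.assoc[symmetric] by (rule mult_right_mono) (simp_all add: cpt_def)
   finally have "Lip*2 powr (- real_of_int i)*norm (freq k) \<le> cpt*2 powr (- real_of_int j)*norm (freq k)" by (rule mult_right_mono) simp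
   thus ?thesis using lip unfolding m by linarith
  qed
 qed
qed

lemma sum_L2_le: assumes "finite A" "sob_le 0 f a" shows "L2_set (\<lambda>k. norm (f k)) A \<le> a" using assms unfolding sob_le_def by simp

text \<open>Each coefficient of the convolution is bounded by Cauchy-Schwarz after
  \<open>sym_far_le\<close> has taken out the factor \<open>sym i (freq l)\<close>. The quotient of
  |k| by 2^max(i, j) makes low output frequencies small, which stands in for their absence.\<close>

lemma pair_pointwise:
 assumes f: "lo s A f" and g: "hi b B g" and i: "-1 \<le> i" and j: "-1 \<le> j" and ij: "2 \<le> \<bar>i - j\<bar>"
 shows "norm (pair f g i j k) \<le> cpt*2 powr (- real_of_int (max i j)) * sqrt (bessel k)*(A*B*(dy i (- s)*dy j (- b)))"
proof -
 let ?c = "cpt*2 powr (- real_of_int (max i j))*norm (freq k)"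
 let ?f = "\<lambda>l. if l \<in> supp i then f l else 0" and ?g = "block P j g"
 have c0: "0 \<le> ?c" using cpt_nonneg by simp
 have fin: "finite (supp i)" by (rule finite_supp[OF i])
 have "pair f g i j k = (\<Sum>l\<in>supp i. block P i f l*?g (k - l))" by (rule tmul_finite[OF fin block_outside])
 hence "norm (pair f g i j k) \<le> (\<Sum>l\<in>supp i. norm (block P i f l*?g (k - l)))" by (simp only: norm_sum)
 also have "... \<le> (\<Sum>l\<in>supp i. ?c*(\<bar>norm (?f l)\<bar>*\<bar>norm (?g (k - l))\<bar>))"
 proof (rule sum_mono)
  fix l assume l: "l \<in> supp i"
  show "norm (block P i f l*?g (k - l)) \<le> ?c*(\<bar>norm (?f l)\<bar>*\<bar>norm (?g (k - l))\<bar>)"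
  proof (cases "k - l \<in> supp j")
   case True
   have "sym i (freq l) \<le> ?c" by (rule sym_far_le[OF i j ij, where l = l]) (use l True in \<open>simp_all add: supp_def\<close>)
   hence "sym i (freq l)*(norm (f l)*norm (?g (k - l))) \<le> ?c*(norm (f l)*norm (?g (k - l)))" by (rule mult_right_mono) simp
   thus ?thesis using l sym_nonneg[of i "freq l"] by (simp add: block_sym[of i] norm_mult mult.assoc)
  next
   case False
   hence "?g (k - l) = 0" by (rule block_outside)
   thus ?thesis using c0 by simp
  qed
 qed
 also have "... = ?c*(\<Sum>l\<in>supp i. \<bar>norm (?f l)\<bar>*\<bar>norm (?g (k - l))\<bar>)" by (simp only: sum_distrib_left)
 also have "... \<le> ?c*(L2_set (\<lambda>l. norm (?f l)) (supp i)*L2_set (\<lambda>l. norm (?g (k - l))) (supp i))"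
  by (rule mult_left_mono[OF L2_set_mult_ineq c0])
 also have "L2_set (\<lambda>l. norm (?g (k - l))) (supp i) = L2_set (\<lambda>l. norm (?g l)) ((\<lambda>l. k - l) ` supp i)"
  unfolding L2_set_def by (subst sum.reindex) (simp_all add: inj_on_def)
 also have "?c*(L2_set (\<lambda>l. norm (?f l)) (supp i)*L2_set (\<lambda>l. norm (?g l)) ((\<lambda>l. k - l) ` supp i))
  \<le> ?c*((A*dy i (- s))*(B*dy j (- b)))" using sum_L2_le[OF fin loD[OF f i]] sum_L2_le[OF finite_imageI[OF fin] hi_block[OF g j]]
   lo_nonneg[OF f] by (intro mult_left_mono[OF _ c0] mult_mono) (simp_all add: L2_set_nonneg)
 also have "... \<le> cpt*2 powr (- real_of_int (max i j)) * sqrt (bessel k)*(A*B*(dy i (- s)*dy j (- b)))"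
 proof -
  have "?c \<le> cpt*2 powr (- real_of_int (max i j)) * sqrt (bessel k)" using norm_freq_le[of k] cpt_nonneg by (intro mult_left_mono) simp_all
  moreover have "0 \<le> A*B*(dy i (- s)*dy j (- b))" using lo_nonneg[OF f] hi_nonneg[OF g] by simp
  ultimately have "?c*(A*B*(dy i (- s)*dy j (- b))) \<le> cpt*2 powr (- real_of_int (max i j)) * sqrt (bessel k)*(A*B*(dy i (- s)*dy j (- b)))"
   by (rule mult_right_mono)
  thus ?thesis by (simp add: mult_ac)
 qed
 finally show ?thesis .
qed

end

section \<open>Paraproducts\<close>

lemma L2_set_le_card:
 assumes "finite G" "finite K" "0 \<le> t" "\<And>k. k \<in> G ==> k \<in> K ==> \<bar>h k\<bar> \<le> t" "\<And>k. k \<in> G ==> k \<notin> K ==> h k = 0"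
 shows "L2_set h G \<le> sqrt (card K)*t"
proof -
 have "(\<Sum>k\<in>G. (h k)^2) = (\<Sum>k\<in>G \<inter> K. (h k)^2)" by (rule sum.mono_neutral_right) (use assms(1,5) in auto)
 also have "... \<le> (\<Sum>k\<in>G \<inter> K. t^2)"
 proof (rule sum_mono)
  fix k assume "k \<in> G \<inter> K"
  hence "\<bar>h k\<bar>^2 \<le> t^2" using assms(4)[of k] by (intro power_mono) simp_all
  thus "(h k)^2 \<le> t^2" by simp
 qed
 also have "... \<le> card K*t^2" using card_mono[OF assms(2), of "G \<inter> K"] by (simp add: mult_right_mono)
 finally have "L2_set h G \<le> sqrt (card K*t^2)" unfolding L2_set_def by simp
 thus ?thesis using assms(3) by (simp add: real_sqrt_mult)
qed

text \<open>Cut at \<open>bessel k = 2 powr m\<close>. Above the cut the weight of order -9/10 gives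
  \<open>dy m (- 9/20)\<close>. Below it there are at most 9*2^m frequencies, each with weighted
  size at most c*2^(-m)*2^(m/20) times \<open>S\<close>, and 1/2 - 1 + 1/20 = -9/20. A function
  truly localised at |k| of order 2^m would gain \<open>dy m (- 9/10)\<close>; half of that is
  enough later.\<close>

lemma sob_le_neg:
 assumes F: "sob_le 0 F S" and c: "0 \<le> c" and m: "0 \<le> m"
  and pt: "\<And>k. norm (F k) \<le> c*2 powr (- real_of_int m) * sqrt (bessel k)*S"
 shows "sob_le (- 9/10) F ((1 + 3*c)*(dy m (- 9/20)*S))"
proof -
 have S: "0 \<le> S" by (rule sob_leD_nonneg[OF F])
 define K where "K = {k. bessel k \<le> 2 powr m}"
 have "1 \<le> 2 powr real_of_int m" using m by (intro ge_one_powr_ge_zero) simp_all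
 note K = bessel_ball[OF this, folded K_def]
 define F1 where "F1 k = (if k \<in> K then F k else 0)" for k
 define F2 where "F2 k = (if k \<in> K then 0 else F k)" for k
 have "F = F1 + F2" by (simp add: fun_eq_iff F1_def F2_def)
 moreover have "sob_le (- 9/10) F2 (dy m (- 9/20)*S)"
 proof (rule sob_le_mult[where r = "9/10" and f = F])
  show "sob_le (- 9/10 + 9/10) F S" using F by simp
  fix k
  show "norm (F2 k) \<le> dy m (- 9/20)*bessel k powr (9/10/2)*norm (F k)"
  proof (cases "k \<in> K")
   case False
   have "1 = dy m (- 9/20)*dy m (9/20)" by (simp only: dy_add) simp
   also have "dy m (9/20) = (2 powr m) powr (9/20)" by (simp add: powr_powr)
   also have "dy m (- 9/20)*(2 powr m) powr (9/20) \<le> dy m (- 9/20)*bessel k powr (9/20)"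
    using False by (intro mult_left_mono powr_mono2) (simp_all add: K_def)
   finally have "1*norm (F k) \<le> dy m (- 9/20)*bessel k powr (9/20)*norm (F k)" by (rule mult_right_mono) simp
   thus ?thesis using False by (simp add: F2_def)
  qed (simp add: F2_def)
 qed simp
 moreover have "sob_le (- 9/10) F1 (3*c*(dy m (- 9/20)*S))" unfolding sob_le_def
 proof (intro allI impI)
  fix G :: "(int \<times> int) set" assume G: "finite G"
  define t where "t = c*2 powr (- real_of_int m)*(2 powr m) powr (1/20)*S"
  have t0: "0 \<le> t" using c S by (simp add: t_def)
  have tb: "bessel k powr (- 9/10/2)*norm (F k) \<le> t" if k: "k \<in> K" for k
  proof -
   have "bessel k powr (- 9/10/2)*norm (F k) \<le> bessel k powr (- 9/10/2)*(c*2 powr (- real_of_int m) * sqrt (bessel k)*S)"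
    by (rule mult_left_mono[OF pt]) simp
   also have "sqrt (bessel k) = bessel k powr (1/2)" by (rule powr_half_sqrt[OF less_imp_le[OF bessel_pos], symmetric])
   also have "bessel k powr (- 9/10/2)*(c*2 powr (- real_of_int m)*bessel k powr (1/2)*S)
    = (c*2 powr (- real_of_int m))*((bessel k powr (- 9/10/2)*bessel k powr (1/2))*S)" by (simp only: mult_ac)
   also have "bessel k powr (- 9/10/2)*bessel k powr (1/2) = bessel k powr (1/20)" by (simp add: powr_add[symmetric])
   also have "(c*2 powr (- real_of_int m))*(bessel k powr (1/20)*S) \<le> (c*2 powr (- real_of_int m))*((2 powr m) powr (1/20)*S)"
    using k c S by (intro mult_left_mono mult_right_mono powr_mono2) (simp_all add: K_def less_imp_le)
   finally show ?thesis by (simp only: t_def mult.assoc)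
  qed
  have "L2_set (\<lambda>k. bessel k powr (- 9/10/2)*norm (F1 k)) G \<le> sqrt (card K)*t"
   by (rule L2_set_le_card[OF G K(1) t0]) (use tb in \<open>simp_all add: F1_def abs_mult\<close>)
  also have "... \<le> (3*(2 powr m) powr (1/2))*t"
  proof (rule mult_right_mono[OF _ t0])
   have "sqrt (card K) \<le> sqrt (9*2 powr m)" using K(2) by simp
   also have "... = 3*(2 powr m) powr (1/2)" by (simp add: real_sqrt_mult powr_half_sqrt)
   finally show "sqrt (card K) \<le> 3*(2 powr m) powr (1/2)" .
  qed
  also have "... = 3*c*(((2 powr m) powr (1/2)*2 powr (- real_of_int m)*(2 powr m) powr (1/20))*S)" by (simp add: t_def mult_ac)
  also have "(2 powr m) powr (1/2)*2 powr (- real_of_int m)*(2 powr m) powr (1/20) = dy m (- 9/20)"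
   unfolding powr_powr powr_add[symmetric] by (rule arg_cong[where f = "\<lambda>x. 2 powr x"]) simp
  finally show "L2_set (\<lambda>k. bessel k powr (- 9/10/2)*norm (F1 k)) G \<le> 3*c*(dy m (- 9/20)*S)" .
 qed
 ultimately have "sob_le (- 9/10) F (3*c*(dy m (- 9/20)*S) + dy m (- 9/20)*S)" using sob_le_add by blast
 thus ?thesis by (rule sob_le_mono) (simp add: algebra_simps)
qed

lemma sob_le_pos:
 assumes F: "sob_le 0 F S" and s: "0 \<le> s" and D: "0 < D"
  and supp: "\<And>k. F k \<noteq> 0 ==> bessel k \<le> D*4 powr (real_of_int m)"
 shows "sob_le s F (D powr (s/2)*(dy m s*S))"
proof -
 have "sob_le s F ((D powr (s/2)*dy m s)*S)"
 proof (rule sob_le_mult[where r = "- s" and f = F])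
  show "sob_le (s + - s) F S" using F by simp
  fix k
  show "norm (F k) \<le> D powr (s/2)*dy m s*bessel k powr (- s/2)*norm (F k)"
  proof (cases "F k = 0")
   case False
   have "bessel k powr (s/2) \<le> (D*dy m 2) powr (s/2)" using supp[OF False] s by (intro powr_mono2) (simp_all add: four_powr_dy less_imp_le)
   also have "... = D powr (s/2)*dy m s" using D by (simp add: powr_mult dy_powr)
   finally have "bessel k powr (s/2)*bessel k powr (- s/2) \<le> D powr (s/2)*dy m s*bessel k powr (- s/2)" by (rule mult_right_mono) simp
   moreover have "bessel k powr (s/2)*bessel k powr (- s/2) = 1" by (simp add: powr_add[symmetric])
   ultimately have "1 \<le> D powr (s/2)*dy m s*bessel k powr (- s/2)" by (simp only:)
   hence "1*norm (F k) \<le> D powr (s/2)*dy m s*bessel k powr (- s/2)*norm (F k)" by (rule mult_right_mono) simp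
   thus ?thesis by simp
  qed simp
 qed simp
 thus ?thesis by (simp only: mult.assoc)
qed

text \<open>The weight j + 2 dominates the number of inner indices of a paraproduct at level
  \<open>j\<close> and is at least 1 from j = -1 on, so the same constant serves series with and
  without an inner sum.\<close>

definition gsum :: "real \<Rightarrow> real" where
 "gsum t = (\<Sum>\<^sub>\<infinity>j\<in>{-1..}. (real_of_int j + 2)*dy j (- t))"

lemma gsum:
 assumes t: "0 < t"
 shows "(\<lambda>j. (real_of_int j + 2)*dy j (- t)) summable_on {-1..}" "0 \<le> gsum t"
proof -
 let ?h = "\<lambda>n::nat. int n - 1"
 have "bij_betw ?h UNIV {-1..}" by (rule bij_betwI[where g = "\<lambda>j. nat (j + 1)"]) auto
 hence eq: "(\<lambda>j. (real_of_int j + 2)*dy j (- t)) summable_on {-1..}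
   \<longleftrightarrow> (\<lambda>n. (real_of_int (?h n) + 2)*dy (?h n) (- t)) summable_on UNIV" by (rule summable_on_reindex_bij_betw[symmetric])
 let ?z = "2 powr (- t)"
 have z: "norm ?z < 1" using powr_less_mono[of "- t" 0 "2 :: real"] t by simp
 have "(real_of_int (?h n) + 2)*dy (?h n) (- t) = 2 powr t*(real (Suc n)*?z^n)" for n
 proof -
  have "?z powr real n = ?z^n" by (rule powr_realpow) simp
  hence e1: "?z^n = 2 powr (- t*real n)" by (simp only: powr_powr)
  have "real_of_int (?h n)*(- t) = t + (- t*real n)" by (simp add: algebra_simps)
  hence e2: "dy (?h n) (- t) = 2 powr t*?z^n" unfolding e1 by (simp only: powr_add)
  have e3: "real_of_int (?h n) + 2 = real (Suc n)" by simp
  show ?thesis unfolding e2 e3 by (simp only: mult_ac)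
 qed
 moreover have "summable (\<lambda>n. 2 powr t*(real (Suc n)*?z^n))" by (rule summable_mult) (rule sums_summable[OF geometric_deriv_sums[OF z]])
 ultimately have "summable (\<lambda>n. (real_of_int (?h n) + 2)*dy (?h n) (- t))" by (simp only:)
 hence "(\<lambda>n. (real_of_int (?h n) + 2)*dy (?h n) (- t)) summable_on UNIV" by (subst summable_on_UNIV_nonneg_real_iff) simp_all
 thus "(\<lambda>j. (real_of_int j + 2)*dy j (- t)) summable_on {-1..}" unfolding eq .
 show "0 \<le> gsum t" unfolding gsum_def by (rule infsum_nonneg) simp
qed

context lp_blocks begin

lemma pair_sob_pos:
 assumes "sob_le 0 (pair f g i j) S" and "0 \<le> s" and ij: "-1 \<le> i" "-1 \<le> j"
 shows "sob_le s (pair f g i j) ((4*bmax) powr (s/2)*(dy (max i j) s*S))"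
 by (rule sob_le_pos[OF assms(1,2) _ pair_support[OF ij]]) (use bmax_ge_1 in simp, assumption)

lemma pair_sob_neg:
 assumes f: "lo s A f" and g: "hi b B g" and ij: "-1 \<le> i" "-1 \<le> j" "2 \<le> \<bar>i - j\<bar>"
 shows "sob_le (- 9/10) (pair f g i j) ((1 + 3*cpt)*(dy (max i j) (- 9/20)*(A*B*(dy i (- s)*dy j (- b)))))"
 by (rule sob_le_neg[OF pair_L2[OF f g ij(1,2)] cpt_nonneg])
  (use ij pair_pointwise[OF f g ij] in simp_all)

definition para_block :: "tdist \<Rightarrow> tdist \<Rightarrow> int \<Rightarrow> tdist" where
 "para_block f g j = (\<lambda>k. \<Sum>i\<in>{-1..j - 2}. pair f g i j k)"

definition reso_block :: "tdist \<Rightarrow> tdist \<Rightarrow> int \<Rightarrow> tdist" where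
 "reso_block f g j = (\<lambda>k. \<Sum>i\<in>{i. i \<ge> -1 \<and> \<bar>i - j\<bar> \<le> 1}. pair f g i j k)"

lemma para_para_block: "para P f g k = (\<Sum>\<^sub>\<infinity>j\<in>{-1..}. para_block f g j k)" by (simp add: para_def para_block_def)

lemma reso_reso_block: "reso P f g k = (\<Sum>\<^sub>\<infinity>j\<in>{-1..}. reso_block f g j k)" by (simp add: reso_def reso_block_def)

text \<open>\<open>infsum\<close> of a family that is not summable is 0, so additivity of
  \<open>para\<close> and \<open>reso\<close> has to be backed by convergence. These predicates
  carry that information.\<close>

definition psum :: "tdist \<Rightarrow> tdist \<Rightarrow> bool" where
 "psum f g \<longleftrightarrow> (\<forall>k. (\<lambda>j. norm (para_block f g j k)) summable_on {-1..})"

definition rsum :: "tdist \<Rightarrow> tdist \<Rightarrow> bool" where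
 "rsum f g \<longleftrightarrow> (\<forall>k. (\<lambda>j. norm (reso_block f g j k)) summable_on {-1..})"

lemma dy_le_low:
 assumes "-1 \<le> i" "i \<le> j" shows "dy i (- a) \<le> 2 powr \<bar>a\<bar>*dy j (max 0 (- a))"
proof (cases "0 \<le> a")
 case True
 have "(-1)*a \<le> real_of_int i*a" using assms True by (intro mult_right_mono) simp_all
 hence "dy i (- a) \<le> 2 powr a" by simp
 thus ?thesis using True by simp
next
 case False
 have "real_of_int i*(- a) \<le> real_of_int j*(- a)" using assms False by (intro mult_right_mono) simp_all
 hence "dy i (- a) \<le> 1*dy j (- a)" by simp
 also have "... \<le> 2 powr \<bar>a\<bar>*dy j (- a)" by (intro mult_right_mono ge_one_powr_ge_zero) simp_all
 finally show ?thesis using False by simp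
qed

text \<open>Summing the low-frequency factor costs the number of its terms and, for negative
  \<open>a\<close>, a factor \<open>dy j (- a)\<close>. The decay rate left over is
  \<open>b - max 0 (- a)\<close>, which is at least \<open>t\<close>, and \<open>gsum t\<close>
  absorbs the count.\<close>

lemma para_sum:
 assumes le: "\<And>i j. -1 \<le> i ==> i \<le> j - 2 ==> sob_le s (pair f g i j) (K*(dy i (- a)*dy j (- b)))"
  and K: "0 \<le> K" and t: "0 < t" "t \<le> b" "t \<le> a + b"
 shows "psum f g" "sob_le s (para P f g) (2 powr \<bar>a\<bar>*gsum t*K*2 powr (b - t + max 0 (- a)))"
proof -
 let ?u = "b - max 0 (- a)"
 have tu: "t \<le> ?u" using t by (simp add: max_def)
 let ?c = "2 powr (?u - t)"
 have blk: "sob_le s (para_block f g j) (2 powr \<bar>a\<bar>*K*?c*((real_of_int j + 2)*dy j (- t)))" if j: "-1 \<le> j" for j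
 proof -
  have S: "sob_le s (para_block f g j) (\<Sum>i\<in>{-1..j - 2}. K*(dy i (- a)*dy j (- b)))" unfolding para_block_def by (rule sob_le_sum) (use le in simp_all)
  have "(\<Sum>i\<in>{-1..j - 2}. K*(dy i (- a)*dy j (- b))) \<le> (\<Sum>i\<in>{-1..j - 2}. K*((2 powr \<bar>a\<bar>*dy j (max 0 (- a)))*dy j (- b)))"
   by (intro sum_mono mult_left_mono mult_right_mono dy_le_low K) simp_all
  also have "... = real (card {-1..j - 2})*(K*((2 powr \<bar>a\<bar>*dy j (max 0 (- a)))*dy j (- b)))" by simp
  also have "... \<le> (real_of_int j + 2)*(K*((2 powr \<bar>a\<bar>*dy j (max 0 (- a)))*dy j (- b)))" using j K by (intro mult_right_mono) simp_all
  also have "... = 2 powr \<bar>a\<bar>*K*((real_of_int j + 2)*(dy j (max 0 (- a))*dy j (- b)))" by (simp only: mult_ac)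
  also have "dy j (max 0 (- a))*dy j (- b) = dy j (- ?u)" by (simp only: dy_add) simp
  also have "2 powr \<bar>a\<bar>*K*((real_of_int j + 2)*dy j (- ?u)) \<le> 2 powr \<bar>a\<bar>*K*((real_of_int j + 2)*(?c*dy j (- t)))"
   using K j by (intro mult_left_mono dy_index_le tu) simp_all
  also have "... = 2 powr \<bar>a\<bar>*K*?c*((real_of_int j + 2)*dy j (- t))" by (simp only: mult_ac)
  finally show ?thesis by (rule sob_le_mono[OF S])
 qed
 have sm: "(\<lambda>j. 2 powr \<bar>a\<bar>*K*?c*((real_of_int j + 2)*dy j (- t))) summable_on {-1..}"
  by (rule summable_on_cmult_right) (rule gsum(1)[OF t(1)])
 have blk': "\<And>j. j \<in> {-1..} ==> sob_le s (para_block f g j) (2 powr \<bar>a\<bar>*K*?c*((real_of_int j + 2)*dy j (- t)))" using blk by simp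
 show "psum f g" unfolding psum_def using sob_le_infsum(1)[OF blk' sm] by simp
 have "sob_le s (para P f g) (\<Sum>\<^sub>\<infinity>j\<in>{-1..}. 2 powr \<bar>a\<bar>*K*?c*((real_of_int j + 2)*dy j (- t)))"
  using sob_le_infsum(2)[OF blk' sm] unfolding para_para_block[symmetric] by simp
 also have "(\<Sum>\<^sub>\<infinity>j\<in>{-1..}. 2 powr \<bar>a\<bar>*K*?c*((real_of_int j + 2)*dy j (- t))) = 2 powr \<bar>a\<bar>*K*?c*gsum t"
  unfolding gsum_def by (rule infsum_cmult_right')
 finally have *: "sob_le s (para P f g) (2 powr \<bar>a\<bar>*K*?c*gsum t)" .
 have "2 powr \<bar>a\<bar>*K*?c*gsum t \<le> 2 powr \<bar>a\<bar>*K*2 powr (b - t + max 0 (- a))*gsum t"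
  using K gsum(2)[OF t(1)] by (intro mult_right_mono mult_left_mono) simp_all
 thus "sob_le s (para P f g) (2 powr \<bar>a\<bar>*gsum t*K*2 powr (b - t + max 0 (- a)))" by (intro sob_le_mono[OF *]) (simp only: mult_ac)
qed

text \<open>Neighbouring indices make \<open>dy i (- a)\<close> and \<open>dy j (- a)\<close>
  comparable up to \<open>2 powr \<bar>a\<bar>\<close>, so only the sum of the two orders
  matters.\<close>

lemma reso_sum:
 assumes le: "\<And>i j. -1 \<le> i ==> -1 \<le> j ==> sob_le 0 (pair f g i j) (K*(dy i (- a)*dy j (- b)))"
  and K: "0 \<le> K" and t: "0 < a + b"
 shows "rsum f g" "sob_le 0 (reso P f g) (3*2 powr \<bar>a\<bar>*gsum (a + b)*K)"
proof -
 have blk: "sob_le 0 (reso_block f g j) (3*2 powr \<bar>a\<bar>*K*((real_of_int j + 2)*dy j (- (a + b))))" if j: "-1 \<le> j" for j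
 proof -
  let ?I = "{i. i \<ge> -1 \<and> \<bar>i - j\<bar> \<le> 1}"
  have sub: "?I \<subseteq> {j - 1..j + 1}" by auto
  have fin: "finite ?I" by (rule finite_subset[OF sub]) simp
  have "card ?I \<le> card {j - 1..j + 1}" by (rule card_mono[OF _ sub]) simp
  hence card: "card ?I \<le> 3" by simp
  have S: "sob_le 0 (reso_block f g j) (\<Sum>i\<in>?I. K*(dy i (- a)*dy j (- b)))" unfolding reso_block_def by (rule sob_le_sum[OF fin]) (use le j in simp_all)
  have "(\<Sum>i\<in>?I. K*(dy i (- a)*dy j (- b))) \<le> (\<Sum>i\<in>?I. K*((2 powr \<bar>a\<bar>*dy j (- a))*dy j (- b)))"
  proof (intro sum_mono mult_left_mono mult_right_mono K)
   fix i assume i: "i \<in> ?I"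
   have "\<bar>i - j\<bar> \<le> 1" using i by simp
   hence "\<bar>real_of_int j - real_of_int i\<bar> \<le> 1" by linarith
   hence "\<bar>(real_of_int j - real_of_int i)*a\<bar> \<le> 1*\<bar>a\<bar>" unfolding abs_mult by (rule mult_right_mono) simp
   hence "real_of_int i*(- a) \<le> \<bar>a\<bar> + real_of_int j*(- a)" by (simp add: algebra_simps abs_le_iff)
   thus "dy i (- a) \<le> 2 powr \<bar>a\<bar>*dy j (- a)" by (simp only: powr_add[symmetric] powr_le_cancel_iff)
  qed simp_all
  also have "... = real (card ?I)*(K*((2 powr \<bar>a\<bar>*dy j (- a))*dy j (- b)))" by simp
  also have "... \<le> (3*(real_of_int j + 2))*(K*((2 powr \<bar>a\<bar>*dy j (- a))*dy j (- b)))" using card j K by (intro mult_right_mono) simp_all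
  also have "... = 3*2 powr \<bar>a\<bar>*K*((real_of_int j + 2)*(dy j (- a)*dy j (- b)))" by (simp only: mult_ac)
  also have "dy j (- a)*dy j (- b) = dy j (- (a + b))" by (simp only: dy_add) simp
  finally show ?thesis by (rule sob_le_mono[OF S])
 qed
 have sm: "(\<lambda>j. 3*2 powr \<bar>a\<bar>*K*((real_of_int j + 2)*dy j (- (a + b)))) summable_on {-1..}"
  by (rule summable_on_cmult_right) (rule gsum(1)[OF t])
 have blk': "\<And>j. j \<in> {-1..} ==> sob_le 0 (reso_block f g j) (3*2 powr \<bar>a\<bar>*K*((real_of_int j + 2)*dy j (- (a + b))))" using blk by simp
 show "rsum f g" unfolding rsum_def using sob_le_infsum(1)[OF blk' sm] by simp
 have "sob_le 0 (reso P f g) (\<Sum>\<^sub>\<infinity>j\<in>{-1..}. 3*2 powr \<bar>a\<bar>*K*((real_of_int j + 2)*dy j (- (a + b))))"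
  using sob_le_infsum(2)[OF blk' sm] unfolding reso_reso_block[symmetric] by simp
 also have "(\<Sum>\<^sub>\<infinity>j\<in>{-1..}. 3*2 powr \<bar>a\<bar>*K*((real_of_int j + 2)*dy j (- (a + b)))) = 3*2 powr \<bar>a\<bar>*K*gsum (a + b)"
  unfolding gsum_def by (rule infsum_cmult_right')
 finally show "sob_le 0 (reso P f g) (3*2 powr \<bar>a\<bar>*gsum (a + b)*K)" by (simp only: mult_ac)
qed

end

section \<open>Additivity and mapping properties of paraproducts and resonant products\<close>

lemma tmul_diff_left_fsupp:
 assumes "fsupp f" "fsupp f'" shows "tmul (f - f') g = tmul f g - tmul f' g"
proof
 fix k
 let ?A = "{k. f k \<noteq> 0} \<union> {k. f' k \<noteq> 0}"
 have A: "finite ?A" using assms by (simp add: fsupp_def)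
 have "tmul (f - f') g k = (\<Sum>l\<in>?A. (f - f') l*g (k - l))" by (rule tmul_finite[OF A]) simp
 also have "... = (\<Sum>l\<in>?A. f l*g (k - l)) - (\<Sum>l\<in>?A. f' l*g (k - l))" by (simp add: left_diff_distrib sum_subtractf)
 also have "(\<Sum>l\<in>?A. f l*g (k - l)) = tmul f g k" by (rule tmul_finite[OF A, symmetric]) simp
 also have "(\<Sum>l\<in>?A. f' l*g (k - l)) = tmul f' g k" by (rule tmul_finite[OF A, symmetric]) simp
 finally show "tmul (f - f') g k = (tmul f g - tmul f' g) k" unfolding fun_diff_def .
qed

context lp_blocks begin

lemma pair_diff_left: "-1 \<le> i ==> pair (f - f') g i j = pair f g i j - pair f' g i j"
 unfolding block_diff by (rule tmul_diff_left_fsupp) (rule fsupp_block; assumption)+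

lemma pair_diff_right: "-1 \<le> j ==> pair f (g - g') i j = pair f g i j - pair f g' i j" by (subst (1 2 3) pair_commute) (rule pair_diff_left)

lemma para_block_diff_left: "para_block (f - f') g j = para_block f g j - para_block f' g j"
 by (simp add: para_block_def fun_eq_iff pair_diff_left sum_subtractf)

lemma para_block_diff_right: "-1 \<le> j ==> para_block f (g - g') j = para_block f g j - para_block f g' j"
 by (simp add: para_block_def fun_eq_iff pair_diff_right sum_subtractf)

lemma reso_block_diff_left: "reso_block (f - f') g j = reso_block f g j - reso_block f' g j"
 by (simp add: reso_block_def fun_eq_iff pair_diff_left sum_subtractf)

lemma reso_block_diff_right: "-1 \<le> j ==> reso_block f (g - g') j = reso_block f g j - reso_block f g' j"
 by (simp add: reso_block_def fun_eq_iff pair_diff_right sum_subtractf)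

lemma norm_summable_diff:
 fixes f g :: "'i \<Rightarrow> complex"
 assumes "(\<lambda>j. norm (f j)) summable_on I" "(\<lambda>j. norm (g j)) summable_on I" "\<And>j. j \<in> I ==> h j = f j - g j"
 shows "(\<lambda>j. norm (h j)) summable_on I" "(\<Sum>\<^sub>\<infinity>j\<in>I. h j) = (\<Sum>\<^sub>\<infinity>j\<in>I. f j) - (\<Sum>\<^sub>\<infinity>j\<in>I. g j)"
proof -
 show "(\<lambda>j. norm (h j)) summable_on I"
 proof (rule summable_on_comparison_test[OF summable_on_add[OF assms(1,2)]])
  show "norm (h j) \<le> norm (f j) + norm (g j)" if "j \<in> I" for j unfolding assms(3)[OF that] by (rule norm_triangle_ineq4)
 qed simp
 have "(\<Sum>\<^sub>\<infinity>j\<in>I. h j) = (\<Sum>\<^sub>\<infinity>j\<in>I. f j - g j)" by (rule infsum_cong) (rule assms(3))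
 also have "... = (\<Sum>\<^sub>\<infinity>j\<in>I. f j) - (\<Sum>\<^sub>\<infinity>j\<in>I. g j)"
 proof -
  have "((\<lambda>j. f j + - g j) has_sum (infsum f I + - infsum g I)) I" using abs_summable_summable[OF assms(1)] abs_summable_summable[OF assms(2)]
   by (intro has_sum_add) (simp_all add: has_sum_uminus)
  thus ?thesis by (simp add: infsumI)
 qed
 finally show "(\<Sum>\<^sub>\<infinity>j\<in>I. h j) = (\<Sum>\<^sub>\<infinity>j\<in>I. f j) - (\<Sum>\<^sub>\<infinity>j\<in>I. g j)" .
qed

lemma psumD: "psum f g ==> (\<lambda>j. norm (para_block f g j k)) summable_on {-1..}" unfolding psum_def by (rule spec)

lemma rsumD: "rsum f g ==> (\<lambda>j. norm (reso_block f g j k)) summable_on {-1..}" unfolding rsum_def by (rule spec)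

lemma para_diff_left:
 assumes "psum f g" "psum f' g"
 shows "psum (f - f') g" "para P (f - f') g = para P f g - para P f' g"
proof -
 note d = norm_summable_diff[OF psumD[OF assms(1)] psumD[OF assms(2)], where h = "\<lambda>j. para_block (f - f') g j k" for k]
 show "psum (f - f') g" unfolding psum_def using d(1) by (simp add: para_block_diff_left)
 show "para P (f - f') g = para P f g - para P f' g" using d(2) by (simp add: para_block_diff_left para_para_block fun_eq_iff)
qed

lemma para_diff_right:
 assumes "psum f g" "psum f g'"
 shows "psum f (g - g')" "para P f (g - g') = para P f g - para P f g'"
proof -
 note d = norm_summable_diff[OF psumD[OF assms(1)] psumD[OF assms(2)], where h = "\<lambda>j. para_block f (g - g') j k" for k]
 show "psum f (g - g')" unfolding psum_def using d(1) by (simp add: para_block_diff_right)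
 show "para P f (g - g') = para P f g - para P f g'" using d(2) by (simp add: para_block_diff_right para_para_block fun_eq_iff)
qed

lemma reso_diff_left:
 assumes "rsum f g" "rsum f' g"
 shows "rsum (f - f') g" "reso P (f - f') g = reso P f g - reso P f' g"
proof -
 note d = norm_summable_diff[OF rsumD[OF assms(1)] rsumD[OF assms(2)], where h = "\<lambda>j. reso_block (f - f') g j k" for k]
 show "rsum (f - f') g" unfolding rsum_def using d(1) by (simp add: reso_block_diff_left)
 show "reso P (f - f') g = reso P f g - reso P f' g" using d(2) by (simp add: reso_block_diff_left reso_reso_block fun_eq_iff)
qed

lemma reso_diff_right:
 assumes "rsum f g" "rsum f g'"
 shows "rsum f (g - g')" "reso P f (g - g') = reso P f g - reso P f g'"
proof -
 note d = norm_summable_diff[OF rsumD[OF assms(1)] rsumD[OF assms(2)], where h = "\<lambda>j. reso_block f (g - g') j k" for k]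
 show "rsum f (g - g')" unfolding rsum_def using d(1) by (simp add: reso_block_diff_right)
 show "reso P f (g - g') = reso P f g - reso P f g'" using d(2) by (simp add: reso_block_diff_right reso_reso_block fun_eq_iff)
qed

definition pcon :: "real \<Rightarrow> real \<Rightarrow> real" where
 "pcon a b = 2 powr \<bar>a\<bar>*gsum (min b (a + b))*2 powr (b - min b (a + b) + max 0 (- a))"

lemma pcon_nonneg: "0 < b ==> 0 < a + b ==> 0 \<le> pcon a b" unfolding pcon_def by (intro mult_nonneg_nonneg gsum(2)) simp_all

lemma para_sum':
 assumes "\<And>i j. -1 \<le> i ==> i \<le> j - 2 ==> sob_le s (pair f g i j) (K*(dy i (- a)*dy j (- b)))"
  and "0 \<le> K" "0 < b" "0 < a + b"
 shows "psum f g" "sob_le s (para P f g) (pcon a b*K)"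
proof -
 show "psum f g" by (rule para_sum(1)[OF assms(1,2), where t = "min b (a + b)"]) (use assms in simp_all)
 have "sob_le s (para P f g) (2 powr \<bar>a\<bar>*gsum (min b (a + b))*K*2 powr (b - min b (a + b) + max 0 (- a)))"
  by (rule para_sum(2)[OF assms(1,2)]) (use assms in simp_all)
 thus "sob_le s (para P f g) (pcon a b*K)" by (simp only: pcon_def mult_ac)
qed

lemma para_lo_hi_pos:
 assumes f: "lo s A f" and g: "hi b B g" and r: "0 \<le> r" and t: "r < b" "r < s + b"
 shows "psum f g" "sob_le r (para P f g) (pcon s (b - r)*((4*bmax) powr (r/2)*(A*B)))"
proof -
 have AB: "0 \<le> A" "0 \<le> B" using lo_nonneg[OF f] hi_nonneg[OF g] by simp_all
 have K: "0 \<le> (4*bmax) powr (r/2)*(A*B)" using AB by simp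
 have "sob_le r (pair f g i j) ((4*bmax) powr (r/2)*(A*B)*(dy i (- s)*dy j (- (b - r))))"
  if ij: "-1 \<le> i" "i \<le> j - 2" for i j
 proof -
  have "sob_le r (pair f g i j) ((4*bmax) powr (r/2)*(dy (max i j) r*(A*B*(dy i (- s)*dy j (- b)))))"
   by (rule pair_sob_pos[OF pair_L2[OF f g] r]) (use ij in simp_all)
  moreover have "max i j = j" using ij by simp
  moreover have "(4*bmax) powr (r/2)*(dy j r*(A*B*(dy i (- s)*dy j (- b))))
   = (4*bmax) powr (r/2)*(A*B)*(dy i (- s)*(dy j r*dy j (- b)))" by (simp only: mult_ac)
  moreover have "dy j r*dy j (- b) = dy j (- (b - r))" by (simp only: dy_add) simp
  ultimately show ?thesis by (simp only:)
 qed
 from para_sum'[OF this K] show "psum f g" "sob_le r (para P f g) (pcon s (b - r)*((4*bmax) powr (r/2)*(A*B)))" using t by simp_all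
qed

lemma para_lo_hi_neg:
 assumes f: "lo s A f" and g: "hi b B g" and t: "- 9/20 < b" "- 9/20 < s + b"
 shows "psum f g" "sob_le (- 9/10) (para P f g) (pcon s (b + 9/20)*((1 + 3*cpt)*(A*B)))"
proof -
 have AB: "0 \<le> A" "0 \<le> B" using lo_nonneg[OF f] hi_nonneg[OF g] by simp_all
 have K: "0 \<le> (1 + 3*cpt)*(A*B)" using AB cpt_nonneg by simp
 have "sob_le (- 9/10) (pair f g i j) ((1 + 3*cpt)*(A*B)*(dy i (- s)*dy j (- (b + 9/20))))"
  if ij: "-1 \<le> i" "i \<le> j - 2" for i j
 proof -
  have "sob_le (- 9/10) (pair f g i j) ((1 + 3*cpt)*(dy (max i j) (- 9/20)*(A*B*(dy i (- s)*dy j (- b)))))" by (rule pair_sob_neg[OF f g]) (use ij in simp_all)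
  moreover have "max i j = j" using ij by simp
  moreover have "(1 + 3*cpt)*(dy j (- 9/20)*(A*B*(dy i (- s)*dy j (- b))))
   = (1 + 3*cpt)*(A*B)*(dy i (- s)*(dy j (- b)*dy j (- 9/20)))" by (simp only: mult_ac)
  moreover have "dy j (- b)*dy j (- 9/20) = dy j (- (b + 9/20))" by (simp only: dy_add) simp
  ultimately show ?thesis by (simp only:)
 qed
 from para_sum'[OF this K] show "psum f g" "sob_le (- 9/10) (para P f g) (pcon s (b + 9/20)*((1 + 3*cpt)*(A*B)))" using t by simp_all
qed

lemma para_hi_lo_neg:
 assumes f: "hi b B f" and g: "lo s A g" and t: "- 9/20 < s" "- 9/20 < s + b"
 shows "psum f g" "sob_le (- 9/10) (para P f g) (pcon b (s + 9/20)*((1 + 3*cpt)*(A*B)))"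
proof -
 have AB: "0 \<le> A" "0 \<le> B" using lo_nonneg[OF g] hi_nonneg[OF f] by simp_all
 have K: "0 \<le> (1 + 3*cpt)*(A*B)" using AB cpt_nonneg by simp
 have "sob_le (- 9/10) (pair f g i j) ((1 + 3*cpt)*(A*B)*(dy i (- b)*dy j (- (s + 9/20))))"
  if ij: "-1 \<le> i" "i \<le> j - 2" for i j
 proof -
  have "sob_le (- 9/10) (pair g f j i) ((1 + 3*cpt)*(dy (max j i) (- 9/20)*(A*B*(dy j (- s)*dy i (- b)))))" by (rule pair_sob_neg[OF g f]) (use ij in simp_all)
  moreover have "max j i = j" using ij by simp
  moreover have "(1 + 3*cpt)*(dy j (- 9/20)*(A*B*(dy j (- s)*dy i (- b))))
   = (1 + 3*cpt)*(A*B)*(dy i (- b)*(dy j (- s)*dy j (- 9/20)))" by (simp only: mult_ac)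
  moreover have "dy j (- s)*dy j (- 9/20) = dy j (- (s + 9/20))" by (simp only: dy_add) simp
  ultimately show ?thesis by (simp only: pair_commute[where f = f and g = g])
 qed
 from para_sum'[OF this K] show "psum f g" "sob_le (- 9/10) (para P f g) (pcon b (s + 9/20)*((1 + 3*cpt)*(A*B)))" using t by (simp_all add: add.commute)
qed

lemma para_hi_lo_0:
 assumes f: "hi b B f" and g: "lo s A g" and t: "0 < s" "0 < s + b"
 shows "psum f g" "sob_le 0 (para P f g) (pcon b s*(A*B))"
proof -
 have AB: "0 \<le> A*B" using lo_nonneg[OF g] hi_nonneg[OF f] by simp
 have "sob_le 0 (pair f g i j) (A*B*(dy i (- b)*dy j (- s)))"
  if ij: "-1 \<le> i" "i \<le> j - 2" for i j using pair_L2[OF g f, of j i] ij by (simp add: pair_commute[where f = f and g = g] mult_ac)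
 from para_sum'[OF this AB] show "psum f g" "sob_le 0 (para P f g) (pcon b s*(A*B))" using t by (simp_all add: add.commute)
qed

lemma reso_lo_hi:
 assumes f: "lo s A f" and g: "hi b B g" and t: "0 < s + b"
 shows "rsum f g" "sob_le 0 (reso P f g) (3*2 powr \<bar>s\<bar>*gsum (s + b)*(A*B))"
proof -
 have AB: "0 \<le> A*B" using lo_nonneg[OF f] hi_nonneg[OF g] by simp
 show "rsum f g" "sob_le 0 (reso P f g) (3*2 powr \<bar>s\<bar>*gsum (s + b)*(A*B))"
  by (rule reso_sum[OF _ AB t], rule pair_L2[OF f g], assumption, assumption)+
qed

text \<open>Bernstein's inequality in two dimensions: a block has of the order of 4^j frequencies,
  so Cauchy-Schwarz costs 2^j, that is, one derivative.\<close>

lemma lo_block_sup: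
 assumes f: "lo s A f" and j: "-1 \<le> j"
 shows "tsup (block P j f) (3 * sqrt bmax*A*dy j (- (s - 1)))"
proof -
 have A: "0 \<le> A*dy j (- s)" using lo_nonneg[OF f] by simp
 have S: "tsup (block P j f) (\<Sum>k\<in>supp j. norm (block P j f k))" by (rule tsup_l1[OF finite_supp[OF j] block_outside])
 have "(\<Sum>k\<in>supp j. norm (block P j f k)) \<le> sqrt (card (supp j))*(A*dy j (- s))" by (rule sum_norm_le_L2[OF finite_supp[OF j] lo_block[OF f j]])
 also have "... \<le> sqrt (9*(bmax*4 powr j))*(A*dy j (- s))" using card_supp[OF j] by (intro mult_right_mono[OF _ A]) simp
 also have "sqrt (9*(bmax*4 powr j)) = 3 * sqrt bmax*dy j 1" by (simp add: real_sqrt_mult powr_2_sq[symmetric])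
 also have "3 * sqrt bmax*dy j 1*(A*dy j (- s)) = 3 * sqrt bmax*A*(dy j 1*dy j (- s))" by (simp only: mult_ac)
 also have "dy j 1*dy j (- s) = dy j (- (s - 1))" by (simp only: dy_add) simp
 finally show ?thesis by (rule tsup_mono[OF S])
qed

lemma fsupp_blocks_finite:
 assumes "fsupp g" shows "\<exists>J. \<forall>j>J. block P j g = 0"
proof -
 let ?A = "{k. g k \<noteq> 0}"
 have fin: "finite ?A" using assms by (simp add: fsupp_def)
 define M where "M = (\<Sum>k\<in>?A. bessel k) + 1"
 have M: "bessel k < M" if "k \<in> ?A" for k using member_le_sum[OF that _ fin, of bessel] by (simp add: M_def less_imp_le)
 obtain n where n: "M/bmin < 4^n" using real_arch_pow[of 4 "M/bmin"] by auto
 have "block P j g = 0" if j: "j > int n" for j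
 proof
  fix k
  show "block P j g k = 0 k"
  proof (cases "k \<in> supp j \<and> g k \<noteq> 0")
   case True
   have "4^n \<le> 4 powr real_of_int j" using j powr_mono[of "real n" "real_of_int j" 4] by (simp add: powr_realpow)
   hence "M/bmin < 4 powr j" using n by linarith
   hence "M < bmin*4 powr j" using bmin_pos by (simp add: field_simps)
   also have "... \<le> bessel k" by (rule supp_bessel_ge) (use j True in simp_all)
   finally show ?thesis using M[of k] True by simp
  next
   case False
   thus ?thesis by (auto simp: block_sym supp_def)
  qed
 qed
 thus ?thesis by blast
qed

lemma para_fsupp_right:
 assumes "fsupp g"
 shows "\<exists>J. \<forall>f k. para P f g k = (\<Sum>j\<in>{-1..J}. para_block f g j k)"
proof -
 obtain J where J: "\<And>j. j > J ==> block P j g = 0" using fsupp_blocks_finite[OF assms] by blast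
 have "para P f g k = (\<Sum>j\<in>{-1..J}. para_block f g j k)" for f k
 proof -
  have "para P f g k = (\<Sum>\<^sub>\<infinity>j\<in>{-1..J}. para_block f g j k)" unfolding para_para_block
  proof (rule infsum_cong_neutral)
   fix j assume "j \<in> {-1..} - {-1..J}"
   hence "block P j g = 0" by (intro J) auto
   thus "para_block f g j k = 0" by (simp add: para_block_def tmul_def)
  qed auto
  thus ?thesis by simp
 qed
 thus ?thesis by blast
qed

lemma fsupp_sum: "finite I ==> (\<And>i. i \<in> I ==> fsupp (F i)) ==> fsupp (\<lambda>k. \<Sum>i\<in>I. F i k)"
proof -
 assume I: "finite I" and F: "\<And>i. i \<in> I ==> fsupp (F i)"
 show "fsupp (\<lambda>k. \<Sum>i\<in>I. F i k)"
 proof (rule fsupp_finite)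
  show "finite (\<Union>i\<in>I. {k. F i k \<noteq> 0})" using I F by (simp add: fsupp_def)
  show "(\<Sum>i\<in>I. F i k) = 0" if "k \<notin> (\<Union>i\<in>I. {k. F i k \<noteq> 0})" for k using that by (intro sum.neutral) simp
 qed
qed

lemma fsupp_pair: "-1 \<le> i ==> -1 \<le> j ==> fsupp (pair f g i j)" by (rule fsupp_tmul) (rule fsupp_block; assumption)+

lemma fsupp_para_block: "-1 \<le> j ==> fsupp (para_block f g j)" unfolding para_block_def by (rule fsupp_sum) (simp_all add: fsupp_pair)

lemma fsupp_para: "fsupp g ==> fsupp (para P f g)"
proof -
 assume "fsupp g"
 then obtain J where "\<And>k. para P f g k = (\<Sum>j\<in>{-1..J}. para_block f g j k)" using para_fsupp_right by blast
 hence "para P f g = (\<lambda>k. \<Sum>j\<in>{-1..J}. para_block f g j k)" by (rule ext)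
 moreover have "fsupp (\<lambda>k. \<Sum>j\<in>{-1..J}. para_block f g j k)" by (rule fsupp_sum) (simp_all add: fsupp_para_block)
 ultimately show ?thesis by simp
qed

lemma tsup_tmul:
 assumes "fsupp f" "tsup f A" "fsupp g" "tsup g B" shows "tsup (tmul f g) (A*B)" unfolding tsup_def trig_tmul[OF assms(1,3)] norm_mult
 by (intro allI mult_mono tsupD assms tsup_nonneg[OF assms(2)]) simp

text \<open>By Bernstein the low-frequency factor has order \<open>s - 1\<close> in the sup norm, so
  the terms are summable once s - 1 + b > 0, even where s < 1 and \<open>f\<close> itself may be
  unbounded. Finite support of \<open>g\<close> makes the paraproduct a finite sum to which
  \<open>tsup\<close> applies.\<close>

lemma para_lo_hi_sup:
 assumes f: "lo s A f" and g: "hi b B g" "fsupp g" and t: "0 < b" "0 < s - 1 + b"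
 shows "tsup (para P f g) (pcon (s - 1) b*(3 * sqrt bmax*A*B))"
proof -
 let ?a = "s - 1" and ?K = "3 * sqrt bmax*A*B"
 let ?t = "min b (?a + b)" and ?u = "b - max 0 (- ?a)"
 let ?c = "2 powr (?u - ?t)"
 have tp: "0 < ?t" and tu: "?t \<le> ?u" using t by (simp_all add: max_def)
 have K: "0 \<le> ?K" using lo_nonneg[OF f] hi_nonneg[OF g(1)] bmax_ge_1 by simp
 obtain J where J: "\<And>k. para P f g k = (\<Sum>j\<in>{-1..J}. para_block f g j k)" using para_fsupp_right[OF g(2)] by blast
 have blk: "tsup (para_block f g j) (2 powr \<bar>?a\<bar>*?K*?c*((real_of_int j + 2)*dy j (- ?t)))" if j: "-1 \<le> j" for j
 proof -
  have "fsupp (para_block f g j) \<and> tsup (para_block f g j) (\<Sum>i\<in>{-1..j - 2}. ?K*(dy i (- ?a)*dy j (- b)))" unfolding para_block_def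
  proof (rule tsup_sum)
   fix i assume i: "i \<in> {-1..j - 2}"
   thus "fsupp (pair f g i j)" using j by (simp add: fsupp_pair)
   have "tsup (pair f g i j) ((3 * sqrt bmax*A*dy i (- ?a))*(B*dy j (- b)))"
    by (rule tsup_tmul[OF fsupp_block lo_block_sup[OF f] fsupp_block hiD[OF g(1)]]) (use i j in simp_all)
   thus "tsup (pair f g i j) (?K*(dy i (- ?a)*dy j (- b)))" by (simp only: mult_ac)
  qed simp
  hence S: "tsup (para_block f g j) (\<Sum>i\<in>{-1..j - 2}. ?K*(dy i (- ?a)*dy j (- b)))" ..
  have "(\<Sum>i\<in>{-1..j - 2}. ?K*(dy i (- ?a)*dy j (- b))) \<le> (\<Sum>i\<in>{-1..j - 2}. ?K*((2 powr \<bar>?a\<bar>*dy j (max 0 (- ?a)))*dy j (- b)))"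
   by (intro sum_mono mult_left_mono mult_right_mono dy_le_low K) simp_all
  also have "... = real (card {-1..j - 2})*(?K*((2 powr \<bar>?a\<bar>*dy j (max 0 (- ?a)))*dy j (- b)))" by simp
  also have "... \<le> (real_of_int j + 2)*(?K*((2 powr \<bar>?a\<bar>*dy j (max 0 (- ?a)))*dy j (- b)))" using j K by (intro mult_right_mono) simp_all
  also have "... = 2 powr \<bar>?a\<bar>*?K*((real_of_int j + 2)*(dy j (max 0 (- ?a))*dy j (- b)))" by (simp only: mult_ac)
  also have "dy j (max 0 (- ?a))*dy j (- b) = dy j (- ?u)" by (simp only: dy_add) simp
  also have "2 powr \<bar>?a\<bar>*?K*((real_of_int j + 2)*dy j (- ?u)) \<le> 2 powr \<bar>?a\<bar>*?K*((real_of_int j + 2)*(?c*dy j (- ?t)))"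
   using K j by (intro mult_left_mono dy_index_le tu) simp_all
  also have "... = 2 powr \<bar>?a\<bar>*?K*?c*((real_of_int j + 2)*dy j (- ?t))" by (simp only: mult_ac)
  finally show ?thesis by (rule tsup_mono[OF S])
 qed
 have "para P f g = (\<lambda>k. \<Sum>j\<in>{-1..J}. para_block f g j k)" using J by (rule ext)
 moreover have "fsupp (\<lambda>k. \<Sum>j\<in>{-1..J}. para_block f g j k) \<and> tsup (\<lambda>k. \<Sum>j\<in>{-1..J}. para_block f g j k)
  (\<Sum>j\<in>{-1..J}. 2 powr \<bar>?a\<bar>*?K*?c*((real_of_int j + 2)*dy j (- ?t)))" by (rule tsup_sum) (use blk fsupp_para_block in simp_all)
 ultimately have S: "tsup (para P f g) (\<Sum>j\<in>{-1..J}. 2 powr \<bar>?a\<bar>*?K*?c*((real_of_int j + 2)*dy j (- ?t)))" by simp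
 have "(\<Sum>j\<in>{-1..J}. (real_of_int j + 2)*dy j (- ?t)) \<le> gsum ?t" unfolding gsum_def by (rule finite_sum_le_infsum[OF gsum(1)[OF tp]]) auto
 hence "(\<Sum>j\<in>{-1..J}. 2 powr \<bar>?a\<bar>*?K*?c*((real_of_int j + 2)*dy j (- ?t))) \<le> 2 powr \<bar>?a\<bar>*?K*?c*gsum ?t"
  unfolding sum_distrib_left[symmetric] using K by (intro mult_left_mono) simp_all
 also have "... \<le> 2 powr \<bar>?a\<bar>*?K*2 powr (b - ?t + max 0 (- ?a))*gsum ?t" using K gsum(2)[OF tp] by (intro mult_right_mono mult_left_mono) simp_all
 also have "... = pcon ?a b*?K" by (simp only: pcon_def mult_ac)
 finally show ?thesis by (rule tsup_mono[OF S])
qed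

end

section \<open>Products of distributions; resolvent and derivatives in Besov spaces\<close>

lemma bessel_peetre: "bessel (k - l) \<le> 2*bessel k*bessel l"
proof -
 let ?a = "norm (freq k)" and ?b = "norm (freq l)"
 have "(norm (freq (k - l)))^2 \<le> (?a + ?b)^2" unfolding freq_diff by (rule power_mono[OF norm_triangle_ineq4]) simp
 also have "... \<le> 2*?a^2 + 2*?b^2" using sum_squares_bound[of ?a ?b] by (simp add: power2_sum)
 finally have "4*pi^2*(norm (freq (k - l)))^2 \<le> 4*pi^2*(2*?a^2 + 2*?b^2)" by (rule mult_left_mono) simp
 hence 1: "4*pi^2*(norm (freq (k - l)))^2 \<le> 2*(4*pi^2*?a^2) + 2*(4*pi^2*?b^2)" by (simp only: distrib_left mult_ac)
 have "1 + z \<le> 2*(1 + x)*(1 + y)" if "z \<le> 2*x + 2*y" "0 \<le> x" "0 \<le> y" for x y z :: real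
 proof -
  have "0 \<le> x*y" using that by simp
  moreover have "2*(1 + x)*(1 + y) = 2 + 2*x + 2*y + 2*(x*y)" by (simp add: algebra_simps)
  ultimately show ?thesis using that by linarith
 qed
 from this[OF 1] show ?thesis unfolding bessel_def by simp
qed

text \<open>Peetre's inequality moves the weight of \<open>v\<close> onto \<open>g\<close> at the
  price of a factor depending on \<open>k\<close> only, and Cauchy-Schwarz does the rest. The bound
  of a single coefficient is what makes multiplication by a fixed \<open>g\<close> a bounded
  functional in \<open>bfun_tmul\<close>.\<close>

lemma product_summable:
 assumes v: "sob_le s v A" and g: "sob_le (- s) g B" and s: "0 \<le> s"
 shows "(\<lambda>l. norm (v l*g (k - l))) summable_on UNIV" "norm (tmul v g k) \<le> (2*bessel k) powr (s/2)*(A*B)"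
proof -
 let ?a = "\<lambda>l. bessel l powr (s/2)*norm (v l)" and ?b = "\<lambda>l. bessel l powr (- s/2)*norm (g l)"
 let ?c = "(2*bessel k) powr (s/2)"
 have pt: "norm (v l*g (k - l)) \<le> ?c*(\<bar>?a l\<bar>*\<bar>?b (k - l)\<bar>)" for l
 proof -
  have "bessel (k - l) powr (s/2) \<le> (2*bessel k*bessel l) powr (s/2)" using s bessel_peetre by (intro powr_mono2) (simp_all add: less_imp_le)
  also have "... = ?c*bessel l powr (s/2)" by (simp add: powr_mult)
  finally have "bessel (k - l) powr (s/2)*(bessel (k - l) powr (- s/2)*(norm (v l)*norm (g (k - l))))
   \<le> ?c*bessel l powr (s/2)*(bessel (k - l) powr (- s/2)*(norm (v l)*norm (g (k - l))))" by (rule mult_right_mono) simp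
  moreover have "bessel (k - l) powr (s/2)*bessel (k - l) powr (- s/2) = 1" by (simp add: powr_add[symmetric])
  hence "bessel (k - l) powr (s/2)*(bessel (k - l) powr (- s/2)*(norm (v l)*norm (g (k - l)))) = norm (v l)*norm (g (k - l))"
   by (simp only: mult.assoc[symmetric] mult_1_left)
  ultimately have "norm (v l)*norm (g (k - l)) \<le> ?c*(?a l*?b (k - l))" by (simp only: mult_ac)
  thus ?thesis by (simp add: norm_mult)
 qed
 have le: "(\<Sum>l\<in>F. norm (v l*g (k - l))) \<le> ?c*(A*B)" if F: "finite F" for F
 proof -
  have inj: "inj_on (\<lambda>l. k - l) F" by (auto intro: inj_onI)
  have "(\<Sum>l\<in>F. norm (v l*g (k - l))) \<le> (\<Sum>l\<in>F. ?c*(\<bar>?a l\<bar>*\<bar>?b (k - l)\<bar>))" by (rule sum_mono[OF pt])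
  also have "... = ?c*(\<Sum>l\<in>F. \<bar>?a l\<bar>*\<bar>?b (k - l)\<bar>)" by (simp only: sum_distrib_left)
  also have "... \<le> ?c*(L2_set ?a F*L2_set (\<lambda>l. ?b (k - l)) F)" by (intro mult_left_mono L2_set_mult_ineq) simp
  also have "L2_set (\<lambda>l. ?b (k - l)) F = L2_set ?b ((\<lambda>l. k - l) ` F)" unfolding L2_set_def sum.reindex[OF inj] by simp
  also have "?c*(L2_set ?a F*L2_set ?b ((\<lambda>l. k - l) ` F)) \<le> ?c*(A*B)"
   using v g F sob_leD_nonneg[OF v] unfolding sob_le_def by (intro mult_left_mono mult_mono) (simp_all add: L2_set_nonneg)
  finally show ?thesis .
 qed
 show sm: "(\<lambda>l. norm (v l*g (k - l))) summable_on UNIV" by (rule nonneg_bdd_above_summable_on) (auto intro!: bdd_aboveI2[where M = "?c*(A*B)"] le)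
 have "norm (tmul v g k) \<le> (\<Sum>\<^sub>\<infinity>l. norm (v l*g (k - l)))" unfolding tmul_def by (rule norm_infsum_bound[OF sm])
 also have "... \<le> ?c*(A*B)" by (rule infsum_le_finite_sums[OF sm]) (rule le)
 finally show "norm (tmul v g k) \<le> ?c*(A*B)" .
qed

context lp_blocks begin

lemma block_has_sum: "((\<lambda>j. block P j f k) has_sum f k) {-1..}"
proof -
 have "((\<lambda>j. of_real (sym j (freq k))*f k) has_sum (of_real 1*f k)) {-1..}" by (rule has_sum_cmult_left) (rule has_sum_of_real[OF sym_has_sum])
 thus ?thesis by (simp add: block_sym)
qed

lemma hi_sob_le:
 assumes g: "hi b B g" and s: "s < b" "s \<le> 0"
 shows "sob_le s g (bmin powr (s/2)*gsum (b - s)*B)"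
proof -
 have B: "0 \<le> B" by (rule hi_nonneg[OF g])
 let ?K = "bmin powr (s/2)*B"
 have le: "sob_le s (block P j g) (?K*((real_of_int j + 2)*dy j (- (b - s))))" if j: "j \<in> {-1..}" for j
 proof -
  have j: "-1 \<le> j" using j by simp
  have "sob_le s (block P j g) ((bmin powr (s/2)*dy j s)*(B*dy j (- b)))"
  proof (rule sob_le_mult[where r = "- s" and f = "block P j g"])
   show "sob_le (s + - s) (block P j g) (B*dy j (- b))" using hi_block[OF g j] by simp
   fix k
   show "norm (block P j g k) \<le> bmin powr (s/2)*dy j s*bessel k powr (- s/2)*norm (block P j g k)"
   proof (cases "k \<in> supp j")
    case True
    have "(bmin*4 powr j) powr (- s/2) \<le> bessel k powr (- s/2)" using s bmin_pos supp_bessel_ge[OF j True] by (intro powr_mono2) simp_all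
    moreover have "(bmin*4 powr j) powr (- s/2) = bmin powr (- s/2)*dy j (- s)" using bmin_pos by (simp add: powr_mult four_powr_dy dy_powr)
    ultimately have "(bmin powr (s/2)*dy j s)*(bmin powr (- s/2)*dy j (- s)) \<le> (bmin powr (s/2)*dy j s)*bessel k powr (- s/2)"
     by (intro mult_left_mono) simp_all
    moreover have "(bmin powr (s/2)*dy j s)*(bmin powr (- s/2)*dy j (- s)) = (bmin powr (s/2)*bmin powr (- s/2))*(dy j (- s)*dy j s)" by (simp only: mult_ac)
    moreover have "bmin powr (s/2)*bmin powr (- s/2) = 1" using bmin_pos by (simp add: powr_add[symmetric])
    ultimately have "1 \<le> (bmin powr (s/2)*dy j s)*bessel k powr (- s/2)" by (simp only: dy_uminus mult_1_left)
    from mult_right_mono[OF this norm_ge_zero[of "block P j g k"]] show ?thesis by simp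
   qed (simp add: block_outside)
  qed simp
  moreover have "(bmin powr (s/2)*dy j s)*(B*dy j (- b)) = ?K*(dy j s*dy j (- b))" by (simp only: mult_ac)
  moreover have "dy j s*dy j (- b) = dy j (- (b - s))" by (simp only: dy_add) simp
  ultimately have 1: "sob_le s (block P j g) (?K*dy j (- (b - s)))" by (simp only:)
  have "1*dy j (- (b - s)) \<le> (real_of_int j + 2)*dy j (- (b - s))" using j by (intro mult_right_mono) simp_all
  hence "?K*dy j (- (b - s)) \<le> ?K*((real_of_int j + 2)*dy j (- (b - s)))" using B by (intro mult_left_mono) simp_all
  with 1 show ?thesis by (rule sob_le_mono)
 qed
 have t: "0 < b - s" using s by simp
 have sm: "(\<lambda>j. ?K*((real_of_int j + 2)*dy j (- (b - s)))) summable_on {-1..}" by (rule summable_on_cmult_right) (rule gsum(1)[OF t])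
 have "sob_le s (\<lambda>k. \<Sum>\<^sub>\<infinity>j\<in>{-1..}. block P j g k) (\<Sum>\<^sub>\<infinity>j\<in>{-1..}. ?K*((real_of_int j + 2)*dy j (- (b - s))))"
  by (rule sob_le_infsum(2)[OF le sm])
 moreover have "(\<lambda>k. \<Sum>\<^sub>\<infinity>j\<in>{-1..}. block P j g k) = g" using infsumI[OF block_has_sum] by blast
 moreover have "(\<Sum>\<^sub>\<infinity>j\<in>{-1..}. ?K*((real_of_int j + 2)*dy j (- (b - s)))) = ?K*gsum (b - s)"
  unfolding gsum_def by (rule infsum_cmult_right) (use gsum(1)[OF t] in simp)
 ultimately show ?thesis by (simp only: mult_ac)
qed

lemma dy_ge_linear:
 assumes "0 < d" shows "\<exists>c>0. \<forall>j\<ge>-1. real_of_int j + 2 \<le> c*dy j d"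
proof -
 let ?f = "\<lambda>j. (real_of_int j + 2)*dy j (- d)"
 have sm: "?f summable_on {-1..}" by (rule gsum(1)[OF assms])
 have le: "?f j \<le> gsum d" if "-1 \<le> j" for j using finite_sum_le_infsum[OF sm, of "{j}"] that by (simp add: gsum_def)
 have "real_of_int j + 2 \<le> (gsum d + 1)*dy j d" if "-1 \<le> j" for j
 proof -
  have "?f j*dy j d \<le> (gsum d + 1)*dy j d" using le[OF that] by (intro mult_right_mono) simp_all
  moreover have "?f j*dy j d = (real_of_int j + 2)*(dy j (- d)*dy j d)" by (simp only: mult_ac)
  ultimately show ?thesis using that by (simp only: dy_uminus mult_1_right)
 qed
 thus ?thesis using gsum(2)[OF assms] by (intro exI[of _ "gsum d + 1"]) auto
qed

lemma block_resolv: "block P j (resolv f) = resolv (block P j f)" by (simp add: block_def resolv_def fun_eq_iff)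

lemma block_ddir: "block P j (ddir e f) = ddir e (block P j f)" by (simp add: block_def ddir_def fun_eq_iff)

lemma sqrt_card_supp: assumes "-1 \<le> j" shows "sqrt (card (supp j)) \<le> 3 * sqrt bmax*dy j 1"
proof -
 have "sqrt (card (supp j)) \<le> sqrt (9*(bmax*4 powr j))" by (rule real_sqrt_le_mono[OF card_supp[OF assms]])
 also have "... = 3 * sqrt bmax * sqrt (dy j 2)" by (simp add: real_sqrt_mult four_powr_dy)
 also have "sqrt (dy j 2) = dy j 1" by (simp add: powr_half_sqrt[symmetric] dy_powr)
 finally show ?thesis .
qed

text \<open>Two derivatives are gained up to an arbitrarily small loss \<open>d\<close>. In
  \<open>tsup_resolv_annulus\<close> the number of terms is taken proportional to \<open>j\<close>:
  the geometric remainder then beats the root of the number of frequencies, about 2^j, while the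
  main part carries a factor linear in \<open>j\<close>, which \<open>dy j d\<close>
  absorbs.\<close>

lemma hi_resolv:
 assumes d: "0 < d" shows "\<exists>c\<ge>0. \<forall>a Z f. hi a Z f --> hi (a + 2 - d) (c*Z) (resolv f)"
proof -
 obtain c where c: "0 < c" "\<And>j. -1 \<le> j ==> real_of_int j + 2 \<le> c*dy j d" using dy_ge_linear[OF d] by blast
 let ?r = "1/(1 + bmin)"
 have r: "0 \<le> ?r" "?r < 1" using bmin_pos by simp_all
 obtain m where m: "?r^m < 1/2" using real_arch_pow_inv[OF _ r(2), of "1/2"] by auto
 let ?K = "(real m + 3/2 * sqrt bmax/bmin)*c"
 have K: "0 \<le> ?K" using c(1) bmin_pos bmax_ge_1 by simp
 have "hi (a + 2 - d) (?K*Z) (resolv f)" if h: "hi a Z f" for a Z f unfolding hi_def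
 proof (intro allI impI)
  fix j :: int assume j: "-1 \<le> j"
  have Z: "0 \<le> Z" by (rule hi_nonneg[OF h])
  \<comment> \<open>One factor 1/2 for each dyadic level, so that (1/2)^(j + 1) cancels the growth
    2^j in \<open>sqrt_card_supp\<close>.\<close>
  let ?n = "m*nat (j + 1)"
  have "bmin*dy j 2 \<le> bessel k" if "k \<in> supp j" for k using supp_bessel_ge[OF j that] by (simp add: four_powr_dy)
  hence 1: "tsup (resolv (block P j f)) ((real ?n/dy j 2 + sqrt (card (supp j))*?r^?n/(bmin*dy j 2))*(Z*dy j (- a)))"
   by (intro tsup_resolv_annulus[OF finite_supp[OF j] _ hiD[OF h j] _ bmin_pos]) (simp_all add: block_outside)
  have "?r^?n = (?r^m)^nat (j + 1)" by (simp only: power_mult)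
  also have "... \<le> (1/2)^nat (j + 1)" using m r by (intro power_mono) simp_all
  also have "... = dy (j + 1) (- 1)"
  proof -
   have "0 \<le> j + 1" using j by simp
   hence e: "2^nat (j + 1) = 2 powr real_of_int (j + 1)" by (rule power_nat_powr)
   show ?thesis unfolding power_one_over e mult_minus_right powr_minus mult_1_right by (rule inverse_eq_divide[symmetric])
  qed
  also have "... = dy j (- 1)/2"
  proof -
   have "real_of_int (j + 1) * - 1 = real_of_int j * - 1 - 1" by simp
   hence "dy (j + 1) (- 1) = dy j (- 1)/2 powr 1" by (simp only: powr_diff)
   thus ?thesis by simp
  qed
  finally have "sqrt (card (supp j))*?r^?n \<le> (3 * sqrt bmax*dy j 1)*(dy j (- 1)/2)" using r bmax_ge_1 by (intro mult_mono sqrt_card_supp[OF j]) simp_all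
  also have "... = 3/2 * sqrt bmax*(dy j (- 1)*dy j 1)" by (simp only: times_divide_eq_left times_divide_eq_right mult.assoc mult.commute[of "dy j 1"])
  also have "... = 3/2 * sqrt bmax" unfolding dy_uminus by (rule mult_1_right)
  finally have "sqrt (card (supp j))*?r^?n \<le> 3/2 * sqrt bmax" .
  hence "sqrt (card (supp j))*?r^?n/(bmin*dy j 2) \<le> 3/2 * sqrt bmax/(bmin*dy j 2)" using bmin_pos by (intro divide_right_mono) simp_all
  hence "real ?n/dy j 2 + sqrt (card (supp j))*?r^?n/(bmin*dy j 2)
    \<le> real ?n/dy j 2 + 3/2 * sqrt bmax/(bmin*dy j 2)" by simp
  also have "... = (real ?n + 3/2 * sqrt bmax/bmin)*dy j (- 2)" using bmin_pos by (simp add: field_simps powr_minus)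
  also have "... \<le> (?K*dy j d)*dy j (- 2)"
  proof (rule mult_right_mono)
   have "real ?n = real m*(real_of_int j + 1)" using j by simp
   also have "... \<le> real m*(c*dy j d)" using c(2)[OF j] by (intro mult_left_mono) simp_all
   finally have 2: "real ?n \<le> real m*(c*dy j d)" .
   have "1 \<le> c*dy j d" using c(2)[OF j] j by linarith
   hence "3/2 * sqrt bmax/bmin*1 \<le> 3/2 * sqrt bmax/bmin*(c*dy j d)" using bmin_pos bmax_ge_1 by (intro mult_left_mono) simp_all
   with 2 have "real ?n + 3/2 * sqrt bmax/bmin \<le> real m*(c*dy j d) + 3/2 * sqrt bmax/bmin*(c*dy j d)" by simp
   thus "real ?n + 3/2 * sqrt bmax/bmin \<le> ?K*dy j d" by (simp only: distrib_right mult.assoc)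
  qed simp
  finally have 2: "real ?n/dy j 2 + sqrt (card (supp j))*?r^?n/(bmin*dy j 2) \<le> (?K*dy j d)*dy j (- 2)" .
  have "(real ?n/dy j 2 + sqrt (card (supp j))*?r^?n/(bmin*dy j 2))*(Z*dy j (- a)) \<le> ((?K*dy j d)*dy j (- 2))*(Z*dy j (- a))"
   by (rule mult_right_mono[OF 2]) (simp add: Z)
  also have "... = ?K*Z*(dy j d*dy j (- 2)*dy j (- a))" by (simp only: mult_ac)
  also have "dy j d*dy j (- 2)*dy j (- a) = dy j (- (a + 2 - d))" by (simp only: dy_add) (simp add: algebra_simps)
  finally show "tsup (block P j (resolv f)) (?K*Z*dy j (- (a + 2 - d)))" unfolding block_resolv by (rule tsup_mono[OF 1])
 qed
 thus ?thesis by (intro exI[of _ ?K] conjI K allI impI)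
qed

text \<open>Here the length \<open>n\<close> of the expansion is fixed, and the parameter l, a
  multiple of 2^(j(1 + d)), exceeds the radius of the block by the factor 2^(jd). With n*d \<ge> 1
  the remainder factor (N/l)^n makes up for the number of frequencies; the loss \<open>d\<close> is
  the excess in the exponent of l.\<close>

lemma hi_ddir:
 assumes d: "0 < d" and e: "norm e \<le> 1"
 shows "\<exists>c\<ge>0. \<forall>b Z f. hi b Z f --> hi (b - 1 - d) (c*Z) (ddir e f)"
proof -
 obtain n :: nat where n: "1/d < real n" using reals_Archimedean2 by blast
 have nd: "1 \<le> real n*d" using n d by (simp add: field_simps)
 let ?N = "\<lambda>j. sqrt bmax*dy j 1"
 let ?K = "sqrt bmax*2^(n + 1) + 2 powr (real n*d - 1 + d)*3*bmax"
 have K: "0 \<le> ?K" using bmax_ge_1 by simp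
 have "hi (b - 1 - d) (?K*Z) (ddir e f)" if h: "hi b Z f" for b Z f unfolding hi_def
 proof (intro allI impI)
  fix j :: int assume j: "-1 \<le> j"
  have Z: "0 \<le> Z" by (rule hi_nonneg[OF h])
  let ?l = "sqrt bmax*dy j (1 + d)"
  have N: "\<bar>2*pi*(freq k \<bullet> e)\<bar> \<le> ?N j" if "k \<in> supp j" for k using ddir_le_bessel[OF e, of k] supp_sqrt_bessel[OF j that] by linarith
  have 1: "tsup (ddir e (block P j f)) ((?l*2^(n + 1) + sqrt (card (supp j))*(?N j/?l)^n*?N j)*(Z*dy j (- b)))"
   using bmax_ge_1 by (intro tsup_ddir_ball[OF finite_supp[OF j] _ hiD[OF h j] _ N]) (simp_all add: block_outside)
  have "sqrt bmax \<noteq> 0" using bmax_ge_1 by simp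
  hence "?N j/?l = dy j 1/dy j (1 + d)" by (rule mult_divide_mult_cancel_left)
  also have "... = dy j (- d)" by (simp add: powr_diff[symmetric] algebra_simps)
  finally have "(?N j/?l)^n = dy j (- d) powr real n" by (simp add: powr_realpow)
  also have "... = dy j (- (real n*d))" by (simp add: powr_powr mult_ac)
  also have "... \<le> 2 powr (real n*d - (1 - d))*dy j (- (1 - d))"
  proof (rule dy_index_le[OF _ j])
   show "1 - d \<le> real n*d" using nd d by linarith
  qed
  finally have 2: "(?N j/?l)^n \<le> 2 powr (real n*d - 1 + d)*dy j (d - 1)" by (simp add: algebra_simps)
  have "sqrt (card (supp j))*(?N j/?l)^n*?N j \<le> (3 * sqrt bmax*dy j 1)*(2 powr (real n*d - 1 + d)*dy j (d - 1))*?N j"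
   using bmax_ge_1 by (intro mult_right_mono mult_mono[OF sqrt_card_supp[OF j] 2]) simp_all
  also have "... = 2 powr (real n*d - 1 + d)*3*(sqrt bmax * sqrt bmax)*(dy j 1*dy j (d - 1)*dy j 1)" by (simp only: mult_ac)
  finally have 3: "sqrt (card (supp j))*(?N j/?l)^n*?N j \<le> 2 powr (real n*d - 1 + d)*3*(sqrt bmax * sqrt bmax)*(dy j 1*dy j (d - 1)*dy j 1)" .
  have "sqrt bmax * sqrt bmax = bmax" using bmax_ge_1 by simp
  moreover have "dy j 1*dy j (d - 1)*dy j 1 = dy j (1 + d)" by (simp only: dy_add) (simp add: add.commute)
  ultimately have "sqrt (card (supp j))*(?N j/?l)^n*?N j \<le> 2 powr (real n*d - 1 + d)*3*bmax*dy j (1 + d)" using 3 by (simp only:)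
  note 4 = this
  have "?l*2^(n + 1) = sqrt bmax*2^(n + 1)*dy j (1 + d)" by (simp only: mult.commute mult.left_commute)
  with 4 have "(?l*2^(n + 1) + sqrt (card (supp j))*(?N j/?l)^n*?N j) \<le> ?K*dy j (1 + d)"
   unfolding distrib_right by (intro add_mono) (simp_all only: order_refl)
  hence "(?l*2^(n + 1) + sqrt (card (supp j))*(?N j/?l)^n*?N j)*(Z*dy j (- b)) \<le> (?K*dy j (1 + d))*(Z*dy j (- b))" by (rule mult_right_mono) (simp add: Z)
  also have "... = ?K*Z*(dy j (1 + d)*dy j (- b))" by (simp only: mult_ac)
  also have "dy j (1 + d)*dy j (- b) = dy j (- (b - 1 - d))" by (simp only: dy_add) (simp add: algebra_simps)
  finally show "tsup (block P j (ddir e f)) (?K*Z*dy j (- (b - 1 - d)))" unfolding block_ddir by (rule tsup_mono[OF 1])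
 qed
 thus ?thesis by (intro exI[of _ ?K] conjI K allI impI)
qed

end

section \<open>Bounded functionals, Bony's decomposition and the Leibniz rule\<close>

definition single :: "int \<times> int \<Rightarrow> complex \<Rightarrow> tdist" where
 "single l z = (\<lambda>k. if k = l then z else 0)"

text \<open>Compatibility with differences, together with the values at all multiples of characters,
  determines a bounded functional. This form matches the difference lemmas for \<open>para\<close>,
  \<open>reso\<close> and the commutator directly.\<close>

definition bfun :: "real \<Rightarrow> (tdist \<Rightarrow> complex) \<Rightarrow> bool" where
 "bfun s T \<longleftrightarrow> (\<forall>u\<in>sobolev s. \<forall>v\<in>sobolev s. T (u - v) = T u - T v) \<and> (\<exists>c. \<forall>u A. sob_le s u A --> norm (T u) \<le> c*A)"

lemma bfunI:
 assumes "\<And>u v. u \<in> sobolev s ==> v \<in> sobolev s ==> T (u - v) = T u - T v"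
  and "\<And>u A. sob_le s u A ==> norm (T u) \<le> c*A"
 shows "bfun s T" using assms unfolding bfun_def by blast

lemma bfun_add: assumes "bfun s T" "bfun s S" shows "bfun s (\<lambda>u. T u + S u)"
proof -
 obtain c d where c: "\<And>u A. sob_le s u A ==> norm (T u) \<le> c*A" and d: "\<And>u A. sob_le s u A ==> norm (S u) \<le> d*A"
  using assms unfolding bfun_def by blast
 show ?thesis
 proof (rule bfunI[where c = "c + d"])
  show "T (u - v) + S (u - v) = T u + S u - (T v + S v)" if "u \<in> sobolev s" "v \<in> sobolev s" for u v using assms that unfolding bfun_def by simp
  show "norm (T u + S u) \<le> (c + d)*A" if "sob_le s u A" for u A using norm_triangle_ineq[of "T u" "S u"] c[OF that] d[OF that] by (simp add: algebra_simps)
 qed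
qed

lemma bfun_cmult: assumes "bfun s T" shows "bfun s (\<lambda>u. z*T u)"
proof -
 obtain c where c: "\<And>u A. sob_le s u A ==> norm (T u) \<le> c*A" using assms unfolding bfun_def by blast
 show ?thesis
 proof (rule bfunI[where c = "norm z*c"])
  show "z*T (u - v) = z*T u - z*T v" if uv: "u \<in> sobolev s" "v \<in> sobolev s" for u v
  proof -
   have "T (u - v) = T u - T v" using assms uv unfolding bfun_def by blast
   thus ?thesis by (simp only: right_diff_distrib)
  qed
  show "norm (z*T u) \<le> norm z*c*A" if "sob_le s u A" for u A using mult_left_mono[OF c[OF that] norm_ge_zero[of z]] by (simp add: norm_mult mult.assoc)
 qed
qed

lemma bfun_diff: "bfun s T ==> bfun s S ==> bfun s (\<lambda>u. T u - S u)" using bfun_add[OF _ bfun_cmult[of s S "-1"], of T] by simp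

lemma sob_le_single: "sob_le s (single l z) (bessel l powr (s/2)*norm z)" unfolding sob_le_def
proof (intro allI impI)
 fix F :: "(int \<times> int) set" assume F: "finite F"
 have "L2_set (\<lambda>k. bessel k powr (s/2)*norm (single l z k)) F
   = sqrt (\<Sum>k\<in>F. if k = l then (bessel l powr (s/2)*norm z)^2 else 0)"
  unfolding L2_set_def by (rule arg_cong[where f = sqrt], rule sum.cong) (auto simp: single_def)
 also have "... \<le> bessel l powr (s/2)*norm z" using F by (simp add: sum.delta)
 finally show "L2_set (\<lambda>k. bessel k powr (s/2)*norm (single l z k)) F \<le> bessel l powr (s/2)*norm z" .
qed

lemma sob_le_sq_summable:
 assumes "sob_le s f A" shows "(\<lambda>k. (bessel k powr (s/2)*norm (f k))^2) summable_on UNIV"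
proof -
 have "(bessel k powr (s/2))^2 = bessel k powr s" for k by (simp add: power2_eq_square powr_add[symmetric])
 thus ?thesis using sob_le_sobolev[OF assms] by (simp add: sobolev_def power_mult_distrib)
qed

lemma sob_le_tail:
 assumes v: "sob_le s v A" and e: "0 < e"
 shows "\<exists>F. finite F \<and> sob_le s (\<lambda>k. if k \<in> F then 0 else v k) e"
proof -
 let ?q = "\<lambda>k. (bessel k powr (s/2)*norm (v k))^2"
 have sm: "?q summable_on UNIV" by (rule sob_le_sq_summable[OF v])
 obtain F where F: "finite F" "dist (sum ?q F) (infsum ?q UNIV) \<le> e^2" using infsum_finite_approximation[OF sm, of "e^2"] e by auto
 have "sob_le s (\<lambda>k. if k \<in> F then 0 else v k) e" unfolding sob_le_def
 proof (intro allI impI)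
  fix G :: "(int \<times> int) set" assume G: "finite G"
  have "(\<Sum>k\<in>G. (bessel k powr (s/2)*norm (if k \<in> F then 0 else v k))^2) = sum ?q (G - F)" using G by (intro sum.mono_neutral_cong_right) auto
  moreover have "sum ?q (G - F) + sum ?q F = sum ?q ((G - F) \<union> F)" using G F(1) by (subst sum.union_disjoint) auto
  moreover have "sum ?q ((G - F) \<union> F) \<le> infsum ?q UNIV" using G F(1) by (intro finite_sum_le_infsum[OF sm]) auto
  ultimately have "(\<Sum>k\<in>G. (bessel k powr (s/2)*norm (if k \<in> F then 0 else v k))^2) \<le> e^2" using F(2) unfolding dist_real_def by linarith
  hence "L2_set (\<lambda>k. bessel k powr (s/2)*norm (if k \<in> F then 0 else v k)) G \<le> sqrt (e^2)" unfolding L2_set_def by (rule real_sqrt_le_mono)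
  thus "L2_set (\<lambda>k. bessel k powr (s/2)*norm (if k \<in> F then 0 else v k)) G \<le> e" using e by simp
 qed
 with F(1) show ?thesis by blast
qed

text \<open>Trigonometric polynomials are dense, so that identities between functionals may be checked on characters.\<close>

lemma bfun_zero:
 assumes T: "bfun s T" and z: "\<And>l z. T (single l z) = 0" and v: "sob_le s v A"
 shows "T v = 0"
proof -
 obtain c where c: "\<And>u A. sob_le s u A ==> norm (T u) \<le> c*A" using T unfolding bfun_def by blast
 have add: "T (u - v) = T u - T v" if "u \<in> sobolev s" "v \<in> sobolev s" for u v using T that unfolding bfun_def by blast
 let ?r = "\<lambda>F k. if k \<in> F then v k else 0"
 have r: "sob_le s (?r F) (1*A)" for F by (rule sob_le_mult0[OF v]) simp_all
 have fin: "T (?r F) = 0" if "finite F" for F using that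
 proof induction
  case empty
  have "T (0 - 0) = T 0 - T 0" by (rule add) (rule sob_le_sobolev[OF sob_le_zero[OF order_refl]])+
  thus ?case by (simp add: zero_fun_def fun_diff_def)
 next
  case (insert l F)
  have "?r (insert l F) = ?r F - single l (- v l)" using insert.hyps by (auto simp: single_def fun_eq_iff)
  hence "T (?r (insert l F)) = T (?r F) - T (single l (- v l))" by (simp only: add[OF sob_le_sobolev[OF r] sob_le_sobolev[OF sob_le_single]])
  thus ?case by (simp add: insert.IH z)
 qed
 have "norm (T v) \<le> 0 + e" if e: "0 < e" for e :: real
 proof -
  define d where "d = e/(\<bar>c\<bar> + 1)"
  have d: "0 < d" using e by (simp add: d_def)
  obtain F where F: "finite F" "sob_le s (\<lambda>k. if k \<in> F then 0 else v k) d" using sob_le_tail[OF v d] by blast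
  have "v - ?r F = (\<lambda>k. if k \<in> F then 0 else v k)" by (auto simp: fun_eq_iff)
  hence "norm (T (v - ?r F)) \<le> c*d" using c[OF F(2)] by simp
  also have "c*d \<le> (\<bar>c\<bar> + 1)*d" using d by (intro mult_right_mono) simp_all
  also have "... = e" by (simp add: d_def add_pos_nonneg)
  finally show ?thesis by (simp add: add[OF sob_le_sobolev[OF v] sob_le_sobolev[OF r]] fin[OF F(1)])
 qed
 thus ?thesis using field_le_epsilon[of "norm (T v)" 0] by simp
qed

context lp_blocks begin

lemma bfun_tmul:
 assumes g: "sob_le (- s) g B" and s: "0 \<le> s" shows "bfun s (\<lambda>v. tmul v g k)"
proof (rule bfunI[where c = "(2*bessel k) powr (s/2)*B"])
 fix u v assume uv: "u \<in> sobolev s" "v \<in> sobolev s"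
 show "tmul (u - v) g k = tmul u g k - tmul v g k"
  unfolding tmul_def by (rule norm_summable_diff(2)[OF product_summable(1)[OF sobolev_sob_le[OF uv(1)] g s] product_summable(1)[OF sobolev_sob_le[OF uv(2)] g s]])
   (simp add: algebra_simps)
next
 fix u A assume "sob_le s u A"
 from product_summable(2)[OF this g s, of k] show "norm (tmul u g k) \<le> (2*bessel k) powr (s/2)*B*A" by (simp add: mult_ac)
qed

lemma bfun_coeff:
 assumes "\<And>u v. u \<in> sobolev s ==> v \<in> sobolev s ==> F (u - v) = F u - F v"
  and "\<And>u A. sob_le s u A ==> sob_le r (F u) (c*A)"
 shows "bfun s (\<lambda>v. F v k)"
proof (rule bfunI[where c = "bessel k powr (- r/2)*c"])
 show "F (u - v) k = F u k - F v k" if "u \<in> sobolev s" "v \<in> sobolev s" for u v using assms(1)[OF that] by simp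
 show "norm (F u k) \<le> bessel k powr (- r/2)*c*A" if "sob_le s u A" for u A using sob_le_coeff_diff[OF assms(2)[OF that], of k] by (simp add: mult_ac)
qed

lemma bfun_para_left:
 assumes g: "hi b B g" and t: "- 9/20 < b" "- 9/20 < s + b"
 shows "bfun s (\<lambda>v. para P v g k)"
proof (rule bfun_coeff[where r = "- 9/10" and c = "pcon s (b + 9/20)*((1 + 3*cpt)*(cs s*B))"])
 fix u v assume "u \<in> sobolev s" "v \<in> sobolev s"
 thus "para P (u - v) g = para P u g - para P v g" by (intro para_diff_left(2) para_lo_hi_neg(1)[OF sob_le_lo[OF sobolev_sob_le] g t])
next
 fix u A assume "sob_le s u A"
 from para_lo_hi_neg(2)[OF sob_le_lo[OF this] g t]
 show "sob_le (- 9/10) (para P u g) (pcon s (b + 9/20)*((1 + 3*cpt)*(cs s*B))*A)" by (simp only: mult_ac)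
qed

lemma bfun_para_right:
 assumes g: "hi b B g" and t: "- 9/20 < s" "- 9/20 < s + b"
 shows "bfun s (\<lambda>v. para P g v k)"
proof (rule bfun_coeff[where r = "- 9/10" and c = "pcon b (s + 9/20)*((1 + 3*cpt)*(cs s*B))"])
 fix u v assume "u \<in> sobolev s" "v \<in> sobolev s"
 thus "para P g (u - v) = para P g u - para P g v" by (intro para_diff_right(2) para_hi_lo_neg(1)[OF g sob_le_lo[OF sobolev_sob_le] t])
next
 fix u A assume "sob_le s u A"
 from para_hi_lo_neg(2)[OF g sob_le_lo[OF this] t]
 show "sob_le (- 9/10) (para P g u) (pcon b (s + 9/20)*((1 + 3*cpt)*(cs s*B))*A)" by (simp only: mult_ac)
qed

lemma bfun_reso:
 assumes g: "hi b B g" and t: "0 < s + b"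
 shows "bfun s (\<lambda>v. reso P v g k)"
proof (rule bfun_coeff[where r = 0 and c = "3*2 powr \<bar>s\<bar>*gsum (s + b)*(cs s*B)"])
 fix u v assume "u \<in> sobolev s" "v \<in> sobolev s"
 thus "reso P (u - v) g = reso P u g - reso P v g" by (intro reso_diff_left(2) reso_lo_hi(1)[OF sob_le_lo[OF sobolev_sob_le] g t])
next
 fix u A assume "sob_le s u A"
 from reso_lo_hi(2)[OF sob_le_lo[OF this] g t]
 show "sob_le 0 (reso P u g) (3*2 powr \<bar>s\<bar>*gsum (s + b)*(cs s*B)*A)" by (simp only: mult_ac)
qed

lemma sym_large_zero: "\<exists>J\<ge>-1. \<forall>j>J. sym j (freq k) = 0"
proof -
 obtain J where J: "\<And>j. J < j ==> block P j (single k 1) = 0"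
 proof -
  have "fsupp (single k 1)" by (simp add: fsupp_def single_def)
  from fsupp_blocks_finite[OF this] show ?thesis using that by blast
 qed
 have "sym j (freq k) = 0" if "J < j" for j using fun_cong[OF J[OF that], of k] by (simp add: block_sym single_def)
 thus ?thesis by (intro exI[of _ "max (-1) J"]) auto
qed

lemma sum_sym_eq_1: assumes "-1 \<le> J" "\<And>j. J < j ==> sym j x = 0" shows "(\<Sum>j\<in>{-1..J}. sym j x) = 1"
proof -
 have "((\<lambda>j. sym j x) has_sum (\<Sum>j\<in>{-1..J}. sym j x)) {-1..}" using assms by (intro has_sum_finite_neutralI) (auto simp: not_le)
 from has_sum_unique[OF this sym_has_sum] show ?thesis .
qed

lemma infsum_truncate:
 fixes F :: "int \<Rightarrow> complex"
 assumes "\<And>j. J < j ==> F j = 0" shows "(\<Sum>\<^sub>\<infinity>j\<in>{-1..}. F j) = (\<Sum>j\<in>{-1..J}. F j)"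
proof -
 have "(\<Sum>\<^sub>\<infinity>j\<in>{-1..}. F j) = (\<Sum>\<^sub>\<infinity>j\<in>{-1..J}. F j)"
  by (rule infsum_cong_neutral) (use assms in \<open>auto simp: not_le\<close>)
 thus ?thesis by simp
qed

text \<open>Brings the three parts of a product to the same finite square of block indices, each
  with the indicator of its region. Bony's decomposition then amounts to the regions forming a
  partition of the square.\<close>

lemma band_sum:
 fixes h :: "int \<Rightarrow> int \<Rightarrow> complex"
 assumes z: "\<And>i j. J < i \<or> J < j ==> h i j = 0" and S: "\<And>j. finite (S j)" "\<And>j. S j \<subseteq> {-1..}"
 shows "(\<Sum>\<^sub>\<infinity>j\<in>{-1..}. \<Sum>i\<in>S j. h i j) = (\<Sum>j\<in>{-1..J}. \<Sum>i\<in>{-1..J}. if i \<in> S j then h i j else 0)"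
proof -
 have "(\<Sum>i\<in>S j. h i j) = (\<Sum>i\<in>{-1..J}. if i \<in> S j then h i j else 0)" for j
 proof -
  have "(\<Sum>i\<in>S j. h i j) = (\<Sum>i\<in>{i\<in>{-1..J}. i \<in> S j}. h i j)"
  proof (rule sum.mono_neutral_right[OF S(1)])
   show "{i \<in> {-1..J}. i \<in> S j} \<subseteq> S j" by blast
   show "\<forall>i\<in>S j - {i \<in> {-1..J}. i \<in> S j}. h i j = 0"
   proof
    fix i assume i: "i \<in> S j - {i \<in> {-1..J}. i \<in> S j}"
    hence "J < i" using S(2)[of j] by (auto simp: subset_eq not_le)
    thus "h i j = 0" by (intro z disjI1)
   qed
  qed
  also have "... = (\<Sum>i\<in>{-1..J}. if i \<in> S j then h i j else 0)" by (rule sum.inter_filter) simp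
  finally show ?thesis .
 qed
 moreover have "(\<Sum>\<^sub>\<infinity>j\<in>{-1..}. \<Sum>i\<in>S j. h i j) = (\<Sum>j\<in>{-1..J}. \<Sum>i\<in>S j. h i j)"
  by (rule infsum_truncate) (intro sum.neutral ballI z disjI2)
 ultimately show ?thesis by simp
qed

lemma para_set: "finite {-1..j - 2}" "{-1..j - 2} \<subseteq> {-1..}" for j :: int by auto

lemma reso_set: "finite {i. - 1 \<le> i \<and> \<bar>i - j\<bar> \<le> 1}" "{i. - 1 \<le> i \<and> \<bar>i - j\<bar> \<le> 1} \<subseteq> {-1..}" for j :: int
 by (rule finite_subset[of _ "{-1..j+1}"]) auto

lemma pair_single: "pair (single l z) g i j k = of_real (sym i (freq l) * sym j (freq (k - l)))*(z*g (k - l))"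
proof -
 have "pair (single l z) g i j k = (\<Sum>m\<in>{l}. block P i (single l z) m*block P j g (k - m))" by (rule tmul_finite) (simp_all add: block_sym single_def)
 thus ?thesis by (simp add: block_sym single_def)
qed

lemma bony_single: "tmul (single l z) g k = para P (single l z) g k + reso P (single l z) g k + para P g (single l z) k"
proof -
 obtain J1 where J1: "-1 \<le> J1" "\<And>j. J1 < j ==> sym j (freq l) = 0" using sym_large_zero by blast
 obtain J2 where J2: "-1 \<le> J2" "\<And>j. J2 < j ==> sym j (freq (k - l)) = 0" using sym_large_zero by blast
 define J where "J = max J1 J2"
 let ?I = "{-1..J}"
 let ?p = "\<lambda>i j. of_real (sym i (freq l) * sym j (freq (k - l)))*(z*g (k - l))"
 have z0: "?p i j = 0" if "J < i \<or> J < j" for i j using that J1(2)[of i] J2(2)[of j] unfolding J_def by fastforce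
 have 1: "para P (single l z) g k = (\<Sum>j\<in>?I. \<Sum>i\<in>?I. if i \<in> {-1..j - 2} then ?p i j else 0)"
  unfolding para_def pair_single by (rule band_sum[OF z0 para_set])
 have 2: "reso P (single l z) g k = (\<Sum>j\<in>?I. \<Sum>i\<in>?I. if i \<in> {i. - 1 \<le> i \<and> \<bar>i - j\<bar> \<le> 1} then ?p i j else 0)"
  unfolding reso_def pair_single by (rule band_sum[OF z0 reso_set])
 have "para P g (single l z) k = (\<Sum>i\<in>?I. \<Sum>j\<in>?I. if j \<in> {-1..i - 2} then ?p i j else 0)"
  unfolding para_def pair_commute[where f = g] pair_single by (rule band_sum[OF _ para_set]) (use z0 in blast)
 also have "... = (\<Sum>j\<in>?I. \<Sum>i\<in>?I. if j \<in> {-1..i - 2} then ?p i j else 0)" by (rule sum.swap)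
 finally have 3: "para P g (single l z) k = (\<Sum>j\<in>?I. \<Sum>i\<in>?I. if j \<in> {-1..i - 2} then ?p i j else 0)" .
 have "para P (single l z) g k + reso P (single l z) g k + para P g (single l z) k = (\<Sum>j\<in>?I. \<Sum>i\<in>?I. ?p i j)"
  unfolding 1 2 3 sum.distrib[symmetric] by (intro sum.cong refl) auto
 also have "... = of_real ((\<Sum>i\<in>?I. sym i (freq l))*(\<Sum>j\<in>?I. sym j (freq (k - l))))*(z*g (k - l))"
  by (subst sum.swap) (simp only: sum_product of_real_sum[symmetric] sum_distrib_right[symmetric])
 also have "(\<Sum>i\<in>?I. sym i (freq l)) = 1" by (rule sum_sym_eq_1) (use J1 in \<open>auto simp: J_def\<close>)
 also have "(\<Sum>i\<in>?I. sym i (freq (k - l))) = 1" by (rule sum_sym_eq_1) (use J2 in \<open>auto simp: J_def\<close>)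
 also have "of_real (1*1)*(z*g (k - l)) = tmul (single l z) g k" by (subst tmul_finite[of "{l}"]) (simp_all add: single_def)
 finally show ?thesis by (rule sym)
qed

text \<open>For fixed \<open>g\<close> every coefficient of both sides is a bounded functional of
  \<open>v\<close>, so the identity for single characters extends by density.\<close>

lemma bony:
 assumes v: "sob_le s v A" and g: "hi b B g" and s: "0 < s" "0 < s + b" and b: "- 9/20 < b"
 shows "tmul v g = para P v g + reso P v g + para P g v"
proof
 fix k
 let ?r = "min 0 ((b - s)/2)"
 have "sob_le (- s) g (bmin powr ((- s)/2)*gsum (b - (- s))*B)" using s by (intro hi_sob_le[OF g]) simp_all
 hence "bfun s (\<lambda>v. tmul v g k - (para P v g k + reso P v g k + para P g v k))"
  using s b by (intro bfun_diff bfun_add bfun_tmul bfun_para_left[OF g] bfun_para_right[OF g] bfun_reso[OF g]) auto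
 from bfun_zero[OF this _ v] have "tmul v g k - (para P v g k + reso P v g k + para P g v k) = 0" using bony_single by simp
 thus "tmul v g k = (para P v g + reso P v g + para P g v) k" by simp
qed

lemma pair_sum:
 assumes "-1 \<le> i"
 shows "pair f g i j k = (\<Sum>l\<in>supp i. block P i f l*block P j g (k - l))" by (rule tmul_finite[OF finite_supp[OF assms] block_outside])

text \<open>The identity |k|^2 = |l|^2 + |k - l|^2 + 2 l.(k - l) is the Leibniz rule for the
  Laplacian on the Fourier side, and blocks commute with derivatives.\<close>

lemma pair_leibniz:
 assumes "-1 \<le> i"
 shows "pair f (laplace g) i j k = laplace (pair f g i j) k - pair (laplace f) g i j k
  - (2*pair (dx1 f) (dx1 g) i j k + 2*pair (dx2 f) (dx2 g) i j k)"
proof -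
 have nf: "(norm (freq k))^2 = (of_int (fst k))^2 + (of_int (snd k))^2" for k by (simp add: freq_def norm_Pair)
 have "block P i f l*block P j (laplace g) (k - l) = - of_real (4*pi^2*(norm (freq k))^2)*(block P i f l*block P j g (k - l))
  - block P i (laplace f) l*block P j g (k - l)
  - (2*(block P i (dx1 f) l*block P j (dx1 g) (k - l)) + 2*(block P i (dx2 f) l*block P j (dx2 g) (k - l)))" for l
  unfolding block_sym laplace_def dx1_def dx2_def nf by (simp add: algebra_simps power2_eq_square)
 thus ?thesis unfolding pair_sum[OF assms] laplace_def[of "tmul _ _"] by (simp only: sum_subtractf sum.distrib sum_distrib_left)
qed

lemma has_sum_sub: "(f has_sum a) A ==> (g has_sum b) A ==> ((\<lambda>x. f x - g x) has_sum (a - b)) A" for f g :: "'i \<Rightarrow> complex"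
 using has_sum_add[of f A a "\<lambda>x. - g x" "- b"] by (simp add: has_sum_uminus)

text \<open>The correction terms are those of \<open>B_op\<close> that contain derivatives of
  \<open>v\<close>; they were put there in order to cancel against this identity.\<close>

lemma para_leibniz:
 assumes p: "psum v X" "psum (laplace v) X" "psum (dx1 v) (dx1 X)" "psum (dx2 v) (dx2 X)"
 shows "psum v (laplace X)"
  "para P v (laplace X) = laplace (para P v X) - para P (laplace v) X - tscale 2 (para P (dx1 v) (dx1 X) + para P (dx2 v) (dx2 X))"
proof -
 have e: "para_block v (laplace X) j k = - of_real (4*pi^2*(norm (freq k))^2)*para_block v X j k - para_block (laplace v) X j k
   - (2*para_block (dx1 v) (dx1 X) j k + 2*para_block (dx2 v) (dx2 X) j k)" for j k
  unfolding para_block_def sum_distrib_left sum_subtractf[symmetric] sum.distrib[symmetric]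
 proof (rule sum.cong[OF refl])
  fix i assume "i \<in> {-1..j - 2}"
  hence "-1 \<le> i" by simp
  from pair_leibniz[OF this, where f = v and g = X and j = j and k = k] show "pair v (laplace X) i j k = - of_real (4*pi^2*(norm (freq k))^2)*pair v X i j k - pair (laplace v) X i j k
   - (2*pair (dx1 v) (dx1 X) i j k + 2*pair (dx2 v) (dx2 X) i j k)" unfolding laplace_def[of "pair v X i j"] .
 qed
 have sm: "(\<lambda>j. c*para_block f g j k) summable_on {-1..}" if "psum f g" for f g k c
  by (rule summable_on_cmult_right[OF abs_summable_summable[OF psumD[OF that]]])
 show ps: "psum v (laplace X)" unfolding psum_def
 proof
  fix k
  have "(\<lambda>j. norm (4*pi^2*(norm (freq k))^2)*norm (para_block v X j k) + norm (para_block (laplace v) X j k)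
   + (2*norm (para_block (dx1 v) (dx1 X) j k) + 2*norm (para_block (dx2 v) (dx2 X) j k))) summable_on {-1..}"
   by (intro summable_on_add summable_on_cmult_right psumD p)
  thus "(\<lambda>j. norm (para_block v (laplace X) j k)) summable_on {-1..}"
  proof (rule summable_on_comparison_test)
   fix j
   have n: "norm (- a*x - y - (2*z + 2*w)) \<le> norm a*norm x + norm y + (2*norm z + 2*norm w)" for a x y z w :: complex
    by (intro order_trans[OF norm_triangle_ineq4] add_mono order_trans[OF norm_triangle_ineq]) (simp_all add: norm_mult)
   show "norm (para_block v (laplace X) j k) \<le> norm (4*pi^2*(norm (freq k))^2)*norm (para_block v X j k) + norm (para_block (laplace v) X j k)
   + (2*norm (para_block (dx1 v) (dx1 X) j k) + 2*norm (para_block (dx2 v) (dx2 X) j k))"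
    unfolding e using n[of "of_real (4*pi^2*(norm (freq k))^2)"] by (simp only: norm_of_real real_norm_def)
  qed simp
 qed
 show "para P v (laplace X) = laplace (para P v X) - para P (laplace v) X - tscale 2 (para P (dx1 v) (dx1 X) + para P (dx2 v) (dx2 X))"
 proof
  fix k
  have hs: "((\<lambda>j. para_block f g j k) has_sum para P f g k) {-1..}" if "psum f g" for f g unfolding para_para_block using sm[OF that, of 1 k] by simp
  have "((\<lambda>j. - of_real (4*pi^2*(norm (freq k))^2)*para_block v X j k - para_block (laplace v) X j k
   - (2*para_block (dx1 v) (dx1 X) j k + 2*para_block (dx2 v) (dx2 X) j k)) has_sum
   (- of_real (4*pi^2*(norm (freq k))^2)*para P v X k - para P (laplace v) X k - (2*para P (dx1 v) (dx1 X) k + 2*para P (dx2 v) (dx2 X) k))) {-1..}"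
   by (intro has_sum_sub has_sum_add has_sum_cmult_right hs p)
  from has_sum_unique[OF hs[OF ps] this[folded e]]
  show "para P v (laplace X) k = (laplace (para P v X) - para P (laplace v) X - tscale 2 (para P (dx1 v) (dx1 X) + para P (dx2 v) (dx2 X))) k"
   by (simp add: laplace_def tscale_def algebra_simps)
 qed
qed

text \<open>The band |i - j| \<le> 1 is symmetric, but the series in \<open>reso\<close> runs over
  the index of the second factor; finite support makes both sums finite and exchangeable. The
  enhanced noise is built from \<open>reso P xi (resolv xi)\<close>, whereas the commutator produces
  \<open>reso P (resolv xi) xi\<close>.\<close>

lemma reso_commute_fsupp:
 assumes "fsupp f" "fsupp g" shows "reso P f g = reso P g f"
proof
 fix k
 obtain J1 where J1: "\<And>j. J1 < j ==> block P j f = 0" using fsupp_blocks_finite[OF assms(1)] by blast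
 obtain J2 where J2: "\<And>j. J2 < j ==> block P j g = 0" using fsupp_blocks_finite[OF assms(2)] by blast
 define J where "J = max J1 J2"
 let ?I = "{-1..J}"
 have z: "pair f g i j = 0" if "J < i \<or> J < j" for i j
 proof -
  have "block P i f = 0 \<or> block P j g = 0" using that J1[of i] J2[of j] unfolding J_def by linarith
  thus ?thesis by (auto simp: tmul_def zero_fun_def)
 qed
 let ?S = "\<lambda>j. {i. - 1 \<le> i \<and> \<bar>i - j\<bar> \<le> 1}"
 have "reso P f g k = (\<Sum>j\<in>?I. \<Sum>i\<in>?I. if i \<in> ?S j then pair f g i j k else 0)"
  unfolding reso_def by (rule band_sum[OF _ reso_set]) (simp add: z)
 also have "... = (\<Sum>j\<in>?I. \<Sum>i\<in>?I. if j \<in> ?S i then pair f g j i k else 0)" by (rule sum.swap)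
 also have "... = (\<Sum>j\<in>?I. \<Sum>i\<in>?I. if i \<in> ?S j then pair g f i j k else 0)"
  by (intro sum.cong refl) (auto simp: abs_minus_commute pair_commute[where f = f and g = g])
 also have "... = reso P g f k" unfolding reso_def by (rule band_sum[OF _ reso_set, symmetric]) (auto simp: z pair_commute[where f = g and g = f])
 finally show "reso P f g k = reso P g f k" .
qed

end

section \<open>The paracontrolled operator\<close>

lemma laplace_diff: "laplace (f - g) = laplace f - laplace g"
 and resolv_diff: "resolv (f - g) = resolv f - resolv g"
 and dx1_diff: "dx1 (f - g) = dx1 f - dx1 g"
 and dx2_diff: "dx2 (f - g) = dx2 f - dx2 g"
 and resolv_add: "resolv (f + g) = resolv f + resolv g"
 and laplace_add: "laplace (f + g) = laplace f + laplace g"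
 and tscale_diff: "tscale c (f - g) = tscale c f - tscale c g"
 by (simp_all add: laplace_def resolv_def dx1_def dx2_def tscale_def fun_eq_iff algebra_simps diff_divide_distrib add_divide_distrib)

lemma laplace_resolv: "laplace (resolv f) = resolv f - f" by (simp add: laplace_bessel resolv_def fun_eq_iff field_simps)

lemma sob_le_laplace: assumes "sob_le s f A" shows "sob_le (s - 2) (laplace f) A"
proof -
 have "sob_le (s - 2) (laplace f) (1*A)"
 proof (rule sob_le_mult[where r = 2 and f = f])
  fix k
  have "\<bar>1 - bessel k\<bar> \<le> bessel k" using bessel_ge_1[of k] by linarith
  hence "\<bar>1 - bessel k\<bar>*norm (f k) \<le> bessel k*norm (f k)" by (rule mult_right_mono) simp
  moreover have "norm (laplace f k) = \<bar>1 - bessel k\<bar>*norm (f k)" by (simp only: laplace_bessel norm_mult norm_of_real)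
  moreover have "bessel k powr (2/2) = bessel k" using powr_one[OF less_imp_le[OF bessel_pos[of k]]] by simp
  ultimately show "norm (laplace f k) \<le> 1*bessel k powr (2/2)*norm (f k)" by (simp only: mult_1_left)
 qed (use assms in simp_all)
 thus ?thesis by simp
qed

lemma sob_le_resolv: assumes "sob_le s f A" shows "sob_le (s + 2) (resolv f) A"
proof -
 have "sob_le (s + 2) (resolv f) (1*A)"
 proof (rule sob_le_mult[where r = "- 2" and f = f])
  fix k
  have "bessel k powr (- 2/2) = inverse (bessel k)" using powr_minus[of "bessel k" 1] powr_one[OF less_imp_le[OF bessel_pos[of k]]] by simp
  moreover have "norm (resolv f k) = inverse (bessel k)*norm (f k)"
   unfolding resolv_def norm_divide norm_of_real abs_of_pos[OF bessel_pos] by (simp only: divide_inverse mult.commute)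
  ultimately show "norm (resolv f k) \<le> 1*bessel k powr (- 2/2)*norm (f k)" by (simp only: mult_1_left)
 qed (use assms in simp_all)
 thus ?thesis by simp
qed

context lp_blocks begin

lemma sob_le_ddir: assumes "sob_le s f A" "norm e \<le> 1" shows "sob_le (s - 1) (ddir e f) A"
proof -
 have "sob_le (s - 1) (ddir e f) (1*A)"
 proof (rule sob_le_mult[where r = 1 and f = f])
  fix k
  show "norm (ddir e f k) \<le> 1*bessel k powr (1/2)*norm (f k)"
  proof -
   have "norm (ddir e f k) = \<bar>2*pi*(freq k \<bullet> e)\<bar>*norm (f k)" unfolding ddir_def norm_mult norm_of_real norm_ii by simp
   moreover have "bessel k powr (1/2) = sqrt (bessel k)" by (rule powr_half_sqrt[OF less_imp_le[OF bessel_pos]])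
   ultimately show ?thesis using mult_right_mono[OF ddir_le_bessel[OF assms(2), of k] norm_ge_zero[of "f k"]] by (simp only: mult_1_left)
  qed
 qed (use assms in simp_all)
 thus ?thesis by simp
qed

lemma sob_le_dx:
 assumes "sob_le s f A" shows "sob_le (s - 1) (dx1 f) A" "sob_le (s - 1) (dx2 f) A" unfolding dx_ddir by (rule sob_le_ddir[OF assms], simp add: norm_Pair)+

text \<open>Constants for a Sobolev factor of order \<open>s\<close> against a noise factor of order
  \<open>b\<close>, named so that they visibly depend on the orders and not on the noise.\<close>

definition "kpos s b r = pcon s (b - r)*((4*bmax) powr (r/2)*cs s)"
definition "kneg s b = pcon s (b + 9/20)*((1 + 3*cpt)*cs s)"
definition "kneg' s b = pcon b (s + 9/20)*((1 + 3*cpt)*cs s)"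
definition "kres s b = 3*2 powr \<bar>s\<bar>*gsum (s + b)*cs s"

lemma para_pos_bound:
 assumes "0 \<le> r" "r < b" "r < s + b"
 shows "0 \<le> kpos s b r" "sob_le s f A ==> hi b B g ==> sob_le r (para P f g) (kpos s b r*(A*B))"
 using pcon_nonneg[of "b - r" s] para_lo_hi_pos(2)[OF sob_le_lo _ assms, of f A B g] cs_pos[of s] assms unfolding kpos_def by (simp_all add: mult_ac)

lemma para_neg_bound:
 assumes "- 9/20 < b" "- 9/20 < s + b"
 shows "0 \<le> kneg s b" "sob_le s f A ==> hi b B g ==> sob_le (- 9/10) (para P f g) (kneg s b*(A*B))"
 using pcon_nonneg[of "b + 9/20" s] para_lo_hi_neg(2)[OF sob_le_lo _ assms, of f A B g] cs_pos[of s] cpt_nonneg assms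
 unfolding kneg_def by (simp_all add: mult_ac)

lemma para_hi_neg_bound:
 assumes "- 9/20 < s" "- 9/20 < s + b"
 shows "0 \<le> kneg' s b" "sob_le s f A ==> hi b B g ==> sob_le (- 9/10) (para P g f) (kneg' s b*(A*B))"
 using pcon_nonneg[of "s + 9/20" b] para_hi_lo_neg(2)[OF _ sob_le_lo assms, of B g f A] cs_pos[of s] cpt_nonneg assms
 unfolding kneg'_def by (simp_all add: mult_ac)

lemma para_hi_bound:
 assumes "0 < s" "0 < s + b"
 shows "0 \<le> pcon b s*cs s" "sob_le s f A ==> hi b B g ==> sob_le 0 (para P g f) (pcon b s*cs s*(A*B))"
 using pcon_nonneg[of s b] para_hi_lo_0(2)[OF _ sob_le_lo assms, of B g f A] cs_pos[of s] assms by (simp_all add: mult_ac)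

lemma reso_bound:
 assumes "0 < s + b"
 shows "0 \<le> kres s b" "sob_le s f A ==> hi b B g ==> sob_le 0 (reso P f g) (kres s b*(A*B))"
 using reso_lo_hi(2)[OF sob_le_lo _ assms, of f A B g] cs_pos[of s] gsum(2)[OF assms] unfolding kres_def by (simp_all add: mult_ac)

end

locale model = lp_blocks P for P +
 fixes \<alpha> \<gamma> :: real and C :: "tdist \<Rightarrow> tdist \<Rightarrow> tdist \<Rightarrow> tdist"
 assumes range: "- 4/3 < \<alpha>" "\<alpha> < - 1" "2/3 < \<gamma>" "\<gamma> \<le> \<alpha> + 2"
  and com: "is_commutator P \<gamma> (\<alpha> + 2) \<alpha> C"
begin

text \<open>\<open>eta\<close> is the room spent on the noise: its norms are finite for every order
  below -1, so -1 - eta is used instead of \<alpha>, and the losses in \<open>hi_resolv\<close> and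
  \<open>hi_ddir\<close> are set to \<open>eta\<close>. \<open>\<kappa>\<close> is a quarter of the
  gap between \<alpha> and -1 and becomes the gain in \<open>W_bound\<close>; the assumption
  \<gamma> \<le> \<alpha> + 2 leaves room for it in the form \<gamma> + 4\<kappa> \<le> 1.\<close>

definition eta :: real where "eta = min (1/100) ((- 1 - \<alpha>)/16)"
definition \<kappa> :: real where "\<kappa> = (- 1 - \<alpha>)/4"

lemma eta: "0 < eta" "eta \<le> 1/100" "eta \<le> (- 1 - \<alpha>)/16"
proof -
 show "0 < eta" using range by (simp add: eta_def)
 show "eta \<le> 1/100" unfolding eta_def by (rule min.cobounded1)
 show "eta \<le> (- 1 - \<alpha>)/16" unfolding eta_def by (rule min.cobounded2)
qed

lemma kappa: "0 < \<kappa>" "\<kappa> < 1/12" "4*eta \<le> \<kappa>" "\<gamma> + 4*\<kappa> \<le> 1" "\<alpha> = - 1 - 4*\<kappa>"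
 using range eta(3) unfolding \<kappa>_def by - (simp_all add: field_simps)

text \<open>Later estimates see the noise only through \<open>Z\<close>, so they hold uniformly for
  the regularised noises and their limit. The orders of X and its derivatives follow from -1 - eta
  with a loss of \<open>eta\<close> per operation; the two entries of order \<alpha> and \<alpha> +
  2 are for the commutator.\<close>

definition noise :: "real \<Rightarrow> tdist \<Rightarrow> tdist \<Rightarrow> bool" where
 "noise Z xi Xi \<longleftrightarrow> hi (- 1 - eta) Z xi \<and> hi (1 - 2*eta) Z (resolv xi) \<and> hi (- 3*eta) Z (dx1 (resolv xi)) \<and>
  hi (- 3*eta) Z (dx2 (resolv xi)) \<and> hi (- 2*eta) Z Xi \<and> hi \<alpha> Z xi \<and> hi (\<alpha> + 2) Z (resolv xi)"

lemma noiseD: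
 assumes "noise Z xi Xi"
 shows "hi (- 1 - eta) Z xi" "hi (1 - 2*eta) Z (resolv xi)" "hi (- 3*eta) Z (dx1 (resolv xi))"
  "hi (- 3*eta) Z (dx2 (resolv xi))" "hi (- 2*eta) Z Xi" "hi \<alpha> Z xi" "hi (\<alpha> + 2) Z (resolv xi)"
 using assms unfolding noise_def by - (elim conjE, assumption)+

lemma noise_nonneg: "noise Z xi Xi ==> 0 \<le> Z" by (rule hi_nonneg[OF noiseD(1)])

lemma noise_mono: "noise Z xi Xi ==> Z \<le> Z' ==> noise Z' xi Xi" unfolding noise_def by (elim conjE, intro conjI) (rule hi_mono, assumption+)+

lemma noise_diff:
 assumes "noise Z xi Xi" "noise Z' xi' Xi'" shows "noise (Z + Z') (xi - xi') (Xi - Xi')" unfolding noise_def resolv_diff dx1_diff dx2_diff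
 by (intro conjI hi_diff noiseD[OF assms(1)] noiseD[OF assms(2)])

lemma noise_base:
 obtains c where "0 \<le> c" "\<And>Z xi Xi. hi (- 1 - eta) Z xi ==> hi (- 2*eta) Z Xi ==> noise (c*Z) xi Xi"
proof -
 obtain c1 where c1: "0 \<le> c1" "\<forall>a Z f. hi a Z f --> hi (a + 2 - eta) (c1*Z) (resolv f)" using hi_resolv[OF eta(1)] by (elim exE conjE)
 obtain c2 where c2: "0 \<le> c2" "\<forall>a Z f. hi a Z f --> hi (a - 1 - eta) (c2*Z) (ddir (1, 0) f)"
  using hi_ddir[OF eta(1), of "(1, 0)"] by (simp add: norm_Pair) (elim exE conjE)
 obtain c3 where c3: "0 \<le> c3" "\<forall>a Z f. hi a Z f --> hi (a - 1 - eta) (c3*Z) (ddir (0, 1) f)"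
  using hi_ddir[OF eta(1), of "(0, 1)"] by (simp add: norm_Pair) (elim exE conjE)
 define e1 where "e1 = 2 powr (- 1 - eta - \<alpha>)"
 define e2 where "e2 = 2 powr (1 - 2*eta - (\<alpha> + 2))"
 have e: "0 \<le> e1" "0 \<le> e2" by (simp_all add: e1_def e2_def)
 define c where "c = 1 + c1 + c2*c1 + c3*c1 + e1 + e2*c1"
 have cn: "0 \<le> c2*c1" "0 \<le> c3*c1" "0 \<le> e2*c1" using c1(1) c2(1) c3(1) e by simp_all
 show ?thesis
 proof (rule that[of c])
  show "0 \<le> c" using c1(1) e cn by (simp add: c_def)
  fix Z xi Xi assume x: "hi (- 1 - eta) Z xi" and y: "hi (- 2*eta) Z Xi"
  have Z: "0 \<le> Z" by (rule hi_nonneg[OF x])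
  have mono: "hi a (r*Z) f ==> r \<le> c ==> hi a (c*Z) f" for a r f by (erule hi_mono) (rule mult_right_mono[OF _ Z])
  have X: "hi (1 - 2*eta) (c1*Z) (resolv xi)"
  proof -
   have "hi (- 1 - eta + 2 - eta) (c1*Z) (resolv xi)" using c1(2)[rule_format, OF x] .
   moreover have "- 1 - eta + 2 - eta = 1 - 2*eta" by simp
   ultimately show ?thesis by (simp only:)
  qed
  have i: "1 - 2*eta - 1 - eta = - 3*eta" by simp
  have D1: "hi (- 3*eta) (c2*c1*Z) (dx1 (resolv xi))" using c2(2)[rule_format, OF X] unfolding i dx_ddir mult.assoc .
  have D2: "hi (- 3*eta) (c3*c1*Z) (dx2 (resolv xi))" using c3(2)[rule_format, OF X] unfolding i dx_ddir mult.assoc .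
  have A: "hi \<alpha> (e1*Z) xi" unfolding e1_def
  proof (rule hi_index[OF x])
   show "\<alpha> \<le> - 1 - eta" using kappa eta by linarith
  qed
  have AX: "hi (\<alpha> + 2) (e2*c1*Z) (resolv xi)" unfolding e2_def mult.assoc
  proof (rule hi_index[OF X])
   show "\<alpha> + 2 \<le> 1 - 2*eta" using kappa eta by linarith
  qed
  have le: "1 \<le> c" "c1 \<le> c" "c2*c1 \<le> c" "c3*c1 \<le> c" "e1 \<le> c" "e2*c1 \<le> c" using c1(1) e cn unfolding c_def by linarith+
  show "noise (c*Z) xi Xi" unfolding noise_def by (intro conjI mono[OF X le(2)] mono[OF D1 le(3)] mono[OF D2 le(4)] mono[OF A le(5)] mono[OF AX le(6)]
     mono[of _ 1, OF _ le(1)]) (simp_all only: mult_1_left x y)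
 qed
qed

end

context model begin

lemma C_facts:
 obtains c where "0 \<le> c"
  "\<And>f g h V Z Z'. sob_le \<gamma> f V ==> hi (\<alpha> + 2) Z g ==> hi \<alpha> Z' h ==> sob_le 0 (C f g h) (c*(Z*Z'*V))"
proof -
 obtain B where B: "\<forall>f\<in>sobolev \<gamma>. \<forall>g\<in>holder P (\<alpha> + 2). \<forall>h\<in>holder P \<alpha>.
    sobolev_norm (\<gamma> + (\<alpha> + 2) + \<alpha>) (C f g h) \<le> B * sobolev_norm \<gamma> f*holder_norm P (\<alpha> + 2) g*holder_norm P \<alpha> h"
  using com unfolding is_commutator_def by (elim conjE exE)
 have mem: "\<forall>f\<in>sobolev \<gamma>. \<forall>g\<in>holder P (\<alpha> + 2). \<forall>h\<in>holder P \<alpha>. C f g h \<in> sobolev (\<gamma> + (\<alpha> + 2) + \<alpha>)"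
  using com unfolding is_commutator_def by (elim conjE)
 show ?thesis
 proof (rule that[of "max B 0"])
  fix f g h V Z Z' assume f: "sob_le \<gamma> f V" and g: "hi (\<alpha> + 2) Z g" and h: "hi \<alpha> Z' h"
  have f': "f \<in> sobolev \<gamma>" "sobolev_norm \<gamma> f \<le> V" using f by (simp_all add: sob_le_iff)
  have g': "g \<in> holder P (\<alpha> + 2)" "holder_norm P (\<alpha> + 2) g \<le> Z" using g by (simp_all only: hi_iff_holder)
  have h': "h \<in> holder P \<alpha>" "holder_norm P \<alpha> h \<le> Z'" using h by (simp_all only: hi_iff_holder)
  have n: "0 \<le> sobolev_norm \<gamma> f" "0 \<le> holder_norm P (\<alpha> + 2) g" "0 \<le> holder_norm P \<alpha> h"
   using hi_nonneg[OF hi_holder[OF g'(1)]] hi_nonneg[OF hi_holder[OF h'(1)]] by simp_all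
  have "sobolev_norm (\<gamma> + (\<alpha> + 2) + \<alpha>) (C f g h) \<le> B * sobolev_norm \<gamma> f*holder_norm P (\<alpha> + 2) g*holder_norm P \<alpha> h"
   using B f'(1) g'(1) h'(1) by blast
  also have "... = B*(holder_norm P (\<alpha> + 2) g*holder_norm P \<alpha> h * sobolev_norm \<gamma> f)" by (simp only: mult_ac)
  also have "... \<le> max B 0*(Z*Z'*V)" using f'(2) g'(2) h'(2) n by (intro mult_mono) (auto intro!: mult_nonneg_nonneg)
  finally have "sob_le (\<gamma> + (\<alpha> + 2) + \<alpha>) (C f g h) (max B 0*(Z*Z'*V))" using mem f'(1) g'(1) h'(1) unfolding sob_le_iff by blast
  thus "sob_le 0 (C f g h) (max B 0*(Z*Z'*V))"
  proof (rule sob_le_index)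
   \<comment> \<open>The commutator lands in L2 because \<gamma> > 2/3 and 2\<alpha> + 2 >
     -2/3.\<close>
   show "0 \<le> \<gamma> + (\<alpha> + 2) + \<alpha>" using kappa(2,5) range(3) by linarith
  qed
 qed simp
qed

lemma C_diff:
 assumes f: "f \<in> sobolev \<gamma>" "f' \<in> sobolev \<gamma>" and g: "hi (\<alpha> + 2) Z g" "hi (\<alpha> + 2) Z' g'" and h: "hi \<alpha> Y h" "hi \<alpha> Y' h'"
 shows "C (f - f') g h = C f g h - C f' g h" "C f (g - g') h = C f g h - C f g' h" "C f g (h - h') = C f g h - C f g h'"
proof -
 have eq: "a - b = tscale (-1) b + a" for a b :: tdist by (simp add: tscale_def fun_eq_iff)
 have g': "g \<in> holder P (\<alpha> + 2)" "g' \<in> holder P (\<alpha> + 2)" using g by (simp_all only: hi_iff_holder)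
 have h': "h \<in> holder P \<alpha>" "h' \<in> holder P \<alpha>" using h by (simp_all only: hi_iff_holder)
 have 1: "\<forall>z. \<forall>f\<in>sobolev \<gamma>. \<forall>f'\<in>sobolev \<gamma>. \<forall>g\<in>holder P (\<alpha> + 2). \<forall>h\<in>holder P \<alpha>. C (tscale z f + f') g h = tscale z (C f g h) + C f' g h"
  using com unfolding is_commutator_def by (elim conjE)
 have 2: "\<forall>z. \<forall>f\<in>sobolev \<gamma>. \<forall>g\<in>holder P (\<alpha> + 2). \<forall>g'\<in>holder P (\<alpha> + 2). \<forall>h\<in>holder P \<alpha>. C f (tscale z g + g') h = tscale z (C f g h) + C f g' h"
  using com unfolding is_commutator_def by (elim conjE)
 have 3: "\<forall>z. \<forall>f\<in>sobolev \<gamma>. \<forall>g\<in>holder P (\<alpha> + 2). \<forall>h\<in>holder P \<alpha>. \<forall>h'\<in>holder P \<alpha>. C f g (tscale z h + h') = tscale z (C f g h) + C f g h'"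
  using com unfolding is_commutator_def by (elim conjE)
 show "C (f - f') g h = C f g h - C f' g h" unfolding eq using 1 f g' h' by blast
 show "C f (g - g') h = C f g h - C f g' h" unfolding eq using 2 f g' h' by blast
 show "C f g (h - h') = C f g h - C f g h'" unfolding eq using 3 f g' h' by blast
qed

lemma B_op_alt: "B_op P xi Xi v = resolv (para P (laplace v) (resolv xi)
  + tscale 2 (para P (dx1 v) (dx1 (resolv xi)) + para P (dx2 v) (dx2 (resolv xi))) + para P xi v + para P v Xi)" by (simp only: B_op_def Let_def)

lemma psums:
 assumes n: "noise Z xi Xi" and v: "v \<in> sobolev \<gamma>"
 shows "psum v (resolv xi)" "psum (laplace v) (resolv xi)" "psum (dx1 v) (dx1 (resolv xi))" "psum (dx2 v) (dx2 (resolv xi))"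
  "psum xi v" "psum v Xi" "psum Xi v" "rsum v Xi"
proof -
 note V = sobolev_sob_le[OF v] and g = range(3) eta(1,2)
 note lo = sob_le_lo[OF V] and lo1 = sob_le_lo[OF sob_le_dx(1)[OF V]] and lo2 = sob_le_lo[OF sob_le_dx(2)[OF V]]
  and lol = sob_le_lo[OF sob_le_laplace[OF V]]
 show "psum v (resolv xi)" by (rule para_lo_hi_neg(1)[OF lo noiseD(2)[OF n]]) (use g in linarith)+
 show "psum (laplace v) (resolv xi)" by (rule para_lo_hi_neg(1)[OF lol noiseD(2)[OF n]]) (use g in linarith)+
 show "psum (dx1 v) (dx1 (resolv xi))" by (rule para_lo_hi_neg(1)[OF lo1 noiseD(3)[OF n]]) (use g in linarith)+
 show "psum (dx2 v) (dx2 (resolv xi))" by (rule para_lo_hi_neg(1)[OF lo2 noiseD(4)[OF n]]) (use g in linarith)+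
 show "psum xi v" by (rule para_hi_lo_neg(1)[OF noiseD(1)[OF n] lo]) (use g in linarith)+
 show "psum v Xi" by (rule para_lo_hi_neg(1)[OF lo noiseD(5)[OF n]]) (use g in linarith)+
 show "psum Xi v" by (rule para_hi_lo_neg(1)[OF noiseD(5)[OF n] lo]) (use g in linarith)+
 show "rsum v Xi" by (rule reso_lo_hi(1)[OF lo noiseD(5)[OF n]]) (use g in linarith)
qed

lemma rsum_noise:
 assumes n: "noise Z xi Xi" and R: "R \<in> sobolev (11/10)" shows "rsum R xi"
 by (rule reso_lo_hi(1)[OF sob_le_lo[OF sobolev_sob_le[OF R]] noiseD(1)[OF n]]) (use eta(2) in linarith)

lemma B_diff:
 assumes n: "noise Z xi Xi" and u: "u \<in> sobolev \<gamma>" and v: "v \<in> sobolev \<gamma>"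
 shows "B_op P xi Xi (u - v) = B_op P xi Xi u - B_op P xi Xi v" unfolding B_op_alt laplace_diff dx1_diff dx2_diff resolv_diff[symmetric]
  para_diff_left(2)[OF psums(2)[OF n u] psums(2)[OF n v]] para_diff_left(2)[OF psums(3)[OF n u] psums(3)[OF n v]]
  para_diff_left(2)[OF psums(4)[OF n u] psums(4)[OF n v]] para_diff_right(2)[OF psums(5)[OF n u] psums(5)[OF n v]]
  para_diff_left(2)[OF psums(6)[OF n u] psums(6)[OF n v]] by (rule arg_cong[where f = resolv]) (simp add: tscale_def fun_eq_iff algebra_simps)

lemma B_noise_diff:
 assumes n: "noise Z xi Xi" and n': "noise Z' xi' Xi'" and v: "v \<in> sobolev \<gamma>"
 shows "B_op P (xi - xi') (Xi - Xi') v = B_op P xi Xi v - B_op P xi' Xi' v" unfolding B_op_alt resolv_diff[of xi] dx1_diff dx2_diff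
  para_diff_right(2)[OF psums(2)[OF n v] psums(2)[OF n' v]] para_diff_right(2)[OF psums(3)[OF n v] psums(3)[OF n' v]]
  para_diff_right(2)[OF psums(4)[OF n v] psums(4)[OF n' v]] para_diff_left(2)[OF psums(5)[OF n v] psums(5)[OF n' v]]
  para_diff_right(2)[OF psums(6)[OF n v] psums(6)[OF n' v]] unfolding resolv_diff[of "_ + _", symmetric]
 by (rule arg_cong[where f = resolv]) (simp add: tscale_def fun_eq_iff algebra_simps)

definition "cB = kneg (\<gamma> - 2) (1 - 2*eta) + 4*kneg (\<gamma> - 1) (- 3*eta) + kneg' \<gamma> (- 1 - eta) + kneg \<gamma> (- 2*eta)"

text \<open>All four paraproducts are put into order -9/10, and the resolvent adds 2. The critical
  ones have total order about \<gamma> - 1, which is above -1/3 and so clears the threshold -9/20 of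
  the paraproduct bounds. The resulting order 11/10 exceeds 1 + eta, so the resonant product with
  the noise converges.\<close>

lemma cB: "0 \<le> cB"
 and B_bound: "noise Z xi Xi ==> sob_le \<gamma> v V ==> sob_le (11/10) (B_op P xi Xi v) (cB*(Z*V))"
proof -
 note g = range(3) eta(1,2)
 have e: "- 9/20 < 1 - 2*eta" "- 9/20 < \<gamma> - 2 + (1 - 2*eta)" "- 9/20 < - 3*eta" "- 9/20 < \<gamma> - 1 + - 3*eta"
  "- 9/20 < \<gamma>" "- 9/20 < \<gamma> + (- 1 - eta)" "- 9/20 < - 2*eta" "- 9/20 < \<gamma> + - 2*eta" using g by linarith+
 note c1 = para_neg_bound[OF e(1,2)] and c2 = para_neg_bound[OF e(3,4)] and c3 = para_hi_neg_bound[OF e(5,6)] and c4 = para_neg_bound[OF e(7,8)]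
 show "0 \<le> cB" unfolding cB_def using c1(1) c2(1) c3(1) c4(1) by simp
 assume n: "noise Z xi Xi" and V: "sob_le \<gamma> v V"
 have "sob_le (- 9/10 + 2) (B_op P xi Xi v) (kneg (\<gamma> - 2) (1 - 2*eta)*(V*Z) + norm (2 :: complex)*(kneg (\<gamma> - 1) (- 3*eta)*(V*Z) + kneg (\<gamma> - 1) (- 3*eta)*(V*Z))
   + kneg' \<gamma> (- 1 - eta)*(V*Z) + kneg \<gamma> (- 2*eta)*(V*Z))" unfolding B_op_alt
  by (intro sob_le_resolv sob_le_add sob_le_tscale c1(2)[OF sob_le_laplace[OF V]] c2(2)[OF sob_le_dx(1)[OF V]] c2(2)[OF sob_le_dx(2)[OF V]]
    c3(2)[OF V] c4(2)[OF V] noiseD[OF n])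
 thus "sob_le (11/10) (B_op P xi Xi v) (cB*(Z*V))" by (simp add: cB_def algebra_simps)
qed

definition Wop :: "tdist \<Rightarrow> tdist \<Rightarrow> tdist \<Rightarrow> tdist" where
 "Wop xi Xi v = para P v (resolv xi) + B_op P xi Xi v"

lemma R_op_W: "R_op P xi Xi v = v - Wop xi Xi v" by (simp add: R_op_def Wop_def fun_eq_iff)

definition "cW = kpos \<gamma> (1 - 2*eta) (\<gamma> + \<kappa>) + cB"

text \<open>The paracontrolled part is smoother than \<open>v\<close>: the paraproduct takes its
  order from X, which is 1 - 2*eta, and \<gamma> + \<kappa> stays below that. Because of this gain
  the part becomes negligible for a large resolvent parameter.\<close>

lemma cW: "0 \<le> cW"
 and W_bound: "noise Z xi Xi ==> sob_le \<gamma> v V ==> sob_le (\<gamma> + \<kappa>) (Wop xi Xi v) (cW*(Z*V))"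
proof -
 have e: "0 \<le> \<gamma> + \<kappa>" "\<gamma> + \<kappa> < 1 - 2*eta" "\<gamma> + \<kappa> < \<gamma> + (1 - 2*eta)" "\<gamma> + \<kappa> \<le> 11/10"
  using range(3) kappa eta(1,2) by linarith+
 note c1 = para_pos_bound[OF e(1-3)]
 show "0 \<le> cW" unfolding cW_def using c1(1) cB by simp
 assume n: "noise Z xi Xi" and V: "sob_le \<gamma> v V"
 from sob_le_add[OF c1(2)[OF V noiseD(2)[OF n]] sob_le_index[OF B_bound[OF n V] e(4)]]
 show "sob_le (\<gamma> + \<kappa>) (Wop xi Xi v) (cW*(Z*V))" by (simp add: Wop_def cW_def algebra_simps)
qed

lemma W_diff:
 assumes n: "noise Z xi Xi" and u: "u \<in> sobolev \<gamma>" and v: "v \<in> sobolev \<gamma>"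
 shows "Wop xi Xi (u - v) = Wop xi Xi u - Wop xi Xi v" unfolding Wop_def B_diff[OF assms] para_diff_left(2)[OF psums(1)[OF n u] psums(1)[OF n v]]
 by (simp add: fun_eq_iff)

lemma W_noise_diff:
 assumes n: "noise Z xi Xi" and n': "noise Z' xi' Xi'" and v: "v \<in> sobolev \<gamma>"
 shows "Wop (xi - xi') (Xi - Xi') v = Wop xi Xi v - Wop xi' Xi' v"
 unfolding Wop_def B_noise_diff[OF assms] resolv_diff[of xi] para_diff_right(2)[OF psums(1)[OF n v] psums(1)[OF n' v]] by (simp add: fun_eq_iff)

text \<open>The part of A v that is linear in the pair (xi, Xi), as a function of \<open>v\<close>
  and the remainder separately, so that differences in the noise and in the solution can be taken
  independently.\<close>

definition Lop :: "tdist \<Rightarrow> tdist \<Rightarrow> tdist \<Rightarrow> tdist \<Rightarrow> tdist" where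
 "Lop xi Xi v R = reso P R xi + para P v (resolv xi) + B_op P xi Xi v + para P Xi v + reso P v Xi"

text \<open>The part quadratic in the noise. The second copy of the noise is an argument of its own,
  so that for two noises the difference splits into two terms, each linear in the difference of the
  noises.\<close>

definition Kop :: "tdist \<Rightarrow> tdist \<Rightarrow> tdist \<Rightarrow> tdist \<Rightarrow> tdist" where
 "Kop xi Xi xi' v = C v (resolv xi) xi' + reso P (B_op P xi Xi v) xi'"

lemma B_mem: "noise Z xi Xi ==> v \<in> sobolev \<gamma> ==> B_op P xi Xi v \<in> sobolev (11/10)" by (rule sob_le_sobolev[OF B_bound[OF _ sobolev_sob_le]])

text \<open>Write \<xi> = X - \<Delta>X. The Leibniz rule turns v \<prec> \<xi> into v \<prec> X -
  \<Delta>(v \<prec> X) plus the derivative terms of \<open>B_op\<close>. The Laplacian completes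
  \<Delta>v to \<Delta>R; since \<Delta>B equals B minus the bracket that defines it, the derivative
  terms, \<xi> \<prec> v and the paraproduct v \<prec> \<Xi> from Bony's decomposition cancel.
  Everything left over is bounded into L2.\<close>

lemma A_op_decomp:
 assumes n: "noise Z xi Xi" and v: "v \<in> sobolev \<gamma>"
 shows "A_op P C xi Xi v = laplace (R_op P xi Xi v) + Lop xi Xi v (R_op P xi Xi v) + Kop xi Xi xi v"
proof -
 let ?X = "resolv xi"
 note ps = psums[OF n v]
 have "xi = ?X - laplace ?X" by (simp add: laplace_resolv fun_eq_iff)
 hence "para P v xi = para P v (?X - laplace ?X)" by (rule arg_cong)
 also have "... = para P v ?X - para P v (laplace ?X)" by (rule para_diff_right(2)[OF ps(1) para_leibniz(1)[OF ps(1-4)]])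
 finally have 1: "para P v xi = para P v ?X - (laplace (para P v ?X) - para P (laplace v) ?X - tscale 2 (para P (dx1 v) (dx1 ?X) + para P (dx2 v) (dx2 ?X)))"
  unfolding para_leibniz(2)[OF ps(1-4)] .
 have 2: "tmul v Xi = para P v Xi + reso P v Xi + para P Xi v" by (rule bony[OF sobolev_sob_le[OF v] noiseD(5)[OF n]]) (use range(3) eta(1,2) in linarith)+
 have 3: "laplace (B_op P xi Xi v) = B_op P xi Xi v - (para P (laplace v) ?X
  + tscale 2 (para P (dx1 v) (dx1 ?X) + para P (dx2 v) (dx2 ?X)) + para P xi v + para P v Xi)" unfolding B_op_alt by (rule laplace_resolv)
 have 4: "laplace (R_op P xi Xi v) = laplace v - laplace (para P v ?X) - laplace (B_op P xi Xi v)" unfolding R_op_def laplace_diff ..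
 show ?thesis unfolding A_op_def Lop_def Kop_def 1 2 4 3 by (simp add: fun_eq_iff)
qed

definition "cL = kres (11/10) (- 1 - eta) + kpos \<gamma> (1 - 2*eta) 0 + cB + pcon (- 2*eta) \<gamma>*cs \<gamma> + kres \<gamma> (- 2*eta)"
definition "cK = (SOME c. 0 \<le> c \<and> (\<forall>f g h V Z Z'. sob_le \<gamma> f V --> hi (\<alpha> + 2) Z g --> hi \<alpha> Z' h --> sob_le 0 (C f g h) (c*(Z*Z'*V))))
 + kres (11/10) (- 1 - eta)*cB"

lemma cL: "0 \<le> cL"
 and L_bound: "noise Z xi Xi ==> sob_le \<gamma> v V ==> sob_le (11/10) R r ==> sob_le 0 (Lop xi Xi v R) (cL*(Z*(V + r)))"
 and cK: "0 \<le> cK"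
 and K_bound: "noise Z xi Xi ==> noise Z' xi' Xi' ==> sob_le \<gamma> v V ==> sob_le 0 (Kop xi Xi xi' v) (cK*(Z*Z'*V))"
proof -
 note g = range(3) eta(1,2)
 have e: "0 < 11/10 + (- 1 - eta)" "0 < 1 - 2*eta" "0 < \<gamma> + (1 - 2*eta)" "0 < \<gamma>" "0 < \<gamma> + - 2*eta" using g by linarith+
 note c1 = reso_bound[OF e(1)] and c2 = para_pos_bound[OF order_refl e(2,3)] and c4 = para_hi_bound[OF e(4,5)] and c5 = reso_bound[OF e(5)]
 show nn: "0 \<le> cL" unfolding cL_def using c1(1) c2(1) cB c4(1) c5(1) by simp
 let ?P = "\<lambda>c. 0 \<le> c \<and> (\<forall>f g h V Z Z'. sob_le \<gamma> f V --> hi (\<alpha> + 2) Z g --> hi \<alpha> Z' h --> sob_le 0 (C f g h) (c*(Z*Z'*V)))"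
 have "\<exists>c. ?P c" by (rule C_facts) blast
 from someI_ex[OF this] obtain c where c: "?P c" and cc: "cK = c + kres (11/10) (- 1 - eta)*cB" unfolding cK_def by blast
 show "0 \<le> cK" unfolding cc using c c1(1) cB by simp
 assume n: "noise Z xi Xi" and V: "sob_le \<gamma> v V"
 {
  assume r: "sob_le (11/10) R r"
  have nz: "0 \<le> Z" "0 \<le> V" "0 \<le> r" by (rule noise_nonneg[OF n], rule sob_leD_nonneg[OF V], rule sob_leD_nonneg[OF r])
  let ?a = "kres (11/10) (- 1 - eta)" and ?b = "kpos \<gamma> (1 - 2*eta) 0" and ?c = "pcon (- 2*eta) \<gamma>*cs \<gamma>" and ?d = "kres \<gamma> (- 2*eta)"
  have "sob_le 0 (Lop xi Xi v R) (?a*(r*Z) + ?b*(V*Z) + cB*(Z*V) + ?c*(V*Z) + ?d*(V*Z))" unfolding Lop_def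
   by (intro sob_le_add c1(2)[OF r] c2(2)[OF V] c4(2)[OF V] c5(2)[OF V] noiseD[OF n] sob_le_index[OF B_bound[OF n V]]) simp
  thus "sob_le 0 (Lop xi Xi v R) (cL*(Z*(V + r)))"
  proof (rule sob_le_mono)
   have "0 \<le> ?a*(Z*V) + (?b + cB + ?c + ?d)*(Z*r)" using nz c1(1) c2(1) cB c4(1) c5(1) by (intro c4(1) add_nonneg_nonneg mult_nonneg_nonneg)
   thus "?a*(r*Z) + ?b*(V*Z) + cB*(Z*V) + ?c*(V*Z) + ?d*(V*Z) \<le> cL*(Z*(V + r))" unfolding cL_def by (simp add: algebra_simps)
  qed
 }
 assume n': "noise Z' xi' Xi'"
 have "sob_le 0 (Kop xi Xi xi' v) (c*(Z*Z'*V) + kres (11/10) (- 1 - eta)*(cB*(Z*V)*Z'))"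
  unfolding Kop_def using c V noiseD(7)[OF n] noiseD(6)[OF n'] by (intro sob_le_add c1(2)[OF B_bound[OF n V] noiseD(1)[OF n']]) blast
 thus "sob_le 0 (Kop xi Xi xi' v) (cK*(Z*Z'*V))" by (simp add: cc algebra_simps)
qed

lemma L_diff:
 assumes n: "noise Z xi Xi" and v: "v \<in> sobolev \<gamma>" "v' \<in> sobolev \<gamma>" and R: "R \<in> sobolev (11/10)" "R' \<in> sobolev (11/10)"
 shows "Lop xi Xi (v - v') (R - R') = Lop xi Xi v R - Lop xi Xi v' R'"
 unfolding Lop_def B_diff[OF n v] para_diff_left(2)[OF psums(1)[OF n v(1)] psums(1)[OF n v(2)]]
  para_diff_right(2)[OF psums(7)[OF n v(1)] psums(7)[OF n v(2)]] reso_diff_left(2)[OF psums(8)[OF n v(1)] psums(8)[OF n v(2)]]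
  reso_diff_left(2)[OF rsum_noise[OF n R(1)] rsum_noise[OF n R(2)]] by (simp add: fun_eq_iff)

lemma L_noise_diff:
 assumes n: "noise Z xi Xi" and n': "noise Z' xi' Xi'" and v: "v \<in> sobolev \<gamma>" and R: "R \<in> sobolev (11/10)"
 shows "Lop (xi - xi') (Xi - Xi') v R = Lop xi Xi v R - Lop xi' Xi' v R"
 unfolding Lop_def B_noise_diff[OF n n' v] resolv_diff[of xi] para_diff_right(2)[OF psums(1)[OF n v] psums(1)[OF n' v]]
  para_diff_left(2)[OF psums(7)[OF n v] psums(7)[OF n' v]] reso_diff_right(2)[OF psums(8)[OF n v] psums(8)[OF n' v]]
  reso_diff_right(2)[OF rsum_noise[OF n R] rsum_noise[OF n' R]] by (simp add: fun_eq_iff)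

lemma K_diff:
 assumes n: "noise Z xi Xi" and v: "v \<in> sobolev \<gamma>" "v' \<in> sobolev \<gamma>"
 shows "Kop xi Xi xi (v - v') = Kop xi Xi xi v - Kop xi Xi xi v'"
 unfolding Kop_def B_diff[OF n v] C_diff(1)[OF v noiseD(7)[OF n] noiseD(7)[OF n] noiseD(6)[OF n] noiseD(6)[OF n]]
  reso_diff_left(2)[OF rsum_noise[OF n B_mem[OF n v(1)]] rsum_noise[OF n B_mem[OF n v(2)]]] by (simp add: fun_eq_iff)

lemma K_noise_diff:
 assumes n: "noise Z xi Xi" and n': "noise Z' xi' Xi'" and v: "v \<in> sobolev \<gamma>"
 shows "Kop xi Xi xi v - Kop xi' Xi' xi' v = Kop (xi - xi') (Xi - Xi') xi v + Kop xi' Xi' (xi - xi') v"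
 unfolding Kop_def B_noise_diff[OF n n' v] resolv_diff[of xi]
  C_diff(2)[OF v v noiseD(7)[OF n] noiseD(7)[OF n'] noiseD(6)[OF n] noiseD(6)[OF n]]
  C_diff(3)[OF v v noiseD(7)[OF n'] noiseD(7)[OF n'] noiseD(6)[OF n] noiseD(6)[OF n']]
  reso_diff_left(2)[OF rsum_noise[OF n B_mem[OF n v]] rsum_noise[OF n B_mem[OF n' v]]]
  reso_diff_right(2)[OF rsum_noise[OF n B_mem[OF n' v]] rsum_noise[OF n' B_mem[OF n' v]]] by (simp add: fun_eq_iff)

end

section \<open>Resolvent estimates\<close>

text \<open>The resolvent (l - \<Delta>)^(-1), as \<open>bessel\<close> is the symbol of 1 -
  \<Delta>.\<close>

definition mres :: "real \<Rightarrow> tdist \<Rightarrow> tdist" where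
 "mres l f = (\<lambda>k. f k/of_real (l - 1 + bessel k))"

lemma bessel_nonneg [simp]: "0 \<le> bessel k" by (rule less_imp_le[OF bessel_pos])

lemma mres_pos: "1 \<le> l ==> 0 < l - 1 + bessel k" using bessel_ge_1[of k] by linarith

text \<open>Both \<open>l\<close> and \<open>bessel k\<close> are at most the denominator, hence so
  is every weighted geometric mean of them: raising the order by 2a leaves the power a - 1 of
  \<open>l\<close>.\<close>

lemma sob_le_mres:
 assumes f: "sob_le r f A" and l: "1 \<le> l" and s: "0 \<le> (s - r)/2" "(s - r)/2 \<le> 1"
 shows "sob_le s (mres l f) (l powr ((s - r)/2 - 1)*A)"
proof (rule sob_le_mult[where r = "r - s" and f = f])
 show "sob_le (s + (r - s)) f A" using f by simp
 fix k
 let ?a = "(s - r)/2" and ?D = "l - 1 + bessel k"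
 have D: "l \<le> ?D" "bessel k \<le> ?D" "0 < ?D" using l bessel_ge_1[of k] by linarith+
 have "bessel k powr ?a*l powr (1 - ?a) \<le> ?D powr ?a*?D powr (1 - ?a)" using D l s by (intro mult_mono powr_mono2) simp_all
 also have "... = ?D" using D(3) by (simp add: powr_add[symmetric])
 finally have 1: "bessel k powr ?a*l powr (1 - ?a) \<le> ?D" .
 have "1/?D \<le> 1/(bessel k powr ?a*l powr (1 - ?a))" using 1 l D(3) by (intro divide_left_mono mult_pos_pos) simp_all
 also have "... = l powr (?a - 1)*bessel k powr ((r - s)/2)"
 proof -
  have "l powr (?a - 1) = inverse (l powr (1 - ?a))" using powr_minus[of l "1 - ?a"] by simp
  moreover have "bessel k powr ((r - s)/2) = inverse (bessel k powr ?a)"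
  proof -
   have "(r - s)/2 = - ?a" by (simp add: field_simps)
   thus ?thesis by (simp only: powr_minus)
  qed
  ultimately show ?thesis by (simp only: divide_inverse inverse_mult_distrib mult_1_left mult.commute)
 qed
 finally have 2: "1/?D \<le> l powr (?a - 1)*bessel k powr ((r - s)/2)" .
 have "norm (mres l f k) = norm (f k)/?D" unfolding mres_def norm_divide norm_of_real using D(3) by simp
 also have "... = 1/?D*norm (f k)" by simp
 also have "... \<le> l powr (?a - 1)*bessel k powr ((r - s)/2)*norm (f k)" by (rule mult_right_mono[OF 2]) simp
 finally show "norm (mres l f k) \<le> l powr (?a - 1)*bessel k powr ((r - s)/2)*norm (f k)" .
qed simp

text \<open>The bound for \<open>R\<close> has a growing power of \<open>l\<close> in front of
  \<open>Om\<close>, so the quantities are combined with a weight, W + l^(-q)*R with q = p + 1/10.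
  Then all unknowns on the right carry at most l^(-k) and can be absorbed. Undoing the weight costs
  l^q, and the worst exponent is -1/2 + 22/100 + 1/10 = -18/100.\<close>

lemma combine_bounds:
 fixes l p k W R S E Om c e o' :: real
 assumes l: "1 \<le> l" and p: "1/20 \<le> p" "p \<le> 22/100" and k: "0 \<le> k" "k \<le> 1/10"
  and nn: "0 \<le> W" "0 \<le> R" "0 \<le> S" "0 \<le> E" "0 \<le> Om" "0 \<le> c" "0 \<le> e" "0 \<le> o'"
  and W: "W \<le> l powr (- 1/2)*(S + E) + l powr (- k)*Om"
  and R: "R \<le> l powr (- 9/20)*(S + E) + l powr p*Om"
  and E: "E \<le> c*(W + R) + e" and Om: "Om \<le> c*W + o'" and c: "4*c*l powr (- k) \<le> 1/2"
 shows "W + R \<le> 4*l powr (- 18/100)*S + 4*l*(e + o')"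
proof -
 let ?q = "p + 1/10"
 define t u where "t = l powr ?q" and "u = l powr (- ?q)"
 define a b where "a = l powr (- 1/2)" and "b = l powr (- k)"
 have l0: "0 < l" using l by simp
 have tu: "t*u = 1" unfolding t_def u_def using l0 by (simp add: powr_add[symmetric])
 have t1: "1 \<le> t" unfolding t_def using l p by (intro ge_one_powr_ge_zero) simp_all
 have u0: "0 \<le> u" by (simp add: u_def)
 have a1: "0 \<le> a" "a \<le> 1" unfolding a_def using l powr_mono[of "-1/2" 0 l] by simp_all
 have b1: "0 \<le> b" "b \<le> 1" unfolding b_def using l k powr_mono[of "-k" 0 l] by simp_all
 define Y where "Y = W + u*R"
 have Y0: "0 \<le> Y" unfolding Y_def using nn u0 by simp
 have "t*Y = t*W + (t*u)*R" unfolding Y_def by (simp only: distrib_left mult.assoc)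
 hence tY: "t*Y = t*W + R" by (simp only: tu mult_1_left)
 have WR: "W + R \<le> t*Y" using mult_right_mono[OF t1 nn(1)] unfolding tY by simp
 have WY: "W \<le> Y" unfolding Y_def using nn u0 by simp
 have u1: "u*l powr (- 9/20) \<le> a" "u*l powr p \<le> b"
 proof -
  have "u*l powr (- 9/20) = l powr (- ?q + - 9/20)" unfolding u_def by (rule powr_add[symmetric])
  also have "... \<le> a" unfolding a_def using l p by (intro powr_mono) simp_all
  finally show "u*l powr (- 9/20) \<le> a" .
  have "u*l powr p = l powr (- ?q + p)" unfolding u_def by (rule powr_add[symmetric])
  also have "... \<le> b" unfolding b_def using l k by (intro powr_mono) simp_all
  finally show "u*l powr p \<le> b" .
 qed
 have "u*R \<le> u*(l powr (- 9/20)*(S + E) + l powr p*Om)" by (rule mult_left_mono[OF R u0])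
 also have "... = (u*l powr (- 9/20))*(S + E) + (u*l powr p)*Om" by (simp only: distrib_left mult.assoc)
 also have "... \<le> a*(S + E) + b*Om" using nn by (intro add_mono mult_right_mono u1) simp_all
 finally have Y1: "Y \<le> 2*a*(S + E) + 2*b*Om" using W unfolding Y_def a_def[symmetric] b_def[symmetric] by linarith
 have at: "a*t \<le> b"
 proof -
  have "a*t = l powr (- 1/2 + ?q)" unfolding a_def t_def by (rule powr_add[symmetric])
  also have "... \<le> b" unfolding b_def using l p k by (intro powr_mono) simp_all
  finally show ?thesis .
 qed
 have "a*E \<le> a*(c*(t*Y) + e)" using E mult_left_mono[OF WR nn(6)] a1 by (intro mult_left_mono) simp_all
 also have "... = (a*t)*(c*Y) + a*e" by (simp only: distrib_left mult_ac)
 also have "... \<le> b*(c*Y) + 1*e" using nn Y0 a1 by (intro add_mono mult_right_mono at) simp_all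
 finally have aE: "a*E \<le> b*(c*Y) + e" by simp
 have "b*Om \<le> b*(c*Y + o')" using Om mult_left_mono[OF WY nn(6)] b1 by (intro mult_left_mono) simp_all
 also have "... = b*(c*Y) + b * o'" by (rule distrib_left)
 also have "... \<le> b*(c*Y) + 1 * o'" using nn b1 by (intro add_mono mult_right_mono order_refl) simp_all
 finally have bO: "b*Om \<le> b*(c*Y) + o'" by simp
 have "4*c*b*Y \<le> 1/2*Y" unfolding b_def by (rule mult_right_mono[OF c Y0])
 hence cY: "4*(b*(c*Y)) \<le> 1/2*Y" by (simp only: mult_ac)
 have "2*a*(S + E) + 2*b*Om = 2*(a*S) + 2*(a*E) + 2*(b*Om)" by (simp add: algebra_simps)
 moreover have lin: "Y \<le> x ==> x = 2*f + 2*g + 2*h ==> g \<le> i + e ==> h \<le> i + o' ==> Y \<le> 2*f + 4*i + 2*(e + o')" for x f g h i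
  by (simp add: algebra_simps)
 ultimately have "Y \<le> 2*(a*S) + 4*(b*(c*Y)) + 2*(e + o')" using Y1 aE bO by (rule_tac lin)
 hence Y2: "Y \<le> 4*(a*S) + 4*(e + o')" using cY by linarith
 have "W + R \<le> t*(4*(a*S) + 4*(e + o'))" using WR mult_left_mono[OF Y2, of t] t1 by linarith
 also have "... = 4*(a*t)*S + 4*t*(e + o')" by (simp only: distrib_left mult_ac)
 also have "... \<le> 4*l powr (- 18/100)*S + 4*l*(e + o')"
 proof (intro add_mono mult_right_mono mult_left_mono)
  have "a*t = l powr (- 1/2 + ?q)" unfolding a_def t_def by (rule powr_add[symmetric])
  also have "... \<le> l powr (- 18/100)" using l p by (intro powr_mono) simp_all
  finally show "a*t \<le> l powr (- 18/100)" .
  have "t \<le> l powr 1" unfolding t_def using l p by (intro powr_mono) simp_all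
  thus "t \<le> l" using l by simp
 qed (use nn in simp_all)
 finally show ?thesis .
qed

context model begin

abbreviation "Rop \<equiv> R_op P"
abbreviation "Aop \<equiv> A_op P C"
abbreviation "Adom \<equiv> A_dom P \<gamma>"

lemma AdomD:
 assumes "v \<in> Adom xi Xi" shows "v \<in> sobolev \<gamma>" "Rop xi Xi v \<in> sobolev 2" "Rop xi Xi v \<in> sobolev (11/10)"
proof -
 show "v \<in> sobolev \<gamma>" and 2: "Rop xi Xi v \<in> sobolev 2" using assms by (simp_all add: A_dom_def)
 show "Rop xi Xi v \<in> sobolev (11/10)" by (rule sob_le_sobolev[OF sob_le_index[OF sobolev_sob_le[OF 2]]]) simp
qed

abbreviation "res l xi Xi v \<equiv> tscale (of_real l) v - Aop xi Xi v"
abbreviation "dn xi Xi v \<equiv> sobolev_norm \<gamma> v + sobolev_norm (11/10) (Rop xi Xi v)"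

text \<open>Two noises and two solutions in one statement serve twice: with the second solution zero
  it is an a priori bound, with equal right-hand sides it is stability of the resolvent in the
  noise.\<close>

definition "resolvent_bound Z l0 c \<longleftrightarrow> (\<forall>l xi1 Xi1 xi2 Xi2 d v1 v2 S. l0 \<le> l --> noise Z xi1 Xi1 --> noise Z xi2 Xi2 --> noise d (xi1 - xi2) (Xi1 - Xi2) -->
   v1 \<in> Adom xi1 Xi1 --> v2 \<in> Adom xi2 Xi2 -->
   sob_le 0 (res l xi1 Xi1 v1 - res l xi2 Xi2 v2) S -->
   sobolev_norm \<gamma> (v1 - v2) + sobolev_norm (11/10) (Rop xi1 Xi1 v1 - Rop xi2 Xi2 v2)
    \<le> 4*l powr (- 18/100)*S + c*l*d*(dn xi2 Xi2 v2))"

lemma main_estimate: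
 assumes Z: "0 \<le> Z"
 obtains l0 c where "1 \<le> l0" "0 \<le> c" "resolvent_bound Z l0 c"
proof -
 define c1 where "c1 = cL*Z + cK*(Z*Z) + cW*Z"
 have c1: "0 \<le> c1" unfolding c1_def using Z cL cK cW by simp
 \<comment> \<open>Chosen so that l^(\<kappa>/2) \<ge> 8*c1 + 1 for l \<ge> l0, which is the
   smallness that \<open>combine_bounds\<close> asks for with k = \<kappa>/2.\<close>
 define l0 where "l0 = (8*c1 + 1) powr (2/\<kappa>)"
 have l0: "1 \<le> l0" unfolding l0_def using c1 kappa(1) by (intro ge_one_powr_ge_zero) simp_all
 define c2 where "c2 = cL + 2*cK*Z + cW"
 have c2: "0 \<le> c2" unfolding c2_def using Z cL cK cW by simp
 show ?thesis
 proof (rule that[of l0 "4*c2"])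
  show "1 \<le> l0" by (rule l0)
  show "0 \<le> 4*c2" using c2 by simp
  show "resolvent_bound Z l0 (4*c2)" unfolding resolvent_bound_def
  proof (intro allI impI)
   fix l xi1 Xi1 xi2 Xi2 d v1 v2 S
   assume l: "l0 \<le> l" and n1: "noise Z xi1 Xi1" and n2: "noise Z xi2 Xi2" and nd: "noise d (xi1 - xi2) (Xi1 - Xi2)"
    and v1: "v1 \<in> Adom xi1 Xi1" and v2: "v2 \<in> Adom xi2 Xi2"
    and S: "sob_le 0 (res l xi1 Xi1 v1 - res l xi2 Xi2 v2) S"
   note D1 = AdomD[OF v1] and D2 = AdomD[OF v2]
   let ?R1 = "Rop xi1 Xi1 v1" and ?R2 = "Rop xi2 Xi2 v2"
   define w \<rho> where "w = v1 - v2" and "\<rho> = ?R1 - ?R2"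
   define s where "s = res l xi1 Xi1 v1 - res l xi2 Xi2 v2"
   define \<omega> where "\<omega> = Wop xi1 Xi1 w + Wop (xi1 - xi2) (Xi1 - Xi2) v2"
   define E1 where "E1 = Lop xi1 Xi1 w \<rho> + Kop xi1 Xi1 xi1 w"
   define E2 where "E2 = Lop (xi1 - xi2) (Xi1 - Xi2) v2 ?R2 + (Kop (xi1 - xi2) (Xi1 - Xi2) xi1 v2 + Kop xi2 Xi2 (xi1 - xi2) v2)"
   have l1: "1 \<le> l" using l l0 by linarith
   have dnn: "0 \<le> d" by (rule noise_nonneg[OF nd])
   have wm: "w \<in> sobolev \<gamma>" unfolding w_def by (rule sob_le_sobolev[OF sob_le_diff[OF sobolev_sob_le[OF D1(1)] sobolev_sob_le[OF D2(1)]]])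
   have rm: "\<rho> \<in> sobolev (11/10)" unfolding \<rho>_def by (rule sob_le_sobolev[OF sob_le_diff[OF sobolev_sob_le[OF D1(3)] sobolev_sob_le[OF D2(3)]]])
   let ?W = "sobolev_norm \<gamma> w" and ?R = "sobolev_norm (11/10) \<rho>"
   let ?V2 = "sobolev_norm \<gamma> v2" and ?r2 = "sobolev_norm (11/10) ?R2"
   note wb = sobolev_sob_le[OF wm] and rb = sobolev_sob_le[OF rm] and vb = sobolev_sob_le[OF D2(1)] and Rb = sobolev_sob_le[OF D2(3)]
   \<comment> \<open>The difference of the solutions splits as w = \<rho> + \<omega>, where \<omega>
     collects the paracontrolled parts and has the better order \<gamma> + \<kappa>.\<close>
   have \<omega>: "\<omega> = w - \<rho>"
    unfolding \<omega>_def W_noise_diff[OF n1 n2 D2(1)] unfolding w_def W_diff[OF n1 D1(1) D2(1)] \<rho>_def R_op_W by (simp add: fun_eq_iff)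
   have A: "Aop xi1 Xi1 v1 - Aop xi2 Xi2 v2 = laplace \<rho> + (E1 + E2)"
    unfolding A_op_decomp[OF n1 D1(1)] A_op_decomp[OF n2 D2(1)] E1_def E2_def \<rho>_def laplace_diff
     K_noise_diff[OF n1 n2 D2(1), symmetric] L_noise_diff[OF n1 n2 D2(1) D2(3)] w_def
     L_diff[OF n1 D1(1) D2(1) D1(3) D2(3)] K_diff[OF n1 D1(1) D2(1)] by (simp add: fun_eq_iff)
   have s: "s = tscale (of_real l) w - (laplace \<rho> + (E1 + E2))" unfolding A[symmetric] s_def w_def tscale_diff by (simp add: fun_eq_iff)
   \<comment> \<open>This solves (l - \<Delta>)\<rho> = s + E1 + E2 - l\<omega>.\<close>
   have \<rho>: "\<rho> = mres l (s + (E1 + E2)) - tscale (of_real l) (mres l \<omega>)"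
   proof
    fix k
    let ?D = "of_real (l - 1 + bessel k) :: complex"
    have D: "?D \<noteq> 0" using mres_pos[OF l1, of k] unfolding of_real_eq_0_iff by linarith
    have "?D*\<rho> k = (s + (E1 + E2)) k - of_real l*\<omega> k" unfolding s \<omega> by (simp add: tscale_def laplace_bessel algebra_simps)
    hence "\<rho> k*?D = (s + (E1 + E2)) k - of_real l*\<omega> k" by (simp only: mult.commute)
    hence "\<rho> k = ((s + (E1 + E2)) k - of_real l*\<omega> k)/?D" by (rule eq_divide_imp[OF D])
    thus "\<rho> k = (mres l (s + (E1 + E2)) - tscale (of_real l) (mres l \<omega>)) k"
     by (simp only: mres_def tscale_def fun_diff_def diff_divide_distrib times_divide_eq_right)
   qed
   \<comment> \<open>The same equation solved for w reads (l - \<Delta>)w = s + E1 + E2 -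
     \<Delta>\<omega>. No factor \<open>l\<close> stands in front of \<omega> here, so its
     contribution decays like l^(-\<kappa>/2), whereas in the equation for \<rho> it may
     grow.\<close>
   have w: "w = mres l (s + (E1 + E2)) - mres l (laplace \<omega>)"
   proof
    fix k
    let ?D = "of_real (l - 1 + bessel k) :: complex"
    have D: "?D \<noteq> 0" using mres_pos[OF l1, of k] unfolding of_real_eq_0_iff by linarith
    have "w k = \<rho> k + \<omega> k" unfolding \<omega> by simp
    also have "... = mres l (s + (E1 + E2)) k - (of_real l*(\<omega> k/?D) - \<omega> k)" by (subst \<rho>) (simp add: mres_def tscale_def)
    also have "of_real l*(\<omega> k/?D) - \<omega> k = (of_real l*\<omega> k - ?D*\<omega> k)/?D" using D by (simp add: field_simps)
    also have "of_real l*\<omega> k - ?D*\<omega> k = laplace \<omega> k" by (simp add: laplace_bessel algebra_simps)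
    finally show "w k = (mres l (s + (E1 + E2)) - mres l (laplace \<omega>)) k" by (simp add: mres_def)
   qed
   have Ob: "sob_le (\<gamma> + \<kappa>) \<omega> (cW*(Z*?W) + cW*(d*?V2))" unfolding \<omega>_def by (intro sob_le_add W_bound[OF n1 wb] W_bound[OF nd vb])
   have Eb: "sob_le 0 (E1 + E2) (cL*(Z*(?W + ?R)) + cK*(Z*Z*?W) + (cL*(d*(?V2 + ?r2)) + (cK*(d*Z*?V2) + cK*(Z*d*?V2))))" unfolding E1_def E2_def
    by (intro sob_le_add L_bound[OF n1 wb rb] K_bound[OF n1 n1 wb] L_bound[OF nd vb Rb] K_bound[OF nd n1 vb] K_bound[OF n2 nd vb])
   let ?O = "cW*(Z*?W) + cW*(d*?V2)"
   let ?E = "cL*(Z*(?W + ?R)) + cK*(Z*Z*?W) + (cL*(d*(?V2 + ?r2)) + (cK*(d*Z*?V2) + cK*(Z*d*?V2)))"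
   have sE: "sob_le 0 (s + (E1 + E2)) (S + ?E)" unfolding s_def by (intro sob_le_add S Eb)
   have W: "?W \<le> l powr (- 1/2)*(S + ?E) + l powr (- (\<kappa>/2))*?O"
   proof -
    have "sob_le \<gamma> (mres l (s + (E1 + E2))) (l powr ((\<gamma> - 0)/2 - 1)*(S + ?E))" by (rule sob_le_mres[OF sE l1]) (use range(3) kappa in simp_all)
    moreover have "sob_le \<gamma> (mres l (laplace \<omega>)) (l powr ((\<gamma> - (\<gamma> + \<kappa> - 2))/2 - 1)*?O)"
     by (rule sob_le_mres[OF sob_le_laplace[OF Ob] l1]) (use range(3) kappa in simp_all)
    ultimately have "sob_le \<gamma> w (l powr ((\<gamma> - 0)/2 - 1)*(S + ?E) + l powr ((\<gamma> - (\<gamma> + \<kappa> - 2))/2 - 1)*?O)"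
     by (subst w) (rule sob_le_diff)
    hence "?W \<le> l powr ((\<gamma> - 0)/2 - 1)*(S + ?E) + l powr ((\<gamma> - (\<gamma> + \<kappa> - 2))/2 - 1)*?O" by (rule sob_le_norm)
    also have "(\<gamma> - (\<gamma> + \<kappa> - 2))/2 - 1 = - (\<kappa>/2)" by (simp add: field_simps)
    also have "l powr ((\<gamma> - 0)/2 - 1)*(S + ?E) \<le> l powr (- 1/2)*(S + ?E)"
    proof (rule mult_right_mono)
     show "l powr ((\<gamma> - 0)/2 - 1) \<le> l powr (- 1/2)" using l1 kappa by (intro powr_mono) simp_all
     show "0 \<le> S + ?E" by (rule sob_leD_nonneg[OF sE])
    qed
    finally show ?thesis by simp
   qed
   have R: "?R \<le> l powr (- 9/20)*(S + ?E) + l powr ((11/10 - \<gamma> - \<kappa>)/2)*?O"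
   proof -
    have "sob_le (11/10) (mres l (s + (E1 + E2))) (l powr ((11/10 - 0)/2 - 1)*(S + ?E))" by (rule sob_le_mres[OF sE l1]) simp_all
    moreover have "sob_le (11/10) (tscale (of_real l) (mres l \<omega>)) (norm (of_real l :: complex)*(l powr ((11/10 - (\<gamma> + \<kappa>))/2 - 1)*?O))"
     by (intro sob_le_tscale sob_le_mres[OF Ob l1]) (use range(3) kappa in simp_all)
    ultimately have "sob_le (11/10) \<rho> (l powr ((11/10 - 0)/2 - 1)*(S + ?E) + norm (of_real l :: complex)*(l powr ((11/10 - (\<gamma> + \<kappa>))/2 - 1)*?O))"
     by (subst \<rho>) (rule sob_le_diff)
    hence "?R \<le> l powr ((11/10 - 0)/2 - 1)*(S + ?E) + norm (of_real l :: complex)*(l powr ((11/10 - (\<gamma> + \<kappa>))/2 - 1)*?O)" by (rule sob_le_norm)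
    also have "(11/10 - 0)/2 - 1 = - 9/(20 :: real)" by simp
    also have "norm (of_real l :: complex)*(l powr ((11/10 - (\<gamma> + \<kappa>))/2 - 1)*?O) = l powr ((11/10 - \<gamma> - \<kappa>)/2)*?O"
    proof -
     have "norm (of_real l :: complex) = l powr 1" using l1 by simp
     moreover have "l powr 1*l powr ((11/10 - (\<gamma> + \<kappa>))/2 - 1) = l powr ((11/10 - \<gamma> - \<kappa>)/2)"
     proof -
      have "1 + ((11/10 - (\<gamma> + \<kappa>))/2 - 1) = (11/10 - \<gamma> - \<kappa>)/2" by (simp add: field_simps)
      thus ?thesis by (simp only: powr_add[symmetric])
     qed
     ultimately show ?thesis by (simp only: mult.assoc[symmetric])
    qed
    finally show ?thesis .
   qed
   have nn: "0 \<le> ?W" "0 \<le> ?R" "0 \<le> ?V2" "0 \<le> ?r2" by simp_all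
   have small: "4*c1*l powr (- (\<kappa>/2)) \<le> 1/2"
   proof -
    have "8*c1 + 1 = l0 powr (\<kappa>/2)" unfolding l0_def powr_powr using kappa(1) c1 by simp
    also have "... \<le> l powr (\<kappa>/2)" using l l0 kappa(1) by (intro powr_mono2) simp_all
    finally have "8*c1*l powr (- (\<kappa>/2)) \<le> l powr (\<kappa>/2)*l powr (- (\<kappa>/2))" by (intro mult_right_mono) simp_all
    thus ?thesis using l1 by (simp add: powr_add[symmetric])
   qed
   have "?W + ?R \<le> 4*l powr (- 18/100)*S + 4*l*((cL + 2*cK*Z)*(d*(?V2 + ?r2)) + cW*(d*(?V2 + ?r2)))"
   proof (rule combine_bounds[OF l1 _ _ _ _ _ _ _ _ _ c1 _ _ W R _ _ small])
    \<comment> \<open>The lower bound on the exponent comes from \<gamma> + \<kappa> \<le> 1, the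
      upper one from \<gamma> > 2/3, as (11/10 - 2/3)/2 < 22/100.\<close>
    show "1/20 \<le> (11/10 - \<gamma> - \<kappa>)/2" "(11/10 - \<gamma> - \<kappa>)/2 \<le> 22/100" "0 \<le> \<kappa>/2" "\<kappa>/2 \<le> 1/10"
     using kappa range(3) by - (simp_all add: field_simps)
    show "0 \<le> ?W" "0 \<le> ?R" by (rule nn)+
    show "0 \<le> S" by (rule sob_leD_nonneg[OF S])
    show "0 \<le> ?E" by (rule sob_leD_nonneg[OF Eb])
    show "0 \<le> ?O" by (rule sob_leD_nonneg[OF Ob])
    show "0 \<le> (cL + 2*cK*Z)*(d*(?V2 + ?r2))" "0 \<le> cW*(d*(?V2 + ?r2))" using nn dnn Z cL cK cW by simp_all
    have "0 \<le> cK*(Z*Z)*?R" "0 \<le> cW*Z*?W" "0 \<le> cW*Z*?R" "0 \<le> cK*Z*d*?r2" "0 \<le> cL*Z*?W" "0 \<le> cL*Z*?R" "0 \<le> cK*(Z*Z)*?W" "0 \<le> cW*d*?r2"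
     using nn dnn Z cL cK cW by simp_all
    thus "?E \<le> c1*(?W + ?R) + (cL + 2*cK*Z)*(d*(?V2 + ?r2))" "?O \<le> c1*?W + cW*(d*(?V2 + ?r2))" unfolding c1_def by (simp_all add: algebra_simps)
   qed
   also have "4*l*((cL + 2*cK*Z)*(d*(?V2 + ?r2)) + cW*(d*(?V2 + ?r2))) = 4*c2*l*d*(?V2 + ?r2)" unfolding c2_def by (simp add: algebra_simps)
   finally show "sobolev_norm \<gamma> (v1 - v2) + sobolev_norm (11/10) (?R1 - ?R2) \<le> 4*l powr (- 18/100)*S + 4*c2*l*d*(?V2 + ?r2)"
    unfolding w_def \<rho>_def .
  qed
 qed
qed

end

section \<open>Trigonometric polynomials as noise: the operator becomes \<Delta> + \<xi> - c\<close>

lemma fsupp_sob_le: assumes "fsupp f" shows "\<exists>B. sob_le s f B"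
proof -
 let ?A = "{k. f k \<noteq> 0}"
 let ?g = "\<lambda>k. bessel k powr (s/2)*norm (f k)"
 have A: "finite ?A" by (rule fsupp_finite_set[OF assms])
 have "L2_set ?g F \<le> L2_set ?g ?A" if F: "finite F" for F unfolding L2_set_def
 proof (rule real_sqrt_le_mono)
  have "(\<Sum>k\<in>F. (?g k)^2) = (\<Sum>k\<in>F \<inter> ?A. (?g k)^2)" using F by (intro sum.mono_neutral_right) auto
  also have "... \<le> (\<Sum>k\<in>?A. (?g k)^2)" using A by (intro sum_mono2) auto
  finally show "(\<Sum>k\<in>F. (?g k)^2) \<le> (\<Sum>k\<in>?A. (?g k)^2)" .
 qed
 thus ?thesis unfolding sob_le_def by blast
qed

lemma fsupp_sobolev: "fsupp f ==> f \<in> sobolev s" using fsupp_sob_le[of f s] sob_le_sobolev by blast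

lemma fsupp_single: "fsupp (single l z)" by (simp add: fsupp_def single_def)

lemma fsupp_tconst: "fsupp (tconst c)" by (simp add: fsupp_def tconst_def)

lemma fsupp_diff: "fsupp f ==> fsupp g ==> fsupp (f - g)"
proof -
 assume "fsupp f" "fsupp g"
 hence "fsupp (f + tscale (-1) g)" by (intro fsupp_add fsupp_tscale)
 moreover have "f + tscale (-1) g = f - g" by (simp add: tscale_def fun_eq_iff)
 ultimately show ?thesis by simp
qed

lemma fsupp_resolv: "fsupp f ==> fsupp (resolv f)" unfolding resolv_def divide_inverse mult.commute[of "f _"] by (rule fsupp_mult)

lemma fsupp_dx: "fsupp f ==> fsupp (dx1 f)" "fsupp f ==> fsupp (dx2 f)" unfolding dx_ddir by (erule fsupp_ddir)+

lemma trig_has_derivative: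
 assumes "fsupp f"
 shows "(trig f has_derivative (\<lambda>h. fst h *\<^sub>R trig (dx1 f) x + snd h *\<^sub>R trig (dx2 f) x)) (at x)"
proof -
 let ?A = "{k. f k \<noteq> 0}"
 have A: "finite ?A" by (rule fsupp_finite_set[OF assms])
 have T: "trig g y = (\<Sum>k\<in>?A. g k*character k y)" if "\<And>k. f k = 0 ==> g k = 0" for g y by (rule trig_finite[OF A]) (use that in simp)
 have ch: "(character k has_derivative (\<lambda>h. (\<i> * of_real (2*pi*(freq k \<bullet> h)))*character k x)) (at x)" for k
 proof -
  have "((\<lambda>y. \<i> * of_real (2*pi*(freq k \<bullet> y))) has_derivative (\<lambda>h. \<i> * of_real (2*pi*(freq k \<bullet> h)))) (at x)"
   by (intro has_derivative_mult_right has_derivative_of_real has_derivative_inner_right has_derivative_ident)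
  from has_derivative_compose[OF this, of exp, OF DERIV_exp[unfolded has_field_derivative_def]]
  have "((\<lambda>y. exp (\<i> * of_real (2*pi*(freq k \<bullet> y)))) has_derivative
   (\<lambda>h. exp (\<i> * of_real (2*pi*(freq k \<bullet> x)))*(\<i> * of_real (2*pi*(freq k \<bullet> h))))) (at x)" .
  thus ?thesis by (simp add: character_def[abs_def] cis_conv_exp mult.commute)
 qed
 have fh: "freq k \<bullet> h = of_int (fst k)*fst h + of_int (snd k) * snd h" for k h by (simp add: freq_def inner_prod_def)
 have "((\<lambda>y. \<Sum>k\<in>?A. f k*character k y) has_derivative
   (\<lambda>h. \<Sum>k\<in>?A. f k*((\<i> * of_real (2*pi*(freq k \<bullet> h)))*character k x))) (at x)"
  by (intro has_derivative_sum has_derivative_mult_right ch)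
 moreover have "trig f = (\<lambda>y. \<Sum>k\<in>?A. f k*character k y)" by (rule ext, rule T)
 moreover have "(\<Sum>k\<in>?A. f k*((\<i> * of_real (2*pi*(freq k \<bullet> h)))*character k x))
   = fst h *\<^sub>R trig (dx1 f) x + snd h *\<^sub>R trig (dx2 f) x" for h
 proof -
  have "trig (dx1 f) x = (\<Sum>k\<in>?A. dx1 f k*character k x)" "trig (dx2 f) x = (\<Sum>k\<in>?A. dx2 f k*character k x)"
   by (rule T, simp add: dx1_def, rule T, simp add: dx2_def)
  thus ?thesis by (simp only: scaleR_sum_right sum.distrib[symmetric])
    (intro sum.cong refl, simp add: fh dx1_def dx2_def scaleR_conv_of_real algebra_simps)
 qed
 ultimately show ?thesis by (simp only:)
qed

text \<open>The commutator is prescribed on \<open>smooth_torus\<close>; this puts trigonometric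
  polynomials, in particular the multiples of characters tested in \<open>bfun_zero\<close>, within
  its reach.\<close>

lemma fsupp_smooth_torus: assumes "fsupp f" shows "f \<in> smooth_torus"
proof -
 let ?D = "\<lambda>p q. trig ((dx1 ^^ p) ((dx2 ^^ q) f))"
 have comm: "dx1 (dx2 g) = dx2 (dx1 g)" for g by (simp add: dx1_def dx2_def fun_eq_iff)
 have pw: "dx2 ((dx1 ^^ p) g) = (dx1 ^^ p) (dx2 g)" for p g by (induction p) (simp_all add: comm[symmetric])
 have fs2: "fsupp ((dx2 ^^ q) f)" for q by (induction q) (simp_all add: assms fsupp_dx)
 have fs: "fsupp ((dx1 ^^ p) ((dx2 ^^ q) f))" for p q by (induction p) (simp_all add: fs2 fsupp_dx)
 have "smooth_on UNIV (trig f)" unfolding smooth_on_def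
 proof (rule exI[of _ ?D], intro conjI allI ballI)
  show "?D 0 0 = trig f" by simp
  fix p q x
  have "(dx1 ^^ p) ((dx2 ^^ Suc q) f) = dx2 ((dx1 ^^ p) ((dx2 ^^ q) f))" by (simp add: pw)
  thus "(?D p q has_derivative (\<lambda>h. fst h *\<^sub>R ?D (Suc p) q x + snd h *\<^sub>R ?D p (Suc q) x)) (at x)"
   using trig_has_derivative[OF fs[of p q], of x] by simp
 qed
 moreover have "trig f (x + 1, y) = trig f (x, y) \<and> trig f (x, y + 1) = trig f (x, y)" for x y
 proof -
  have "character k (x + 1, y) = character k (x, y)" "character k (x, y + 1) = character k (x, y)" for k
   using character_periodic[of k "(x, y)" 1 0] character_periodic[of k "(x, y)" 0 1] by simp_all
  thus ?thesis by (simp add: trig_character)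
 qed
 ultimately show ?thesis unfolding smooth_torus_def using fourier_trig_fsupp[OF assms] by (intro image_eqI[of _ _ "trig f"]) simp_all
qed

context lp_blocks begin

lemma fsupp_hi_0: assumes "fsupp g" shows "\<exists>B. hi 0 B g"
proof -
 let ?A = "{k. g k \<noteq> 0}"
 have A: "finite ?A" by (rule fsupp_finite_set[OF assms])
 have "tsup (block P j g) (\<Sum>k\<in>?A. norm (g k))" if j: "-1 \<le> j" for j
 proof (rule tsup_mono[OF tsup_l1[OF A]])
  show "block P j g k = 0" if "k \<notin> ?A" for k using that by (simp add: block_sym)
  show "(\<Sum>k\<in>?A. norm (block P j g k)) \<le> (\<Sum>k\<in>?A. norm (g k))"
   using sym_nonneg sym_le_1[OF j] by (intro sum_mono) (simp add: block_sym norm_mult mult_left_le_one_le)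
 qed
 thus ?thesis unfolding hi_def by (intro exI[of _ "\<Sum>k\<in>?A. norm (g k)"]) simp
qed

lemma fsupp_hi: assumes "fsupp g" shows "\<exists>B. hi b B g"
proof -
 obtain J where J: "\<forall>j>J. block P j g = 0" using fsupp_blocks_finite[OF assms] by blast
 obtain B where B: "hi 0 B g" using fsupp_hi_0[OF assms] by blast
 define c where "c = (\<Sum>j\<in>{-1..J}. dy j b)"
 have c0: "0 \<le> c" unfolding c_def by (intro sum_nonneg) simp
 have "tsup (block P j g) (c*B*dy j (- b))" if j: "-1 \<le> j" for j
 proof (cases "j \<le> J")
  case True
  have "dy j b \<le> c" unfolding c_def using True j by (intro member_le_sum) auto
  hence "dy j b*dy j (- b) \<le> c*dy j (- b)" by (intro mult_right_mono) simp_all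
  hence "1 \<le> c*dy j (- b)" by (simp only: mult.commute[of "dy j b"] dy_uminus)
  hence "1*B \<le> c*dy j (- b)*B" by (intro mult_right_mono hi_nonneg[OF B])
  thus ?thesis using hiD[OF B j] by (intro tsup_mono[OF hiD[OF B j]]) (simp add: mult_ac)
 next
  case False
  hence "block P j g = 0" using J by simp
  moreover have "tsup 0 (0::real)" by (simp add: tsup_def trig_def)
  moreover have "0 \<le> c*B*dy j (- b)" using c0 hi_nonneg[OF B] by simp
  ultimately show ?thesis using tsup_mono by metis
 qed
 thus ?thesis unfolding hi_def by blast
qed

lemma fsupp_reso_block: "-1 \<le> j ==> fsupp (reso_block f g j)" unfolding reso_block_def by (intro fsupp_sum reso_set(1) fsupp_pair) auto

lemma fsupp_reso: assumes "fsupp g" shows "fsupp (reso P f g)"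
proof -
 obtain J where J: "\<forall>j>J. block P j g = 0" using fsupp_blocks_finite[OF assms] by blast
 have "reso P f g k = (\<Sum>j\<in>{-1..J}. reso_block f g j k)" for k unfolding reso_reso_block
 proof (rule infsum_truncate)
  fix j assume "J < j"
  hence "block P j g = 0" using J by blast
  thus "reso_block f g j k = 0" by (simp add: reso_block_def tmul_def)
 qed
 hence "reso P f g = (\<lambda>k. \<Sum>j\<in>{-1..J}. reso_block f g j k)" by (rule ext)
 thus ?thesis by (simp only:) (intro fsupp_sum fsupp_reso_block, simp_all)
qed

end

context model begin

text \<open>The defining identity is for three smooth arguments, while \<open>v\<close> is only in
  \<open>sobolev \<gamma>\<close>. For a fixed trigonometric polynomial as noise both sides are
  bounded functionals of \<open>v\<close>, and they agree on characters.\<close>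

lemma C_smooth:
 assumes v: "v \<in> sobolev \<gamma>" and n: "noise Z xi Xi" and f: "fsupp xi"
 shows "C v (resolv xi) xi = reso P (para P v (resolv xi)) xi - tmul v (reso P (resolv xi) xi)"
proof
 fix k
 let ?X = "resolv xi"
 obtain c where c: "0 \<le> c" "\<And>f g h V Z Z'. sob_le \<gamma> f V ==> hi (\<alpha> + 2) Z g ==> hi \<alpha> Z' h ==> sob_le 0 (C f g h) (c*(Z*Z'*V))"
  by (rule C_facts) (rule that)
 have e: "0 \<le> \<gamma>" "\<gamma> < 1 - 2*eta" "\<gamma> < \<gamma> + (1 - 2*eta)" "0 < \<gamma> + 0" using range(3) kappa eta by linarith+
 note c1 = para_pos_bound(2)[OF e(1-3)]
 obtain B where B: "hi 0 B xi" using fsupp_hi_0[OF f] by blast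
 note c2 = reso_bound(2)[OF e(4)]
 obtain D where D: "sob_le (- \<gamma>) (reso P ?X xi) D" using fsupp_sob_le[OF fsupp_reso[OF f]] by blast
 have 1: "bfun \<gamma> (\<lambda>v. C v ?X xi k)"
 proof (rule bfun_coeff[where r = 0 and c = "c*(Z*Z)"])
  show "C (u - v) ?X xi = C u ?X xi - C v ?X xi" if "u \<in> sobolev \<gamma>" "v \<in> sobolev \<gamma>" for u v
   by (rule C_diff(1)[OF that noiseD(7)[OF n] noiseD(7)[OF n] noiseD(6)[OF n] noiseD(6)[OF n]])
  show "sob_le 0 (C u ?X xi) (c*(Z*Z)*A)" if "sob_le \<gamma> u A" for u A using c(2)[OF that noiseD(7)[OF n] noiseD(6)[OF n]] by (simp only: mult.assoc)
 qed
 have 2: "bfun \<gamma> (\<lambda>v. reso P (para P v ?X) xi k)"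
 proof (rule bfun_coeff[where r = 0 and c = "kres \<gamma> 0*(kpos \<gamma> (1 - 2*eta) \<gamma>*Z*B)"])
  note X = noiseD(2)[OF n]
  show "reso P (para P (u - v) ?X) xi = reso P (para P u ?X) xi - reso P (para P v ?X) xi" if "u \<in> sobolev \<gamma>" "v \<in> sobolev \<gamma>" for u v
   unfolding para_diff_left(2)[OF psums(1)[OF n that(1)] psums(1)[OF n that(2)]]
   by (intro reso_diff_left(2) reso_lo_hi(1)[OF sob_le_lo[OF c1[OF sobolev_sob_le[OF _] X]] B e(4)] that)
  show "sob_le 0 (reso P (para P u ?X) xi) (kres \<gamma> 0*(kpos \<gamma> (1 - 2*eta) \<gamma>*Z*B)*A)" if "sob_le \<gamma> u A" for u A
   using c2[OF c1[OF that X] B] by (simp only: mult_ac)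
 qed
 have "bfun \<gamma> (\<lambda>v. C v ?X xi k - (reso P (para P v ?X) xi k - tmul v (reso P ?X xi) k))" by (intro bfun_diff 1 2 bfun_tmul[OF D e(1)])
 moreover have "C (single l z) ?X xi k - (reso P (para P (single l z) ?X) xi k - tmul (single l z) (reso P ?X xi) k) = 0" for l z
 proof -
  have "\<forall>f\<in>smooth_torus. \<forall>g\<in>smooth_torus. \<forall>h\<in>smooth_torus. C f g h = reso P (para P f g) h - tmul f (reso P g h)"
   using com unfolding is_commutator_def by (elim conjE)
  from this[rule_format, OF fsupp_smooth_torus[OF fsupp_single] fsupp_smooth_torus[OF fsupp_resolv[OF f]] fsupp_smooth_torus[OF f]]
  show ?thesis by simp
 qed
 ultimately have "C v ?X xi k - (reso P (para P v ?X) xi k - tmul v (reso P ?X xi) k) = 0" by (rule bfun_zero[OF _ _ sobolev_sob_le[OF v]])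
 thus "C v ?X xi k = (reso P (para P v ?X) xi - tmul v (reso P ?X xi)) k" by simp
qed

lemma tmul_tconst: "tmul v (tconst c) = tscale c v"
proof -
 have "tmul (tconst c) v k = c * v k" for k by (subst tmul_finite[of "{0}"]) (simp_all add: tconst_def)
 thus ?thesis unfolding tmul_commute[of v] tscale_def by (rule ext)
qed

lemma sobolev_index: "f \<in> sobolev s ==> r \<le> s ==> f \<in> sobolev r" using sob_le_sobolev[OF sob_le_index[OF sobolev_sob_le]] by blast

text \<open>A paraproduct whose high-frequency factor has finite support is a trigonometric
  polynomial. The one other term, \<open>para P xi v\<close>, lies in L2 because \<open>v\<close>
  has order 2 and \<open>xi\<close> order 0, and it gains two derivatives inside
  \<open>B_op\<close>.\<close>

lemma smooth_noise_dom:
 assumes n: "noise Z xi Xi" and f: "fsupp xi" "fsupp Xi" and v: "v \<in> sobolev 2"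
 shows "v \<in> Adom xi Xi"
proof -
 let ?X = "resolv xi"
 have g: "v \<in> sobolev \<gamma>" by (rule sobolev_index[OF v]) (use range kappa in linarith)
 have X: "fsupp ?X" "fsupp (dx1 ?X)" "fsupp (dx2 ?X)" using f(1) by (simp_all add: fsupp_resolv fsupp_dx)
 obtain B where B: "hi 0 B xi" using fsupp_hi_0[OF f(1)] by blast
 note c = para_hi_bound(2)[of 2 0, simplified]
 have fs: "fsupp (para P (laplace v) ?X + tscale 2 (para P (dx1 v) (dx1 ?X) + para P (dx2 v) (dx2 ?X)))" by (intro fsupp_add fsupp_tscale fsupp_para X)
 obtain B1 where B1: "sob_le 0 (para P (laplace v) ?X + tscale 2 (para P (dx1 v) (dx1 ?X) + para P (dx2 v) (dx2 ?X))) B1" using fsupp_sob_le[OF fs] by blast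
 obtain B2 where B2: "sob_le 0 (para P v Xi) B2" using fsupp_sob_le[OF fsupp_para[OF f(2)]] by blast
 have "sob_le (0 + 2) (B_op P xi Xi v) (B1 + pcon 0 2*cs 2*(sobolev_norm 2 v * B) + B2)"
  unfolding B_op_alt by (intro sob_le_resolv sob_le_add B1 B2 c[OF sobolev_sob_le[OF v] B])
 hence B3: "sob_le 2 (B_op P xi Xi v) (B1 + pcon 0 2*cs 2*(sobolev_norm 2 v * B) + B2)" by simp
 obtain B4 where B4: "sob_le 2 (para P v ?X) B4" using fsupp_sob_le[OF fsupp_para[OF X(1)]] by blast
 have "Rop xi Xi v \<in> sobolev 2" unfolding R_op_def by (rule sob_le_sobolev[OF sob_le_diff[OF sob_le_diff[OF sobolev_sob_le[OF v] B4] B3]])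
 with g show ?thesis by (simp add: A_dom_def)
qed

text \<open>The term v(X \<circ> \<xi>) subtracted by the commutator cancels the one in v\<Xi>, and
  -c v is left. The resonant products of v \<prec> X, B and R with \<xi> add up to v \<circ> \<xi>,
  and Bony's decomposition restores the product \<xi>v.\<close>

lemma smooth_noise_A_op:
 assumes n: "noise Z xi Xi" and f: "fsupp xi" and Xi: "Xi = reso P xi (resolv xi) - tconst c" and v: "v \<in> sobolev 2"
 shows "Aop xi Xi v = laplace v + tmul xi v - tscale c v"
proof -
 let ?X = "resolv xi"
 have fX: "fsupp ?X" by (rule fsupp_resolv[OF f])
 have g: "v \<in> sobolev \<gamma>" by (rule sobolev_index[OF v]) (use range kappa in linarith)
 obtain B where B: "hi 0 B xi" using fsupp_hi_0[OF f] by blast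
 have rs: "rsum u xi" if "u \<in> sobolev \<gamma>" for u by (rule reso_lo_hi(1)[OF sob_le_lo[OF sobolev_sob_le[OF that]] B]) (use range in simp)
 have pm: "para P v ?X \<in> sobolev \<gamma>" by (rule fsupp_sobolev[OF fsupp_para[OF fX]])
 have Bm: "B_op P xi Xi v \<in> sobolev \<gamma>" by (rule sobolev_index[OF B_mem[OF n g]]) (use range kappa in linarith)
 have r: "reso P (Rop xi Xi v) xi = reso P v xi - reso P (para P v ?X) xi - reso P (B_op P xi Xi v) xi"
 proof -
  have vp: "rsum (v - para P v ?X) xi" by (rule reso_diff_left(1)[OF rs[OF g] rs[OF pm]])
  show ?thesis unfolding R_op_def reso_diff_left(2)[OF vp rs[OF Bm]] reso_diff_left(2)[OF rs[OF g] rs[OF pm]] ..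
 qed
 have t: "tmul v Xi = tmul v (reso P xi ?X) - tscale c v"
 proof -
  obtain D where D: "sob_le (- \<gamma>) (reso P xi ?X) D" using fsupp_sob_le[OF fsupp_reso[OF fX]] by blast
  obtain E where E: "sob_le (- \<gamma>) (tconst c) E" using fsupp_sob_le[OF fsupp_tconst] by blast
  have "tmul v Xi k = tmul v (reso P xi ?X) k - tmul v (tconst c) k" for k unfolding tmul_def Xi
   by (rule norm_summable_diff(2)[OF product_summable(1)[OF sobolev_sob_le[OF g] D] product_summable(1)[OF sobolev_sob_le[OF g] E]])
    (use range in \<open>simp_all add: algebra_simps\<close>)
  thus ?thesis unfolding tmul_tconst[symmetric] by (simp add: fun_eq_iff)
 qed
 have b: "tmul xi v = para P v xi + reso P v xi + para P xi v" unfolding tmul_commute[of xi] by (rule bony[OF sobolev_sob_le[OF g] B]) (use range in simp_all)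
 show ?thesis unfolding A_op_def C_smooth[OF g n f] r t b reso_commute_fsupp[OF fX f] by (simp add: fun_eq_iff)
qed

end

section \<open>Sup bounds and the final resolvent estimates\<close>

context lp_blocks begin

lemma sum_coeff_block:
 assumes f: "sob_le s f A" and j: "-1 \<le> j"
 shows "(\<Sum>k\<in>supp j. norm (block P j f k)) \<le> 3 * sqrt bmax*(cs s*A)*dy j (1 - s)"
proof -
 have "(\<Sum>k\<in>supp j. norm (block P j f k)) \<le> sqrt (card (supp j))*(cs s*A*dy j (- s))"
  by (rule sum_norm_le_L2[OF finite_supp[OF j] lo_block[OF sob_le_lo[OF f] j]])
 also have "... \<le> (3 * sqrt bmax*dy j 1)*(cs s*A*dy j (- s))" using cs_pos[of s] sob_leD_nonneg[OF f] by (intro mult_right_mono sqrt_card_supp[OF j]) simp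
 also have "... = 3 * sqrt bmax*(cs s*A)*(dy j 1*dy j (- s))" by (simp only: mult_ac)
 also have "dy j 1*dy j (- s) = dy j (1 - s)" by (simp only: dy_add) simp
 finally show ?thesis .
qed

text \<open>On each block Cauchy-Schwarz over about 4^j frequencies leaves 2^(j(1 - s)), summable
  for s > 1: such functions have absolutely convergent Fourier series.\<close>

lemma sum_coeff_bound:
 assumes f: "sob_le s f A" and s: "1 < s"
 shows "(\<lambda>k. norm (f k)) summable_on UNIV" "(\<Sum>\<^sub>\<infinity>k. norm (f k)) \<le> 3 * sqrt bmax*cs s*gsum (s - 1)*A"
proof -
 let ?c = "3 * sqrt bmax*(cs s*A)"
 have c: "0 \<le> ?c" using cs_pos[of s] sob_leD_nonneg[OF f] bmax_ge_1 by simp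
 have t: "0 < s - 1" using s by simp
 have le: "(\<Sum>k\<in>F. norm (f k)) \<le> 3 * sqrt bmax*cs s*gsum (s - 1)*A" if F: "finite F" for F
 proof -
  have "\<exists>J. \<forall>k\<in>F. -1 \<le> J k \<and> (\<forall>j>J k. sym j (freq k) = 0)" using sym_large_zero by metis
  then obtain J where J: "\<And>k. k \<in> F ==> -1 \<le> J k" "\<And>k j. k \<in> F ==> J k < j ==> sym j (freq k) = 0" by metis
  define M where "M = Max (insert (-1) (J ` F))"
  have M: "-1 \<le> M" "\<And>k. k \<in> F ==> J k \<le> M" unfolding M_def using F by (auto intro: Max_ge)
  have "norm (f k) = (\<Sum>j\<in>{-1..M}. norm (block P j f k))" if k: "k \<in> F" for k
  proof -
   have "(\<Sum>j\<in>{-1..M}. sym j (freq k)) = 1"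
   proof (rule sum_sym_eq_1[OF M(1)])
    fix j assume "M < j" thus "sym j (freq k) = 0" using J(2)[OF k, of j] M(2)[OF k] by simp
   qed
   moreover have "norm (block P j f k) = sym j (freq k)*norm (f k)" for j using sym_nonneg[of j "freq k"] by (simp add: block_sym norm_mult)
   ultimately show ?thesis by (simp only: sum_distrib_right[symmetric])
  qed
  hence "(\<Sum>k\<in>F. norm (f k)) = (\<Sum>k\<in>F. \<Sum>j\<in>{-1..M}. norm (block P j f k))" by (rule sum.cong[OF refl])
  also have "... = (\<Sum>j\<in>{-1..M}. \<Sum>k\<in>F. norm (block P j f k))" by (rule sum.swap)
  also have "... \<le> (\<Sum>j\<in>{-1..M}. ?c*((real_of_int j + 2)*dy j (- (s - 1))))"
  proof (rule sum_mono)
   fix j assume "j \<in> {-1..M}"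
   hence j: "-1 \<le> j" by simp
   have "(\<Sum>k\<in>F. norm (block P j f k)) = (\<Sum>k\<in>F \<inter> supp j. norm (block P j f k))"
    using F by (intro sum.mono_neutral_right) (auto simp: block_outside)
   also have "... \<le> (\<Sum>k\<in>supp j. norm (block P j f k))" using finite_supp[OF j] by (intro sum_mono2) auto
   also have "... \<le> ?c*dy j (1 - s)" by (rule sum_coeff_block[OF f j])
   also have "... = ?c*(1*dy j (- (s - 1)))" by simp
   also have "... \<le> ?c*((real_of_int j + 2)*dy j (- (s - 1)))" using j by (intro mult_left_mono[OF _ c] mult_right_mono) simp_all
   finally show "(\<Sum>k\<in>F. norm (block P j f k)) \<le> ?c*((real_of_int j + 2)*dy j (- (s - 1)))" .
  qed
  also have "... = ?c*(\<Sum>j\<in>{-1..M}. (real_of_int j + 2)*dy j (- (s - 1)))" by (rule sum_distrib_left[symmetric])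
  also have "... \<le> ?c*gsum (s - 1)" unfolding gsum_def by (intro mult_left_mono[OF _ c] finite_sum_le_infsum[OF gsum(1)[OF t]]) auto
  finally show ?thesis by (simp only: mult_ac)
 qed
 show sm: "(\<lambda>k. norm (f k)) summable_on UNIV"
  by (rule nonneg_bdd_above_summable_on) (auto intro!: bdd_aboveI2[where M = "3 * sqrt bmax*cs s*gsum (s - 1)*A"] le)
 show "(\<Sum>\<^sub>\<infinity>k. norm (f k)) \<le> 3 * sqrt bmax*cs s*gsum (s - 1)*A" by (rule infsum_le_finite_sums[OF sm le])
qed

lemma sup_le_sobolev:
 assumes f: "sob_le s f A" and s: "1 < s" shows "sup_le (3 * sqrt bmax*cs s*gsum (s - 1)*A) f"
 by (rule sup_le_trig[OF sum_coeff_bound(1)[OF assms]]) (rule order_trans[OF trig_summable(3)[OF sum_coeff_bound(1)[OF assms]] sum_coeff_bound(2)[OF assms]])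

lemma fsupp_norm_summable: "fsupp f ==> (\<lambda>k. norm (f k)) summable_on UNIV"
 by (rule sum_coeff_bound(1)[OF sobolev_sob_le[OF fsupp_sobolev[of f 2]]]) simp_all

lemma sup_le_tsup: "fsupp f ==> tsup f B ==> sup_le B f" by (rule sup_le_trig[OF fsupp_norm_summable]) (assumption, rule tsupD)

lemma hi_zero: "hi b 0 0" unfolding hi_def block_zero by (simp add: tsup_def trig_def)

end

context model begin

lemma noise_zero: "noise 0 (xi - xi) (Xi - Xi)"
proof -
 have "xi - xi = 0" "Xi - Xi = 0" by simp_all
 moreover have "resolv 0 = 0" "dx1 0 = 0" "dx2 0 = 0" by (simp_all add: resolv_def dx1_def dx2_def fun_eq_iff)
 ultimately show ?thesis unfolding noise_def by (simp only: hi_zero simp_thms)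
qed

lemma R_diff:
 assumes n: "noise Z xi Xi" and u: "u \<in> sobolev \<gamma>" and v: "v \<in> sobolev \<gamma>"
 shows "Rop xi Xi (u - v) = Rop xi Xi u - Rop xi Xi v" unfolding R_op_W W_diff[OF assms] by (simp add: fun_eq_iff)

lemma sobolev_diff: "u \<in> sobolev s ==> v \<in> sobolev s ==> u - v \<in> sobolev s" using sob_le_sobolev[OF sob_le_diff[OF sobolev_sob_le sobolev_sob_le]] .

lemma Adom_diff:
 assumes n: "noise Z xi Xi" and u: "u \<in> Adom xi Xi" and v: "v \<in> Adom xi Xi" shows "u - v \<in> Adom xi Xi"
 using sobolev_diff[OF AdomD(1)[OF u] AdomD(1)[OF v]] sobolev_diff[OF AdomD(2)[OF u] AdomD(2)[OF v]]
 unfolding R_diff[OF n AdomD(1)[OF u] AdomD(1)[OF v], symmetric] by (simp add: A_dom_def)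

lemma A_diff:
 assumes n: "noise Z xi Xi" and u: "u \<in> Adom xi Xi" and v: "v \<in> Adom xi Xi"
 shows "Aop xi Xi (u - v) = Aop xi Xi u - Aop xi Xi v"
proof -
 note u' = AdomD[OF u] and v' = AdomD[OF v]
 show ?thesis unfolding A_op_decomp[OF n u'(1)] A_op_decomp[OF n v'(1)] A_op_decomp[OF n sobolev_diff[OF u'(1) v'(1)]]
   R_diff[OF n u'(1) v'(1)] laplace_diff L_diff[OF n u'(1) v'(1) u'(3) v'(3)] K_diff[OF n u'(1) v'(1)] by (simp add: fun_eq_iff)
qed

lemma A_mem: assumes n: "noise Z xi Xi" and u: "u \<in> Adom xi Xi" shows "Aop xi Xi u \<in> sobolev 0"
proof -
 note u' = AdomD[OF u]
 have "sob_le 0 (laplace (Rop xi Xi u)) (sobolev_norm 2 (Rop xi Xi u))" using sob_le_laplace[OF sobolev_sob_le[OF u'(2)]] by simp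
 from sob_le_sobolev[OF sob_le_add[OF sob_le_add[OF this L_bound[OF n sobolev_sob_le[OF u'(1)] sobolev_sob_le[OF u'(3)]]] K_bound[OF n n sobolev_sob_le[OF u'(1)]]]]
 show ?thesis unfolding A_op_decomp[OF n u'(1)] .
qed

text \<open>As \<gamma> < 1 there is no Sobolev embedding for \<open>v\<close> itself. Its rough
  part is a paraproduct with X, bounded by \<open>para_lo_hi_sup\<close> since \<gamma> - 1 + (1 -
  2*eta) > 0; the rest has order 11/10 > 1.\<close>

lemma sup_bound:
 assumes Z: "0 \<le> Z"
 obtains c where "0 \<le> c" "\<And>xi Xi v. noise Z xi Xi ==> fsupp xi ==> v \<in> Adom xi Xi ==>
  sup_le (c*(dn xi Xi v)) v"
proof -
 have e: "0 < 1 - 2*eta" "0 < \<gamma> - 1 + (1 - 2*eta)" using range eta by linarith+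
 define c1 where "c1 = pcon (\<gamma> - 1) (1 - 2*eta)*(3 * sqrt bmax*cs \<gamma>*Z)"
 define c2 where "c2 = 3 * sqrt bmax*cs (11/10)*gsum (11/10 - 1)"
 have c1: "0 \<le> c1" unfolding c1_def using Z cs_pos[of \<gamma>] bmax_ge_1 by (intro mult_nonneg_nonneg pcon_nonneg e) simp_all
 have c2: "0 \<le> c2" unfolding c2_def using cs_pos[of "11/10"] bmax_ge_1 gsum(2)[of "11/10 - 1"] by simp
 show ?thesis
 proof (rule that[of "c1 + c2*(cB*Z) + c2"])
  show "0 \<le> c1 + c2*(cB*Z) + c2" using c1 c2 cB Z by simp
  fix xi Xi v assume n: "noise Z xi Xi" and f: "fsupp xi" and v: "v \<in> Adom xi Xi"
  note v' = AdomD[OF v]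
  let ?V = "sobolev_norm \<gamma> v" and ?r = "sobolev_norm (11/10) (Rop xi Xi v)"
  have fX: "fsupp (resolv xi)" by (rule fsupp_resolv[OF f])
  have "tsup (para P v (resolv xi)) (pcon (\<gamma> - 1) (1 - 2*eta)*(3 * sqrt bmax*(cs \<gamma>*?V)*Z))"
   by (rule para_lo_hi_sup[OF sob_le_lo[OF sobolev_sob_le[OF v'(1)]] noiseD(2)[OF n] fX e])
  also have "pcon (\<gamma> - 1) (1 - 2*eta)*(3 * sqrt bmax*(cs \<gamma>*?V)*Z) = c1*?V" unfolding c1_def by (simp only: mult_ac)
  finally have 1: "sup_le (c1*?V) (para P v (resolv xi))" by (rule sup_le_tsup[OF fsupp_para[OF fX]])
  have 2: "sup_le (c2*(cB*(Z*?V) + ?r)) (B_op P xi Xi v + Rop xi Xi v)"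
   unfolding c2_def by (intro sup_le_sobolev sob_le_add B_bound[OF n] sobolev_sob_le v') simp
  have "sup_le (c1*?V + c2*(cB*(Z*?V) + ?r)) (para P v (resolv xi) + (B_op P xi Xi v + Rop xi Xi v))" by (rule sup_le_add[OF 1 2])
  moreover have "para P v (resolv xi) + (B_op P xi Xi v + Rop xi Xi v) = v" by (simp add: R_op_def fun_eq_iff)
  moreover have "c1*?V + c2*(cB*(Z*?V) + ?r) \<le> (c1 + c2*(cB*Z) + c2)*(?V + ?r)"
  proof -
   have "0 \<le> c2*?V" "0 \<le> (c1 + c2*(cB*Z))*?r" using c1 c2 cB Z by simp_all
   thus ?thesis by (simp add: algebra_simps)
  qed
  ultimately show "sup_le ((c1 + c2*(cB*Z) + c2)*(?V + ?r)) v" using sup_le_mono by simp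
 qed
qed

abbreviation "ehrling_const Z K \<delta> D \<equiv> \<forall>xi Xi v S B. noise Z xi Xi --> fsupp xi --> v \<in> Adom xi Xi -->
   sob_le 0 (res K xi Xi v) S --> sob_le 0 v B --> sup_le (\<delta>*S + D*B) v"
abbreviation "stability_const Z K xi2 Xi2 v2 D \<equiv> \<forall>xi1 Xi1 d v1. noise Z xi1 Xi1 -->
   noise d (xi1 - xi2) (Xi1 - Xi2) --> v1 \<in> Adom xi1 Xi1 -->
   res K xi1 Xi1 v1 = res K xi2 Xi2 v2 --> sob_le 0 (v1 - v2) (D*d)"

text \<open>All three properties are specialisations of \<open>main_estimate\<close>. The
  arbitrarily small factor \<delta> comes from the decay in the resolvent parameter: the estimate is
  used at some l far above K, and the difference (l - K)v is charged to the L2 norm of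
  \<open>v\<close>.\<close>

lemma resolvent_estimates:
 assumes Z: "0 \<le> Z"
 obtains K0 where "1 \<le> K0"
  "\<And>K xi Xi v S. K0 \<le> K ==> noise Z xi Xi ==> v \<in> Adom xi Xi ==> sob_le 0 (res K xi Xi v) S ==> sob_le 0 v (4*S)"
  "\<And>K \<delta>. K0 \<le> K ==> 0 < \<delta> ==> \<exists>D\<ge>0. ehrling_const Z K \<delta> D"
  "\<And>K xi2 Xi2 v2. K0 \<le> K ==> noise Z xi2 Xi2 ==> v2 \<in> Adom xi2 Xi2 ==> \<exists>D\<ge>0. stability_const Z K xi2 Xi2 v2 D"
proof -
 obtain l0 c where l0: "1 \<le> l0" and c: "0 \<le> c" and "resolvent_bound Z l0 c" by (rule main_estimate[OF Z])
 note main = this(3)[unfolded resolvent_bound_def, rule_format]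
 obtain cs' where cs': "0 \<le> cs'" "\<And>xi Xi v. noise Z xi Xi ==> fsupp xi ==> v \<in> Adom xi Xi ==>
  sup_le (cs'*(dn xi Xi v)) v" by (rule sup_bound[OF Z]) (rule that)
 have ap: "dn xi Xi v \<le> 4*l powr (- 18/100)*S"
  if l: "l0 \<le> l" and n: "noise Z xi Xi" and v: "v \<in> Adom xi Xi" and S: "sob_le 0 (res l xi Xi v) S" for l xi Xi v S
 proof -
  \<comment> \<open>The zero solution enters as \<open>v - v\<close>, so that its membership and its
    images follow from additivity.\<close>
  have z: "v - v \<in> Adom xi Xi" by (rule Adom_diff[OF n v v])
  have A0: "Aop xi Xi (v - v) = 0" unfolding A_diff[OF n v v] by simp
  have R0: "Rop xi Xi (v - v) = 0" unfolding R_diff[OF n AdomD(1)[OF v] AdomD(1)[OF v]] by simp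
  have S': "sob_le 0 (res l xi Xi v - res l xi Xi (v - v)) S" using S unfolding A0 tscale_diff by simp
  show ?thesis using main[OF l n n noise_zero v z S'] unfolding R0 by simp
 qed
 have L2: "sob_le 0 v (sobolev_norm \<gamma> v)" if "v \<in> sobolev \<gamma>" for v by (rule sob_le_index[OF sobolev_sob_le[OF that]]) (use range in linarith)
 show ?thesis
 proof (rule that[of l0])
  show "1 \<le> l0" by (rule l0)
 next
  fix K xi Xi v S assume K: "l0 \<le> K" and n: "noise Z xi Xi" and v: "v \<in> Adom xi Xi" and S: "sob_le 0 (res K xi Xi v) S"
  have "K powr (- 18/100) \<le> K powr 0" using K l0 by (intro powr_mono) simp_all
  hence "4*K powr (- 18/100)*S \<le> 4*S" using K l0 sob_leD_nonneg[OF S] by (intro mult_right_mono) simp_all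
  with ap[OF K n v S] have "sobolev_norm \<gamma> v \<le> 4*S" using sobolev_norm_nonneg[of "11/10" "Rop xi Xi v"] by linarith
  thus "sob_le 0 v (4*S)" by (rule sob_le_mono[OF L2[OF AdomD(1)[OF v]]])
 next
  fix K \<delta> :: real assume K: "l0 \<le> K" and \<delta>: "0 < \<delta>"
  \<comment> \<open>The power 100/18 inverts the decay exponent, so that 4*cs'*l powr (- 18/100)
    drops to \<delta> or below.\<close>
  define l where "l = max K ((4*cs'/\<delta> + 1) powr (100/18))"
  have l: "l0 \<le> l" "K \<le> l" "1 \<le> l" using K l0 by (simp_all add: l_def)
  have small: "cs'*(4*l powr (- 18/100)) \<le> \<delta>"
  proof -
   have p: "0 < 4*cs'/\<delta> + 1" using cs'(1) \<delta> by (simp add: add_nonneg_pos)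
   have "4*cs'/\<delta> + 1 = ((4*cs'/\<delta> + 1) powr (100/18)) powr (18/100)" using p by (simp add: powr_powr)
   also have "... \<le> l powr (18/100)" unfolding l_def by (intro powr_mono2) simp_all
   finally have "4*cs'/\<delta> \<le> l powr (18/100)" by simp
   hence "4*cs' \<le> \<delta>*l powr (18/100)" using \<delta> by (simp add: field_simps)
   hence "4*cs'*l powr (- 18/100) \<le> \<delta>*l powr (18/100)*l powr (- 18/100)" by (rule mult_right_mono) simp
   also have "... = \<delta>" using l(3) by (simp add: powr_add[symmetric] mult.assoc)
   finally show ?thesis by (simp only: mult_ac)
  qed
  show "\<exists>D\<ge>0. ehrling_const Z K \<delta> D"
  proof (intro exI[of _ "\<delta>*(l - K)"] conjI allI impI)
   show "0 \<le> \<delta>*(l - K)" using \<delta> l by simp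
   fix xi Xi v S B assume n: "noise Z xi Xi" and f: "fsupp xi" and v: "v \<in> Adom xi Xi"
    and S: "sob_le 0 (res K xi Xi v) S" and B: "sob_le 0 v B"
   have "sob_le 0 ((res K xi Xi v) + tscale (of_real (l - K)) v) (S + norm (of_real (l - K) :: complex)*B)" by (intro sob_le_add S sob_le_tscale B)
   moreover have "(res K xi Xi v) + tscale (of_real (l - K)) v = res l xi Xi v" by (simp add: tscale_def fun_eq_iff algebra_simps)
   moreover have "norm (of_real (l - K) :: complex) = l - K" using l unfolding norm_of_real by simp
   ultimately have S': "sob_le 0 (res l xi Xi v) (S + (l - K)*B)" by (simp only:)
   have "cs'*(dn xi Xi v) \<le> cs'*(4*l powr (- 18/100)*(S + (l - K)*B))" by (rule mult_left_mono[OF ap[OF l(1) n v S'] cs'(1)])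
   also have "... = (cs'*(4*l powr (- 18/100)))*(S + (l - K)*B)" by (simp only: mult_ac)
   also have "... \<le> \<delta>*(S + (l - K)*B)" by (rule mult_right_mono[OF small sob_leD_nonneg[OF S']])
   also have "... = \<delta>*S + \<delta>*(l - K)*B" by (simp add: distrib_left)
   finally show "sup_le (\<delta>*S + \<delta>*(l - K)*B) v" by (rule sup_le_mono[OF cs'(2)[OF n f v]])
  qed
 next
  fix K xi2 Xi2 v2 assume K: "l0 \<le> K" and n2: "noise Z xi2 Xi2" and v2: "v2 \<in> Adom xi2 Xi2"
  let ?D = "c*K*(dn xi2 Xi2 v2)"
  show "\<exists>D\<ge>0. stability_const Z K xi2 Xi2 v2 D"
  proof (intro exI[of _ ?D] conjI allI impI)
   show "0 \<le> ?D" using c K l0 by simp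
   fix xi1 Xi1 d v1 assume n1: "noise Z xi1 Xi1" and nd: "noise d (xi1 - xi2) (Xi1 - Xi2)" and v1: "v1 \<in> Adom xi1 Xi1"
    and eq: "res K xi1 Xi1 v1 = res K xi2 Xi2 v2"
   have S: "sob_le 0 (res K xi1 Xi1 v1 - res K xi2 Xi2 v2) 0" unfolding eq diff_self by (rule sob_le_zero) simp
   have "sobolev_norm \<gamma> (v1 - v2) \<le> sobolev_norm \<gamma> (v1 - v2) + sobolev_norm (11/10) (Rop xi1 Xi1 v1 - Rop xi2 Xi2 v2)" by simp
   also note main[OF K n1 n2 nd v1 v2 S]
   finally have "sobolev_norm \<gamma> (v1 - v2) \<le> ?D*d" by (simp add: mult_ac)
   thus "sob_le 0 (v1 - v2) (?D*d)" by (rule sob_le_mono[OF L2[OF sobolev_diff[OF AdomD(1)[OF v1] AdomD(1)[OF v2]]]])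
  qed
 qed
qed

end

section \<open>The evolution problem in an abstract Hilbert space\<close>

lemma gronwall:
 fixes \<phi> :: "real \<Rightarrow> real"
 assumes T: "0 \<le> T" and d: "\<And>t. t \<in> {0..T} ==> (\<phi> has_real_derivative \<phi>' t) (at t within {0..T})"
  and le: "\<And>t. 0 < t ==> t < T ==> \<phi>' t \<le> a*\<phi> t + b" and ab: "0 \<le> a" "0 \<le> b"
 shows "\<phi> T \<le> exp (a*T)*(\<phi> 0 + b*T)"
proof -
 let ?\<psi> = "\<lambda>t. exp (- a*t)*\<phi> t - b*t"
 have "?\<psi> T \<le> ?\<psi> 0"
 proof (rule DERIV_nonpos_imp_decreasing_open[OF T])
  fix t assume t: "0 < t" "t < T"
  hence "(\<phi> has_real_derivative \<phi>' t) (at t)" using d[of t] by (simp add: at_within_Icc_at)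
  hence "(?\<psi> has_real_derivative (exp (- a*t)*(\<phi>' t - a*\<phi> t) - b)) (at t)" by (auto intro!: derivative_eq_intros simp: algebra_simps)
  moreover have "exp (- a*t)*(\<phi>' t - a*\<phi> t) \<le> exp (- a*t)*b" using le[of t] t by (intro mult_left_mono) auto
  moreover have "exp (- a*t)*b \<le> 1*b" using ab t by (intro mult_right_mono) auto
  ultimately show "\<exists>y. (?\<psi> has_real_derivative y) (at t) \<and> y \<le> 0" by (intro exI conjI) (assumption, linarith)
 next
  have "continuous_on {0..T} \<phi>" unfolding continuous_on_eq_continuous_within using d DERIV_continuous by blast
  thus "continuous_on {0..T} ?\<psi>" by (intro continuous_intros)
 qed
 hence "exp (a*T)*(exp (- a*T)*\<phi> T) \<le> exp (a*T)*(\<phi> 0 + b*T)" by (intro mult_left_mono) simp_all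
 thus ?thesis by (simp add: mult.assoc[symmetric] exp_add[symmetric])
qed

lemma energy_bound:
 fixes x :: "real \<Rightarrow> 'a :: real_inner"
 assumes T: "0 \<le> T" and d: "\<And>t. t \<in> {0..T} ==> (x has_vector_derivative x' t) (at t within {0..T})"
  and le: "\<And>t. 0 < t ==> t < T ==> 2*inner (x t) (x' t) \<le> a*(norm (x t))^2 + b" and ab: "0 \<le> a" "0 \<le> b"
 shows "(norm (x T))^2 \<le> exp (a*T)*((norm (x 0))^2 + b*T)"
proof -
 have "((\<lambda>s. (norm (x s))^2) has_real_derivative 2*inner (x t) (x' t)) (at t within {0..T})" if t: "t \<in> {0..T}" for t
 proof -
  have "((\<lambda>s. inner (x s) (x s)) has_derivative (\<lambda>h. inner (x t) (h *\<^sub>R x' t) + inner (h *\<^sub>R x' t) (x t))) (at t within {0..T})"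
   using d[OF t] unfolding has_vector_derivative_def by (rule has_derivative_inner[OF _ d[OF t, unfolded has_vector_derivative_def]])
  thus ?thesis unfolding has_field_derivative_def power2_norm_eq_inner by (rule has_derivative_eq_rhs) (auto simp: inner_commute algebra_simps)
 qed
 from gronwall[OF T this le ab] show ?thesis by simp
qed

lemma vector_derivative_shift:
 fixes x :: "real \<Rightarrow> 'a :: real_normed_vector"
 assumes d: "\<And>t. t \<in> {0..T} ==> (x has_vector_derivative x' t) (at t within {0..T})" and h: "0 \<le> h" and t: "t \<in> {0..T - h}"
 shows "((\<lambda>s. x (s + h)) has_vector_derivative x' (t + h)) (at t within {0..T - h})"
proof -
 have "(x has_vector_derivative x' (t + h)) (at (t + h) within (\<lambda>s. s + h) ` {0..T - h})"
  by (rule has_vector_derivative_within_subset[OF d]) (use h t in auto)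
 moreover have "((\<lambda>s. s + h) has_vector_derivative 1) (at t within {0..T - h})" by (auto intro!: derivative_eq_intros)
 ultimately show ?thesis using vector_diff_chain_within[of "\<lambda>s. s + h" 1 t "{0..T - h}" x "x' (t + h)"] by (simp add: o_def)
qed

lemma has_vector_derivative_quotient:
 fixes x :: "real \<Rightarrow> 'a :: real_normed_vector"
 shows "(x has_vector_derivative v) (at s within A) \<longleftrightarrow> ((\<lambda>y. (1/(y - s)) *\<^sub>R (x y - x s)) \<longlongrightarrow> v) (at s within A)"
proof -
 have "norm (x y - x s - (y - s) *\<^sub>R v)/norm (y - s) = norm ((1/(y - s)) *\<^sub>R (x y - x s) - v)" if "y \<noteq> s" for y
 proof -
  have "(1/(y - s)) *\<^sub>R (x y - x s) - v = (1/(y - s)) *\<^sub>R (x y - x s - (y - s) *\<^sub>R v)" using that by (simp add: scaleR_right_diff_distrib)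
  thus ?thesis by (simp add: divide_inverse abs_inverse mult.commute)
 qed
 hence "((\<lambda>y. norm (x y - x s - (y - s) *\<^sub>R v)/norm (y - s)) \<longlongrightarrow> 0) (at s within A) \<longleftrightarrow>
   ((\<lambda>y. norm ((1/(y - s)) *\<^sub>R (x y - x s) - v)) \<longlongrightarrow> 0) (at s within A)"
  by (intro filterlim_cong refl) (auto simp: eventually_at_filter)
 thus ?thesis unfolding has_vector_derivative_def has_derivative_iff_norm by (simp add: bounded_linear_scaleR_left tendsto_norm_zero_iff LIM_zero_iff)
qed

lemma difference_quotient:
 fixes x :: "real \<Rightarrow> 'a :: real_normed_vector"
 assumes "(x has_vector_derivative v) (at s within {0..T})" "0 \<le> s" "s < T"
 shows "((\<lambda>h. (1/h) *\<^sub>R (x (s + h) - x s)) \<longlongrightarrow> v) (at_right 0)"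
proof -
 have "(x has_vector_derivative v) (at s within {s..T})" by (rule has_vector_derivative_within_subset[OF assms(1)]) (use assms in auto)
 hence "((\<lambda>y. (1/(y - s)) *\<^sub>R (x y - x s)) \<longlongrightarrow> v) (at_right s)"
  using assms by (simp add: at_within_Icc_at_right has_vector_derivative_quotient)
 thus ?thesis unfolding filterlim_at_right_to_0[of _ _ s] by (simp add: add.commute)
qed

lemma mean_value_bound:
 fixes x :: "real \<Rightarrow> 'a :: real_normed_vector"
 assumes "0 \<le> h" and d: "\<And>s. s \<in> {a..a + h} ==> (x has_vector_derivative x' s) (at s within {a..a + h})"
  and le: "\<And>s. s \<in> {a..a + h} ==> norm (x' s - v) \<le> B"
 shows "norm (x (a + h) - x a - h *\<^sub>R v) \<le> B*h"
proof -
 have "norm ((x (a + h) - (a + h) *\<^sub>R v) - (x a - a *\<^sub>R v)) \<le> B*norm (a + h - a)"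
 proof (rule differentiable_bound[of "{a..a + h}" "\<lambda>s. x s - s *\<^sub>R v" "\<lambda>s t. t *\<^sub>R (x' s - v)"])
  fix s assume s: "s \<in> {a..a + h}"
  have "((\<lambda>s. x s - s *\<^sub>R v) has_vector_derivative (x' s - v)) (at s within {a..a + h})" using d[OF s] by (auto intro!: derivative_eq_intros)
  thus "((\<lambda>s. x s - s *\<^sub>R v) has_derivative (\<lambda>t. t *\<^sub>R (x' s - v))) (at s within {a..a + h})"
   by (simp only: has_vector_derivative_def)
  have "norm (t *\<^sub>R (x' s - v)) \<le> B*norm t" for t using mult_left_mono[OF le[OF s] abs_ge_zero[of t]] by (simp add: mult.commute)
  thus "onorm (\<lambda>t. t *\<^sub>R (x' s - v)) \<le> B" by (rule onorm_le)
 qed (use assms(1) in auto)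
 thus ?thesis using assms(1) by (simp add: algebra_simps)
qed

lemma twice_square: "a \<le> n*(k*n) ==> 2*a \<le> 2*k*n^2" for a n k :: real by (simp add: power2_eq_square mult_ac)

lemma exp_six: "exp (6*a * s) = (exp (3*a * s))^2" for a s :: real unfolding power2_eq_square exp_add[symmetric] by simp

lemma frac_mult_le: "0 \<le> k ==> 0 \<le> a ==> k*(a/(k + 1)) \<le> a" for a k :: real by (simp add: field_simps)

lemma norm_four: "norm (- p + q + (r - s)) \<le> norm p + norm q + (norm r + norm s)" for p :: "'a :: real_normed_vector"
 using norm_triangle_ineq[of "- p + q" "r - s"] norm_triangle_ineq[of "- p" q] norm_triangle_ineq4[of r s] by simp

text \<open>\<open>J\<close> is multiplication by i, \<open>G e\<close> the inverse of H_e,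
  \<open>S a x\<close> the bound of |x| by \<open>a\<close>; \<open>fe e\<close> and
  \<open>f\<close> are H_e u_e and H u. With inverses in place of the operators no domains have to
  be compared. Symmetry over the complex numbers reads \<open>inner (J x) (G e x) = 0\<close> in a
  real inner product space. The limit operator enters through the convergence of
  \<open>G e (f t)\<close> to \<open>u t\<close>.\<close>

locale nls_limit =
 fixes J F :: "'a :: real_inner \<Rightarrow> 'a" and G :: "real \<Rightarrow> 'a \<Rightarrow> 'a" and S :: "real \<Rightarrow> 'a \<Rightarrow> bool"
  and e0 T c :: real and u du f :: "real \<Rightarrow> 'a" and ue due fe :: "real \<Rightarrow> real \<Rightarrow> 'a"
 assumes T: "0 < T" and e0: "0 < e0" and c: "0 \<le> c"
  and J: "\<And>x y. J (x - y) = J x - J y" "\<And>x y. inner (J x) (J y) = inner x y" "\<And>x. J (J x) = - x"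
  and G: "\<And>e x y. e \<in> {0<..<e0} ==> G e (x - y) = G e x - G e y"
   "\<And>e x. e \<in> {0<..<e0} ==> norm (G e x) \<le> c*norm x"
   "\<And>e x. e \<in> {0<..<e0} ==> inner (J x) (G e x) = 0"
  and S: "\<And>a b x. S a x ==> a \<le> b ==> S b x" "\<And>a b x y. S a x ==> S b y ==> S (a + b) (x + y)"
   "\<And>a t. t \<in> {0..T} ==> 0 \<le> a ==> (\<And>e. 0 < e ==> \<exists>y. S a y \<and> norm (u t - y) \<le> e) ==> S a (u t)"
  and ehrling: "\<And>\<delta>. 0 < \<delta> ==> \<exists>D\<ge>0. \<forall>e\<in>{0<..<e0}. \<forall>x. S (\<delta>*norm x + D*norm (G e x)) (G e x)"
  and F: "\<And>M a. S M a ==> norm (F a) \<le> M^3"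
   "\<And>M a b. S M a ==> S M b ==> norm (F a - F b) \<le> 3*M^2*norm (a - b)"
   "\<And>M w a b c d. S M a ==> S M b ==> S M c ==> S M d ==> S w (a - c) ==> S w (b - d) ==>
    norm (F a - F b - (F c - F d)) \<le> 3*M^2*norm (a - b - (c - d)) + 6*M*w*norm (c - d)"
  and ue: "\<And>e t. e \<in> {0<..<e0} ==> t \<in> {0..T} ==> (ue e has_vector_derivative due e t) (at t within {0..T})"
   "\<And>e. e \<in> {0<..<e0} ==> continuous_on {0..T} (due e)" "\<And>e. e \<in> {0<..<e0} ==> continuous_on {0..T} (fe e)"
   "\<And>e t. e \<in> {0<..<e0} ==> t \<in> {0..T} ==> ue e t = G e (fe e t)"
   "\<And>e t. e \<in> {0<..<e0} ==> t \<in> {0..T} ==> J (due e t) = fe e t - F (ue e t)"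
   "\<And>e. e \<in> {0<..<e0} ==> fe e 0 = f 0"
  and u: "\<And>t. t \<in> {0..T} ==> (u has_vector_derivative du t) (at t within {0..T})" "continuous_on {0..T} du"
   "continuous_on {0..T} f" "\<And>t. t \<in> {0..T} ==> J (du t) = f t - F (u t)"
   "\<And>t. t \<in> {0..T} ==> ((\<lambda>e. G e (f t)) \<longlongrightarrow> u t) (at_right 0)"
begin

lemma eventually_index: "\<forall>\<^sub>F e in at_right 0. e \<in> {0<..<e0}" using e0 by (rule eventually_at_right_real)

lemma J_norm: "norm (J x) = norm x" by (simp add: norm_eq_sqrt_inner J(2))

lemma J_skew: "inner x (J y) = - inner (J x) y" using J(2)[of x "J y"] by (simp add: J(3))

lemma G_skew: "e \<in> {0<..<e0} ==> inner (J x) (G e y) = - inner (J y) (G e x)"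
 using G(3)[of e "x - y"] G(3)[of e x] G(3)[of e y] by (simp add: G(1) J(1) inner_diff_left inner_diff_right)

text \<open>The pairing of \<open>J (G e g)\<close> with \<open>g\<close> vanishes by symmetry of
  \<open>G e\<close>, so the unbounded operator drops out of the energy and only the nonlinear part
  \<open>p\<close> is left.\<close>

lemma inner_energy:
 assumes e: "e \<in> {0<..<e0}" and x: "J x' = g - p" shows "inner (G e g) x' \<le> norm (G e g)*norm p"
proof -
 have "inner (G e g) x' = inner (J (G e g)) g - inner (J (G e g)) p" unfolding J(2)[symmetric, of "G e g" x'] x by (rule inner_diff_right)
 also have "inner (J (G e g)) g = 0" using J_skew[of g "G e g"] G(3)[OF e, of g] by (simp add: inner_commute)
 finally show ?thesis using Cauchy_Schwarz_ineq2[of "J (G e g)" p] unfolding J_norm by linarith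
qed

definition "\<Phi> = (SOME b. \<forall>t\<in>{0..T}. norm (f t) \<le> b)"

lemma f_bound: "t \<in> {0..T} ==> norm (f t) \<le> \<Phi>"
proof -
 have "\<exists>b. \<forall>t\<in>{0..T}. norm (f t) \<le> b"
  using compact_imp_bounded[OF compact_continuous_image[OF u(3) compact_Icc]] unfolding bounded_iff by simp
 from someI_ex[OF this] show "t \<in> {0..T} ==> norm (f t) \<le> \<Phi>" unfolding \<Phi>_def by blast
qed

lemma \<Phi>_nonneg: "0 \<le> \<Phi>" using f_bound[of 0] T norm_ge_zero[of "f 0"] by (simp del: norm_ge_zero)

text \<open>A bound for \<open>G e\<close> from L2 to bounded functions: the small-factor inequality
  with \<delta> = 1, its second term being controlled by the L2 bound \<open>c\<close>.\<close>

definition "kS = 1 + c*(SOME D. D \<ge> 0 \<and> (\<forall>e\<in>{0<..<e0}. \<forall>x. S (1*norm x + D*norm (G e x)) (G e x)))"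

lemma kS: "0 \<le> kS" "e \<in> {0<..<e0} ==> S (kS*norm x) (G e x)"
proof -
 let ?D = "SOME D. D \<ge> 0 \<and> (\<forall>e\<in>{0<..<e0}. \<forall>x. S (1*norm x + D*norm (G e x)) (G e x))"
 have D: "?D \<ge> 0 \<and> (\<forall>e\<in>{0<..<e0}. \<forall>x. S (1*norm x + ?D*norm (G e x)) (G e x))" using someI_ex[OF ehrling[of 1]] by simp
 thus "0 \<le> kS" unfolding kS_def using c by simp
 assume e: "e \<in> {0<..<e0}"
 show "S (kS*norm x) (G e x)"
 proof (rule S(1))
  show "S (1*norm x + ?D*norm (G e x)) (G e x)" using D e by blast
  show "1*norm x + ?D*norm (G e x) \<le> kS*norm x" using mult_left_mono[OF G(2)[OF e, of x], of ?D] D unfolding kS_def by (simp add: algebra_simps)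
 qed
qed

text \<open>\<open>M0\<close> bounds the limit solution and all \<open>G e (f t)\<close>;
  \<open>M\<close> is the radius of the bootstrap, with room 1 to spare; \<open>V\<close> and
  \<open>V1\<close> bound \<open>due\<close> and \<open>fe\<close> as long as the solution stays
  within that radius.\<close>

definition "M0 = kS*\<Phi>"
definition "M = M0 + 1"
definition "V = exp (3*M^2*T)*(\<Phi> + M^3)"
definition "V1 = V + M^3"

lemma M: "0 \<le> M0" "0 \<le> M" "0 \<le> V" "0 \<le> V1" "\<Phi> + M^3 \<le> V"
proof -
 show 0: "0 \<le> M0" "0 \<le> M" unfolding M_def M0_def using kS(1) \<Phi>_nonneg by simp_all
 have p: "0 \<le> \<Phi> + M^3" using 0 \<Phi>_nonneg by simp
 thus "0 \<le> V" unfolding V_def by simp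
 thus "0 \<le> V1" unfolding V1_def using 0 by simp
 have "1*(\<Phi> + M^3) \<le> V" unfolding V_def using p T by (intro mult_right_mono) simp_all
 thus "\<Phi> + M^3 \<le> V" by simp
qed

lemma S_Gf: "e \<in> {0<..<e0} ==> t \<in> {0..T} ==> S M0 (G e (f t))" unfolding M0_def using kS(1) by (intro S(1)[OF kS(2)] mult_left_mono f_bound)

lemma S_u: assumes t: "t \<in> {0..T}" shows "S M0 (u t)"
proof (rule S(3)[OF t M(1)])
 fix d :: real assume d: "0 < d"
 have "\<forall>\<^sub>F e in at_right 0. dist (G e (f t)) (u t) < d" using u(5)[OF t] d by (rule tendstoD)
 moreover note eventually_index
 ultimately have "\<forall>\<^sub>F e in at_right (0::real). \<exists>y. S M0 y \<and> norm (u t - y) \<le> d"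
  by eventually_elim (use S_Gf[OF _ t] in \<open>force simp: dist_norm norm_minus_commute\<close>)
 thus "\<exists>y. S M0 y \<and> norm (u t - y) \<le> d" by simp
qed

lemma S_M: "S M0 x ==> S M x" by (erule S(1)) (simp add: M_def)

section \<open>Bootstrap of the uniform sup bound\<close>

definition "good e t \<longleftrightarrow> e \<in> {0<..<e0} \<and> t \<in> {0..T} \<and> (\<forall>s\<in>{0..t}. S M (ue e s))"

lemma goodD: "good e t ==> e \<in> {0<..<e0}" "good e t ==> t \<in> {0..T}" "good e t ==> 0 \<le> s ==> s \<le> t ==> S M (ue e s)" by (auto simp: good_def)

lemma shift_derivative:
 assumes g: "good e t1" and h: "0 \<le> h" "s + h \<le> t1" and r: "r \<in> {0..s}"
 shows "((\<lambda>r. ue e (r + h)) has_vector_derivative due e (r + h)) (at r within {0..s})"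
proof -
 have "(ue e has_vector_derivative due e t) (at t within {0..s + h})" if "t \<in> {0..s + h}" for t
  by (rule has_vector_derivative_within_subset[OF ue(1)[OF goodD(1)[OF g]]]) (use that h goodD(2)[OF g] in auto)
 from vector_derivative_shift[of "s + h" "ue e" "due e" h r, OF this h(1)] r show ?thesis by simp
qed

text \<open>The solution has only one time derivative, so the equation is differenced instead of
  differentiated. The operator drops out by \<open>inner_energy\<close>, the nonlinearity is
  Lipschitz with constant \<open>3*M^2\<close>, and Gronwall gives the growth.\<close>

lemma first_difference:
 assumes g: "good e t1" and h: "0 \<le> h" "0 \<le> s" "s + h \<le> t1"
 shows "norm (ue e (s + h) - ue e s) \<le> exp (3*M^2 * s)*norm (ue e h - ue e 0)"
proof -
 note e = goodD(1)[OF g] and t1 = goodD(2)[OF g]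
 let ?x = "\<lambda>r. ue e (r + h) - ue e r" and ?x' = "\<lambda>r. due e (r + h) - due e r"
 have "(norm (?x s))^2 \<le> exp (6*M^2 * s)*((norm (?x 0))^2 + 0 * s)"
 proof (rule energy_bound[OF h(2), where x' = ?x'])
  fix r assume r: "r \<in> {0..s}"
  have "((\<lambda>r. ue e (r + 0)) has_vector_derivative due e (r + 0)) (at r within {0..s})" by (rule shift_derivative[OF g _ _ r]) (use h in simp_all)
  thus "(?x has_vector_derivative ?x' r) (at r within {0..s})" by (intro has_vector_derivative_diff shift_derivative[OF g h(1,3) r]) simp
 next
  fix r assume r: "0 < r" "r < s"
  have m: "r \<in> {0..T}" "r + h \<in> {0..T}" using r h t1 by auto
  have x: "?x r = G e (fe e (r + h) - fe e r)" unfolding G(1)[OF e] ue(4)[OF e m(1)] ue(4)[OF e m(2)] ..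
  have "J (?x' r) = (fe e (r + h) - fe e r) - (F (ue e (r + h)) - F (ue e r))" unfolding J(1) ue(5)[OF e m(1)] ue(5)[OF e m(2)] by simp
  from inner_energy[OF e this] have "inner (?x r) (?x' r) \<le> norm (?x r)*norm (F (ue e (r + h)) - F (ue e r))" unfolding x .
  also have "... \<le> norm (?x r)*(3*M^2*norm (?x r))" using r h by (intro mult_left_mono F(2) goodD(3)[OF g]) simp_all
  finally have "2*inner (?x r) (?x' r) \<le> 2*(3*M^2)*(norm (?x r))^2" by (rule twice_square)
  thus "2*inner (?x r) (?x' r) \<le> 6*M^2*(norm (?x r))^2 + 0" by simp
 qed simp_all
 also have "... = (exp (3*M^2 * s)*norm (?x 0))^2" unfolding exp_six power_mult_distrib by simp
 finally have "norm (?x s) \<le> exp (3*M^2 * s)*norm (?x 0)" by (rule power2_le_imp_le) simp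
 thus ?thesis by simp
qed

text \<open>This is what the choice of initial data buys: \<open>fe e 0 = f 0\<close> for all
  \<open>e\<close>, so the equation bounds the initial velocity uniformly.\<close>

lemma due_0: assumes e: "e \<in> {0<..<e0}" shows "norm (due e 0) \<le> \<Phi> + M^3" "S M (ue e 0)"
proof -
 have 0: "0 \<in> {0..T}" using T by simp
 show s: "S M (ue e 0)" using S_M[OF S_Gf[OF e 0]] unfolding ue(4)[OF e 0] ue(6)[OF e] .
 have "norm (due e 0) = norm (f 0 - F (ue e 0))" unfolding J_norm[symmetric, of "due e 0"] ue(5)[OF e 0] ue(6)[OF e] ..
 also have "... \<le> norm (f 0) + norm (F (ue e 0))" by (rule norm_triangle_ineq4)
 also have "... \<le> \<Phi> + M^3" by (intro add_mono f_bound[OF 0] F(1) s)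
 finally show "norm (due e 0) \<le> \<Phi> + M^3" .
qed

text \<open>Divide \<open>first_difference\<close> by the step and let it tend to 0. The quotients
  are taken from the right, hence the strict inequality s < t1.\<close>

lemma due_growth:
 assumes g: "good e t1" and s: "0 \<le> s" "s < t1"
 shows "norm (due e s) \<le> exp (3*M^2 * s)*norm (due e 0)" "norm (due e s) \<le> V"
proof -
 note e = goodD(1)[OF g] and t1 = goodD(2)[OF g]
 have q: "((\<lambda>h. (1/h) *\<^sub>R (ue e (r + h) - ue e r)) \<longlongrightarrow> due e r) (at_right 0)" if "0 \<le> r" "r < t1" for r
  by (rule difference_quotient[OF ue(1)[OF e]]) (use that t1 in auto)
 show 1: "norm (due e s) \<le> exp (3*M^2 * s)*norm (due e 0)"
 proof (rule tendsto_le[OF _ tendsto_mult[OF tendsto_const tendsto_norm[OF q]] tendsto_norm[OF q[OF s]]])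
  have "\<forall>\<^sub>F h in at_right 0. h \<in> {0<..<t1 - s}" using s by (intro eventually_at_right_real) simp
  thus "\<forall>\<^sub>F h in at_right 0. norm ((1/h) *\<^sub>R (ue e (s + h) - ue e s)) \<le> exp (3*M^2 * s)*norm ((1/h) *\<^sub>R (ue e (0 + h) - ue e 0))"
  proof eventually_elim
   case (elim h)
   have "norm (ue e (s + h) - ue e s) \<le> exp (3*M^2 * s)*norm (ue e h - ue e 0)" by (rule first_difference[OF g]) (use elim s in auto)
   thus ?case using elim by (simp add: divide_simps)
  qed
 qed (use s in auto)
 also have "... \<le> exp (3*M^2*T)*(\<Phi> + M^3)" using s t1 by (intro mult_mono due_0(1)[OF e]) (auto intro!: mult_left_mono)
 finally show "norm (due e s) \<le> V" unfolding V_def .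
qed

lemma fe_bound: assumes g: "good e t1" and s: "0 \<le> s" "s < t1" shows "norm (fe e s) \<le> V1"
proof -
 note e = goodD(1)[OF g]
 have m: "s \<in> {0..T}" using s goodD(2)[OF g] by auto
 have "norm (fe e s) = norm (J (due e s) + F (ue e s))" unfolding ue(5)[OF e m] by simp
 also have "... \<le> norm (due e s) + norm (F (ue e s))" unfolding J_norm[symmetric, of "due e s"] by (rule norm_triangle_ineq)
 also have "... \<le> V1" unfolding V1_def by (intro add_mono due_growth(2)[OF g s] F(1) goodD(3)[OF g]) (use s in simp_all)
 finally show ?thesis .
qed

text \<open>The uniform bound \<open>c\<close> makes the maps \<open>G e\<close> equicontinuous, so
  their pointwise convergence is uniform along the compact curve of pairs (f t, u t). The three
  thirds of the error are the move to a net point before and after applying \<open>G e\<close>, and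
  the error at the net point.\<close>

lemma uniform_resolvent:
 assumes eta: "0 < eta" shows "\<forall>\<^sub>F e in at_right 0. \<forall>t\<in>{0..T}. norm (G e (f t) - u t) \<le> eta"
proof -
 have cu: "continuous_on {0..T} u" unfolding continuous_on_eq_continuous_within using u(1) has_vector_derivative_continuous by blast
 have "uniformly_continuous_on {0..T} (\<lambda>t. (f t, u t))" by (intro compact_uniformly_continuous continuous_on_Pair u(3) cu compact_Icc)
 moreover have h: "0 < eta/(3*(c + 1))" using eta c by simp
 ultimately obtain d where d: "0 < d" "\<And>s t. s \<in> {0..T} ==> t \<in> {0..T} ==> dist s t < d ==> dist (f s, u s) (f t, u t) < eta/(3*(c + 1))"
  unfolding uniformly_continuous_on_def by metis
 obtain N where N: "finite N" "N \<subseteq> {0..T}" "{0..T} \<subseteq> (\<Union>x\<in>N. ball x d)"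
 proof (rule compactE_image[OF compact_Icc, of "{0..T}" "\<lambda>x. ball x d"])
  show "{0..T} \<subseteq> (\<Union>x\<in>{0..T}. ball x d)" using d(1) by auto
 qed (simp_all add: that)
 have "\<forall>\<^sub>F e in at_right 0. \<forall>x\<in>N. dist (G e (f x)) (u x) < eta/3"
  using N(2) eta by (intro eventually_ball_finite[OF N(1)] ballI tendstoD[OF u(5)]) auto
 moreover note eventually_index
 ultimately show ?thesis
 proof eventually_elim
  case (elim e)
  show ?case
  proof
   fix t assume t: "t \<in> {0..T}"
   then obtain x where x: "x \<in> N" "dist x t < d" using N(3) by auto
   have *: "dist (f x, u x) (f t, u t) < eta/(3*(c + 1))" using d(2) x t N(2) by blast
   have "norm (f t - f x) \<le> eta/(3*(c + 1))" "norm (u x - u t) \<le> eta/(3*(c + 1))"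
    using dist_fst_le[of "(f x, u x)" "(f t, u t)"] dist_snd_le[of "(f x, u x)" "(f t, u t)"] * by (simp_all add: dist_norm norm_minus_commute)
   moreover have "norm (G e (f t - f x)) \<le> c*norm (f t - f x)" by (rule G(2)[OF elim(2)])
   moreover have "c*norm (f t - f x) \<le> c*(eta/(3*(c + 1)))" using calculation(1) c by (intro mult_left_mono)
   moreover have "c*(eta/(3*(c + 1))) \<le> eta/3" "eta/(3*(c + 1)) \<le> eta/3" using c eta by (simp_all add: divide_simps)
   moreover have "norm (G e (f x) - u x) < eta/3" using elim(1) x(1) by (simp add: dist_norm)
   moreover have "G e (f t) - u t = G e (f t - f x) + (G e (f x) - u x) + (u x - u t)" unfolding G(1)[OF elim(2)] by simp
   hence "norm (G e (f t) - u t) \<le> norm (G e (f t - f x)) + norm (G e (f x) - u x) + norm (u x - u t)"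
    using norm_triangle_ineq[of "G e (f t - f x) + (G e (f x) - u x)" "u x - u t"] norm_triangle_ineq[of "G e (f t - f x)" "G e (f x) - u x"] by simp
   ultimately show "norm (G e (f t) - u t) \<le> eta" by linarith
  qed
 qed
qed

definition "err eta = sqrt (exp (6*M^2*T)*(eta^2 + 2*eta*(V1 + \<Phi>)*T))"

text \<open>Split u_e - u = G_e(f_e - f) + r with the resolvent error r = G_e f - u. The first part
  pairs to zero with f_e - f. The second costs at most \<open>eta\<close> times the bound
  \<open>V1 + \<Phi>\<close> of f_e - f, and this is where a bound on H_e u_e is required besides
  the one on u_e.\<close>

lemma conditional_convergence:
 assumes g: "good e t1" and eta: "0 \<le> eta" "\<And>t. t \<in> {0..T} ==> norm (G e (f t) - u t) \<le> eta" and s: "0 \<le> s" "s \<le> t1"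
 shows "norm (ue e s - u s) \<le> err eta"
proof -
 note e = goodD(1)[OF g] and t1 = goodD(2)[OF g]
 let ?x = "\<lambda>r. ue e r - u r" and ?x' = "\<lambda>r. due e r - du r" and ?b = "2*eta*(V1 + \<Phi>)"
 have b: "0 \<le> ?b" using eta(1) M \<Phi>_nonneg by simp
 have sub: "{0..s} \<subseteq> {0..T}" using s t1 by auto
 have "(norm (?x s))^2 \<le> exp (6*M^2 * s)*((norm (?x 0))^2 + ?b * s)"
 proof (rule energy_bound[OF s(1), where x' = ?x'])
  fix r assume "r \<in> {0..s}"
  thus "(?x has_vector_derivative ?x' r) (at r within {0..s})"
   using sub by (intro has_vector_derivative_diff has_vector_derivative_within_subset[OF ue(1)[OF e] sub] has_vector_derivative_within_subset[OF u(1) sub]) auto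
 next
  fix r assume r: "0 < r" "r < s"
  have m: "r \<in> {0..T}" using r sub by auto
  let ?g = "fe e r - f r" and ?r = "G e (f r) - u r" and ?p = "F (ue e r) - F (u r)"
  have x: "?x r = G e ?g + ?r" unfolding G(1)[OF e] ue(4)[OF e m] by simp
  have Jx: "J (?x' r) = ?g - ?p" unfolding J(1) ue(5)[OF e m] u(4)[OF m] by simp
  have "inner (?x r) (?x' r) = inner (J (?x r)) ?g - inner (J (?x r)) ?p" unfolding J(2)[symmetric, of "?x r"] Jx by (rule inner_diff_right)
  also have "inner (J (?x r)) ?g = inner (J (?x r) - J ?r + J ?r) ?g" by simp
  also have "... = inner (J (G e ?g)) ?g + inner (J ?r) ?g" unfolding J(1)[symmetric] x inner_add_left by simp
  also have "inner (J (G e ?g)) ?g = 0" using J_skew[of ?g "G e ?g"] G(3)[OF e, of ?g] by (simp add: inner_commute)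
  finally have "inner (?x r) (?x' r) = inner (J ?r) ?g - inner (J (?x r)) ?p" by simp
  hence "2*inner (?x r) (?x' r) = 2*inner (J ?r) ?g + 2*(- inner (J (?x r)) ?p)" by simp
  moreover have "2*inner (J ?r) ?g \<le> ?b"
  proof -
   have "norm ?g \<le> V1 + \<Phi>" by (intro order_trans[OF norm_triangle_ineq4] add_mono f_bound[OF m] fe_bound[OF g]) (use r s in simp_all)
   hence "norm (J ?r)*norm ?g \<le> eta*(V1 + \<Phi>)" unfolding J_norm by (intro mult_mono eta m) (simp_all add: eta)
   thus ?thesis using norm_cauchy_schwarz[of "J ?r" ?g] unfolding mult.assoc by linarith
  qed
  moreover have "2*(- inner (J (?x r)) ?p) \<le> 2*(3*M^2)*(norm (?x r))^2"
  proof -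
   have "norm (J (?x r))*norm ?p \<le> norm (?x r)*(3*M^2*norm (?x r))" unfolding J_norm
    by (intro mult_left_mono F(2) goodD(3)[OF g] S_M[OF S_u[OF m]]) (use r s in simp_all)
   hence "- inner (J (?x r)) ?p \<le> norm (?x r)*(3*M^2*norm (?x r))" using Cauchy_Schwarz_ineq2[of "J (?x r)" ?p] by linarith
   thus ?thesis by (rule twice_square)
  qed
  ultimately show "2*inner (?x r) (?x' r) \<le> 6*M^2*(norm (?x r))^2 + ?b" by linarith
 qed (use b in simp_all)
 also have "... \<le> exp (6*M^2*T)*(eta^2 + ?b*T)"
 proof (intro mult_mono add_mono power_mono)
  have 0: "0 \<in> {0..T}" using T by simp
  show "norm (?x 0) \<le> eta" using eta(2)[OF 0] unfolding ue(4)[OF e 0] ue(6)[OF e] .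
 qed (use s t1 b eta M(4) \<Phi>_nonneg in \<open>auto intro!: mult_left_mono\<close>)
 finally have "(norm (?x s))^2 \<le> exp (6*M^2*T)*(eta^2 + ?b*T)" .
 thus ?thesis unfolding err_def by (rule real_le_rsqrt)
qed

lemma err_limit: "(err \<longlongrightarrow> 0) (at_right 0)" unfolding err_def[abs_def] by (auto intro!: tendsto_eq_intros)

text \<open>While |u_e| \<le> M, a better bound holds: in u_e = G_e f + G_e(f_e - f) the first term
  is bounded by \<open>M0\<close>, and \<open>ehrling\<close> makes the second small in the sup
  norm, because f_e - f is bounded and G_e(f_e - f) tends to 0 in L2.\<close>

lemma improve:
 assumes \<nu>: "0 < \<nu>"
 shows "\<forall>\<^sub>F e in at_right 0. \<forall>t1. good e t1 --> (\<forall>s. 0 \<le> s --> s \<le> t1 --> norm (ue e s - u s) \<le> \<nu>) \<and>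
  (\<forall>s. 0 \<le> s --> s < t1 --> S (M0 + 1/2) (ue e s))"
proof -
 \<comment> \<open>\<delta> times the bound of f_e - f is at most 1/4; the other 1/4 of the improved
   bound is \<open>D*(err eta + eta)\<close>.\<close>
 define \<delta> where "\<delta> = 1/(4*(V1 + \<Phi> + 1))"
 have p: "0 < V1 + \<Phi> + 1" using M \<Phi>_nonneg by linarith
 have \<delta>: "0 < \<delta>" "\<delta>*(V1 + \<Phi>) \<le> 1/4" using p by (simp_all add: \<delta>_def divide_simps)
 obtain D where D: "0 \<le> D" "\<forall>e\<in>{0<..<e0}. \<forall>x. S (\<delta>*norm x + D*norm (G e x)) (G e x)" using ehrling[OF \<delta>(1)] by blast
 have "((\<lambda>eta. D*(err eta + eta)) \<longlongrightarrow> D*(0 + 0)) (at_right 0)" by (intro tendsto_intros err_limit)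
 hence "\<forall>\<^sub>F eta in at_right 0. D*(err eta + eta) < 1/4" by (rule order_tendstoD(2)) simp
 moreover have "\<forall>\<^sub>F eta in at_right 0. err eta < \<nu>" using err_limit \<nu> by (rule order_tendstoD(2))
 moreover have "\<forall>\<^sub>F eta in at_right (0::real). 0 < eta" by (rule eventually_at_right_less)
 ultimately have "\<forall>\<^sub>F eta in at_right 0. D*(err eta + eta) < 1/4 \<and> err eta < \<nu> \<and> 0 < eta" by eventually_elim blast
 then obtain eta where eta: "D*(err eta + eta) < 1/4" "err eta < \<nu>" "0 < eta" using eventually_happens'[of "at_right (0::real)"] by auto
 show ?thesis using uniform_resolvent[OF eta(3)]
 proof (eventually_elim, intro allI impI conjI)
  fix e t1 s :: real assume r: "\<forall>t\<in>{0..T}. norm (G e (f t) - u t) \<le> eta" and g: "good e t1" and s0: "0 \<le> s"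
  have cc: "norm (ue e s - u s) \<le> err eta" if "s \<le> t1" by (rule conditional_convergence[OF g]) (use r eta s0 that in auto)
  show "norm (ue e s - u s) \<le> \<nu>" if "s \<le> t1" using cc[OF that] eta(2) by simp
  assume s: "s < t1"
  note e = goodD(1)[OF g]
  have m: "s \<in> {0..T}" using s s0 goodD(2)[OF g] by auto
  let ?g = "fe e s - f s"
  have ng: "norm ?g \<le> V1 + \<Phi>" by (intro order_trans[OF norm_triangle_ineq4] add_mono f_bound[OF m] fe_bound[OF g s0 s])
  have x: "G e ?g = (ue e s - u s) + - (G e (f s) - u s)" unfolding G(1)[OF e] ue(4)[OF e m] by simp
  have "norm (G e ?g) \<le> norm (ue e s - u s) + norm (- (G e (f s) - u s))" unfolding x by (rule norm_triangle_ineq)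
  moreover have "norm (ue e s - u s) \<le> err eta" using s by (intro cc) simp
  moreover have "norm (G e (f s) - u s) \<le> eta" using r m by blast
  ultimately have "norm (G e ?g) \<le> err eta + eta" unfolding norm_minus_cancel by linarith
  from mult_left_mono[OF this D(1)] eta(1) have "D*norm (G e ?g) \<le> 1/4" by linarith
  moreover have "\<delta>*norm ?g \<le> 1/4" using mult_left_mono[OF ng, of \<delta>] \<delta> by linarith
  ultimately have "S (1/2) (G e ?g)" by (intro S(1)[OF D(2)[rule_format, OF e]]) linarith
  from S(2)[OF S_Gf[OF e m] this] show "S (M0 + 1/2) (ue e s)" unfolding G(1)[OF e] ue(4)[OF e m] by simp
 qed
qed

text \<open>Take the supremum \<open>t\<close> of the good times. Since \<open>fe e\<close> is
  continuous in L2 and \<open>kS\<close> converts this to the sup norm, the improved bound before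
  \<open>t\<close> persists with 1/4 more on a neighbourhood of \<open>t\<close>, so
  \<open>t\<close> can only be T. The size of the neighbourhood depends on \<open>e\<close>, the
  conclusion does not.\<close>

lemma bootstrap: "\<forall>\<^sub>F e in at_right 0. good e T"
proof -
 show ?thesis using eventually_index improve[OF zero_less_one]
 proof eventually_elim
  case (elim e)
  note e = elim(1)
  define X where "X = {t. good e t}"
  have X0: "0 \<in> X" using e T due_0(2)[OF e] by (auto simp: X_def good_def)
  have XT: "X \<subseteq> {0..T}" by (auto simp: X_def good_def)
  hence bdd: "bdd_above X" by (meson bdd_above_Icc bdd_above_mono)
  define t where "t = Sup X"
  have t: "0 \<le> t" "t \<le> T"
  proof -
   show "0 \<le> t" unfolding t_def by (rule cSup_upper[OF X0 bdd])
   show "t \<le> T" unfolding t_def by (rule cSup_least) (use X0 XT in auto)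
  qed
  have below: "S (M0 + 1/2) (ue e s)" if s: "0 \<le> s" "s < t" for s
  proof -
   have "X \<noteq> {}" using X0 by blast
   then obtain t1 where "t1 \<in> X" "s < t1" using less_cSupD[OF _ s(2)[unfolded t_def]] by blast
   thus ?thesis using elim(2) s(1) by (auto simp: X_def)
  qed
  \<comment> \<open>\<open>kS\<close> times this is at most 1/8, and two such steps, to
    \<open>t\<close> and back, cost 1/4.\<close>
  have q: "0 < 1/(8*(kS + 1))" using kS(1) by simp
  obtain d where d: "0 < d" "\<And>s. s \<in> {0..T} ==> dist s t < d ==> dist (fe e s) (fe e t) < 1/(8*(kS + 1))"
   using ue(3)[OF e, unfolded continuous_on_iff, rule_format, of t, OF _ q] t by auto
  have d8: "kS*norm (fe e s - fe e t) \<le> 1/8" if "s \<in> {0..T}" "dist s t < d" for s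
  proof -
   have "kS*norm (fe e s - fe e t) \<le> kS*(1/(8*(kS + 1)))" using d(2)[OF that] kS(1) by (intro mult_left_mono) (simp_all add: dist_norm)
   also have "... \<le> 1/8" using kS(1) by (simp add: field_simps)
   finally show ?thesis .
  qed
  \<comment> \<open>The improved bound is available strictly before \<open>t\<close>, so a slightly
    earlier time serves as reference; at t = 0 the initial datum takes its place.\<close>
  define s' where "s' = max 0 (t - d/2)"
  have s': "s' \<in> {0..T}" "dist s' t < d" "S (M0 + 1/2) (ue e s')"
  proof -
   show "s' \<in> {0..T}" "dist s' t < d" using t d(1) by (auto simp: s'_def dist_real_def)
   show "S (M0 + 1/2) (ue e s')"
   proof (cases "t = 0")
    case True
    hence "s' = 0" using d(1) by (simp add: s'_def)
    moreover have "S M0 (ue e 0)" using S_Gf[OF e, of 0] T unfolding ue(4)[OF e, of 0, simplified] ue(6)[OF e] by (simp add: ue(4)[OF e] ue(6)[OF e])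
    ultimately show ?thesis by (auto intro: S(1))
   qed (use t d(1) in \<open>auto simp: s'_def intro!: below\<close>)
  qed
  have near: "S M (ue e s)" if s: "s \<in> {0..T}" "dist s t < d" for s
  proof -
   have "fe e s - fe e s' = (fe e s - fe e t) - (fe e s' - fe e t)" by simp
   hence "norm (fe e s - fe e s') \<le> norm (fe e s - fe e t) + norm (fe e s' - fe e t)" by (simp only: norm_triangle_ineq4)
   from mult_left_mono[OF this kS(1)] have "kS*norm (fe e s - fe e s') \<le> 1/4" using d8[OF s] d8[OF s'(1,2)] by (simp add: distrib_left)
   from S(1)[OF kS(2)[OF e] this] have "S (1/4) (ue e s - ue e s')" unfolding G(1)[OF e] ue(4)[OF e s(1)] ue(4)[OF e s'(1)] .
   from S(2)[OF s'(3) this] have "S (M0 + 1/2 + 1/4) (ue e s)" by simp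
   thus ?thesis by (rule S(1)) (simp add: M_def)
  qed
  have "good e (min T (t + d/2))" unfolding good_def
  proof (intro conjI e ballI)
   show "min T (t + d/2) \<in> {0..T}" using t T d by auto
   fix s assume s: "s \<in> {0..min T (t + d/2)}"
   show "S M (ue e s)"
   proof (cases "s < t")
    case True
    thus ?thesis using s by (intro S(1)[OF below]) (auto simp: M_def)
   qed (use s d(1) in \<open>auto intro!: near simp: dist_real_def\<close>)
  qed
  moreover from this have "min T (t + d/2) \<le> t" unfolding t_def by (intro cSup_upper[OF _ bdd]) (simp add: X_def)
  hence "min T (t + d/2) = T" using d(1) by (auto simp: min_def split: if_splits)
  ultimately show ?case by simp
 qed
qed

section \<open>Equicontinuity and convergence of the velocities\<close>

lemma lipschitz:
 assumes g: "good e T" and h: "0 \<le> h" "0 \<le> s" "s + h < T" shows "norm (ue e (s + h) - ue e s) \<le> V*h"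
proof -
 note e = goodD(1)[OF g]
 have "norm (ue e (s + h) - ue e s - h *\<^sub>R 0) \<le> V*h"
 proof (rule mean_value_bound[OF h(1)])
  fix r assume r: "r \<in> {s..s + h}"
  show "(ue e has_vector_derivative due e r) (at r within {s..s + h})" by (rule has_vector_derivative_within_subset[OF ue(1)[OF e]]) (use r h in auto)
  show "norm (due e r - 0) \<le> V" using due_growth(2)[OF g, of r] r h by simp
 qed
 thus ?thesis by simp
qed

lemma uniform_convergence:
 "0 < \<nu> ==> \<forall>\<^sub>F e in at_right 0. good e T \<and> (\<forall>t\<in>{0..T}. norm (ue e t - u t) \<le> \<nu>)"
proof -
 assume "0 < \<nu>"
 from bootstrap improve[OF this] show ?thesis by eventually_elim auto
qed

text \<open>Tested against \<open>G e z\<close>, the increment of f_e = H_e u_e becomes an increment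
  of u_e by symmetry, and u_e is uniformly Lipschitz. So the velocities are equicontinuous against
  elements of the range of \<open>G e\<close>.\<close>

lemma weak_modulus:
 assumes g: "good e T" and h: "0 \<le> h" "h < T"
 shows "\<bar>inner (due e h - due e 0) (G e z)\<bar> \<le> (1 + 3*M^2*c)*norm z*(V*h)"
proof -
 note e = goodD(1)[OF g]
 have m: "h \<in> {0..T}" "0 \<in> {0..T}" using h T by auto
 let ?d = "ue e h - ue e 0" and ?p = "F (ue e h) - F (ue e 0)"
 have d: "?d = G e (fe e h - fe e 0)" unfolding G(1)[OF e] ue(4)[OF e m(1)] ue(4)[OF e m(2)] ..
 have "J (due e h - due e 0) = (fe e h - fe e 0) - ?p" unfolding J(1) ue(5)[OF e m(1)] ue(5)[OF e m(2)] by simp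
 hence "inner (due e h - due e 0) (G e z) = inner (fe e h - fe e 0) (J (G e z)) - inner ?p (J (G e z))"
  unfolding J(2)[symmetric, of "due e h - due e 0"] by (simp only: inner_diff_left)
 also have "inner (fe e h - fe e 0) (J (G e z)) = inner (J z) ?d" unfolding d J_skew G_skew[OF e, of "fe e h - fe e 0" z] by simp
 finally have "\<bar>inner (due e h - due e 0) (G e z)\<bar> \<le> norm z*norm ?d + norm ?p*norm (G e z)"
  using Cauchy_Schwarz_ineq2[of "J z" ?d] Cauchy_Schwarz_ineq2[of ?p "J (G e z)"] unfolding J_norm by linarith
 also have "... \<le> norm z*norm ?d + (3*M^2*norm ?d)*(c*norm z)" using h by (intro add_mono order_refl mult_mono F(2) G(2)[OF e] goodD(3)[OF g]) simp_all
 also have "... = (1 + 3*M^2*c)*norm z*norm ?d" by (simp add: algebra_simps)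
 also have "... \<le> (1 + 3*M^2*c)*norm z*(V*h)" using lipschitz[OF g h(1), of 0] h c by (intro mult_left_mono) simp_all
 finally show ?thesis .
qed

lemma initial_velocity:
 assumes eta: "0 < eta" shows "\<forall>\<^sub>F e in at_right 0. norm (due e 0 - du 0) \<le> eta"
proof -
 have "0 < eta/(3*M^2 + 1)" using eta by (simp add: add_nonneg_pos)
 from uniform_convergence[OF this] show ?thesis
 proof eventually_elim
  case (elim e)
  have m: "0 \<in> {0..T}" using T by simp
  note e = goodD(1)[OF conjunct1[OF elim]]
  have "norm (due e 0 - du 0) = norm (F (ue e 0) - F (u 0))"
   unfolding J_norm[symmetric, of "due e 0 - du 0"] J(1) ue(5)[OF e m] u(4)[OF m] ue(6)[OF e] by (simp add: norm_minus_commute)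
  also have "... \<le> 3*M^2*norm (ue e 0 - u 0)" using m elim by (intro F(2) due_0(2)[OF e] S_M[OF S_u])
  also have "... \<le> 3*M^2*(eta/(3*M^2 + 1))" using elim m by (intro mult_left_mono) auto
  also have "... \<le> eta" using eta by (intro frac_mult_le) simp_all
  finally show ?case .
 qed
qed

text \<open>Weak continuity together with continuity of the norm gives strong continuity, here in
  quantitative form by expanding the square of the increment. The norm of \<open>due e h\<close>
  exceeds that of \<open>due e 0\<close> by at most the Gronwall factor; the cross term is
  controlled by \<open>weak_modulus\<close> once \<open>due e 0\<close> is approximated from the
  range of \<open>G e\<close>, uniformly in \<open>e\<close>.\<close>

lemma equicontinuous_at_0:
 assumes eta: "0 < eta"
 shows "\<exists>h0>0. \<forall>\<^sub>F e in at_right 0. \<forall>h. 0 \<le> h --> h \<le> h0 --> h < T --> norm (due e h - due e 0) \<le> eta"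
proof -
 \<comment> \<open>The pairing with the approximation error \<open>?y\<close> is at most 6*V*n and
   occurs twice, so 12*V*n may use half of eta^2.\<close>
 define n where "n = eta^2/(24*(V + 1))"
 have n: "0 < n" "12*V*n \<le> eta^2/2" using eta M(3) by (auto simp: n_def divide_simps intro!: add_nonneg_pos)
 have "((\<lambda>h. (1/h) *\<^sub>R (u (0 + h) - u 0)) \<longlongrightarrow> du 0) (at_right 0)" by (rule difference_quotient[OF u(1)]) (use T in auto)
 hence "\<forall>\<^sub>F h in at_right 0. dist ((1/h) *\<^sub>R (u (0 + h) - u 0)) (du 0) < n" using n(1) by (rule tendstoD)
 moreover have "\<forall>\<^sub>F h in at_right 0. h \<in> {0<..<T}" using T by (intro eventually_at_right_real)
 ultimately have "\<forall>\<^sub>F h in at_right 0. h \<in> {0<..<T} \<and> dist ((1/h) *\<^sub>R (u (0 + h) - u 0)) (du 0) < n" by eventually_elim blast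
 then obtain \<tau> where \<tau>: "\<tau> \<in> {0<..<T}" "norm (du 0 - (1/\<tau>) *\<^sub>R (u \<tau> - u 0)) < n"
  using eventually_happens'[of "at_right (0::real)"] by (auto simp: dist_norm norm_minus_commute)
 \<comment> \<open>The vector (1/\<tau>)G_e z is close to the difference quotient (u \<tau> - u
   0)/\<tau>, hence to \<open>du 0\<close> and to \<open>due e 0\<close>. Neither \<open>z\<close>
   nor \<tau> depends on \<open>e\<close>.\<close>
 define z where "z = f \<tau> - f 0"
 define C where "C = (1/\<tau>)*((1 + 3*M^2*c)*norm z*V)"
 have "((\<lambda>h. (exp (6*M^2*h) - 1)*V^2 + 2*(C*h)) \<longlongrightarrow> 0) (at_right 0)" by (auto intro!: tendsto_eq_intros)
 hence "\<forall>\<^sub>F h in at_right 0. (exp (6*M^2*h) - 1)*V^2 + 2*(C*h) < eta^2/2" by (rule order_tendstoD(2)) (use eta in simp)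
 then obtain h0 where h0: "0 < h0" "\<And>h. 0 < h ==> h < h0 ==> (exp (6*M^2*h) - 1)*V^2 + 2*(C*h) < eta^2/2" unfolding eventually_at_right_field by blast
 have q: "0 < n*\<tau>/2" using n \<tau> by simp
 have "\<forall>\<^sub>F e in at_right 0. \<forall>h. 0 \<le> h --> h \<le> h0/2 --> h < T --> norm (due e h - due e 0) \<le> eta"
  using bootstrap initial_velocity[OF n(1)] uniform_resolvent[OF q]
 proof (eventually_elim, intro allI impI)
  fix e h assume g: "good e T" and iv: "norm (due e 0 - du 0) \<le> n" and r: "\<forall>t\<in>{0..T}. norm (G e (f t) - u t) \<le> n*\<tau>/2"
   and h: "0 \<le> h" "h \<le> h0/2" "h < T"
  note e = goodD(1)[OF g]
  have m: "\<tau> \<in> {0..T}" "0 \<in> {0..T}" using \<tau> T by auto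
  let ?w = "due e h - due e 0" and ?y = "due e 0 - (1/\<tau>) *\<^sub>R G e z"
  have V0: "norm (due e 0) \<le> V" using due_0(1)[OF e] M(5) by linarith
  have w: "norm ?w \<le> 2*V" using norm_triangle_ineq4[of "due e h" "due e 0"] due_growth(2)[OF g h(1,3)] V0 by linarith
  have "?y = (due e 0 - du 0) + (du 0 - (1/\<tau>) *\<^sub>R (u \<tau> - u 0)) - (1/\<tau>) *\<^sub>R ((G e (f \<tau>) - u \<tau>) - (G e (f 0) - u 0))"
   unfolding z_def G(1)[OF e] by (simp add: algebra_simps)
  hence "norm ?y \<le> norm (due e 0 - du 0) + norm (du 0 - (1/\<tau>) *\<^sub>R (u \<tau> - u 0)) + norm ((1/\<tau>) *\<^sub>R ((G e (f \<tau>) - u \<tau>) - (G e (f 0) - u 0)))"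
   by (simp only:) (intro order_trans[OF norm_triangle_ineq4] add_right_mono norm_triangle_ineq)
  moreover have "norm ((1/\<tau>) *\<^sub>R ((G e (f \<tau>) - u \<tau>) - (G e (f 0) - u 0))) \<le> n"
  proof -
   have "norm ((G e (f \<tau>) - u \<tau>) - (G e (f 0) - u 0)) \<le> n*\<tau>/2 + n*\<tau>/2"
    using norm_triangle_ineq4[of "G e (f \<tau>) - u \<tau>" "G e (f 0) - u 0"] r[rule_format, OF m(1)] r[rule_format, OF m(2)] by linarith
   thus ?thesis using \<tau> by (simp add: divide_simps mult.commute)
  qed
  ultimately have y: "norm ?y \<le> 3*n" using iv \<tau>(2) by linarith
  have "(norm ?w)^2 = (norm (due e h))^2 - (norm (due e 0))^2 - 2*inner ?w (due e 0)"
   by (simp add: power2_norm_eq_inner inner_diff_left inner_diff_right inner_commute)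
  moreover have "inner ?w (due e 0) = (1/\<tau>)*inner ?w (G e z) + inner ?w ?y" by (simp add: inner_diff_right)
  moreover have "\<bar>(1/\<tau>)*inner ?w (G e z)\<bar> \<le> C*h"
  proof -
   have "(1/\<tau>)*\<bar>inner ?w (G e z)\<bar> \<le> (1/\<tau>)*((1 + 3*M^2*c)*norm z*(V*h))"
    using \<tau> by (intro mult_left_mono weak_modulus[OF g h(1,3)]) simp
   thus ?thesis using \<tau> by (simp add: C_def abs_mult mult_ac)
  qed
  moreover have "\<bar>inner ?w ?y\<bar> \<le> 6*V*n"
  proof -
   have "norm ?w*norm ?y \<le> (2*V)*(3*n)" using w y M(3) by (intro mult_mono) simp_all
   thus ?thesis using Cauchy_Schwarz_ineq2[of ?w ?y] by linarith
  qed
  moreover have "(norm (due e h))^2 - (norm (due e 0))^2 \<le> (exp (6*M^2*h) - 1)*V^2"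
  proof -
   have "(norm (due e h))^2 \<le> (exp (3*M^2*h)*norm (due e 0))^2" by (intro power_mono due_growth(1)[OF g h(1,3)]) simp
   hence "(norm (due e h))^2 \<le> exp (6*M^2*h)*(norm (due e 0))^2" unfolding exp_six power_mult_distrib .
   moreover have "(exp (6*M^2*h) - 1)*(norm (due e 0))^2 \<le> (exp (6*M^2*h) - 1)*V^2" using V0 h by (intro mult_left_mono power_mono) simp_all
   ultimately show ?thesis by (simp add: algebra_simps)
  qed
  moreover have "(exp (6*M^2*h) - 1)*V^2 + 2*(C*h) \<le> eta^2/2"
  proof (cases "h = 0")
   case False
   thus ?thesis using h h0(1) by (intro less_imp_le h0(2)) simp_all
  qed simp
  ultimately have "(norm ?w)^2 \<le> eta^2" using n(2) by linarith
  thus "norm ?w \<le> eta" by (rule power2_le_imp_le) (use eta in simp)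
 qed
 thus ?thesis using h0(1) by (intro exI[of _ "h0/2"]) simp
qed

text \<open>A Gronwall estimate for the mixed second difference with steps k and h; dividing by k
  and letting k tend to 0 bounds the h-increment of the velocity without differentiating it. The
  cross term of the nonlinearity is the sup bound \<open>w\<close> of h-increments times the L2 size
  V*k of k-increments.\<close>

lemma second_difference:
 assumes g: "good e T" and h: "0 \<le> h" "0 \<le> s" "s + h < T"
  and w: "0 \<le> w" "\<And>r. 0 \<le> r ==> r + h < T ==> S w (ue e (r + h) - ue e r)"
 shows "(norm (due e (s + h) - due e s))^2 \<le> exp ((6*M^2 + 1)*T)*((norm (due e h - due e 0))^2 + (6*M*w*V)^2*T)"
proof -
 note e = goodD(1)[OF g]
 let ?x = "\<lambda>k r. ue e (r + (k + h)) - ue e (r + h) - (ue e (r + k) - ue e r)"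
 let ?x' = "\<lambda>k r. due e (r + (k + h)) - due e (r + h) - (due e (r + k) - due e r)"
 let ?Q = "6*M*w*V"
 have Q: "0 \<le> ?Q" using M w by simp
 have main: "(norm (?x k s))^2 \<le> exp ((6*M^2 + 1)*T)*((norm (?x k 0))^2 + (?Q*k)^2*T)" if k: "0 < k" "s + h + k < T" for k
 proof -
  have "(norm (?x k s))^2 \<le> exp ((6*M^2 + 1) * s)*((norm (?x k 0))^2 + (?Q*k)^2 * s)"
  proof (rule energy_bound[OF h(2), where x' = "?x' k"])
   fix r assume r: "r \<in> {0..s}"
   have "((\<lambda>r. ue e (r + 0)) has_vector_derivative due e (r + 0)) (at r within {0..s})" by (rule shift_derivative[OF g _ _ r]) (use h in simp_all)
   thus "(?x k has_vector_derivative ?x' k r) (at r within {0..s})" by (intro has_vector_derivative_diff shift_derivative[OF g _ _ r]) (use h k in simp_all)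
  next
   fix r assume r: "0 < r" "r < s"
   have m: "r + (k + h) \<in> {0..T}" "r + h \<in> {0..T}" "r + k \<in> {0..T}" "r \<in> {0..T}" using r h k by auto
   let ?g = "fe e (r + (k + h)) - fe e (r + h) - (fe e (r + k) - fe e r)"
   let ?p = "F (ue e (r + (k + h))) - F (ue e (r + h)) - (F (ue e (r + k)) - F (ue e r))"
   have x: "?x k r = G e ?g" unfolding G(1)[OF e] ue(4)[OF e m(1)] ue(4)[OF e m(2)] ue(4)[OF e m(3)] ue(4)[OF e m(4)] ..
   have "J (?x' k r) = ?g - ?p" unfolding J(1) ue(5)[OF e m(1)] ue(5)[OF e m(2)] ue(5)[OF e m(3)] ue(5)[OF e m(4)] by simp
   from inner_energy[OF e this] have i: "inner (?x k r) (?x' k r) \<le> norm (?x k r)*norm ?p" unfolding x .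
   have "norm ?p \<le> 3*M^2*norm (?x k r) + 6*M*w*norm (ue e (r + k) - ue e r)"
   proof (rule F(3))
    show "S w (ue e (r + (k + h)) - ue e (r + k))" using w(2)[of "r + k"] r h k by (simp add: add.assoc)
    show "S w (ue e (r + h) - ue e r)" using w(2)[of r] r h k by simp
   qed (use r h k in \<open>auto intro!: goodD(3)[OF g]\<close>)
   also have "6*M*w*norm (ue e (r + k) - ue e r) \<le> 6*M*w*(V*k)" using r h k M w by (intro mult_left_mono lipschitz[OF g]) simp_all
   finally have "norm ?p \<le> 3*M^2*norm (?x k r) + ?Q*k" by (simp add: mult.assoc)
   from order_trans[OF i mult_left_mono[OF this norm_ge_zero]]
   have "2*inner (?x k r) (?x' k r) \<le> 6*M^2*(norm (?x k r))^2 + 2*norm (?x k r)*(?Q*k)" by (simp add: algebra_simps power2_eq_square)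
   \<comment> \<open>Young's inequality; the square of the difference accounts for the
     \<open>+ 1\<close> in the exponent.\<close>
   also have "2*norm (?x k r)*(?Q*k) \<le> (norm (?x k r))^2 + (?Q*k)^2" by (rule sum_squares_bound)
   finally show "2*inner (?x k r) (?x' k r) \<le> (6*M^2 + 1)*(norm (?x k r))^2 + (?Q*k)^2" by (simp add: algebra_simps)
  qed simp_all
  also have "... \<le> exp ((6*M^2 + 1)*T)*((norm (?x k 0))^2 + (?Q*k)^2*T)"
   using h T by (intro mult_mono add_mono) (auto intro!: mult_left_mono add_nonneg_nonneg)
  finally show ?thesis .
 qed
 have q: "((\<lambda>k. (1/k) *\<^sub>R (ue e (r + k) - ue e r)) \<longlongrightarrow> due e r) (at_right 0)" if "0 \<le> r" "r < T" for r
  by (rule difference_quotient[OF ue(1)[OF e]]) (use that in auto)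
 have qx: "((\<lambda>k. (1/k) *\<^sub>R ?x k r) \<longlongrightarrow> due e (r + h) - due e r) (at_right 0)" if "0 \<le> r" "r + h < T" for r
  using tendsto_diff[OF q[of "r + h"] q[of r]] that h by (simp add: scaleR_right_diff_distrib add_ac)
 show ?thesis
 proof (rule tendsto_le[OF _ _ tendsto_power[OF tendsto_norm[OF qx[OF h(2,3)]]]])
  show "((\<lambda>k. exp ((6*M^2 + 1)*T)*((norm ((1/k) *\<^sub>R ?x k 0))^2 + ?Q^2*T)) \<longlongrightarrow>
    exp ((6*M^2 + 1)*T)*((norm (due e h - due e 0))^2 + ?Q^2*T)) (at_right 0)" using qx[of 0] h by (intro tendsto_intros) simp
  have "\<forall>\<^sub>F k in at_right 0. k \<in> {0<..<T - (s + h)}" using h by (intro eventually_at_right_real) simp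
  thus "\<forall>\<^sub>F k in at_right 0. (norm ((1/k) *\<^sub>R ?x k s))^2 \<le> exp ((6*M^2 + 1)*T)*((norm ((1/k) *\<^sub>R ?x k 0))^2 + ?Q^2*T)"
  proof eventually_elim
   case (elim k)
   have "(1/k)^2*(norm (?x k s))^2 \<le> (1/k)^2*(exp ((6*M^2 + 1)*T)*((norm (?x k 0))^2 + (?Q*k)^2*T))" using elim by (intro mult_left_mono main) simp_all
   also have "... = exp ((6*M^2 + 1)*T)*((1/k)^2*(norm (?x k 0))^2 + ((1/k)*k)^2*?Q^2*T)" by (simp only: power_mult_distrib distrib_left mult_ac)
   also have "(1/k)*k = 1" using elim by simp
   finally show ?case by (simp add: power_mult_distrib power_divide)
  qed
 qed simp
qed

text \<open>Time increments of u_e are small in L2 by \<open>lipschitz\<close>, and f_e is bounded,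
  so \<open>ehrling\<close> bounds the increments by \<open>w\<close> in the sup norm. With
  \<open>w\<close> small, \<open>second_difference\<close> carries the equicontinuity at time 0 to
  all later times.\<close>

lemma equicontinuous:
 assumes eta: "0 < eta"
 shows "\<exists>h0>0. \<forall>\<^sub>F e in at_right 0. \<forall>s h. 0 \<le> h --> h \<le> h0 --> 0 \<le> s --> s + h < T --> norm (due e (s + h) - due e s) \<le> eta"
proof -
 let ?E = "exp ((6*M^2 + 1)*T)"
 have "((\<lambda>w. ?E*(w^2 + (6*M*w*V)^2*T)) \<longlongrightarrow> 0) (at_right 0)" by (auto intro!: tendsto_eq_intros)
 hence "\<forall>\<^sub>F w in at_right 0. ?E*(w^2 + (6*M*w*V)^2*T) < eta^2" by (rule order_tendstoD(2)) (use eta in simp)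
 moreover have "\<forall>\<^sub>F w in at_right (0::real). 0 < w" by (rule eventually_at_right_less)
 ultimately have "\<forall>\<^sub>F w in at_right 0. ?E*(w^2 + (6*M*w*V)^2*T) < eta^2 \<and> 0 < w" by eventually_elim blast
 then obtain w where w: "?E*(w^2 + (6*M*w*V)^2*T) < eta^2" "0 < w" using eventually_happens'[of "at_right (0::real)"] by auto
 define \<delta> where "\<delta> = w/(4*(V1 + 1))"
 have \<delta>: "0 < \<delta>" "\<delta>*(2*V1) \<le> w/2" using w(2) M(4) by (auto simp: \<delta>_def divide_simps intro!: add_nonneg_pos)
 obtain D where D: "0 \<le> D" "\<forall>e\<in>{0<..<e0}. \<forall>x. S (\<delta>*norm x + D*norm (G e x)) (G e x)" using ehrling[OF \<delta>(1)] by blast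
 obtain h1 where h1: "0 < h1" "\<forall>\<^sub>F e in at_right 0. \<forall>h. 0 \<le> h --> h \<le> h1 --> h < T --> norm (due e h - due e 0) \<le> w"
  using equicontinuous_at_0[OF w(2)] by blast
 define h0 where "h0 = min h1 (w/(2*(D*V + 1)))"
 have DV: "0 < D*V + 1" using D M(3) by (simp add: add_nonneg_pos)
 have h0: "0 < h0" "h0 \<le> h1" using h1(1) w(2) DV by (simp_all add: h0_def)
 have "\<forall>\<^sub>F e in at_right 0. \<forall>s h. 0 \<le> h --> h \<le> h0 --> 0 \<le> s --> s + h < T --> norm (due e (s + h) - due e s) \<le> eta"
  using bootstrap h1(2)
 proof (eventually_elim, intro allI impI)
  fix e s h assume g: "good e T" and n0: "\<forall>h. 0 \<le> h --> h \<le> h1 --> h < T --> norm (due e h - due e 0) \<le> w"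
   and h: "0 \<le> h" "h \<le> h0" "0 \<le> s" "s + h < T"
  note e = goodD(1)[OF g]
  have "(norm (due e (s + h) - due e s))^2 \<le> ?E*((norm (due e h - due e 0))^2 + (6*M*w*V)^2*T)"
  proof (rule second_difference[OF g h(1,3,4)])
   show "0 \<le> w" using w(2) by simp
   fix r assume r: "0 \<le> r" "r + h < T"
   have m: "r + h \<in> {0..T}" "r \<in> {0..T}" using r h by auto
   let ?z = "fe e (r + h) - fe e r"
   have z: "ue e (r + h) - ue e r = G e ?z" unfolding G(1)[OF e] ue(4)[OF e m(1)] ue(4)[OF e m(2)] ..
   have "norm ?z \<le> 2*V1" using norm_triangle_ineq4[of "fe e (r + h)" "fe e r"] fe_bound[OF g, of "r + h"] fe_bound[OF g, of r] r h by simp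
   hence 1: "\<delta>*norm ?z \<le> w/2" using mult_left_mono[of "norm ?z" "2*V1" \<delta>] \<delta> by linarith
   have "D*norm (G e ?z) \<le> D*(V*h)" unfolding z[symmetric] by (intro mult_left_mono lipschitz[OF g] D h r)
   also have "... \<le> (D*V + 1)*h0" using h D M(3) h0 by (simp add: distrib_right) (intro add_increasing2, simp_all add: mult.assoc mult_left_mono)
   also have "... \<le> (D*V + 1)*(w/(2*(D*V + 1)))" using DV by (intro mult_left_mono) (simp_all add: h0_def)
   also have "... = w/2"
   proof -
    have "k*(w/(2*k)) = w/2" if "0 < k" for k :: real using that by simp
    from this[OF DV] show ?thesis .
   qed
   finally show "S w (ue e (r + h) - ue e r)" unfolding z using 1 by (intro S(1)[OF D(2)[rule_format, OF e]]) linarith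
  qed
  also have "... \<le> ?E*(w^2 + (6*M*w*V)^2*T)" using n0 h h0(2) by (intro mult_left_mono add_mono order_refl power_mono) auto
  also have "... \<le> eta^2" using w(1) by simp
  finally show "norm (due e (s + h) - due e s) \<le> eta" by (rule power2_le_imp_le) (use eta in simp)
 qed
 thus ?thesis by (intro exI[of _ h0] conjI h0(1))
qed

text \<open>On a short interval around \<open>t\<close> the velocities are nearly constant,
  uniformly in \<open>e\<close>, so they nearly equal the difference quotients over the interval,
  and these converge because u_e does. Three errors of size \<open>eta\<close> occur, hence the
  quarter of \<open>eta'\<close>.\<close>

lemma velocity_convergence:
 assumes t: "t \<in> {0..T}" shows "((\<lambda>e. due e t) \<longlongrightarrow> du t) (at_right 0)"
proof (rule tendstoI)
 fix eta' :: real assume "0 < eta'"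
 define eta where "eta = eta'/4"
 have eta: "0 < eta" using \<open>0 < eta'\<close> by (simp add: eta_def)
 obtain h0 where h0: "0 < h0" "\<forall>\<^sub>F e in at_right 0. \<forall>s h. 0 \<le> h --> h \<le> h0 --> 0 \<le> s --> s + h < T --> norm (due e (s + h) - due e s) \<le> eta"
  using equicontinuous[OF eta] by blast
 obtain d where d: "0 < d" "\<And>s. s \<in> {0..T} ==> dist s t < d ==> dist (du s) (du t) < eta"
  using u(2)[unfolded continuous_on_iff, rule_format, OF t eta] by auto
 define h where "h = min h0 (min (d/2) (T/2))"
 have h: "0 < h" "h \<le> h0" "h < d" "h < T" using h0(1) d(1) T by (auto simp: h_def)
 \<comment> \<open>A window of length h that contains \<open>t\<close> and stays inside [0, T], also
   for \<open>t\<close> near T.\<close>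
 define a where "a = min t (T - h)"
 have a: "0 \<le> a" "a + h \<le> T" "a \<le> t" "t \<le> a + h" using t h by (auto simp: a_def)
 have q: "0 < eta*h/2" using eta h by simp
 show "\<forall>\<^sub>F e in at_right 0. dist (due e t) (du t) < eta'" using h0(2) uniform_convergence[OF q]
 proof eventually_elim
  case (elim e)
  have g: "good e T" and un: "\<And>t. t \<in> {0..T} ==> norm (ue e t - u t) \<le> eta*h/2" using elim(2) by auto
  note e = goodD(1)[OF g]
  \<comment> \<open>\<open>equicontinuous\<close> stops short of the end time T. Both times are
    shifted to the left by x, and x tends to 0 by continuity of \<open>due e\<close>.\<close>
  have eq: "norm (due e r - due e s) \<le> eta" if rs: "0 < s" "s \<le> r" "r \<le> s + h" "r \<le> T" for r s
  proof -
   have c: "continuous_on {0..s} (\<lambda>x. norm (due e (r - x) - due e (s - x)))"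
    by (intro continuous_intros continuous_on_compose2[OF ue(2)[OF e]]) (use rs in auto)
   show ?thesis
   proof -
    have "norm (due e (r - 0) - due e (s - 0)) \<le> eta"
    proof (rule continuous_le_on_closure[of "{0<..<s}" _ 0])
     show "continuous_on (closure {0<..<s}) (\<lambda>x. norm (due e (r - x) - due e (s - x)))" using c rs by simp
     show "0 \<in> closure {0<..<s}" using rs by simp
     fix x assume "x \<in> {0<..<s}"
     thus "norm (due e (r - x) - due e (s - x)) \<le> eta" using elim(1)[rule_format, of "r - s" "s - x"] rs h by auto
    qed
    thus ?thesis by simp
   qed
  qed
  have near: "norm (due e s - due e t) \<le> eta" if s: "s \<in> {a..a + h}" for s
  proof (cases "0 < min s t")
   case True
   thus ?thesis using eq[of s t] eq[of t s] s a by (cases "s \<le> t") (auto simp: norm_minus_commute)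
  next
   case False
   \<comment> \<open>Time 0 cannot be shifted to the left, but there the window starts at 0 and ends
     before T, and \<open>equicontinuous\<close> applies as it stands.\<close>
   hence z: "min s t = 0" using s a t by auto
   have "norm (due e (0 + max s t) - due e 0) \<le> eta" using z s a h by (intro elim(1)[rule_format]) (auto simp: a_def min_def max_def split: if_splits)
   thus ?thesis using z by (auto simp: min_def max_def norm_minus_commute split: if_splits)
  qed
  have mv: "norm (x (a + h) - x a - h *\<^sub>R v) \<le> eta*h"
   if "\<And>s. s \<in> {0..T} ==> (x has_vector_derivative x' s) (at s within {0..T})" "\<And>s. s \<in> {a..a + h} ==> norm (x' s - v) \<le> eta" for x x' and v :: 'a
  proof (rule mean_value_bound[OF less_imp_le[OF h(1)] _ that(2)])
   fix s assume "s \<in> {a..a + h}"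
   thus "(x has_vector_derivative x' s) (at s within {a..a + h})" using a by (intro has_vector_derivative_within_subset[OF that(1)]) auto
  qed
  have 1: "norm (ue e (a + h) - ue e a - h *\<^sub>R due e t) \<le> eta*h" by (rule mv[OF ue(1)[OF e] near])
  have 2: "norm (u (a + h) - u a - h *\<^sub>R du t) \<le> eta*h"
  proof (rule mv[OF u(1)])
   fix s assume s: "s \<in> {a..a + h}"
   hence "dist s t < d" using a h by (auto simp: dist_real_def)
   thus "norm (du s - du t) \<le> eta" using d(2)[of s] s a by (simp add: dist_norm less_imp_le)
  qed
  have "h *\<^sub>R (due e t - du t) = - (ue e (a + h) - ue e a - h *\<^sub>R due e t) + (u (a + h) - u a - h *\<^sub>R du t)
    + ((ue e (a + h) - u (a + h)) - (ue e a - u a))" by (simp add: scaleR_right_diff_distrib)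
  hence "norm (h *\<^sub>R (due e t - du t)) \<le> norm (ue e (a + h) - ue e a - h *\<^sub>R due e t) + norm (u (a + h) - u a - h *\<^sub>R du t)
    + (norm (ue e (a + h) - u (a + h)) + norm (ue e a - u a))" by (simp only: norm_four)
  moreover have "norm (ue e (a + h) - u (a + h)) \<le> eta*h/2" "norm (ue e a - u a) \<le> eta*h/2" by (rule un, use a h in simp)+
  ultimately have "norm (h *\<^sub>R (due e t - du t)) \<le> 3*(eta*h)" using 1 2 by linarith
  hence "h*norm (due e t - du t) \<le> h*(3*eta)" using h by (simp add: mult_ac)
  hence "norm (due e t - du t) \<le> 3*eta" using h by simp
  thus ?case using \<open>0 < eta'\<close> by (simp add: dist_norm eta_def)
 qed
qed

theorem convergence:
 assumes t: "t \<in> {0..T}"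
 shows "((\<lambda>e. ue e t) \<longlongrightarrow> u t) (at_right 0)" "((\<lambda>e. due e t) \<longlongrightarrow> du t) (at_right 0)" "((\<lambda>e. fe e t) \<longlongrightarrow> f t) (at_right 0)"
proof -
 show 1: "((\<lambda>e. ue e t) \<longlongrightarrow> u t) (at_right 0)"
 proof (rule tendstoI)
  fix \<nu> :: real assume "0 < \<nu>"
  hence "0 < \<nu>/2" by simp
  from uniform_convergence[OF this] show "\<forall>\<^sub>F e in at_right 0. dist (ue e t) (u t) < \<nu>"
   by eventually_elim (use t \<open>0 < \<nu>\<close> in \<open>fastforce simp: dist_norm\<close>)
 qed
 show 2: "((\<lambda>e. due e t) \<longlongrightarrow> du t) (at_right 0)" by (rule velocity_convergence[OF t])
 have "((\<lambda>e. norm (due e t - du t) + 3*M^2*norm (ue e t - u t)) \<longlongrightarrow> norm (du t - du t) + 3*M^2*norm (u t - u t)) (at_right 0)"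
  by (intro tendsto_intros 1 2)
 hence lim: "((\<lambda>e. norm (due e t - du t) + 3*M^2*norm (ue e t - u t)) \<longlongrightarrow> 0) (at_right 0)" by simp
 have ev: "\<forall>\<^sub>F e in at_right 0. norm (fe e t - f t) \<le> norm (due e t - du t) + 3*M^2*norm (ue e t - u t)" using bootstrap
 proof eventually_elim
  case (elim e)
  note e = goodD(1)[OF elim]
  have "fe e t - f t = J (due e t - du t) + (F (ue e t) - F (u t))" unfolding J(1) ue(5)[OF e t] u(4)[OF t] by simp
  also have "norm ... \<le> norm (due e t - du t) + norm (F (ue e t) - F (u t))" unfolding J_norm[symmetric, of "due e t - du t"] by (rule norm_triangle_ineq)
  also have "... \<le> norm (due e t - du t) + 3*M^2*norm (ue e t - u t)" using t by (intro add_left_mono F(2) goodD(3)[OF elim] S_M[OF S_u]) auto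
  finally show ?case .
 qed
 have "((\<lambda>e. fe e t - f t) \<longlongrightarrow> 0) (at_right 0)" by (rule Lim_null_comparison[OF ev lim])
 thus "((\<lambda>e. fe e t) \<longlongrightarrow> f t) (at_right 0)" by (rule LIM_zero_cancel)
qed

end

section \<open>The Hilbert space of Fourier coefficients\<close>

text \<open>Complex square-summable families, made a real Hilbert space by the real part of
  \<open>cip\<close>; the complex structure survives as the isometry \<open>imul\<close>.\<close>

typedef ell2 = "sobolev 0" morphisms coeffs ell2 using sob_le_sobolev[OF sob_le_zero[OF order_refl]] by blast

lemma coeffs_mem [simp]: "coeffs x \<in> sobolev 0" by (rule coeffs)

lemma sobolev_0_sq: "f \<in> sobolev 0 \<longleftrightarrow> (\<lambda>k. (norm (f k))^2) summable_on UNIV" by (simp add: sobolev_def)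

definition cip :: "tdist \<Rightarrow> tdist \<Rightarrow> complex" where
 "cip f g = (\<Sum>\<^sub>\<infinity>k. f k*cnj (g k))"

lemma cip_summable:
 assumes "f \<in> sobolev 0" "g \<in> sobolev 0" shows "(\<lambda>k. f k*cnj (g k)) summable_on UNIV"
proof -
 have "(\<lambda>k. (norm (f k))^2 + (norm (g k))^2) summable_on UNIV" using assms unfolding sobolev_0_sq by (rule summable_on_add)
 hence "(\<lambda>k. norm (f k*cnj (g k))) summable_on UNIV"
 proof (rule summable_on_comparison_test)
  fix k
  have "0 \<le> norm (f k)*norm (g k)" by simp
  thus "norm (f k*cnj (g k)) \<le> (norm (f k))^2 + (norm (g k))^2"
   using sum_squares_bound[of "norm (f k)" "norm (g k)"] unfolding norm_mult complex_mod_cnj by linarith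
 qed simp
 thus ?thesis by (rule abs_summable_summable)
qed

lemma cip_add_left: "f \<in> sobolev 0 ==> g \<in> sobolev 0 ==> h \<in> sobolev 0 ==> cip (f + g) h = cip f h + cip g h"
 unfolding cip_def by (subst infsum_add[symmetric]) (simp_all add: cip_summable distrib_right)

lemma cip_tscale_left: "f \<in> sobolev 0 ==> g \<in> sobolev 0 ==> cip (tscale c f) g = c*cip f g"
 unfolding cip_def tscale_def mult.assoc by (rule infsum_cmult_right) (simp add: cip_summable)

lemma cip_cnj: "cnj (cip f g) = cip g f" unfolding cip_def infsum_cnj[symmetric] by (simp add: mult.commute)

lemma cip_self: "f \<in> sobolev 0 ==> cip f f = of_real ((sobolev_norm 0 f)^2)"
proof -
 assume f: "f \<in> sobolev 0"
 have "cip f f = (\<Sum>\<^sub>\<infinity>k. of_real ((norm (f k))^2))" unfolding cip_def by (simp only: complex_norm_square)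
 also have "... = of_real (\<Sum>\<^sub>\<infinity>k. (norm (f k))^2)" using f unfolding sobolev_0_sq by (intro infsumI has_sum_of_real has_sum_infsum)
 also have "(\<Sum>\<^sub>\<infinity>k. (norm (f k))^2) = (sobolev_norm 0 f)^2" unfolding sobolev_norm_0 by (simp add: infsum_nonneg)
 finally show ?thesis .
qed

instantiation ell2 :: real_inner
begin

definition "zero_ell2 = ell2 0"
definition "plus_ell2 x y = ell2 (coeffs x + coeffs y)"
definition "minus_ell2 x y = ell2 (coeffs x - coeffs y)"
definition "uminus_ell2 x = ell2 (- coeffs x)"
definition "scaleR_ell2 r x = ell2 (tscale (of_real r) (coeffs x))"
definition "inner_ell2 x y = Re (cip (coeffs x) (coeffs y))"
definition "norm_ell2 x = sobolev_norm 0 (coeffs x)"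
definition "dist_ell2 x y = norm (x - y :: ell2)"
definition "sgn_ell2 x = inverse (norm (x :: ell2)) *\<^sub>R x"
definition [code del]: "uniformity_ell2 = (INF e\<in>{0<..}. principal {(x, y :: ell2). dist x y < e})"
definition [code del]: "open_ell2 U = (\<forall>x\<in>U. \<forall>\<^sub>F (x', y) in uniformity. x' = x --> (y :: ell2) \<in> U)"

lemma sobolev_0_closed:
 "f \<in> sobolev s ==> g \<in> sobolev s ==> f + g \<in> sobolev s" "f \<in> sobolev s ==> g \<in> sobolev s ==> f - g \<in> sobolev s"
 "f \<in> sobolev s ==> - f \<in> sobolev s" "f \<in> sobolev s ==> tscale c f \<in> sobolev s" "0 \<in> sobolev s"
 using sob_le_sobolev[OF sob_le_add[OF sobolev_sob_le sobolev_sob_le]] sob_le_sobolev[OF sob_le_diff[OF sobolev_sob_le sobolev_sob_le]]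
  sob_le_sobolev[OF sob_le_uminus[OF sobolev_sob_le]] sob_le_sobolev[OF sob_le_tscale[OF sobolev_sob_le]] sob_le_sobolev[OF sob_le_zero[OF order_refl]]
 by - assumption+

lemma coeffs_simps [simp]:
 "coeffs 0 = 0" "coeffs (x + y) = coeffs x + coeffs y" "coeffs (x - y) = coeffs x - coeffs y"
 "coeffs (- x) = - coeffs x" "coeffs (r *\<^sub>R x) = tscale (of_real r) (coeffs x)"
 by (simp_all add: zero_ell2_def plus_ell2_def minus_ell2_def uminus_ell2_def scaleR_ell2_def ell2_inverse sobolev_0_closed)

instance
proof
 fix x y z :: ell2 and a b :: real
 show "x + y + z = x + (y + z)" "x + y = y + x" "0 + x = x" "- x + x = 0" "x - y = x + - y" by (simp_all add: coeffs_inject[symmetric] fun_eq_iff)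
 show "a *\<^sub>R (x + y) = a *\<^sub>R x + a *\<^sub>R y" "(a + b) *\<^sub>R x = a *\<^sub>R x + b *\<^sub>R x" "a *\<^sub>R b *\<^sub>R x = (a*b) *\<^sub>R x" "1 *\<^sub>R x = x"
  by (simp_all add: coeffs_inject[symmetric] fun_eq_iff tscale_def algebra_simps)
 show "dist x y = norm (x - y)" "sgn x = inverse (norm x) *\<^sub>R x" by (simp_all only: dist_ell2_def sgn_ell2_def)
 show "inner x y = inner y x" unfolding inner_ell2_def by (subst cip_cnj[symmetric]) simp
 show "inner (x + y) z = inner x z + inner y z" by (simp add: inner_ell2_def cip_add_left)
 show "inner (a *\<^sub>R x) y = a*inner x y" by (simp add: inner_ell2_def cip_tscale_left)
 show 1: "0 \<le> inner x x" by (simp add: inner_ell2_def cip_self)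
 show "norm x = sqrt (inner x x)" by (simp add: inner_ell2_def cip_self norm_ell2_def)
 show "inner x x = 0 \<longleftrightarrow> x = 0"
 proof
  assume "inner x x = 0"
  hence "sobolev_norm 0 (coeffs x) = 0" by (simp add: inner_ell2_def cip_self)
  hence "sob_le 0 (coeffs x) 0" using sobolev_sob_le[OF coeffs_mem[of x]] by simp
  from sob_le_coeff_diff[OF this] have "coeffs x = 0" by (simp add: fun_eq_iff)
  thus "x = 0" by (simp add: coeffs_inject[symmetric])
 qed (simp add: inner_ell2_def cip_def)
 show "(uniformity :: (ell2 \<times> ell2) filter) = (INF e\<in>{0<..}. principal {(x, y). dist x y < e})" by (rule uniformity_ell2_def)
 show "open U = (\<forall>x\<in>U. \<forall>\<^sub>F (x', y) in uniformity. x' = x --> y \<in> U)" for U :: "ell2 set" by (rule open_ell2_def)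
qed

end

lemma norm_ell2_le: "norm x \<le> a \<longleftrightarrow> sob_le 0 (coeffs x) a" for x :: ell2 by (simp add: sob_le_iff norm_ell2_def)

lemma coeffs_ell2 [simp]: "f \<in> sobolev 0 ==> coeffs (ell2 f) = f" by (rule ell2_inverse)

lemma sob_le_limit:
 assumes "\<And>k. (\<lambda>n. f n k) \<longlonglongrightarrow> g k" "\<forall>\<^sub>F n in sequentially. sob_le s (f n) a" shows "sob_le s g a"
 unfolding sob_le_def
proof (intro allI impI)
 fix A :: "(int \<times> int) set" assume A: "finite A"
 have "(\<lambda>n. L2_set (\<lambda>k. bessel k powr (s/2)*norm (f n k)) A) \<longlonglongrightarrow> L2_set (\<lambda>k. bessel k powr (s/2)*norm (g k)) A"
  unfolding L2_set_def by (intro tendsto_intros assms(1))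
 moreover have "\<forall>\<^sub>F n in sequentially. L2_set (\<lambda>k. bessel k powr (s/2)*norm (f n k)) A \<le> a"
  using assms(2) by eventually_elim (use A in \<open>simp add: sob_le_def\<close>)
 ultimately show "L2_set (\<lambda>k. bessel k powr (s/2)*norm (g k)) A \<le> a" by (rule tendsto_upperbound) simp
qed

text \<open>Completeness is what the fixed point theorem in \<open>surjective_perturbation\<close>
  rests on.\<close>

instance ell2 :: complete_space
proof
 fix X :: "nat \<Rightarrow> ell2" assume X: "Cauchy X"
 have le: "norm (coeffs x k - coeffs y k) \<le> norm (x - y)" for x y :: ell2 and k
  using sob_le_coeff_diff[of 0 "coeffs (x - y)" "norm (x - y)" k] norm_ell2_le[of "x - y" "norm (x - y)"] by simp
 have "Cauchy (\<lambda>n. coeffs (X n) k)" for k unfolding Cauchy_def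
 proof (intro allI impI)
  fix e :: real assume "0 < e"
  then obtain N where "\<forall>m\<ge>N. \<forall>n\<ge>N. dist (X m) (X n) < e" using X unfolding Cauchy_def by blast
  thus "\<exists>N. \<forall>m\<ge>N. \<forall>n\<ge>N. dist (coeffs (X m) k) (coeffs (X n) k) < e"
   unfolding dist_norm by (intro exI[of _ N]) (use le order_le_less_trans in blast)
 qed
 hence "\<exists>g. \<forall>k. (\<lambda>n. coeffs (X n) k) \<longlonglongrightarrow> g k" by (intro choice allI) (simp add: Cauchy_convergent_iff convergent_def)
 then obtain g where g: "\<And>k. (\<lambda>n. coeffs (X n) k) \<longlonglongrightarrow> g k" by blast
 have lim: "\<exists>N. \<forall>m\<ge>N. sob_le 0 (coeffs (X m) - g) e" if e: "0 < e" for e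
 proof -
  obtain N where N: "\<forall>m\<ge>N. \<forall>n\<ge>N. dist (X m) (X n) < e" using X e unfolding Cauchy_def by blast
  have "sob_le 0 (coeffs (X m) - g) e" if m: "N \<le> m" for m
  proof (rule sob_le_limit[where f = "\<lambda>n. coeffs (X m) - coeffs (X n)"])
   show "(\<lambda>n. (coeffs (X m) - coeffs (X n)) k) \<longlonglongrightarrow> (coeffs (X m) - g) k" for k unfolding fun_diff_def by (intro tendsto_intros g)
   show "\<forall>\<^sub>F n in sequentially. sob_le 0 (coeffs (X m) - coeffs (X n)) e" using eventually_ge_at_top[of N]
    by eventually_elim (use N m in \<open>auto simp: dist_norm norm_ell2_le[symmetric] coeffs_simps(3)[symmetric] simp del: coeffs_simps intro: less_imp_le\<close>)
  qed
  thus ?thesis by blast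
 qed
 obtain m where "sob_le 0 (coeffs (X m) - g) 1" using lim[of 1] by auto
 from sob_le_sobolev[OF sob_le_diff[OF sobolev_sob_le[OF coeffs_mem[of "X m"]] this]] have gm: "g \<in> sobolev 0" by simp
 have "X \<longlonglongrightarrow> ell2 g"
 proof (rule metric_LIMSEQ_I)
  fix e :: real assume e: "0 < e"
  then obtain N where N: "\<forall>m\<ge>N. sob_le 0 (coeffs (X m) - g) (e/2)" using lim[of "e/2"] by auto
  have "dist (X n) (ell2 g) \<le> e/2" if "N \<le> n" for n using N that gm unfolding dist_norm norm_ell2_le by simp
  thus "\<exists>N. \<forall>n\<ge>N. dist (X n) (ell2 g) < e" using e by (intro exI[of _ N]) fastforce
 qed
 thus "convergent X" by (rule convergentI)
qed

definition imul :: "ell2 \<Rightarrow> ell2" where "imul x = ell2 (tscale \<i> (coeffs x))"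

lemma coeffs_imul [simp]: "coeffs (imul x) = tscale \<i> (coeffs x)" by (simp add: imul_def sobolev_0_closed)

lemma cip_tscale_right: "f \<in> sobolev 0 ==> g \<in> sobolev 0 ==> cip f (tscale c g) = cnj c*cip f g"
 unfolding cip_cnj[symmetric, of f] by (simp add: cip_tscale_left)

lemma imul: "imul (x - y) = imul x - imul y" "inner (imul x) (imul y) = inner x y" "imul (imul x) = - x"
 "inner (imul x) y = - Im (cip (coeffs x) (coeffs y))"
 by (simp_all add: coeffs_inject[symmetric] tscale_diff inner_ell2_def cip_tscale_left cip_tscale_right sobolev_0_closed)
  (simp add: tscale_def fun_eq_iff)

text \<open>The equation is the fixed point problem v = L^(-1)(f + N v). The a priori bound makes
  L^(-1) Lipschitz with constant \<open>c\<close> in L2, so the map contracts by c*n \<le>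
  1/2.\<close>

lemma surjective_perturbation:
 assumes surj: "\<And>f. f \<in> sobolev 0 ==> \<exists>v\<in>sobolev 2. L v = f"
  and Ld: "\<And>u v. u \<in> sobolev 2 ==> v \<in> sobolev 2 ==> L (u - v) = L u - L v"
  and Lb: "\<And>v a. v \<in> sobolev 2 ==> sob_le 0 (L v) a ==> sob_le 0 v (c*a)" and c: "0 \<le> c"
  and Nd: "\<And>u v. N (u - v) = N u - N v"
  and Nb: "\<And>v a. sob_le 0 v a ==> sob_le 0 (N v) (n*a)"
  and cn: "c*n \<le> 1/2" and f: "f \<in> sobolev 0"
 shows "\<exists>v\<in>sobolev 2. L v - N v = f"
proof -
 define sol where "sol g = (SOME v. v \<in> sobolev 2 \<and> L v = g)" for g
 have sol: "sol g \<in> sobolev 2" "L (sol g) = g" if "g \<in> sobolev 0" for g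
  using someI_ex[of "\<lambda>v. v \<in> sobolev 2 \<and> L v = g"] surj[OF that] unfolding sol_def by blast+
 have N0: "N v \<in> sobolev 0" if "v \<in> sobolev 0" for v by (rule sob_le_sobolev[OF Nb[OF sobolev_sob_le[OF that]]])
 define g where "g x = f + N (coeffs x)" for x
 have g: "g x \<in> sobolev 0" for x unfolding g_def by (intro sobolev_0_closed f N0) simp
 have s0: "v \<in> sobolev 0" if "v \<in> sobolev 2" for v using sob_le_sobolev[OF sob_le_index[OF sobolev_sob_le[OF that]]] by simp
 have "\<exists>!x. ell2 (sol (g x)) = x"
 proof (rule banach_fix_type[of "1/2"])
  show "\<forall>x y. dist (ell2 (sol (g x))) (ell2 (sol (g y))) \<le> 1/2*dist x y"
  proof (intro allI)
   fix x y
   have "L (sol (g x) - sol (g y)) = N (coeffs (x - y))" unfolding Ld[OF sol(1)[OF g] sol(1)[OF g]] sol(2)[OF g] unfolding g_def by (simp add: Nd)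
   moreover have "sob_le 0 (N (coeffs (x - y))) (n*dist x y)" by (rule Nb) (simp only: dist_norm norm_ell2_le[symmetric])
   ultimately have "sob_le 0 (sol (g x) - sol (g y)) (c*(n*dist x y))" by (intro Lb) (auto intro: sobolev_0_closed sol(1)[OF g])
   hence "dist (ell2 (sol (g x))) (ell2 (sol (g y))) \<le> c*(n*dist x y)" unfolding dist_norm norm_ell2_le coeffs_simps coeffs_ell2[OF s0[OF sol(1)[OF g]]] .
   also have "c*(n*dist x y) = c*n*dist x y" by simp
   also have "... \<le> 1/2*dist x y" by (rule mult_right_mono[OF cn]) simp
   finally show "dist (ell2 (sol (g x))) (ell2 (sol (g y))) \<le> 1/2*dist x y" .
  qed
 qed simp_all
 then obtain x where x: "ell2 (sol (g x)) = x" by blast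
 have "coeffs x = sol (g x)" by (subst x[symmetric]) (rule coeffs_ell2[OF s0[OF sol(1)[OF g]]])
 hence "L (sol (g x)) - N (sol (g x)) = f" unfolding sol(2)[OF g] by (simp add: g_def)
 thus ?thesis using sol(1)[OF g] by blast
qed

section \<open>Surjectivity and symmetry of the regularised operators\<close>

lemma tmul_fsupp_sum: assumes "fsupp xi" shows "tmul xi v k = (\<Sum>l\<in>{l. xi l \<noteq> 0}. xi l * v (k - l))"
 by (rule tmul_finite[OF fsupp_finite_set[OF assms]]) simp

lemma sob_le_shift: assumes "sob_le 0 v a" shows "sob_le 0 (\<lambda>k. v (k - l)) a" unfolding sob_le_def
proof (intro allI impI)
 fix A :: "(int \<times> int) set" assume A: "finite A"
 have inj: "inj_on (\<lambda>k. k - l) A" by (auto intro: inj_onI)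
 have "L2_set (\<lambda>k. norm (v (k - l))) A = L2_set (\<lambda>k. norm (v k)) ((\<lambda>k. k - l) ` A)" unfolding L2_set_def sum.reindex[OF inj] by simp
 also have "... \<le> a" using assms A unfolding sob_le_def by simp
 finally show "L2_set (\<lambda>k. bessel k powr (0/2)*norm (v (k - l))) A \<le> a" by simp
qed

lemma tmul_fsupp_bound:
 assumes f: "fsupp xi" and v: "sob_le 0 v a" shows "sob_le 0 (tmul xi v) ((\<Sum>l\<in>{l. xi l \<noteq> 0}. norm (xi l))*a)"
proof -
 have "tmul xi v = (\<lambda>k. \<Sum>l\<in>{l. xi l \<noteq> 0}. tscale (xi l) (\<lambda>k. v (k - l)) k)"
  unfolding tscale_def by (rule ext) (rule tmul_fsupp_sum[OF f])
 thus ?thesis unfolding sum_distrib_right by (simp only:) (intro sob_le_sum fsupp_finite_set[OF f] sob_le_tscale sob_le_shift v)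
qed

lemma tmul_fsupp_diff: "fsupp xi ==> tmul xi (u - v) = tmul xi u - tmul xi v" by (simp add: fun_eq_iff tmul_fsupp_sum right_diff_distrib sum_subtractf)

definition Hop :: "tdist \<Rightarrow> real \<Rightarrow> tdist \<Rightarrow> tdist" where
 "Hop xi c v = laplace v + tmul xi v - tscale (of_real c) v"

lemma Hop_diff: "fsupp xi ==> Hop xi c (u - v) = Hop xi c u - Hop xi c v" by (simp add: Hop_def laplace_diff tmul_fsupp_diff tscale_diff fun_eq_iff)

lemma Hop_shift: "Hop xi c v - tscale (of_real K) v = Hop xi (c + K) v" by (simp add: Hop_def tscale_def fun_eq_iff algebra_simps)

lemma Hop_mem:
 assumes "fsupp xi" shows "\<exists>b. \<forall>v a. sob_le 2 v a --> sob_le 0 (Hop xi c v) (b*a)"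
proof -
 let ?b = "1 + (\<Sum>l\<in>{l. xi l \<noteq> 0}. norm (xi l)) + \<bar>c\<bar>"
 have "sob_le 0 (Hop xi c v) (?b*a)" if v: "sob_le 2 v a" for v a
 proof -
  have v0: "sob_le 0 v a" by (rule sob_le_index[OF v]) simp
  have "sob_le (2 - 2) (laplace v) a" by (rule sob_le_laplace[OF v])
  hence "sob_le 0 (Hop xi c v) (a + (\<Sum>l\<in>{l. xi l \<noteq> 0}. norm (xi l))*a + norm (of_real c :: complex)*a)"
   unfolding Hop_def by (intro sob_le_diff sob_le_add tmul_fsupp_bound[OF assms v0] sob_le_tscale v0) simp
  thus ?thesis by (simp add: distrib_right)
 qed
 thus ?thesis by blast
qed

text \<open>Method of continuity. For large \<open>l\<close> the zero-order part is a small
  perturbation of \<Delta> - l. Then \<open>l\<close> is lowered in steps of 1/8 towards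
  \<open>K0\<close>: the a priori bound has constant 4 throughout, and 4*(1/8) = 1/2 is what
  \<open>surjective_perturbation\<close> allows. The size of the noise affects only the number of
  steps.\<close>

lemma Hop_surjective:
 assumes f: "fsupp xi" and K0: "1 \<le> K0"
  and bd: "\<And>l v a. K0 \<le> l ==> v \<in> sobolev 2 ==> sob_le 0 (Hop xi (c + l) v) a ==> sob_le 0 v (4*a)"
  and l: "K0 \<le> l" and g: "g \<in> sobolev 0"
 shows "\<exists>v\<in>sobolev 2. Hop xi (c + l) v = g"
proof -
 let ?n = "(\<Sum>l\<in>{l. xi l \<noteq> 0}. norm (xi l)) + \<bar>c\<bar>"
 have n0: "0 \<le> ?n" by (simp add: sum_nonneg)
 \<comment> \<open>Above \<open>L\<close> the inverse of \<Delta> - l, of norm at most 1/l in L2,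
   beats the bound \<open>?n\<close> of the perturbation by a factor 2.\<close>
 define L where "L = 2*?n + 1"
 have big: "\<exists>v\<in>sobolev 2. Hop xi (c + l) v = g" if l: "L \<le> l" and g: "g \<in> sobolev 0" for l g
 proof -
  have l1: "1 \<le> l" using l n0 by (simp add: L_def)
  let ?L = "\<lambda>v. laplace v - tscale (of_real l) v" and ?N = "\<lambda>v. tscale (of_real c) v - tmul xi v"
  have inv: "mres l (- ?L v) = v" for v
  proof
   fix k
   have "(- ?L v) k = v k * of_real (l - 1 + bessel k)" by (simp add: laplace_bessel tscale_def algebra_simps)
   moreover have "of_real (l - 1 + bessel k) \<noteq> (0 :: complex)" using mres_pos[OF l1, of k] unfolding of_real_eq_0_iff by linarith
   ultimately show "mres l (- ?L v) k = v k" unfolding mres_def by (simp only: nonzero_mult_div_cancel_right not_False_eq_True)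
  qed
  have "\<exists>v\<in>sobolev 2. ?L v - ?N v = g"
  proof (rule surjective_perturbation[where c = "1/l" and n = ?n])
   fix f :: tdist assume f: "f \<in> sobolev 0"
   have "sob_le 2 (mres l (- f)) (l powr ((2 - 0)/2 - 1) * sobolev_norm 0 f)" by (rule sob_le_mres[OF sob_le_uminus[OF sobolev_sob_le[OF f]] l1]) simp_all
   moreover have "?L (mres l (- f)) = f"
   proof
    fix k
    have "of_real (l - 1 + bessel k) \<noteq> (0 :: complex)" using mres_pos[OF l1, of k] unfolding of_real_eq_0_iff by linarith
    moreover have "(1 - b)*(- z/d) - x*(- z/d) = z*(x - 1 + b)/d" for b z d x :: complex by (simp add: divide_inverse algebra_simps)
    hence "?L (mres l (- f)) k = f k * of_real (l - 1 + bessel k)/of_real (l - 1 + bessel k)"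
     unfolding mres_def laplace_bessel tscale_def fun_diff_def fun_Compl_def of_real_diff of_real_add of_real_1 .
    ultimately show "?L (mres l (- f)) k = f k" by (simp only: nonzero_mult_div_cancel_right not_False_eq_True)
   qed
   ultimately show "\<exists>v\<in>sobolev 2. ?L v = f" using sob_le_sobolev by blast
  next
   fix v a assume "sob_le 0 (?L v) a"
   from sob_le_mres[OF sob_le_uminus[OF this] l1, of 0] have "sob_le 0 (mres l (- ?L v)) (l powr (- 1)*a)" by simp
   thus "sob_le 0 v (1/l*a)" unfolding inv using l1 by (simp add: powr_minus divide_inverse)
  next
   fix v a assume v: "sob_le 0 v a"
   have "sob_le 0 (?N v) (norm (of_real c :: complex)*a + (\<Sum>l\<in>{l. xi l \<noteq> 0}. norm (xi l))*a)"
    by (intro sob_le_diff sob_le_tscale v tmul_fsupp_bound f)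
   thus "sob_le 0 (?N v) (?n*a)" by (simp add: distrib_right add.commute)
  next
   show "1/l*?n \<le> 1/2" using l l1 by (simp add: L_def field_simps)
  qed (use l1 g in \<open>simp_all add: laplace_diff tscale_diff tmul_fsupp_diff[OF f] fun_eq_iff\<close>)
  moreover have "?L v - ?N v = Hop xi (c + l) v" for v by (simp add: Hop_def tscale_def fun_eq_iff algebra_simps)
  ultimately show ?thesis by simp
 qed
 have "\<forall>l. K0 \<le> l --> L - real m/8 \<le> l --> (\<forall>g\<in>sobolev 0. \<exists>v\<in>sobolev 2. Hop xi (c + l) v = g)" for m
 proof (induction m)
  case 0
  thus ?case using big by simp
 next
  case (Suc m)
  show ?case
  proof (intro allI impI ballI)
   fix l g assume l: "K0 \<le> l" "L - real (Suc m)/8 \<le> l" and g: "g \<in> sobolev 0"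
   have "\<exists>v\<in>sobolev 2. Hop xi (c + (l + 1/8)) v - tscale (of_real (- 1/8)) v = g"
   proof (rule surjective_perturbation[where c = 4 and n = "1/8"])
    have "K0 \<le> l + 1/8" "L - real m/8 \<le> l + 1/8" using l by (simp_all add: add_divide_distrib)
    thus "\<exists>v\<in>sobolev 2. Hop xi (c + (l + 1/8)) v = f" if "f \<in> sobolev 0" for f using Suc.IH[rule_format, of "l + 1/8"] that by blast
    show "sob_le 0 v (4*a)" if "v \<in> sobolev 2" "sob_le 0 (Hop xi (c + (l + 1/8)) v) a" for v a by (rule bd[of "l + 1/8"]) (use l that in auto)
    show "sob_le 0 (tscale (of_real (- 1/8)) v) (1/8*a)" if "sob_le 0 v a" for v a
    proof -
     have "norm (of_real (- 1/8) :: complex) = 1/8" unfolding norm_of_real by simp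
     thus ?thesis using sob_le_tscale[OF that, of "of_real (- 1/8)"] by (simp only:)
    qed
   qed (use g in \<open>simp_all add: Hop_diff[OF f] tscale_diff\<close>)
   thus "\<exists>v\<in>sobolev 2. Hop xi (c + l) v = g" unfolding Hop_shift by (simp add: algebra_simps)
  qed
 qed
 moreover obtain m where "8*(L - l) < real m" using reals_Archimedean2 by blast
 hence "L - real m/8 \<le> l" by (simp add: field_simps)
 ultimately show ?thesis using l g by blast
qed

lemma infsum_finite_sum:
 fixes h :: "'a \<Rightarrow> 'b \<Rightarrow> complex"
 assumes "finite F" "\<And>l. h l summable_on A"
 shows "(\<Sum>\<^sub>\<infinity>k\<in>A. \<Sum>l\<in>F. h l k) = (\<Sum>l\<in>F. \<Sum>\<^sub>\<infinity>k\<in>A. h l k)"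
proof -
 have "((\<lambda>k. \<Sum>l\<in>F. h l k) has_sum (\<Sum>l\<in>F. \<Sum>\<^sub>\<infinity>k\<in>A. h l k)) A"
  using assms(1) by induction (auto intro!: has_sum_add has_sum_infsum assms(2))
 thus ?thesis by (rule infsumI)
qed

text \<open>Multiplication by the noise is a sum of frequency shifts. The adjoint of the shift by l
  is the shift by -l, and reality of the noise makes the coefficients match; the remaining terms
  have real symbols.\<close>

lemma Hop_symmetric:
 assumes f: "fsupp xi" and real: "\<And>k. xi (- k) = cnj (xi k)" and v: "v \<in> sobolev 2"
 shows "Im (cip (Hop xi c v) v) = 0"
proof -
 have v0: "v \<in> sobolev 0" using sob_le_sobolev[OF sob_le_index[OF sobolev_sob_le[OF v]]] by simp
 have l0: "laplace v \<in> sobolev 0" using sob_le_sobolev[OF sob_le_laplace[OF sobolev_sob_le[OF v]]] by simp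
 have t0: "tmul xi v \<in> sobolev 0" by (rule sob_le_sobolev[OF tmul_fsupp_bound[OF f sobolev_sob_le[OF v0]]])
 let ?F = "{l. xi l \<noteq> 0}"
 define S where "S l = (\<Sum>\<^sub>\<infinity>k. v (k - l)*cnj (v k))" for l
 have F: "finite ?F" by (rule fsupp_finite_set[OF f])
 have S: "cnj (S l) = S (- l)" for l
 proof -
  have b: "bij_betw (\<lambda>k. k + l) UNIV (UNIV :: (int \<times> int) set)" by (rule bij_betwI[where g = "\<lambda>k. k - l"]) simp_all
  have "cnj (S l) = (\<Sum>\<^sub>\<infinity>k. cnj (v (k - l)) * v k)" unfolding S_def infsum_cnj[symmetric] by simp
  also have "... = (\<Sum>\<^sub>\<infinity>k. cnj (v (k + l - l)) * v (k + l))" by (rule infsum_reindex_bij_betw[OF b, symmetric])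
  finally show ?thesis by (simp add: S_def mult.commute)
 qed
 have "cip (tmul xi v) v = (\<Sum>\<^sub>\<infinity>k. \<Sum>l\<in>?F. xi l*(v (k - l)*cnj (v k)))"
  unfolding cip_def tmul_fsupp_sum[OF f] sum_distrib_right mult.assoc ..
 also have "... = (\<Sum>l\<in>?F. \<Sum>\<^sub>\<infinity>k. xi l*(v (k - l)*cnj (v k)))"
  by (rule infsum_finite_sum[OF F]) (intro summable_on_cmult_right cip_summable sob_le_sobolev[OF sob_le_shift[OF sobolev_sob_le[OF v0]]] v0)
 also have "... = (\<Sum>l\<in>?F. xi l*S l)"
  unfolding S_def by (intro sum.cong refl infsum_cmult_right cip_summable sob_le_sobolev[OF sob_le_shift[OF sobolev_sob_le[OF v0]]] v0)
 finally have t: "cip (tmul xi v) v = (\<Sum>l\<in>?F. xi l*S l)" .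
 have "cnj (cip (tmul xi v) v) = (\<Sum>l\<in>?F. xi (- l)*S (- l))" unfolding t by (simp add: real S)
 also have "... = (\<Sum>l\<in>?F. xi l*S l)" by (rule sum.reindex_bij_witness[where i = uminus and j = uminus]) (use real in auto)
 finally have T: "cnj (cip (tmul xi v) v) = cip (tmul xi v) v" unfolding t .
 have "cnj (cip (laplace v) v) = cip (laplace v) v" unfolding cip_cnj unfolding cip_def laplace_def by (simp add: mult_ac)
 moreover have "Hop xi c v = (laplace v + tmul xi v) + tscale (of_real (- c)) v" by (simp add: Hop_def tscale_def fun_eq_iff)
 hence "cip (Hop xi c v) v = cip (laplace v) v + cip (tmul xi v) v + of_real (- c) * of_real ((sobolev_norm 0 v)^2)"
  using l0 t0 v0 by (simp only: cip_add_left cip_tscale_left cip_self sobolev_0_closed)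
 ultimately have "cnj (cip (Hop xi c v) v) = cip (Hop xi c v) v" using T by simp
 thus ?thesis by (simp add: complex_eq_iff)
qed

section \<open>Convergence of the solutions\<close>

lemma L2_ell2: assumes "u \<in> L2" shows "coeffs (ell2 u) = u" "norm (ell2 u) = L2norm u"
 using L2_sobolev[OF assms] by (simp_all add: norm_ell2_def L2norm_sobolev_norm[OF assms])

lemma ell2_diff: assumes "u \<in> L2" "v \<in> L2" shows "ell2 u - ell2 v = ell2 (u - v)" by (simp add: coeffs_inject[symmetric] L2_ell2 assms L2_diff)

lemma ell2_scaleR: assumes "u \<in> L2" shows "r *\<^sub>R ell2 u = ell2 (tscale (of_real r) u)" by (simp add: coeffs_inject[symmetric] L2_ell2 assms L2_tscale)

lemma L2_in_ell2_continuous: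
 assumes "cont_on_time L2norm L2 T w" shows "continuous_on {0..T} (\<lambda>t. ell2 (w t))" unfolding continuous_on
proof
 fix t assume t: "t \<in> {0..T}"
 have w: "w s \<in> L2" if "s \<in> {0..T}" for s using assms that unfolding cont_on_time_def by blast
 have "((\<lambda>s. L2norm (w s - w t)) \<longlongrightarrow> 0) (at t within {0..T})" using assms t unfolding cont_on_time_def by blast
 moreover have "L2norm (w s - w t) = norm (ell2 (w s) - ell2 (w t))" if "s \<in> {0..T}" for s
  unfolding ell2_diff[OF w[OF that] w[OF t]] L2_ell2(2)[OF L2_diff[OF w[OF that] w[OF t]]] ..
 hence "\<forall>\<^sub>F s in at t within {0..T}. L2norm (w s - w t) = norm (ell2 (w s) - ell2 (w t))" by (simp add: eventually_at_filter)
 ultimately have "((\<lambda>s. norm (ell2 (w s) - ell2 (w t))) \<longlongrightarrow> 0) (at t within {0..T})" by (rule Lim_transform_eventually)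
 thus "((\<lambda>s. ell2 (w s)) \<longlongrightarrow> ell2 (w t)) (at t within {0..T})" unfolding tendsto_norm_zero_iff LIM_zero_iff .
qed

lemma C1_L2_derivative:
 assumes "C1_L2 T w dw" and t: "t \<in> {0..T}"
 shows "((\<lambda>t. ell2 (w t)) has_vector_derivative ell2 (dw t)) (at t within {0..T})"
proof -
 have w: "w s \<in> L2" "dw s \<in> L2" if "s \<in> {0..T}" for s using assms that unfolding C1_L2_def cont_on_time_def by blast+
 have "((\<lambda>s. L2norm (tscale (of_real (1/(s - t))) (w s - w t) - dw t)) \<longlongrightarrow> 0) (at t within {0..T})" using assms unfolding C1_L2_def by blast
 moreover have "L2norm (tscale (of_real (1/(s - t))) (w s - w t) - dw t)
   = norm ((1/(s - t)) *\<^sub>R (ell2 (w s) - ell2 (w t)) - ell2 (dw t))" if "s \<in> {0..T}" for s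
  unfolding ell2_diff[OF w(1)[OF that] w(1)[OF t]] ell2_scaleR[OF L2_diff[OF w(1)[OF that] w(1)[OF t]]]
   ell2_diff[OF L2_tscale[OF L2_diff[OF w(1)[OF that] w(1)[OF t]]] w(2)[OF t]]
   L2_ell2(2)[OF L2_diff[OF L2_tscale[OF L2_diff[OF w(1)[OF that] w(1)[OF t]]] w(2)[OF t]]] ..
 hence "\<forall>\<^sub>F s in at t within {0..T}. L2norm (tscale (of_real (1/(s - t))) (w s - w t) - dw t)
   = norm ((1/(s - t)) *\<^sub>R (ell2 (w s) - ell2 (w t)) - ell2 (dw t))" by (simp only: eventually_at_filter) (rule always_eventually, blast)
 ultimately have "((\<lambda>s. norm ((1/(s - t)) *\<^sub>R (ell2 (w s) - ell2 (w t)) - ell2 (dw t))) \<longlongrightarrow> 0) (at t within {0..T})" by (rule Lim_transform_eventually)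
 thus ?thesis unfolding has_vector_derivative_quotient tendsto_norm_zero_iff LIM_zero_iff .
qed

lemma sup_le_sob_le: assumes "sup_le M u" shows "sob_le 0 u M"
proof -
 obtain f where f: "f \<in> borel_measurable torus" "\<forall>x\<in>space torus. norm (f x) \<le> M" "fourier f = u" using assms unfolding sup_le_def by blast
 have "sob_le 0 (fourier f) M" by (rule sob_le_fourier[OF L2fun_bounded[OF f(1)] L2_integral_le_sq[OF f(1)] sup_leD(3)[OF assms]]) (use f(2) in auto)
 thus ?thesis using f(3) by simp
qed

definition ecubic :: "ell2 \<Rightarrow> ell2" where "ecubic x = ell2 (cubic (coeffs x))"

lemma coeffs_ecubic: "sup_le M (coeffs x) ==> coeffs (ecubic x) = cubic (coeffs x)"
 unfolding ecubic_def by (intro coeffs_ell2 L2_sobolev sup_leD(1)[OF sup_le_cubic(1)])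

lemma cubic_L2: "sup_le M u ==> cubic u \<in> L2" by (rule sup_leD(1)[OF sup_le_cubic(1)])

section \<open>The regularised noise, its limit, and the assembly of the proof\<close>

locale noise_setting = model +
 fixes m :: "real \<times> real \<Rightarrow> real" and xi Xi2 :: tdist
 assumes moll: "mollifier m" and enh: "enhanced_noise P m xi Xi2" and real_noise: "\<And>k. xi (- k) = cnj (xi k)"
begin

definition "xe ep = regularised m xi ep"
definition "ce ep = renorm_const m ep"
definition "Xe ep = reso P (xe ep) (resolv (xe ep)) - tconst (of_real (ce ep))"

lemma fsupp_xe: assumes "0 < ep" shows "fsupp (xe ep)"
proof -
 obtain r where r: "\<And>x. m x \<noteq> 0 ==> norm x \<le> r" using moll unfolding mollifier_def by blast
 let ?\<rho> = "1 + 4*pi^2*(r/ep)^2"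
 show ?thesis
 proof (rule fsupp_finite[OF bessel_ball(1)])
  show "1 \<le> ?\<rho>" by simp
  fix k assume k: "k \<notin> {k. bessel k \<le> ?\<rho>}"
  have "m (ep *\<^sub>R freq k) = 0"
  proof (rule ccontr)
   assume "m (ep *\<^sub>R freq k) \<noteq> 0"
   hence "norm (freq k) \<le> r/ep" using r[of "ep *\<^sub>R freq k"] assms by (simp add: field_simps)
   hence "bessel k \<le> ?\<rho>" unfolding bessel_def by (intro add_left_mono mult_left_mono power_mono) simp_all
   thus False using k by simp
  qed
  thus "xe ep k = 0" by (simp add: xe_def regularised_def)
 qed
qed

lemma fsupp_Xe: "0 < ep ==> fsupp (Xe ep)" unfolding Xe_def by (intro fsupp_diff fsupp_reso fsupp_resolv fsupp_xe fsupp_tconst)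

lemma real_xe: "xe ep (- k) = cnj (xe ep k)"
proof -
 have "\<forall>x y. norm x = norm y --> m x = m y" using moll unfolding mollifier_def radial_def by blast
 moreover have "norm (ep *\<^sub>R freq (- k)) = norm (ep *\<^sub>R freq k)" by (simp add: freq_uminus)
 ultimately have "m (ep *\<^sub>R freq (- k)) = m (ep *\<^sub>R freq k)" by blast
 thus ?thesis by (simp add: xe_def regularised_def real_noise)
qed

lemma H_eps_Hop: "H_eps m xi K ep v = Hop (xe ep) (ce ep + K) v" using Hop_shift[of "xe ep" "ce ep" v K] unfolding H_eps_def A_eps_def Hop_def xe_def ce_def .

lemma noise_limit:
 obtains Z e0 d where "0 \<le> Z" "0 < e0" "e0 \<le> 1" "noise Z xi Xi2" "(d \<longlongrightarrow> 0) (at_right 0)"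
  "\<And>ep. ep \<in> {0<..<e0} ==> noise Z (xe ep) (Xe ep)" "\<And>ep. ep \<in> {0<..<e0} ==> noise (d ep) (xe ep - xi) (Xe ep - Xi2)"
proof -
 obtain c where c: "0 \<le> c" "\<And>Z xi Xi. hi (- 1 - eta) Z xi ==> hi (- 2*eta) Z Xi ==> noise (c*Z) xi Xi" by (rule noise_base) (rule that)
 have a: "- 1 - eta < - 1" "2*(- 1 - eta) + 2 = - 2*eta" using eta(1) by simp_all
 note E = enh[unfolded enhanced_noise_def, rule_format, OF a(1), unfolded a(2)]
 have m0: "xi \<in> holder P (- 1 - eta)" "Xi2 \<in> holder P (- 2*eta)" using E by blast+
 let ?d1 = "\<lambda>ep. holder_norm P (- 1 - eta) (xe ep - xi)" and ?d2 = "\<lambda>ep. holder_norm P (- 2*eta) (Xe ep - Xi2)"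
 have lim: "(?d1 \<longlongrightarrow> 0) (at_right 0)" "(?d2 \<longlongrightarrow> 0) (at_right 0)" using E unfolding xe_def Xe_def ce_def by blast+
 have comb: "noise (c*(x + y)) f g" if "hi (- 1 - eta) x f" "hi (- 2*eta) y g" for x y f g
  by (rule c(2)[OF hi_mono[OF that(1)] hi_mono[OF that(2)]]) (use hi_nonneg[OF that(1)] hi_nonneg[OF that(2)] in simp_all)
 obtain Z0 where Z0: "noise Z0 xi Xi2" using comb[OF hi_holder[OF m0(1)] hi_holder[OF m0(2)]] by blast
 define d where "d ep = c*(?d1 ep + ?d2 ep)" for ep
 have d: "(d \<longlongrightarrow> 0) (at_right 0)" unfolding d_def[abs_def] using tendsto_mult[OF tendsto_const tendsto_add[OF lim]] by simp
 have nd: "noise (d ep) (xe ep - xi) (Xe ep - Xi2)" if e: "0 < ep" for ep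
 proof -
  obtain B where B: "hi (- 1 - eta) B (xe ep)" using fsupp_hi[OF fsupp_xe[OF e]] by blast
  obtain D where D: "hi (- 2*eta) D (Xe ep)" using fsupp_hi[OF fsupp_Xe[OF e]] by blast
  have "xe ep - xi \<in> holder P (- 1 - eta)" "Xe ep - Xi2 \<in> holder P (- 2*eta)"
   using hi_diff[OF B hi_holder[OF m0(1)]] hi_diff[OF D hi_holder[OF m0(2)]] unfolding hi_iff_holder by blast+
  thus ?thesis unfolding d_def by (intro comb hi_holder)
 qed
 have "\<forall>\<^sub>F ep in at_right 0. d ep < 1" using d by (rule order_tendstoD(2)) simp
 then obtain e where e: "0 < e" "\<And>ep. 0 < ep ==> ep < e ==> d ep < 1" unfolding eventually_at_right_field by blast
 show ?thesis
 proof (rule that[of "Z0 + 1" "min e 1" d])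
  show "0 \<le> Z0 + 1" "0 < min e 1" "min e 1 \<le> 1" using noise_nonneg[OF Z0] e(1) by simp_all
  show "noise (Z0 + 1) xi Xi2" by (rule noise_mono[OF Z0]) simp
  show "noise (d ep) (xe ep - xi) (Xe ep - Xi2)" if "ep \<in> {0<..<min e 1}" for ep using nd that by simp
  show "noise (Z0 + 1) (xe ep) (Xe ep)" if ep: "ep \<in> {0<..<min e 1}" for ep
  proof -
   have "noise (d ep) (xe ep - xi) (Xe ep - Xi2)" using nd ep by simp
   \<comment> \<open>The closure property at hand is that for differences, so \<open>xe ep\<close>
     is written as xi minus (0 minus (xe ep - xi)), with \<open>noise_zero\<close> for the
     0.\<close>
   from noise_diff[OF Z0 noise_diff[OF noise_zero this]]
   have "noise (Z0 + (0 + d ep)) (xi - (xi - xi - (xe ep - xi))) (Xi2 - (Xi2 - Xi2 - (Xe ep - Xi2)))" .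
   moreover have "f - (f - f - (g - f)) = g" for f g :: tdist by (simp add: fun_eq_iff)
   ultimately have n: "noise (Z0 + (0 + d ep)) (xe ep) (Xe ep)" by (simp only:)
   have "d ep < 1" by (rule e(2)) (use ep in simp_all)
   thus ?thesis by (intro noise_mono[OF n]) linarith
  qed
 qed (rule d)
qed

end

context noise_setting begin

abbreviation "Hlim K \<equiv> H_op P C xi Xi2 K"
abbreviation "Heps K ep \<equiv> H_eps m xi K ep"

lemma convergence_theorem:
 "\<exists>K0>0. \<forall>K\<ge>K0. \<forall>T>0. \<forall>u0\<in>Adom xi Xi2. \<forall>ue due :: real \<Rightarrow> real \<Rightarrow> tdist. \<forall>u du :: real \<Rightarrow> tdist.
  (\<forall>ep\<in>{0<..<1}. strong_solution (Heps K ep) (sobolev 2) (sobolev_norm 2) T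
    (inv_into (sobolev 2) (\<lambda>v. - Heps K ep v) (- Hlim K u0)) (ue ep) (due ep)) -->
  strong_solution (Hlim K) (Adom xi Xi2) (\<lambda>v. L2norm (Hlim K v)) T u0 u du -->
  (\<forall>t\<in>{0..T}. ((\<lambda>ep. L2norm (ue ep t - u t)) \<longlongrightarrow> 0) (at_right 0) \<and>
    ((\<lambda>ep. L2norm (Heps K ep (ue ep t) - Hlim K (u t))) \<longlongrightarrow> 0) (at_right 0) \<and>
    ((\<lambda>ep. L2norm (due ep t - du t)) \<longlongrightarrow> 0) (at_right 0))"
proof -
 obtain Z e0 d where Z: "0 \<le> Z" and e0: "0 < e0" "e0 \<le> 1" and n: "noise Z xi Xi2" and d: "(d \<longlongrightarrow> 0) (at_right 0)"
  and ne: "\<And>ep. ep \<in> {0<..<e0} ==> noise Z (xe ep) (Xe ep)"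
  and nd: "\<And>ep. ep \<in> {0<..<e0} ==> noise (d ep) (xe ep - xi) (Xe ep - Xi2)" by (rule noise_limit) (rule that)
 obtain K0 where K0: "1 \<le> K0"
  and est1: "\<And>K xi Xi v S. K0 \<le> K ==> noise Z xi Xi ==> v \<in> Adom xi Xi ==> sob_le 0 (res K xi Xi v) S ==> sob_le 0 v (4*S)"
  and est2: "\<And>K \<delta>. K0 \<le> K ==> 0 < \<delta> ==> \<exists>D\<ge>0. ehrling_const Z K \<delta> D"
  and est3: "\<And>K xi2 Xi2 v2. K0 \<le> K ==> noise Z xi2 Xi2 ==> v2 \<in> Adom xi2 Xi2 ==> \<exists>D\<ge>0. stability_const Z K xi2 Xi2 v2 D"
  by (rule resolvent_estimates[OF Z]) (rule that)
 have dom: "v \<in> Adom (xe ep) (Xe ep)" if "ep \<in> {0<..<e0}" "v \<in> sobolev 2" for ep v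
  by (rule smooth_noise_dom[OF ne[OF that(1)] fsupp_xe fsupp_Xe that(2)]) (use that in simp_all)
 have Aeq: "res l (xe ep) (Xe ep) v = - Hop (xe ep) (ce ep + l) v" if "ep \<in> {0<..<e0}" "v \<in> sobolev 2" for ep v l
  unfolding smooth_noise_A_op[OF ne[OF that(1)] fsupp_xe Xe_def that(2), OF greaterThanLessThan_iff[THEN iffD1, THEN conjunct1, OF that(1)]] Hop_def
  by (simp add: tscale_def fun_eq_iff algebra_simps)
 have bd: "sob_le 0 v (4*a)" if "ep \<in> {0<..<e0}" "K0 \<le> l" "v \<in> sobolev 2" "sob_le 0 (Hop (xe ep) (ce ep + l) v) a" for ep l v a
  by (rule est1[OF that(2) ne[OF that(1)] dom[OF that(1,3)]]) (unfold Aeq[OF that(1,3)], rule sob_le_uminus[OF that(4)])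
 show ?thesis
 proof (rule exI[of _ K0], intro conjI allI impI ballI)
  show "0 < K0" using K0 by simp
 next
  fix K T u0 and ue due :: "real \<Rightarrow> real \<Rightarrow> tdist" and u du :: "real \<Rightarrow> tdist" and t0
  assume K: "K0 \<le> K" and T: "0 < T" and u0: "u0 \<in> Adom xi Xi2"
   and sole: "\<forall>ep\<in>{0<..<1}. strong_solution (Heps K ep) (sobolev 2) (sobolev_norm 2) T
    (inv_into (sobolev 2) (\<lambda>v. - Heps K ep v) (- Hlim K u0)) (ue ep) (due ep)"
   and sol: "strong_solution (Hlim K) (Adom xi Xi2) (\<lambda>v. L2norm (Hlim K v)) T u0 u du"
   and t0: "t0 \<in> {0..T}"
  let ?E = "{0<..<e0}" and ?H = "\<lambda>ep. Hop (xe ep) (ce ep + K)"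
  have fx: "fsupp (xe ep)" if "ep \<in> ?E" for ep using that by (intro fsupp_xe) simp
  have ex: "\<exists>v\<in>sobolev 2. ?H ep v = coeffs x" if e: "ep \<in> ?E" for ep x by (rule Hop_surjective[OF fx[OF e] K0 bd[OF e] K]) simp_all
  \<comment> \<open>The inverse of H_eps on coefficients. It exists by
    \<open>Hop_surjective\<close>, fed with the a priori bound \<open>bd\<close> that is uniform in
    \<open>ep\<close>.\<close>
  define sv where "sv ep x = (SOME v. v \<in> sobolev 2 \<and> ?H ep v = coeffs x)" for ep x
  have sv: "sv ep x \<in> sobolev 2" "?H ep (sv ep x) = coeffs x" if e: "ep \<in> ?E" for ep x
   using someI_ex[of "\<lambda>v. v \<in> sobolev 2 \<and> ?H ep v = coeffs x"] ex[OF e, of x] unfolding sv_def by blast+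
  have uniq: "v = w" if e: "ep \<in> ?E" and vw: "v \<in> sobolev 2" "w \<in> sobolev 2" "?H ep v = ?H ep w" for ep v w
  proof -
   have "sob_le 0 (?H ep (v - w)) 0" unfolding Hop_diff[OF fx[OF e]] vw(3) by (simp add: sob_le_zero)
   from bd[OF e K sobolev_0_closed(2)[OF vw(1,2)] this] have "sob_le 0 (v - w) 0" by simp
   from sob_le_coeff_diff[OF this] show "v = w" by (simp add: fun_eq_iff)
  qed
  have s0: "v \<in> sobolev 0" if "v \<in> sobolev 2" for v by (rule sobolev_index[OF that]) simp
  define G where "G ep x = ell2 (sv ep x)" for ep x
  have Gc: "coeffs (G ep x) = sv ep x" if "ep \<in> ?E" for ep x unfolding G_def by (rule coeffs_ell2[OF s0[OF sv(1)[OF that]]])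
  have Gb: "norm (G ep x) \<le> 4*norm x" if e: "ep \<in> ?E" for ep x
   unfolding norm_ell2_le Gc[OF e] by (rule bd[OF e K sv(1)[OF e]]) (simp add: sv(2)[OF e] norm_ell2_le[symmetric])
  have ehr: "\<exists>D\<ge>0. \<forall>ep\<in>?E. \<forall>x. sup_le (\<delta>*norm x + D*norm (G ep x)) (coeffs (G ep x))" if \<delta>: "0 < \<delta>" for \<delta>
  proof -
   obtain D where D: "0 \<le> D" "ehrling_const Z K \<delta> D" using est2[OF K \<delta>] by (elim exE conjE)
   have "sup_le (\<delta>*norm x + D*norm (G ep x)) (coeffs (G ep x))" if e: "ep \<in> ?E" for ep x unfolding Gc[OF e]
   proof (rule D(2)[rule_format, OF ne[OF e] fx[OF e] dom[OF e sv(1)[OF e]]])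
    show "sob_le 0 (res K (xe ep) (Xe ep) (sv ep x)) (norm x)"
     unfolding Aeq[OF e sv(1)[OF e]] sv(2)[OF e] by (intro sob_le_uminus) (simp add: norm_ell2_le[symmetric])
    show "sob_le 0 (sv ep x) (norm (G ep x))" using norm_ell2_le[of "G ep x" "norm (G ep x)"] unfolding Gc[OF e] by simp
   qed
   with D(1) show ?thesis by blast
  qed
  have S: "cont_on_time (\<lambda>v. L2norm (Hlim K v)) (Adom xi Xi2) T u" "C1_L2 T u du" "u 0 = u0"
   "\<And>t. t \<in> {0..T} ==> tscale \<i> (du t) = Hlim K (u t) - cubic (u t)" using sol unfolding strong_solution_def by blast+
  have ud: "u t \<in> Adom xi Xi2" if "t \<in> {0..T}" for t using S(1) that unfolding cont_on_time_def by blast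
  have uL: "u t \<in> L2" "du t \<in> L2" if "t \<in> {0..T}" for t using S(2) that unfolding C1_L2_def cont_on_time_def by blast+
  have Hd: "Hlim K (v - w) = Hlim K v - Hlim K w" if "v \<in> Adom xi Xi2" "w \<in> Adom xi Xi2" for v w
   unfolding H_op_def A_diff[OF n that] tscale_diff by (simp add: fun_eq_iff)
  have Hm: "Hlim K v \<in> sobolev 0" if "v \<in> Adom xi Xi2" for v
   unfolding H_op_def by (intro sobolev_0_closed A_mem[OF n that] sobolev_index[OF AdomD(1)[OF that]]) (use range in simp)
  define f where "f t = ell2 (Hlim K (u t))" for t
  have fc: "coeffs (f t) = Hlim K (u t)" if "t \<in> {0..T}" for t unfolding f_def by (rule coeffs_ell2[OF Hm[OF ud[OF that]]])
  \<comment> \<open>\<open>sv ep (f t)\<close> and \<open>u t\<close> have the same image under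
    their operators, so stability in the noise compares them directly. The rate is
    \<open>d ep\<close>, with a constant that depends on \<open>u t\<close>.\<close>
  have Glim: "((\<lambda>ep. G ep (f t)) \<longlongrightarrow> ell2 (u t)) (at_right 0)" if t: "t \<in> {0..T}" for t
  proof -
   obtain D where D: "0 \<le> D" "stability_const Z K xi Xi2 (u t) D" using est3[OF K n ud[OF t]] by (elim exE conjE)
   have "norm (G ep (f t) - ell2 (u t)) \<le> D*d ep" if e: "ep \<in> ?E" for ep unfolding norm_ell2_le coeffs_simps Gc[OF e] L2_ell2(1)[OF uL(1)[OF t]]
   proof (rule D(2)[rule_format, OF ne[OF e] nd[OF e] dom[OF e sv(1)[OF e]]])
    show "res K (xe ep) (Xe ep) (sv ep (f t)) = res K xi Xi2 (u t)" unfolding Aeq[OF e sv(1)[OF e]] sv(2)[OF e] fc[OF t] H_op_def by (simp add: fun_eq_iff)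
   qed
   hence "\<forall>\<^sub>F ep in at_right 0. norm (G ep (f t) - ell2 (u t)) \<le> D*d ep"
    using eventually_at_right_real[OF e0(1)] by (rule eventually_mono[rotated])
   moreover have "((\<lambda>ep. D*d ep) \<longlongrightarrow> 0) (at_right 0)" using tendsto_mult[OF tendsto_const d] by simp
   ultimately show ?thesis by (rule LIM_zero_cancel[OF Lim_null_comparison])
  qed
  have closed: "sup_le a (u t)" if t: "t \<in> {0..T}" and a: "0 \<le> a" and ap: "\<And>e. 0 < e ==> \<exists>y. sup_le a (coeffs y) \<and> norm (ell2 (u t) - y) \<le> e" for a t
  proof (rule sup_le_closed[OF uL(1)[OF t] a])
   fix e :: real assume "0 < e"
   from ap[OF this] obtain y where "sup_le a (coeffs y)" "norm (ell2 (u t) - y) \<le> e" by blast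
   thus "\<exists>v. sup_le a v \<and> sob_le 0 (u t - v) e" unfolding norm_ell2_le coeffs_simps L2_ell2(1)[OF uL(1)[OF t]] by blast
  qed
  \<comment> \<open>The limit solution is bounded, being an L2 limit of functions with a common
    bound. Only then is its cube known to lie in L2.\<close>
  have usup: "\<exists>a. sup_le a (u t)" if t: "t \<in> {0..T}" for t
  proof -
   obtain D where D: "0 \<le> D" "\<forall>ep\<in>?E. \<forall>x. sup_le (1*norm x + D*norm (G ep x)) (coeffs (G ep x))" using ehr[of 1] by auto
   let ?a = "norm (f t) + D*(4*norm (f t))"
   have "sup_le ?a (u t)"
   proof (rule closed[OF t])
    fix e :: real assume "0 < e"
    with Glim[OF t] have "\<forall>\<^sub>F ep in at_right 0. dist (G ep (f t)) (ell2 (u t)) < e" by (rule tendstoD)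
    with eventually_at_right_real[OF e0(1)] have "\<forall>\<^sub>F ep in at_right (0::real). \<exists>y. sup_le ?a (coeffs y) \<and> norm (ell2 (u t) - y) \<le> e"
    proof eventually_elim
     case (elim ep)
     have "sup_le ?a (coeffs (G ep (f t)))" using elim(1) D by (intro sup_le_mono[OF D(2)[rule_format, OF elim(1)]] add_mono mult_left_mono Gb) simp_all
     thus ?case using elim(2) by (intro exI[of _ "G ep (f t)"]) (simp add: dist_norm norm_minus_commute)
    qed
    thus "\<exists>y. sup_le ?a (coeffs y) \<and> norm (ell2 (u t) - y) \<le> e" by simp
   qed (use D(1) in simp)
   thus ?thesis by blast
  qed
  have cL: "cubic (u t) \<in> L2" if "t \<in> {0..T}" for t using usup[OF that] cubic_L2 by blast
  \<comment> \<open>\<open>L2norm\<close> is tied to the coefficient norm on the range of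
    \<open>fourier\<close>, so membership in \<open>L2\<close>, beyond that in
    \<open>sobolev 0\<close>, is read off the equation.\<close>
  have HL: "Hlim K (u t) \<in> L2" if t: "t \<in> {0..T}" for t
  proof -
   have "Hlim K (u t) = tscale \<i> (du t) + cubic (u t)" unfolding S(4)[OF t] by simp
   thus ?thesis using L2_add[OF L2_tscale[OF uL(2)[OF t]] cL[OF t]] by simp
  qed
  have E: "cont_on_time (sobolev_norm 2) (sobolev 2) T (ue ep)" "C1_L2 T (ue ep) (due ep)"
   "\<And>t. t \<in> {0..T} ==> tscale \<i> (due ep t) = ?H ep (ue ep t) - cubic (ue ep t)"
   "ue ep 0 = inv_into (sobolev 2) (\<lambda>v. - ?H ep v) (- Hlim K u0)" if e: "ep \<in> ?E" for ep
  proof -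
   have "ep \<in> {0<..<1}" using e e0(2) by auto
   from sole[rule_format, OF this] show "cont_on_time (sobolev_norm 2) (sobolev 2) T (ue ep)" "C1_L2 T (ue ep) (due ep)"
    "\<And>t. t \<in> {0..T} ==> tscale \<i> (due ep t) = ?H ep (ue ep t) - cubic (ue ep t)"
    "ue ep 0 = inv_into (sobolev 2) (\<lambda>v. - ?H ep v) (- Hlim K u0)" unfolding strong_solution_def H_eps_Hop by blast+
  qed
  have e2: "ue ep t \<in> sobolev 2" if "ep \<in> ?E" "t \<in> {0..T}" for ep t using E(1)[OF that(1)] that(2) unfolding cont_on_time_def by blast
  have eL: "ue ep t \<in> L2" "due ep t \<in> L2" if "ep \<in> ?E" "t \<in> {0..T}" for ep t
   using E(2)[OF that(1)] that(2) unfolding C1_L2_def cont_on_time_def by blast+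
  have ecL: "cubic (ue ep t) \<in> L2" if "ep \<in> ?E" "t \<in> {0..T}" for ep t by (rule cubic_L2[OF sup_le_sobolev[OF sobolev_sob_le[OF e2[OF that]]]]) simp
  have eHL: "?H ep (ue ep t) \<in> L2" if "ep \<in> ?E" "t \<in> {0..T}" for ep t
  proof -
   have "?H ep (ue ep t) = tscale \<i> (due ep t) + cubic (ue ep t)" unfolding E(3)[OF that] by simp
   thus ?thesis using L2_add[OF L2_tscale[OF eL(2)[OF that]] ecL[OF that]] by simp
  qed
  interpret nls_limit imul ecubic G "\<lambda>a x. sup_le a (coeffs x)" e0 T 4 "\<lambda>t. ell2 (u t)" "\<lambda>t. ell2 (du t)" f
   "\<lambda>ep t. ell2 (ue ep t)" "\<lambda>ep t. ell2 (due ep t)" "\<lambda>ep t. ell2 (?H ep (ue ep t))"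
  proof
   show "0 < T" "0 < e0" "0 \<le> (4 :: real)" by (simp_all add: T e0(1))
   show "imul (x - y) = imul x - imul y" "inner (imul x) (imul y) = inner x y" "imul (imul x) = - x" for x y by (rule imul)+
   show "G e (x - y) = G e x - G e y" if e: "e \<in> ?E" for e x y
   proof -
    have "sv e (x - y) = sv e x - sv e y"
     by (rule uniq[OF e sv(1)[OF e] sobolev_0_closed(2)[OF sv(1)[OF e] sv(1)[OF e]]]) (simp add: Hop_diff[OF fx[OF e]] sv(2)[OF e])
    thus ?thesis by (simp add: coeffs_inject[symmetric] Gc[OF e])
   qed
   show "norm (G e x) \<le> 4*norm x" if "e \<in> ?E" for e x by (rule Gb[OF that])
   \<comment> \<open>The real pairing with \<open>imul\<close> is minus the imaginary part of the
     quadratic form of H_eps at \<open>sv e x\<close>.\<close>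
   show "inner (imul x) (G e x) = 0" if e: "e \<in> ?E" for e x
    unfolding imul(4) Gc[OF e] sv(2)[OF e, of x, symmetric] by (simp add: Hop_symmetric[OF fx[OF e] real_xe sv(1)[OF e]])
   show "sup_le a (coeffs x) ==> a \<le> b ==> sup_le b (coeffs x)" for a b x by (rule sup_le_mono)
   show "sup_le a (coeffs x) ==> sup_le b (coeffs y) ==> sup_le (a + b) (coeffs (x + y))" for a b x y unfolding coeffs_simps by (rule sup_le_add)
   show "sup_le a (coeffs (ell2 (u t)))" if "t \<in> {0..T}" "0 \<le> a" "\<And>e. 0 < e ==> \<exists>y. sup_le a (coeffs y) \<and> norm (ell2 (u t) - y) \<le> e" for a t
    unfolding L2_ell2(1)[OF uL(1)[OF that(1)]] by (rule closed[OF that])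
   show "\<exists>D\<ge>0. \<forall>e\<in>?E. \<forall>x. sup_le (\<delta>*norm x + D*norm (G e x)) (coeffs (G e x))" if "0 < \<delta>" for \<delta> by (rule ehr[OF that])
   show "norm (ecubic a) \<le> M^3" if "sup_le M (coeffs a)" for M a
    unfolding norm_ell2_le coeffs_ecubic[OF that] by (rule sup_le_sob_le[OF sup_le_cubic(1)[OF that]])
   show "norm (ecubic a - ecubic b) \<le> 3*M^2*norm (a - b)" if "sup_le M (coeffs a)" "sup_le M (coeffs b)" for M a b
    unfolding norm_ell2_le coeffs_simps coeffs_ecubic[OF that(1)] coeffs_ecubic[OF that(2)]
    by (rule cubic_diff_le[OF that]) (simp add: norm_ell2_le[symmetric] coeffs_simps(3)[symmetric] del: coeffs_simps)
   show "norm (ecubic a - ecubic b - (ecubic c - ecubic d)) \<le> 3*M^2*norm (a - b - (c - d)) + 6*M*w*norm (c - d)"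
    if s: "sup_le M (coeffs a)" "sup_le M (coeffs b)" "sup_le M (coeffs c)" "sup_le M (coeffs d)" "sup_le w (coeffs (a - c))" "sup_le w (coeffs (b - d))" for M w a b c d
    unfolding norm_ell2_le coeffs_simps coeffs_ecubic[OF s(1)] coeffs_ecubic[OF s(2)] coeffs_ecubic[OF s(3)] coeffs_ecubic[OF s(4)]
    by (rule cubic_second_diff_le[OF s(1-4) s(5,6)[unfolded coeffs_simps]]) (simp_all add: norm_ell2_le[symmetric] coeffs_simps(3)[symmetric] del: coeffs_simps)
   show "((\<lambda>t. ell2 (ue e t)) has_vector_derivative ell2 (due e t)) (at t within {0..T})" if "e \<in> ?E" "t \<in> {0..T}" for e t
    by (rule C1_L2_derivative[OF E(2)[OF that(1)] that(2)])
   show "continuous_on {0..T} (\<lambda>t. ell2 (due e t))" if "e \<in> ?E" for e using E(2)[OF that] by (intro L2_in_ell2_continuous) (simp add: C1_L2_def)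
   show "continuous_on {0..T} (\<lambda>t. ell2 (?H e (ue e t)))" if e: "e \<in> ?E" for e unfolding continuous_on
   proof
    fix t assume t: "t \<in> {0..T}"
    obtain b where b: "\<And>v a. sob_le 2 v a ==> sob_le 0 (?H e v) (b*a)" using Hop_mem[OF fx[OF e]] by blast
    have "((\<lambda>s. sobolev_norm 2 (ue e s - ue e t)) \<longlongrightarrow> 0) (at t within {0..T})" using E(1)[OF e] t unfolding cont_on_time_def by blast
    from tendsto_mult[OF tendsto_const this] have "((\<lambda>s. b * sobolev_norm 2 (ue e s - ue e t)) \<longlongrightarrow> 0) (at t within {0..T})" by simp
    moreover have "norm (ell2 (?H e (ue e s)) - ell2 (?H e (ue e t))) \<le> b * sobolev_norm 2 (ue e s - ue e t)" if s: "s \<in> {0..T}" for s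
     unfolding norm_ell2_le coeffs_simps L2_ell2(1)[OF eHL[OF e s]] L2_ell2(1)[OF eHL[OF e t]] Hop_diff[OF fx[OF e], symmetric]
     by (intro b sobolev_sob_le sobolev_0_closed e2[OF e] s t)
    hence "\<forall>\<^sub>F s in at t within {0..T}. norm (ell2 (?H e (ue e s)) - ell2 (?H e (ue e t))) \<le> b * sobolev_norm 2 (ue e s - ue e t)"
     by (simp add: eventually_at_filter)
    ultimately show "((\<lambda>s. ell2 (?H e (ue e s))) \<longlongrightarrow> ell2 (?H e (ue e t))) (at t within {0..T})"
     by (rule_tac LIM_zero_cancel[OF Lim_null_comparison])
   qed
   show "ell2 (ue e t) = G e (ell2 (?H e (ue e t)))" if "e \<in> ?E" "t \<in> {0..T}" for e t
   proof -
    have "sv e (ell2 (?H e (ue e t))) = ue e t"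
     by (rule uniq[OF that(1) sv(1)[OF that(1)] e2[OF that]]) (simp add: sv(2)[OF that(1)] L2_ell2(1)[OF eHL[OF that]])
    thus ?thesis by (simp add: G_def)
   qed
   show "imul (ell2 (due e t)) = ell2 (?H e (ue e t)) - ecubic (ell2 (ue e t))" if "e \<in> ?E" "t \<in> {0..T}" for e t
    by (simp add: coeffs_inject[symmetric] ecubic_def L2_ell2(1)[OF eL(1)[OF that]] L2_ell2(1)[OF eL(2)[OF that]] L2_ell2(1)[OF eHL[OF that]] L2_ell2(1)[OF ecL[OF that]] E(3)[OF that])
   show "ell2 (?H e (ue e 0)) = f 0" if e: "e \<in> ?E" for e
   proof -
    obtain v where v: "v \<in> sobolev 2" "?H e v = Hlim K u0" using ex[OF e, of "ell2 (Hlim K u0)"] coeffs_ell2[OF Hm[OF u0]] by auto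
    \<comment> \<open>\<open>inv_into\<close> is meaningful on the image only; surjectivity puts the
      datum there, so the initial value satisfies H_eps u_eps(0) = H u0.\<close>
    hence "- Hlim K u0 \<in> (\<lambda>v. - ?H e v) ` sobolev 2" by (intro image_eqI[of _ _ v]) simp_all
    from f_inv_into_f[OF this] have "?H e (ue e 0) = Hlim K u0" unfolding E(4)[OF e] by simp
    thus ?thesis by (simp add: f_def S(3))
   qed
   show "((\<lambda>t. ell2 (u t)) has_vector_derivative ell2 (du t)) (at t within {0..T})" if "t \<in> {0..T}" for t by (rule C1_L2_derivative[OF S(2) that])
   show "continuous_on {0..T} (\<lambda>t. ell2 (du t))" using S(2) by (intro L2_in_ell2_continuous) (simp add: C1_L2_def)
   show "continuous_on {0..T} f" unfolding f_def
   proof (rule L2_in_ell2_continuous, unfold cont_on_time_def, intro ballI conjI HL)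
    fix t assume t: "t \<in> {0..T}"
    have "((\<lambda>s. L2norm (Hlim K (u s - u t))) \<longlongrightarrow> 0) (at t within {0..T})" using S(1) t unfolding cont_on_time_def by blast
    moreover have "\<forall>\<^sub>F s in at t within {0..T}. L2norm (Hlim K (u s - u t)) = L2norm (Hlim K (u s) - Hlim K (u t))"
     using Hd[OF ud ud[OF t]] by (simp add: eventually_at_filter)
    ultimately show "((\<lambda>s. L2norm (Hlim K (u s) - Hlim K (u t))) \<longlongrightarrow> 0) (at t within {0..T})" by (rule Lim_transform_eventually)
   qed
   show "imul (ell2 (du t)) = f t - ecubic (ell2 (u t))" if t: "t \<in> {0..T}" for t
    by (simp add: coeffs_inject[symmetric] ecubic_def L2_ell2(1)[OF uL(1)[OF t]] L2_ell2(1)[OF uL(2)[OF t]] fc[OF t] L2_ell2(1)[OF cL[OF t]] S(4)[OF t])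
   show "((\<lambda>e. G e (f t)) \<longlongrightarrow> ell2 (u t)) (at_right 0)" if "t \<in> {0..T}" for t by (rule Glim[OF that])
  qed
  have tr: "((\<lambda>ep. L2norm (v ep - w)) \<longlongrightarrow> 0) (at_right 0)"
   if "((\<lambda>ep. ell2 (v ep)) \<longlongrightarrow> ell2 w) (at_right 0)" "\<And>ep. ep \<in> ?E ==> v ep \<in> L2" "w \<in> L2" for v w
  proof (rule Lim_transform_eventually)
   show "((\<lambda>ep. norm (ell2 (v ep) - ell2 w)) \<longlongrightarrow> 0) (at_right 0)" using that(1) by (simp add: tendsto_norm_zero_iff LIM_zero_iff)
   show "\<forall>\<^sub>F ep in at_right 0. norm (ell2 (v ep) - ell2 w) = L2norm (v ep - w)"
    using eventually_at_right_real[OF e0(1)] by eventually_elim (simp add: ell2_diff L2_ell2 L2_diff that)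
  qed
  show "((\<lambda>ep. L2norm (ue ep t0 - u t0)) \<longlongrightarrow> 0) (at_right 0)" by (rule tr[OF convergence(1)[OF t0] eL(1)[OF _ t0] uL(1)[OF t0]])
  show "((\<lambda>ep. L2norm (Heps K ep (ue ep t0) - Hlim K (u t0))) \<longlongrightarrow> 0) (at_right 0)"
   unfolding H_eps_Hop by (rule tr[OF convergence(3)[OF t0, unfolded f_def] eHL[OF _ t0] HL[OF t0]])
  show "((\<lambda>ep. L2norm (due ep t0 - du t0)) \<longlongrightarrow> 0) (at_right 0)" by (rule tr[OF convergence(2)[OF t0] eL(2)[OF _ t0] uL(2)[OF t0]])
 qed
qed

end

theorem theorem3p9:
  fixes P :: dyadic
    and m :: "real \<times> real \<Rightarrow> real"
    and M :: "'w measure"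
    and \<xi>hat :: "int \<times> int \<Rightarrow> 'w \<Rightarrow> complex"
    and \<omega> :: 'w
    and \<xi> \<Xi>2 :: tdist
    and \<alpha> \<gamma> :: real
    and C :: "tdist \<Rightarrow> tdist \<Rightarrow> tdist \<Rightarrow> tdist"
  assumes "dyadic_partition P"
    and "mollifier m"
    and "white_noise M \<xi>hat"
    and "\<omega> \<in> space M"
    and "\<xi> = (\<lambda>k. \<xi>hat k \<omega>)"
    and "enhanced_noise P m \<xi> \<Xi>2"
    and "- 4 / 3 < \<alpha>" "\<alpha> < - 1" "2 / 3 < \<gamma>" "\<gamma> \<le> \<alpha> + 2"
    and "is_commutator P \<gamma> (\<alpha> + 2) \<alpha> C"
  shows "\<exists>K0>0. \<forall>K\<ge>K0.
    (let H = H_op P C \<xi> \<Xi>2 K; DH = A_dom P \<gamma> \<xi> \<Xi>2; H\<epsilon> = H_eps m \<xi> K in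
     \<forall>T>0. \<forall>u0\<in>DH. \<forall>u\<epsilon> du\<epsilon> :: real \<Rightarrow> real \<Rightarrow> tdist. \<forall>u du :: real \<Rightarrow> tdist.
       (\<forall>\<epsilon>\<in>{0<..<1}. strong_solution (H\<epsilon> \<epsilon>) (sobolev 2) (sobolev_norm 2) T
          (inv_into (sobolev 2) (\<lambda>v. - H\<epsilon> \<epsilon> v) (- H u0)) (u\<epsilon> \<epsilon>) (du\<epsilon> \<epsilon>)) \<longrightarrow>
       strong_solution H DH (\<lambda>v. L2norm (H v)) T u0 u du \<longrightarrow>
       (\<forall>t\<in>{0..T}.
          ((\<lambda>\<epsilon>. L2norm (u\<epsilon> \<epsilon> t - u t)) \<longlongrightarrow> 0) (at_right 0) \<and>
          ((\<lambda>\<epsilon>. L2norm (H\<epsilon> \<epsilon> (u\<epsilon> \<epsilon> t) - H (u t))) \<longlongrightarrow> 0) (at_right 0) \<and>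
          ((\<lambda>\<epsilon>. L2norm (du\<epsilon> \<epsilon> t - du t)) \<longlongrightarrow> 0) (at_right 0)))"
proof -
  \<comment> \<open>Reality holds at every point of the sample space, so also at the fixed
    \<omega>.\<close>
  have "\<xi> (- k) = cnj (\<xi> k)" for k using assms(3-5) unfolding white_noise_def by blast
  with assms interpret noise_setting P \<alpha> \<gamma> C m \<xi> \<Xi>2 by unfold_locales
  show ?thesis unfolding Let_def by (rule convergence_theorem)
qed

end
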